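(* Let $(E,\mu,\Gamma)$ be a Markov Triple with generator ${\rm L}$ and algebra $\mathcal{A}$, let $d\ge1$, and let $F=(F_1,\dots,F_d)$ be a vector of centered elements of $\mathcal{A}$. Assume that the distribution $\nu_F$ of $F$ on $\mathbb{R}^d$ admits a smooth density $h$ with respect to the standard Gaussian measure $\gamma$ on $\mathbb{R}^d$, and that $\nu_F$ has a Stein kernel $\tau_{\nu_F}$ with respect to $\gamma$, with Stein discrepancy ${\rm S}(\nu_F\,|\,\gamma)$. Let $\widetilde\Gamma=(\Gamma(F_i,F_j))_{1\le i,j\le d}$. Assume that all the $F_i$, ${\rm L}F_i$, $\Gamma(F_i,F_j)$, $i,j=1,\dots,d$, are in $L^p(\mu)$ for every $p\ge1$, and that $$B_F=\int_E\frac{1}{\det(\widetilde\Gamma)^\alpha}\,d\mu<\infty$$ for some $\alpha>0$. Let $$A_F=\int_E\Big[\big|\det(\widetilde\Gamma)\,\widetilde\Gamma^{-1}{\rm L}F\big|+|V_1|+|V_2|+|F|\Big]^2d\mu,$$ where ${\rm L}F=({\rm L}F_1,\dots,{\rm L}F_d)$ and $$V_1=\bigg(\sum_{i=1}^d\Gamma\big(F_i,\det(\widetilde\Gamma)(\widetilde\Gamma^{-1})_{ij}\big)\bigg)_{1\le j\le d},\qquad V_2=\bigg(\sum_{i=1}^d\det(\widetilde\Gamma)(\widetilde\Gamma^{-1})_{ij}\,\Gamma\big(F_i,\det(\widetilde\Gamma)\big)\bigg)_{1\le j\le d}.$$ Then $A_F<\infty$ and $$ {\rm H}(\nu_F\,|\,\gamma)\,\le\,\frac{{\rm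 S}^2(\nu_F\,|\,\gamma)}{2(1-4\kappa)}\,\Psi\bigg(\frac{2(A_F+d(B_F+1))}{{\rm S}^2(\nu_F\,|\,\gamma)}\bigg), $$ where $\kappa=\frac{2+\alpha}{2(4+3\alpha)}$ $(<\frac14)$. In particular, under the assumptions on $F$, ${\rm H}(\nu_F\,|\,\gamma)\to0$ as ${\rm S}(\nu_F\,|\,\gamma)\to0$.
   Context: $\Psi:\mathbb{R}_+\to\mathbb{R}_+$ is defined by $\Psi(r)=1+\log r$ if $r\ge1$ and $\Psi(r)=r$ if $0\le r\le1$. A Markov Triple $(E,\mu,\Gamma)$ (in the sense of Bakry-Gentil-Ledoux) consists of a probability space $(E,\mathcal{E},\mu)$ with a Markov semigroup with symmetric invariant probability measure $\mu$, infinitesimal generator ${\rm L}$, an underlying algebra $\mathcal{A}$ of (smooth) real functions, and carr\'e du champ operator $\Gamma(f,g)=\frac12[{\rm L}(fg)-f{\rm L}g-g{\rm L}f]$, $\Gamma(f)=\Gamma(f,f)\ge0$, with ${\rm L}$ satisfying the diffusion chain rule and $\int_Ef\,{\rm L}g\,d\mu=-\int_E\Gamma(f,g)\,d\mu$ for $f,g\in\mathcal{A}$. It is implicitly understood that $\mathcal{A}$ (or an extension of it) permits the $\Gamma$-calculus expressions involved. Centered means $\int_EF_i\,d\mu=0$. If $\widetilde\Gamma$ is singular, $\det(\widetilde\Gamma)\widetilde\Gamma^{-1}$ is understood as the adjugate of $\widetilde\Gamma$. A measurable matrix-valued map $\tau_\nu$ on $\mathbb{R}^d$ is a Stein kernel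 for $\nu$ (with respect to $\gamma$) if $\tau_\nu^{ij}\in L^1(\nu)$ for all $i,j$ and, for every smooth test function $\varphi:\mathbb{R}^d\to\mathbb{R}$, $\int x\cdot\nabla\varphi\,d\nu=\int\langle\tau_\nu,{\rm Hess}(\varphi)\rangle_{\rm HS}\,d\nu$ (Hilbert-Schmidt scalar product); the Stein discrepancy is ${\rm S}(\nu|\gamma)=\big(\int\|\tau_\nu-{\rm Id}\|_{\rm HS}^2\,d\nu\big)^{1/2}$. The relative entropy of $d\nu=h\,d\gamma$ is ${\rm H}(\nu|\gamma)=\int h\log h\,d\gamma$. *)

theory Defs
  imports "HOL-Probability.Probability"
begin

text \<open>
  The diffusion chain rule quantifies over the number of variables, so smoothness is defined for
  functions of a family of real coordinates \<open>'i \<Rightarrow> real\<close> that depend only on the coordinates in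
  a (finite) set \<open>I\<close>: \<open>I = {..<k}\<close> with \<open>'i = nat\<close> encodes functions on \<open>\<real>\<^sup>k\<close>. A function
  \<open>f\<close> on \<open>real ^ 'n\<close> is treated as \<open>f \<circ> vec_lambda\<close> with \<open>I = UNIV\<close>.
  Continuity refers to the product topology, which for such functions is Euclidean continuity.
\<close>

definition partial_deriv :: "'i \<Rightarrow> (('i \<Rightarrow> real) \<Rightarrow> real) \<Rightarrow> ('i \<Rightarrow> real) \<Rightarrow> real" where
  "partial_deriv i \<psi> x = deriv (\<lambda>t. \<psi> (x(i := t))) (x i)"

definition smooth_in :: "'i set \<Rightarrow> (('i \<Rightarrow> real) \<Rightarrow> real) \<Rightarrow> bool" where
  "smooth_in I \<psi> \<longleftrightarrow>
     (\<forall>x y. (\<forall>i\<in>I. x i = y i) \<longrightarrow> \<psi> x = \<psi> y) \<and>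
     (\<forall>js\<in>lists I. continuous_on UNIV (foldr partial_deriv js \<psi>) \<and>
        (\<forall>i\<in>I. \<forall>x. (\<lambda>t. foldr partial_deriv js \<psi> (x(i := t))) differentiable (at (x i))))"

definition smooth_poly_growth_in :: "'i set \<Rightarrow> (('i \<Rightarrow> real) \<Rightarrow> real) \<Rightarrow> bool" where
  "smooth_poly_growth_in I \<psi> \<longleftrightarrow> smooth_in I \<psi> \<and>
     (\<forall>js\<in>lists I. \<exists>C m. \<forall>x. \<bar>foldr partial_deriv js \<psi> x\<bar> \<le> C * (1 + (\<Sum>i\<in>I. \<bar>x i\<bar>)) ^ m)"

definition smooth :: "(real ^ 'n::finite \<Rightarrow> real) \<Rightarrow> bool" where
  "smooth f \<longleftrightarrow> smooth_in UNIV (f \<circ> vec_lambda)"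

definition gradient :: "(real ^ 'n::finite \<Rightarrow> real) \<Rightarrow> real ^ 'n \<Rightarrow> real ^ 'n" where
  "gradient f x = (\<chi> i. partial_deriv i (f \<circ> vec_lambda) (vec_nth x))"

definition hessian :: "(real ^ 'n::finite \<Rightarrow> real) \<Rightarrow> real ^ 'n \<Rightarrow> real ^ 'n ^ 'n" where
  "hessian f x = (\<chi> i j. partial_deriv i (partial_deriv j (f \<circ> vec_lambda)) (vec_nth x))"

definition L2 :: "'a measure \<Rightarrow> ('a \<Rightarrow> real) set" where
  "L2 M = {f \<in> borel_measurable M. integrable M (\<lambda>x. (f x)\<^sup>2)}"

definition in_all_Lp :: "'a measure \<Rightarrow> ('a \<Rightarrow> real) \<Rightarrow> bool" where
  "in_all_Lp M f \<longleftrightarrow> f \<in> borel_measurable M \<and> (\<forall>p::real. 1 \<le> p \<longrightarrow> integrable M (\<lambda>x. \<bar>f x\<bar> powr p))"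

text \<open>
  Elements of \<open>L\<^sup>2\<close> are represented by functions; all identities are only required almost everywhere.
\<close>

definition symmetric_markov_semigroup :: "'a measure \<Rightarrow> (real \<Rightarrow> ('a \<Rightarrow> real) \<Rightarrow> 'a \<Rightarrow> real) \<Rightarrow> bool" where
  "symmetric_markov_semigroup M P \<longleftrightarrow>
     (\<forall>t\<ge>0. \<forall>f\<in>L2 M. P t f \<in> L2 M) \<and>
     (\<forall>t\<ge>0. \<forall>f\<in>L2 M. \<forall>g\<in>L2 M. \<forall>a b.
        AE x in M. P t (\<lambda>y. a * f y + b * g y) x = a * P t f x + b * P t g x) \<and>
     (\<forall>f\<in>L2 M. AE x in M. P 0 f x = f x) \<and>
     (\<forall>s\<ge>0. \<forall>t\<ge>0. \<forall>f\<in>L2 M. AE x in M. P (s + t) f x = P s (P t f) x) \<and>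
     (\<forall>t\<ge>0. AE x in M. P t (\<lambda>_. 1) x = 1) \<and>
     (\<forall>t\<ge>0. \<forall>f\<in>L2 M. (AE x in M. 0 \<le> f x) \<longrightarrow> (AE x in M. 0 \<le> P t f x)) \<and>
     (\<forall>t\<ge>0. \<forall>f\<in>L2 M. (LINT x|M. P t f x) = (LINT x|M. f x)) \<and>
     (\<forall>t\<ge>0. \<forall>f\<in>L2 M. \<forall>g\<in>L2 M. (LINT x|M. f x * P t g x) = (LINT x|M. g x * P t f x)) \<and>
     (\<forall>f\<in>L2 M. ((\<lambda>t. LINT x|M. (P t f x - f x)\<^sup>2) \<longlongrightarrow> 0) (at_right 0))"

text \<open>\<open>f\<close> lies in the \<open>L\<^sup>2\<close>-domain of the infinitesimal generator, which maps it to \<open>u\<close>.\<close>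

definition has_generator_value ::
  "'a measure \<Rightarrow> (real \<Rightarrow> ('a \<Rightarrow> real) \<Rightarrow> 'a \<Rightarrow> real) \<Rightarrow> ('a \<Rightarrow> real) \<Rightarrow> ('a \<Rightarrow> real) \<Rightarrow> bool" where
  "has_generator_value M P f u \<longleftrightarrow> f \<in> L2 M \<and> u \<in> L2 M \<and>
     ((\<lambda>t. LINT x|M. ((P t f x - f x) / t - u x)\<^sup>2) \<longlongrightarrow> 0) (at_right 0)"

definition carre_du_champ ::
  "(('a \<Rightarrow> real) \<Rightarrow> 'a \<Rightarrow> real) \<Rightarrow> ('a \<Rightarrow> real) \<Rightarrow> ('a \<Rightarrow> real) \<Rightarrow> 'a \<Rightarrow> real" where
  "carre_du_champ L f g x = (L (\<lambda>y. f y * g y) x - f x * L g x - g x * L f x) / 2"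

text \<open>
  The algebra \<open>A\<close> is stable under \<open>\<Gamma>\<close> and under composition with smooth functions whose derivatives
  have polynomial growth. Stability under arbitrary smooth functions would, together with
  \<open>A \<subseteq> L\<^sup>2\<close>, force every element of \<open>A\<close> to be bounded.
\<close>

locale markov_triple = prob_space M for M :: "'a measure" +
  fixes P :: "real \<Rightarrow> ('a \<Rightarrow> real) \<Rightarrow> 'a \<Rightarrow> real"
    and A :: "('a \<Rightarrow> real) set"
    and L :: "('a \<Rightarrow> real) \<Rightarrow> 'a \<Rightarrow> real"
  assumes semigroup: "symmetric_markov_semigroup M P"
    and generator: "f \<in> A \<Longrightarrow> has_generator_value M P f (L f)"
    and const_closed: "(\<lambda>_. c) \<in> A"
    and add_closed: "f \<in> A \<Longrightarrow> g \<in> A \<Longrightarrow> (\<lambda>x. f x + g x) \<in> A"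
    and mult_closed: "f \<in> A \<Longrightarrow> g \<in> A \<Longrightarrow> (\<lambda>x. f x * g x) \<in> A"
    and Gamma_closed: "f \<in> A \<Longrightarrow> g \<in> A \<Longrightarrow> carre_du_champ L f g \<in> A"
    and smooth_closed: "smooth_poly_growth_in {..<k::nat} \<psi> \<Longrightarrow> (\<And>i. i < k \<Longrightarrow> u i \<in> A) \<Longrightarrow>
          (\<lambda>x. \<psi> (\<lambda>i. u i x)) \<in> A"
    and Gamma_nonneg: "f \<in> A \<Longrightarrow> AE x in M. 0 \<le> carre_du_champ L f f x"
    and integration_by_parts: "f \<in> A \<Longrightarrow> g \<in> A \<Longrightarrow>
          (LINT x|M. f x * L g x) = - (LINT x|M. carre_du_champ L f g x)"
    and diffusion: "smooth_poly_growth_in {..<k::nat} \<psi> \<Longrightarrow> (\<And>i. i < k \<Longrightarrow> u i \<in> A) \<Longrightarrow>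
          AE x in M. L (\<lambda>y. \<psi> (\<lambda>i. u i y)) x =
            (\<Sum>i<k. partial_deriv i \<psi> (\<lambda>l. u l x) * L (u i) x) +
            (\<Sum>i<k. \<Sum>j<k. partial_deriv i (partial_deriv j \<psi>) (\<lambda>l. u l x) * carre_du_champ L (u i) (u j) x)"

definition std_gaussian :: "(real ^ 'n::finite) measure" where
  "std_gaussian = density lborel (\<lambda>x. ennreal (\<Prod>i\<in>UNIV. std_normal_density (x $ i)))"

text \<open>Entropy of the measure with density \<open>h\<close>; meaningful only together with integrability.\<close>

definition relative_entropy :: "(real ^ 'n::finite \<Rightarrow> real) \<Rightarrow> real" where
  "relative_entropy h = (LINT x|std_gaussian. h x * ln (h x))"

text \<open>
  Test functions are the compactly supported smooth functions. The inner product and norm of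
  \<open>real ^ 'n ^ 'n\<close> are the Hilbert-Schmidt ones.
\<close>

definition stein_kernel :: "(real ^ 'n::finite \<Rightarrow> real ^ 'n ^ 'n) \<Rightarrow> (real ^ 'n) measure \<Rightarrow> bool" where
  "stein_kernel \<tau> \<nu> \<longleftrightarrow> \<tau> \<in> borel_measurable borel \<and>
     (\<forall>i j. integrable \<nu> (\<lambda>x. \<tau> x $ i $ j)) \<and>
     (\<forall>\<phi>. smooth \<phi> \<and> compact (closure {x. \<phi> x \<noteq> 0}) \<longrightarrow>
        (LINT x|\<nu>. x \<bullet> gradient \<phi> x) = (LINT x|\<nu>. \<tau> x \<bullet> hessian \<phi> x))"

definition stein_discrepancy_sq :: "(real ^ 'n::finite \<Rightarrow> real ^ 'n ^ 'n) \<Rightarrow> (real ^ 'n) measure \<Rightarrow> ennreal" where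
  "stein_discrepancy_sq \<tau> \<nu> = (\<integral>\<^sup>+ x. ennreal ((norm (\<tau> x - mat 1))\<^sup>2) \<partial>\<nu>)"

text \<open>
  Meaningful only when \<open>stein_discrepancy_sq\<close> is finite. For discrepancy \<open>s = 0\<close> the bound
  \<open>s\<^sup>2 * Psi (c / s\<^sup>2)\<close> evaluates to \<open>0\<close>, which is its limit as \<open>s\<close> tends to \<open>0\<close>.
\<close>

definition stein_discrepancy :: "(real ^ 'n::finite \<Rightarrow> real ^ 'n ^ 'n) \<Rightarrow> (real ^ 'n) measure \<Rightarrow> real" where
  "stein_discrepancy \<tau> \<nu> = sqrt (enn2real (stein_discrepancy_sq \<tau> \<nu>))"

definition Psi :: "real \<Rightarrow> real" where
  "Psi r = (if 1 \<le> r then 1 + ln r else r)"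

definition vec_of :: "('n::finite \<Rightarrow> 'a \<Rightarrow> real) \<Rightarrow> 'a \<Rightarrow> real ^ 'n" where
  "vec_of F x = (\<chi> i. F i x)"

definition law :: "'a measure \<Rightarrow> ('n::finite \<Rightarrow> 'a \<Rightarrow> real) \<Rightarrow> (real ^ 'n) measure" where
  "law M F = distr M borel (vec_of F)"

definition Gamma_matrix ::
  "(('a \<Rightarrow> real) \<Rightarrow> 'a \<Rightarrow> real) \<Rightarrow> ('n::finite \<Rightarrow> 'a \<Rightarrow> real) \<Rightarrow> 'a \<Rightarrow> real ^ 'n ^ 'n" where
  "Gamma_matrix L F x = (\<chi> i j. carre_du_champ L (F i) (F j) x)"

text \<open>
  The \<open>(i, j)\<close> entry is the determinant of \<open>B\<close> with its \<open>i\<close>-th column replaced by the \<open>j\<close>-th basis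
  vector (Cramer's rule), i.e. the \<open>(j, i)\<close> cofactor of \<open>B\<close>.
\<close>

definition adjugate :: "real ^ 'n ^ 'n \<Rightarrow> real ^ 'n ^ 'n::finite" where
  "adjugate B = (\<chi> i j. det (\<chi> k l. if l = i then axis j 1 $ k else B $ k $ l))"

lemma adjugate_eq_det_inverse:
  fixes B :: "real ^ 'n ^ 'n::finite"
  assumes "det B \<noteq> 0"
  shows "adjugate B = det B *\<^sub>R matrix_inv B"
proof -
  have inv: "B ** matrix_inv B = mat 1"
    using assms unfolding invertible_det_nz[symmetric] invertible_def matrix_inv_def
    by (metis (mono_tags, lifting) someI_ex)
  have "adjugate B $ i $ j = det B * matrix_inv B $ i $ j" for i j
  proof -
    have "B *v (matrix_inv B *v axis j 1) = axis j 1"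
      by (simp add: matrix_vector_mul_assoc inv)
    then have "matrix_inv B *v axis j 1 =
        (\<chi> k. det (\<chi> a l. if l = k then axis j 1 $ a else B $ a $ l) / det B)"
      using cramer[OF assms] by blast
    then have "(matrix_inv B *v axis j 1) $ i = adjugate B $ i $ j / det B"
      by (simp add: adjugate_def)
    moreover have "(matrix_inv B *v axis j 1) $ i = matrix_inv B $ i $ j"
      by (simp add: matrix_vector_mult_basis column_def)
    ultimately show ?thesis
      using assms by (simp add: field_simps)
  qed
  then show ?thesis
    by (simp add: vec_eq_iff)
qed

text \<open>The value is infinite where the determinant vanishes, as \<open>1 / 0 = \<infinity>\<close> in \<^typ>\<open>ennreal\<close>.\<close>

definition B_functional ::
  "'a measure \<Rightarrow> (('a \<Rightarrow> real) \<Rightarrow> 'a \<Rightarrow> real) \<Rightarrow> ('n::finite \<Rightarrow> 'a \<Rightarrow> real) \<Rightarrow> real \<Rightarrow> ennreal" where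
  "B_functional M L F \<alpha> = (\<integral>\<^sup>+ x. 1 / ennreal (det (Gamma_matrix L F x) powr \<alpha>) \<partial>M)"

definition V1 ::
  "(('a \<Rightarrow> real) \<Rightarrow> 'a \<Rightarrow> real) \<Rightarrow> ('n::finite \<Rightarrow> 'a \<Rightarrow> real) \<Rightarrow> 'a \<Rightarrow> real ^ 'n" where
  "V1 L F x = (\<chi> j. \<Sum>i\<in>UNIV. carre_du_champ L (F i) (\<lambda>y. adjugate (Gamma_matrix L F y) $ i $ j) x)"

definition V2 ::
  "(('a \<Rightarrow> real) \<Rightarrow> 'a \<Rightarrow> real) \<Rightarrow> ('n::finite \<Rightarrow> 'a \<Rightarrow> real) \<Rightarrow> 'a \<Rightarrow> real ^ 'n" where
  "V2 L F x = (\<chi> j. \<Sum>i\<in>UNIV. adjugate (Gamma_matrix L F x) $ i $ j *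
     carre_du_champ L (F i) (\<lambda>y. det (Gamma_matrix L F y)) x)"

definition A_functional ::
  "'a measure \<Rightarrow> (('a \<Rightarrow> real) \<Rightarrow> 'a \<Rightarrow> real) \<Rightarrow> ('n::finite \<Rightarrow> 'a \<Rightarrow> real) \<Rightarrow> ennreal" where
  "A_functional M L F = (\<integral>\<^sup>+ x. ennreal
     ((norm (adjugate (Gamma_matrix L F x) *v vec_of (\<lambda>i. L (F i)) x) +
       norm (V1 L F x) + norm (V2 L F x) + norm (vec_of F x))\<^sup>2) \<partial>M)"

locale stein_vector = markov_triple M P A L
  for M :: "'a measure" and P A L +
  fixes F :: "'n::finite \<Rightarrow> 'a \<Rightarrow> real"
    and h :: "real ^ 'n \<Rightarrow> real"
    and \<tau> :: "real ^ 'n \<Rightarrow> real ^ 'n ^ 'n"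
    and \<alpha> :: real
  assumes F_in_A: "F i \<in> A"
    and F_centered: "(LINT x|M. F i x) = 0"
    and h_smooth: "smooth h"
    and h_nonneg: "0 \<le> h y"
    and h_density: "law M F = density std_gaussian (\<lambda>y. ennreal (h y))"
    and kernel: "stein_kernel \<tau> (law M F)"
    and F_Lp: "in_all_Lp M (F i)"
    and LF_Lp: "in_all_Lp M (L (F i))"
    and Gamma_Lp: "in_all_Lp M (carre_du_champ L (F i) (F j))"
    and alpha_pos: "0 < \<alpha>"
    and B_finite: "B_functional M L F \<alpha> < \<infinity>"

end

theory Submission
  imports Defs
begin

text \<open>
  Interpolate by \<open>X\<^sub>c = c F + sqrt (1 - c\<^sup>2) Z\<close>, with \<open>Z\<close> standard Gaussian and independent of \<open>F\<close>
  (the Ornstein-Uhlenbeck flow with \<open>c = e\<^sup>-\<^sup>t\<close>). The relative entropy of the law of \<open>X\<^sub>c\<close> vanishes at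
  \<open>c = 0\<close> and has derivative \<open>c I(c)\<close>, where \<open>c\<^sup>2 I(c)\<close> is the relative Fisher information. Put
  \<open>u = 1 - c\<^sup>2\<close>. Testing the Stein kernel against the Gaussian kernel gives
  \<open>I(c) \<le> c\<^sup>2 S\<^sup>2 / u\<close>, which is not integrable at \<open>c = 1\<close>. Near \<open>c = 1\<close> the score is
  rewritten by the integration by parts of the Markov triple, with \<open>1 / det \<Gamma>\<close> regularised to
  \<open>det \<Gamma> / ((det \<Gamma>)\<^sup>2 + \<epsilon>\<^sup>2)\<close>; the error is controlled by \<open>B\<^sub>F\<close>, and \<open>\<epsilon> = u\<^sup>\<kappa>\<close> balances
  both contributions to \<open>I(c) \<le> (A\<^sub>F + d (B\<^sub>F + 1)) u\<^sup>-\<^sup>4\<^sup>\<kappa>\<close>, which is integrable. Use the first bound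
  for \<open>u \<ge> r\<close> and the second for \<open>u \<le> r\<close>, let \<open>c\<close> tend to \<open>1\<close> with Fatou's lemma,
  and optimise over \<open>r\<close>.
\<close>

section \<open>Rings of smooth functions closed under partial derivatives\<close>

text \<open>All bounds on the Fisher information rest on one principle: a field
  E[g(z - c F) (a + b (z - c F))], with g the Gaussian kernel of variance u, is the density of X_c
  times a conditional expectation given X_c, so its square divided by that density integrates to at
  most E|a|^2 + u E|b|^2. Bounding I(c) thus means representing the flux with small a and b. The
  direct choice a = F, b = -(c/u) Id only gives finiteness. The Markov triple moves most of b into a
  weight in a and represents the flux itself. The Stein identity is tested on x . grad phi only, so
  it yields another field with the same divergence; this suffices because the flux is the density
  times a gradient, hence has the least norm among the fields with its divergence. The parameter c
  turns the equilibrium t = infinity of the flow into the interior point c = 0, where no limit has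
  to be taken. At c = 1 the score of F is out of reach, so only an upper bound on the entropy is
  carried to the limit.\<close>

definition has_partial :: "'i \<Rightarrow> (('i \<Rightarrow> real) \<Rightarrow> real) \<Rightarrow> (('i \<Rightarrow> real) \<Rightarrow> real) \<Rightarrow> bool" where
  "has_partial i f f' \<longleftrightarrow> (\<forall>x. ((\<lambda>t. f (x(i := t))) has_real_derivative f' x) (at (x i)))"

lemma partial_deriv_eq: "has_partial i f f' \<Longrightarrow> partial_deriv i f = f'"
  by (auto simp: has_partial_def partial_deriv_def fun_eq_iff intro!: DERIV_imp_deriv)

lemma has_partial_const: "has_partial i (\<lambda>_. c) (\<lambda>_. 0)"
  by (simp add: has_partial_def)

lemma has_partial_coord: "has_partial i (\<lambda>x. x j) (\<lambda>_. of_bool (i = j))"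
  by (auto simp: has_partial_def)

lemma has_partial_add:
  "has_partial i f f' \<Longrightarrow> has_partial i g g' \<Longrightarrow> has_partial i (\<lambda>x. f x + g x) (\<lambda>x. f' x + g' x)"
  by (auto simp: has_partial_def intro!: DERIV_add)

lemma has_partial_mult:
  "has_partial i f f' \<Longrightarrow> has_partial i g g' \<Longrightarrow>
    has_partial i (\<lambda>x. f x * g x) (\<lambda>x. f' x * g x + g' x * f x)"
  unfolding has_partial_def
proof
  fix x
  assume f: "\<forall>x. ((\<lambda>t. f (x(i := t))) has_real_derivative f' x) (at (x i))"
     and g: "\<forall>x. ((\<lambda>t. g (x(i := t))) has_real_derivative g' x) (at (x i))"
  show "((\<lambda>t. f (x(i := t)) * g (x(i := t))) has_real_derivative f' x * g x + g' x * f x) (at (x i))"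
    using DERIV_mult[OF f[rule_format, of x] g[rule_format, of x]] by simp
qed

lemma has_partial_sum:
  "finite S \<Longrightarrow> (\<And>k. k \<in> S \<Longrightarrow> has_partial i (f k) (f' k)) \<Longrightarrow>
    has_partial i (\<lambda>x. \<Sum>k\<in>S. f k x) (\<lambda>x. \<Sum>k\<in>S. f' k x)"
  by (induction S rule: finite_induct) (auto intro!: has_partial_const has_partial_add)

lemma has_partial_compose:
  assumes "has_partial i f f'" "\<And>y. (\<phi> has_real_derivative \<phi>' y) (at y)"
  shows "has_partial i (\<lambda>x. \<phi> (f x)) (\<lambda>x. \<phi>' (f x) * f' x)"
  unfolding has_partial_def
proof
  fix x
  show "((\<lambda>t. \<phi> (f (x(i := t)))) has_real_derivative \<phi>' (f x) * f' x) (at (x i))"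
    using DERIV_chain2[OF assms(2), of "\<lambda>t. f (x(i := t))" "f' x" "x i" UNIV] assms(1)
    by (simp add: has_partial_def)
qed

text \<open>Smoothness and polynomial growth are conditions on all iterated partial derivatives. If
  a ring contains the partials of its generators, the Leibniz rule keeps every iterated partial
  inside it, so one check per generator replaces the infinite family of conditions.\<close>

inductive function_ring :: "('x \<Rightarrow> real) set \<Rightarrow> ('x \<Rightarrow> real) \<Rightarrow> bool" for B where
  const: "function_ring B (\<lambda>_. c)"
| gen: "b \<in> B \<Longrightarrow> function_ring B b"
| add: "function_ring B f \<Longrightarrow> function_ring B g \<Longrightarrow> function_ring B (\<lambda>x. f x + g x)"
| mult: "function_ring B f \<Longrightarrow> function_ring B g \<Longrightarrow> function_ring B (\<lambda>x. f x * g x)"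

lemma function_ring_cmult: "function_ring B f \<Longrightarrow> function_ring B (\<lambda>x. c * f x)"
  by (rule function_ring.mult[OF function_ring.const])

lemma function_ring_diff: "function_ring B f \<Longrightarrow> function_ring B g \<Longrightarrow> function_ring B (\<lambda>x. f x - g x)"
  using function_ring.add[OF _ function_ring_cmult[of B g "-1"], of f] by simp

lemma function_ring_continuous:
  assumes "\<And>b. b \<in> B \<Longrightarrow> continuous_on S b" "function_ring B f"
  shows "continuous_on S f"
  using assms(2) by induction (simp_all add: assms(1) continuous_on_add continuous_on_mult)

lemma function_ring_local:
  assumes "\<And>b x y. b \<in> B \<Longrightarrow> (\<And>i. i \<in> I \<Longrightarrow> x i = y i) \<Longrightarrow> b x = b y"
    and "function_ring B f" "\<And>i. i \<in> I \<Longrightarrow> x i = y i"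
  shows "f x = f y"
  using assms(2)
proof induction
  case (gen b)
  then show ?case by (intro assms(1) assms(3))
qed auto

lemma function_ring_partial:
  assumes "\<And>b. b \<in> B \<Longrightarrow> \<exists>b'. function_ring B b' \<and> has_partial i b b'"
    and "function_ring B f"
  shows "\<exists>f'. function_ring B f' \<and> has_partial i f f'"
  using assms(2)
proof induction
  case (const c)
  show ?case by (rule exI[of _ "\<lambda>_. 0"]) (simp add: function_ring.const has_partial_const)
next
  case (gen b)
  then show ?case by (rule assms(1))
next
  case (add f g)
  then obtain f' g' where "function_ring B f'" "has_partial i f f'" "function_ring B g'" "has_partial i g g'"
    by blast
  then show ?case
    by (intro exI[of _ "\<lambda>x. f' x + g' x"]) (simp add: function_ring.add has_partial_add)
next
  case (mult f g)
  then obtain f' g' where "function_ring B f'" "has_partial i f f'" "function_ring B g'" "has_partial i g g'"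
    by blast
  then show ?case using mult.hyps
    by (intro exI[of _ "\<lambda>x. f' x * g x + g' x * f x"])
      (simp add: has_partial_mult function_ring.add function_ring.mult)
qed

lemma function_ring_iterated_partials:
  assumes "\<And>b i. b \<in> B \<Longrightarrow> i \<in> I \<Longrightarrow> \<exists>b'. function_ring B b' \<and> has_partial i b b'"
    and f: "function_ring B f" and "js \<in> lists I"
  shows "function_ring B (foldr partial_deriv js f)"
  using assms(3)
proof (induction js)
  case (Cons j js)
  then obtain f' where f': "function_ring B f'" "has_partial j (foldr partial_deriv js f) f'"
    using function_ring_partial[of B j "foldr partial_deriv js f", OF assms(1)] Cons by blast
  have "foldr partial_deriv (j # js) f = f'" unfolding foldr.simps o_apply by (rule partial_deriv_eq[OF f'(2)])
  then show ?case using f'(1) by metis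
next
  case Nil
  show ?case using f by (simp only: foldr.simps id_apply)
qed

lemma function_ring_smooth:
  fixes I :: "'i set"
  assumes loc: "\<And>b x y. b \<in> B \<Longrightarrow> (\<And>i. i \<in> I \<Longrightarrow> x i = y i) \<Longrightarrow> b x = b y"
    and cont: "\<And>b. b \<in> B \<Longrightarrow> continuous_on UNIV b"
    and part: "\<And>b i. b \<in> B \<Longrightarrow> i \<in> I \<Longrightarrow> \<exists>b'. function_ring B b' \<and> has_partial i b b'"
    and f: "function_ring B f"
  shows "smooth_in I f"
  unfolding smooth_in_def
proof (intro conjI ballI allI impI)
  fix x y :: "'i \<Rightarrow> real" assume "\<forall>i\<in>I. x i = y i"
  then show "f x = f y" by (intro function_ring_local[OF _ f, of I x y]) (auto intro: loc)
next
  fix js assume js: "js \<in> lists I"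
  have r: "function_ring B (foldr partial_deriv js f)"
    by (rule function_ring_iterated_partials[OF part f js])
  show "continuous_on UNIV (foldr partial_deriv js f)"
    by (rule function_ring_continuous[OF cont r])
  fix i x assume "i \<in> I"
  then obtain f' where "has_partial i (foldr partial_deriv js f) f'"
    using function_ring_partial[OF part r] by blast
  then show "(\<lambda>t. foldr partial_deriv js f (x(i := t))) differentiable at (x i)"
    unfolding has_partial_def real_differentiable_def by blast
qed

definition poly_bounded :: "'i set \<Rightarrow> (('i \<Rightarrow> real) \<Rightarrow> real) \<Rightarrow> bool" where
  "poly_bounded I f \<longleftrightarrow> (\<exists>C m. \<forall>x. \<bar>f x\<bar> \<le> C * (1 + (\<Sum>i\<in>I. \<bar>x i\<bar>)) ^ m)"

lemma poly_boundedI: "(\<And>x. \<bar>f x\<bar> \<le> C * (1 + (\<Sum>i\<in>I. \<bar>x i\<bar>)) ^ m) \<Longrightarrow> poly_bounded I f"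
  unfolding poly_bounded_def by blast

lemma bounded_imp_poly_bounded: "(\<And>x. \<bar>f x\<bar> \<le> C) \<Longrightarrow> poly_bounded I f"
  by (rule poly_boundedI[of _ C I 0]) simp

lemma coord_poly_bounded: "finite I \<Longrightarrow> i \<in> I \<Longrightarrow> poly_bounded I (\<lambda>x. x i)"
proof (rule poly_boundedI[of _ 1 I 1])
  fix x :: "'a \<Rightarrow> real" assume "finite I" "i \<in> I"
  then show "\<bar>x i\<bar> \<le> 1 * (1 + (\<Sum>i\<in>I. \<bar>x i\<bar>)) ^ 1"
    using member_le_sum[of i I "\<lambda>i. \<bar>x i\<bar>"] by simp
qed

lemma poly_bounded_mult:
  assumes "poly_bounded I f" "poly_bounded I g"
  shows "poly_bounded I (\<lambda>x. f x * g x)"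
proof -
  obtain C m D n where f: "\<And>x. \<bar>f x\<bar> \<le> C * (1 + (\<Sum>i\<in>I. \<bar>x i\<bar>)) ^ m"
    and g: "\<And>x. \<bar>g x\<bar> \<le> D * (1 + (\<Sum>i\<in>I. \<bar>x i\<bar>)) ^ n"
    using assms unfolding poly_bounded_def by blast
  have "\<bar>f x * g x\<bar> \<le> (C * D) * (1 + (\<Sum>i\<in>I. \<bar>x i\<bar>)) ^ (m + n)" for x
    using mult_mono'[OF f g, of x x] by (simp add: abs_mult power_add mult_ac)
  then show ?thesis by (rule poly_boundedI)
qed

lemma poly_bounded_add:
  assumes "poly_bounded I f" "poly_bounded I g"
  shows "poly_bounded I (\<lambda>x. f x + g x)"
proof -
  obtain C m D n where f: "\<And>x. \<bar>f x\<bar> \<le> C * (1 + (\<Sum>i\<in>I. \<bar>x i\<bar>)) ^ m"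
    and g: "\<And>x. \<bar>g x\<bar> \<le> D * (1 + (\<Sum>i\<in>I. \<bar>x i\<bar>)) ^ n"
    using assms unfolding poly_bounded_def by blast
  have "\<bar>f x + g x\<bar> \<le> (\<bar>C\<bar> + \<bar>D\<bar>) * (1 + (\<Sum>i\<in>I. \<bar>x i\<bar>)) ^ (m + n)" for x
  proof -
    define S where "S = 1 + (\<Sum>i\<in>I. \<bar>x i\<bar>)"
    have S: "1 \<le> S" unfolding S_def by (simp add: sum_nonneg)
    have "\<bar>f x\<bar> \<le> \<bar>C\<bar> * S ^ (m + n)"
      using f[of x] S unfolding S_def[symmetric]
      by (intro order_trans[OF f[of x]] ) (auto simp: S_def[symmetric] intro!: mult_mono power_increasing)
    moreover have "\<bar>g x\<bar> \<le> \<bar>D\<bar> * S ^ (m + n)"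
      using g[of x] S unfolding S_def[symmetric]
      by (intro order_trans[OF g[of x]] ) (auto simp: S_def[symmetric] intro!: mult_mono power_increasing)
    ultimately show ?thesis unfolding S_def[symmetric] by (simp add: algebra_simps)
  qed
  then show ?thesis by (rule poly_boundedI)
qed

lemma function_ring_poly_bounded:
  assumes "\<And>b. b \<in> B \<Longrightarrow> poly_bounded I b" "function_ring B f"
  shows "poly_bounded I f"
  using assms(2)
proof induction
  case (const c)
  show ?case by (rule bounded_imp_poly_bounded[of _ "\<bar>c\<bar>"]) simp
qed (simp_all add: assms(1) poly_bounded_add poly_bounded_mult)

lemma function_ring_smooth_poly_growth:
  assumes loc: "\<And>b x y. b \<in> B \<Longrightarrow> (\<And>i. i \<in> I \<Longrightarrow> x i = y i) \<Longrightarrow> b x = b y"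
    and cont: "\<And>b. b \<in> B \<Longrightarrow> continuous_on UNIV b"
    and part: "\<And>b i. b \<in> B \<Longrightarrow> i \<in> I \<Longrightarrow> \<exists>b'. function_ring B b' \<and> has_partial i b b'"
    and bdd: "\<And>b. b \<in> B \<Longrightarrow> poly_bounded I b"
    and f: "function_ring B f"
  shows "smooth_poly_growth_in I f"
  unfolding smooth_poly_growth_in_def
proof (intro conjI ballI)
  show "smooth_in I f" by (rule function_ring_smooth[OF _ cont part f]) (rule loc)
  fix js assume js: "js \<in> lists I"
  have "function_ring B (foldr partial_deriv js f)"
    by (rule function_ring_iterated_partials[OF part f js])
  then show "\<exists>C m. \<forall>x. \<bar>foldr partial_deriv js f x\<bar> \<le> C * (1 + (\<Sum>i\<in>I. \<bar>x i\<bar>)) ^ m"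
    using function_ring_poly_bounded[of B I, OF bdd] unfolding poly_bounded_def by blast
qed

section \<open>Differentiation and integration by parts for Lebesgue integrals\<close>

text \<open>The mean value theorem bounds the difference quotients by \<open>w\<close>, and
  dominated convergence along arbitrary sequences gives both claims. The bounds are asked on an
  interval only, because the dominating functions used below degenerate as the parameter approaches
  1.\<close>

lemma has_real_derivative_integral:
  fixes f :: "real \<Rightarrow> 'a \<Rightarrow> real"
  assumes x0: "x0 \<in> {a<..<b}"
    and int: "\<And>t. t \<in> {a<..<b} \<Longrightarrow> integrable M (f t)"
    and der: "\<And>t x. t \<in> {a<..<b} \<Longrightarrow> x \<in> space M \<Longrightarrow> ((\<lambda>s. f s x) has_real_derivative f' t x) (at t)"
    and bd: "\<And>t x. t \<in> {a<..<b} \<Longrightarrow> x \<in> space M \<Longrightarrow> \<bar>f' t x\<bar> \<le> w x"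
    and w: "integrable M w"
  shows "((\<lambda>t. LINT x|M. f t x) has_real_derivative (LINT x|M. f' x0 x)) (at x0)"
    and "integrable M (f' x0)"
proof -
  have quot_bd: "\<bar>(f t x - f x0 x) / (t - x0)\<bar> \<le> w x" if t: "t \<in> {a<..<b}" "t \<noteq> x0" and x: "x \<in> space M" for t x
  proof -
    have conv: "convex {a<..<b}" by simp
    have "norm (f t x - f x0 x) \<le> w x * norm (t - x0)"
    proof (rule field_differentiable_bound[OF conv _ _ t(1) x0, of "\<lambda>s. f s x" "\<lambda>s. f' s x"])
      fix s assume s: "s \<in> {a<..<b}"
      show "((\<lambda>s. f s x) has_field_derivative f' s x) (at s within {a<..<b})"
        by (rule has_field_derivative_at_within[OF der[OF s x]])
      show "norm (f' s x) \<le> w x" using bd[OF s x] by simp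
    qed
    then show ?thesis using t(2) by (simp add: abs_divide divide_le_eq)
  qed
  have seq: "(\<lambda>n. LINT x|M. (f (S n) x - f x0 x) / (S n - x0)) \<longlonglongrightarrow> (LINT x|M. f' x0 x)
     \<and> integrable M (f' x0)" if S: "\<And>n. S n \<in> {a<..<b} - {x0}" "S \<longlonglongrightarrow> x0" for S
  proof
    have lim: "(\<lambda>n. (f (S n) x - f x0 x) / (S n - x0)) \<longlonglongrightarrow> f' x0 x" if "x \<in> space M" for x
    proof -
      have "((\<lambda>t. (f t x - f x0 x) / (t - x0)) \<longlongrightarrow> f' x0 x) (at x0)"
        using der[OF x0 that] by (simp add: has_field_derivative_iff)
      then show ?thesis
        using S by (auto simp: tendsto_at_iff_sequentially comp_def)
    qed
    have meas: "(\<lambda>x. (f (S n) x - f x0 x) / (S n - x0)) \<in> borel_measurable M" for n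
      using int[of "S n"] int[OF x0] S(1)[of n] by auto
    have meas': "f' x0 \<in> borel_measurable M"
      by (rule borel_measurable_LIMSEQ_metric[OF meas lim])
    note dc = meas' meas w AE_I2[OF lim] AE_I2[of M "\<lambda>x. norm ((f (S n) x - f x0 x) / (S n - x0)) \<le> w x" for n]
    show "(\<lambda>n. LINT x|M. (f (S n) x - f x0 x) / (S n - x0)) \<longlonglongrightarrow> (LINT x|M. f' x0 x)"
      by (rule integral_dominated_convergence[OF dc]) (use quot_bd S in auto)
    show "integrable M (f' x0)"
      by (rule integrable_dominated_convergence[OF dc]) (use quot_bd S in auto)
  qed
  have ab: "a < x0" "x0 < b" using x0 by auto
  have quot: "(LINT x|M. (f t x - f x0 x) / (t - x0)) = ((LINT x|M. f t x) - (LINT x|M. f x0 x)) / (t - x0)"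
    if "t \<in> {a<..<b}" for t
    using int[OF that] int[OF x0] by simp
  \<comment> \<open>Integrability of the limit needs one actual sequence in the interval that avoids
    \<open>x0\<close>. The denominators start at 2 to keep it strictly below
    \<open>b\<close>.\<close>
  define S0 where "S0 n = x0 + (b - x0) / real (n + 2)" for n
  have "(\<lambda>n. x0 + (b - x0) * (1 / real (n + 2))) \<longlonglongrightarrow> x0 + (b - x0) * 0"
    using LIMSEQ_ignore_initial_segment[OF lim_1_over_n, of 2] by (intro tendsto_intros) simp
  then have "S0 \<longlonglongrightarrow> x0" unfolding S0_def by simp
  moreover have "S0 n \<in> {a<..<b} - {x0}" for n
  proof -
    have "(b - x0) / real (n + 2) < b - x0" using ab by (simp add: divide_less_eq)
    moreover have "0 < (b - x0) / real (n + 2)" using ab by simp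
    ultimately have "a < S0 n" "S0 n < b" "S0 n \<noteq> x0" using ab unfolding S0_def by linarith+
    then show ?thesis by simp
  qed
  ultimately show "integrable M (f' x0)" using seq by blast
  show "((\<lambda>t. LINT x|M. f t x) has_real_derivative (LINT x|M. f' x0 x)) (at x0)"
    unfolding has_field_derivative_iff
  proof (subst tendsto_within_open_NO_MATCH[symmetric])
    show "x0 \<in> {a<..<b}" "open {a<..<b}" using x0 by auto
    have "((\<lambda>t. (LINT x|M. (f t x - f x0 x) / (t - x0))) \<longlongrightarrow> (LINT x|M. f' x0 x)) (at x0 within {a<..<b})"
      unfolding tendsto_at_iff_sequentially comp_def using seq by auto
    then show "((\<lambda>t. ((LINT x|M. f t x) - (LINT x|M. f x0 x)) / (t - x0)) \<longlongrightarrow> (LINT x|M. f' x0 x)) (at x0 within {a<..<b})"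
      by (rule Lim_transform_eventually) (use quot in \<open>auto simp: eventually_at_filter simp del: Bochner_Integration.integral_diff intro!: always_eventually\<close>)
  qed simp
qed

lemma directional_derivative_shift:
  fixes f f' :: "'a::real_vector \<Rightarrow> real"
  assumes der: "\<And>z. ((\<lambda>t. f (z + t *\<^sub>R e)) has_real_derivative f' z) (at 0)"
  shows "((\<lambda>t. f (z + t *\<^sub>R e)) has_real_derivative f' (z + t *\<^sub>R e)) (at t)"
proof -
  have "((\<lambda>s. f (z + t *\<^sub>R e + (s - t) *\<^sub>R e)) has_real_derivative f' (z + t *\<^sub>R e) * 1) (at t)"
    by (rule DERIV_chain2[of "\<lambda>s. f (z + t *\<^sub>R e + s *\<^sub>R e)" _ "\<lambda>s. s - t" t])
      (use der[of "z + t *\<^sub>R e"] in \<open>auto intro!: derivative_eq_intros\<close>)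
  then show ?thesis by (simp add: algebra_simps)
qed

text \<open>Translation invariance makes the integral of \<open>f (z + e) - f z\<close> vanish; it equals the integral of \<open>f'\<close>.\<close>

lemma integral_directional_derivative_eq_0:
  fixes f f' :: "'a::euclidean_space \<Rightarrow> real"
  assumes der: "\<And>z. ((\<lambda>t. f (z + t *\<^sub>R e)) has_real_derivative f' z) (at 0)"
    and cont: "continuous_on UNIV f'"
    and int: "integrable lborel f" "integrable lborel f'"
  shows "(LINT z|lborel. f' z) = 0"
proof -
  note der' = directional_derivative_shift[OF der]
  have shift_int: "integrable lborel (\<lambda>z. k (z + t *\<^sub>R e))"
    and shift: "(LINT z|lborel. k (z + t *\<^sub>R e)) = (LINT z|lborel. k z)"
    if "integrable lborel k" for k :: "'a \<Rightarrow> real" and t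
  proof -
    have m: "k \<in> borel_measurable borel" using that by auto
    have "integrable (distr lborel borel ((+) (t *\<^sub>R e))) k" using that by (simp add: lborel_distr_plus)
    then show "integrable lborel (\<lambda>z. k (z + t *\<^sub>R e))"
      by (subst (asm) integrable_distr_eq) (auto simp: m add.commute)
    have "(LINT z|distr lborel borel ((+) (t *\<^sub>R e)). k z) = (LINT z|lborel. k z)"
      by (simp add: lborel_distr_plus)
    then show "(LINT z|lborel. k (z + t *\<^sub>R e)) = (LINT z|lborel. k z)"
      by (subst (asm) integral_distr) (auto simp: m add.commute)
  qed
  have cshift: "continuous_on S (\<lambda>t. f' (z + t *\<^sub>R e))" for z S
    by (intro continuous_on_compose2[OF cont]) (auto intro!: continuous_intros)
  have ftc: "(LBINT t=0..1. f' (z + t *\<^sub>R e)) = f (z + 1 *\<^sub>R e) - f (z + 0 *\<^sub>R e)" for z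
    unfolding zero_ereal_def one_ereal_def
    by (rule interval_integral_FTC_finite)
      (use cshift der'[of z] in \<open>auto simp: has_real_derivative_iff_has_vector_derivative
        intro: has_vector_derivative_at_within\<close>)
  \<comment> \<open>The indicator turns the integral over a segment into one over the line, where
    Fubini applies. By translation invariance all slices with \<open>t\<close> in the unit interval
    have the same norm as \<open>f'\<close>, so \<open>Q\<close> is integrable on the
    product.\<close>
  define Q where "Q t z = indicator {0<..<1::real} t *\<^sub>R f' (z + t *\<^sub>R e)" for t z
  have Qm: "case_prod Q \<in> borel_measurable (lborel \<Otimes>\<^sub>M lborel)"
  proof -
    have "continuous_on UNIV (\<lambda>p. f' (snd p + fst p *\<^sub>R e))"
      by (intro continuous_on_compose2[OF cont]) (auto intro!: continuous_intros)
    from borel_measurable_continuous_onI[OF this]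
    have [measurable]: "(\<lambda>p. f' (snd p + fst p *\<^sub>R e)) \<in> borel_measurable (borel \<Otimes>\<^sub>M borel)"
      by (simp add: borel_prod)
    show ?thesis unfolding Q_def by (simp add: case_prod_beta')
  qed
  have Qint: "integrable (lborel \<Otimes>\<^sub>M lborel) (case_prod Q)"
  proof (rule lborel_pair.Fubini_integrable[OF Qm])
    have "(LINT z|lborel. norm (Q t z)) = indicator {0<..<1} t * (LINT z|lborel. \<bar>f' z\<bar>)" for t
      using shift[of "\<lambda>z. \<bar>f' z\<bar>" t] int by (cases "t \<in> {0<..<1}") (simp_all add: Q_def)
    then show "integrable lborel (\<lambda>t. LINT z|lborel. norm (case (t, z) of (t, z) \<Rightarrow> Q t z))"
      by (simp add: integrable_real_indicator)
    show "AE t in lborel. integrable lborel (\<lambda>z. case (t, z) of (t, z) \<Rightarrow> Q t z)"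
      using shift_int[OF int(2)] by (auto simp: Q_def)
  qed
  have "0 = (LINT z|lborel. f (z + 1 *\<^sub>R e)) - (LINT z|lborel. f z)"
    using shift[OF int(1), of 1] by simp
  also have "\<dots> = (LINT z|lborel. f (z + 1 *\<^sub>R e) - f z)"
    using shift_int[OF int(1), of 1] int(1) by simp
  also have "\<dots> = (LINT z|lborel. LINT t|lborel. Q t z)"
    using ftc by (simp add: Q_def interval_lebesgue_integral_def set_lebesgue_integral_def einterval_def
      zero_ereal_def one_ereal_def greaterThanLessThan_def greaterThan_def lessThan_def Int_def)
  also have "\<dots> = (LINT t|lborel. LINT z|lborel. Q t z)"
    using lborel_pair.Fubini_integral[OF Qint] by simp
  also have "\<dots> = (LINT t|lborel. indicator {0<..<1::real} t * (LINT z|lborel. f' z))"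
    using shift[OF int(2)] by (simp add: Q_def)
  also have "\<dots> = (LINT z|lborel. f' z)" by simp
  finally show ?thesis by simp
qed

section \<open>Gaussian densities and rapidly decreasing functions\<close>

text \<open>A polynomial weight that is at least 1, so that its powers increase with the exponent.
  It measures decay, and its inverse to the power of the dimension is already integrable.\<close>

definition bracket :: "'a::real_normed_vector \<Rightarrow> real" where
  "bracket z = 1 + (norm z)\<^sup>2"

lemma bracket_ge_1 [simp]: "1 \<le> bracket z"
  by (simp add: bracket_def)

lemma bracket_pos [simp]: "0 < bracket z"
  using bracket_ge_1[of z] by linarith

lemma bracket_nonneg [simp]: "0 \<le> bracket z"
  using bracket_pos[of z] by linarith

lemma continuous_on_bracket [continuous_intros]:
  "continuous_on S f \<Longrightarrow> continuous_on S (\<lambda>x. bracket (f x))"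
  unfolding bracket_def by (intro continuous_intros)

lemma borel_measurable_bracket [measurable]: "bracket \<in> borel_measurable borel"
  by (intro borel_measurable_continuous_onI continuous_intros)

lemma borel_measurable_vec_component [measurable]:
  "(\<lambda>x. x $ i) \<in> borel_measurable (borel :: (real ^ 'n) measure)"
  by (intro borel_measurable_continuous_onI continuous_on_component continuous_on_id)

lemma norm_le_bracket: "norm z \<le> bracket z"
  using zero_le_power2[of "norm z - 1"] norm_ge_zero[of z]
  unfolding bracket_def power2_diff one_power2 mult_1_right by linarith

lemma component_le_bracket: "\<bar>z $ i\<bar> \<le> bracket (z :: real ^ 'n)"
  using component_le_norm_cart[of z i] norm_le_bracket[of z] by linarith

text \<open>Peetre's inequality. It converts decay in \<open>z - c X\<close> into decay in
  \<open>z\<close> at the price of moments of \<open>X\<close>.\<close>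

lemma bracket_diff_le: "bracket z \<le> 2 * bracket (z - a) * bracket (a :: 'a::real_normed_vector)"
proof -
  have "norm z \<le> norm (z - a) + norm a" using norm_triangle_ineq[of "z - a" a] by simp
  then have "(norm z)\<^sup>2 \<le> (norm (z - a) + norm a)\<^sup>2" by (rule power_mono) simp
  also have "\<dots> \<le> 2 * (norm (z - a))\<^sup>2 + 2 * (norm a)\<^sup>2"
    using zero_le_power2[of "norm (z - a) - norm a"] by (simp add: power2_sum power2_diff)
  finally have "(norm z)\<^sup>2 \<le> 2 * (norm (z - a))\<^sup>2 + 2 * (norm a)\<^sup>2" .
  moreover have "0 \<le> (norm (z - a))\<^sup>2 * (norm a)\<^sup>2" by simp
  moreover have "2 * bracket (z - a) * bracket a
      = 2 + 2 * (norm (z - a))\<^sup>2 + 2 * (norm a)\<^sup>2 + 2 * ((norm (z - a))\<^sup>2 * (norm a)\<^sup>2)"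
    unfolding bracket_def by (simp add: algebra_simps)
  ultimately show ?thesis unfolding bracket_def[of z] by linarith
qed

lemma bracket_scaleR_le:
  assumes "\<bar>c\<bar> \<le> 1"
  shows "bracket (c *\<^sub>R x) \<le> bracket x"
proof -
  have "norm (c *\<^sub>R x) \<le> 1 * norm x" unfolding norm_scaleR using assms by (intro mult_right_mono) auto
  then have "(norm (c *\<^sub>R x))\<^sup>2 \<le> (norm x)\<^sup>2" by (intro power_mono) auto
  then show ?thesis unfolding bracket_def by simp
qed

lemma bracket_power_shift_le:
  assumes "\<bar>c\<bar> \<le> 1"
  shows "bracket z ^ N \<le> bracket (z - c *\<^sub>R x) ^ N * (2 * bracket x) ^ N"
proof -
  have "bracket z \<le> 2 * bracket (z - c *\<^sub>R x) * bracket x"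
    by (rule order_trans[OF bracket_diff_le[of z "c *\<^sub>R x"]])
      (use bracket_scaleR_le[OF assms, of x] in \<open>auto intro!: mult_left_mono\<close>)
  then have "bracket z ^ N \<le> (2 * bracket (z - c *\<^sub>R x) * bracket x) ^ N"
    by (intro power_mono) auto
  then show ?thesis by (simp add: power_mult_distrib mult_ac)
qed

text \<open>With r half of \<open>bracket w\<close>, the inequality (1 + r/N)^N \<le> exp r gives
  r^N \<le> N^N exp r, and r - |w|^2/2 is exactly 1/2.\<close>

lemma bracket_power_exp_le:
  "bracket w ^ N * exp (- (norm w)\<^sup>2 / 2) \<le> (2 * real N) ^ N * exp (1 / 2)"
proof (cases "N = 0")
  case False
  define r where "r = bracket w / 2"
  have r: "0 \<le> r" by (simp add: r_def)
  have "(r / real N) ^ N \<le> (1 + r / real N) ^ N"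
    using r by (intro power_mono) auto
  also have "\<dots> \<le> exp r"
    using False r by (intro exp_ge_one_plus_x_over_n_power_n) auto
  finally have "r ^ N \<le> real N ^ N * exp r"
    using False by (simp add: power_divide divide_le_eq mult.commute)
  then have "bracket w ^ N \<le> (2 * real N) ^ N * exp r"
    by (simp add: r_def power_divide power_mult_distrib divide_le_eq mult_ac)
  then have "bracket w ^ N * exp (- (norm w)\<^sup>2 / 2) \<le> (2 * real N) ^ N * exp r * exp (- (norm w)\<^sup>2 / 2)"
    by (rule mult_right_mono) simp
  also have "\<dots> = (2 * real N) ^ N * exp (r + - (norm w)\<^sup>2 / 2)"
    by (simp only: exp_add mult.assoc)
  also have "r + - (norm w)\<^sup>2 / 2 = 1 / 2"
    by (simp add: r_def bracket_def field_simps)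
  finally show ?thesis .
next
  case True
  have "- (norm w)\<^sup>2 / 2 \<le> 1 / 2" using zero_le_power2[of "norm w"] by linarith
  then show ?thesis using True by simp
qed

lemma nn_integral_vec_prod:
  fixes f :: "'n::finite \<Rightarrow> real \<Rightarrow> ennreal"
  assumes [measurable]: "\<And>i. f i \<in> borel_measurable borel"
  shows "(\<integral>\<^sup>+x. (\<Prod>i\<in>UNIV. f i ((x :: real ^ 'n) $ i)) \<partial>lborel) = (\<Prod>i\<in>UNIV. \<integral>\<^sup>+x. f i x \<partial>lborel)"
proof -
  have inj: "inj (\<lambda>i::'n. axis i (1::real))" by (auto simp: inj_on_def axis_eq_axis)
  have B: "Basis = range (\<lambda>i::'n. axis i (1::real))" by (auto simp: Basis_vec_def)
  define g where "g b = f (inv (\<lambda>i::'n. axis i (1::real)) b)" for b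
  have g: "g (axis i 1) = f i" for i using inv_f_f[OF inj] by (simp add: g_def)
  have "(\<integral>\<^sup>+x. (\<Prod>b\<in>Basis. g b ((x :: real ^ 'n) \<bullet> b)) \<partial>lborel) = (\<Prod>b\<in>Basis. \<integral>\<^sup>+x. g b x \<partial>lborel)"
    by (intro nn_integral_lborel_prod) (auto simp: g_def)
  then show ?thesis
    unfolding B by (simp add: prod.reindex[OF inj] g inner_axis)
qed

lemma norm_power2_eq_sum: "(norm (x :: real ^ 'n::finite))\<^sup>2 = (\<Sum>i\<in>UNIV. (x $ i)\<^sup>2)"
  by (simp add: norm_vec_def L2_set_def sum_nonneg)

text \<open>Each 1 + x_i^2 is at most \<open>bracket x\<close>, so a product of integrable functions
  of one coordinate dominates.\<close>

lemma integrable_inverse_bracket_power: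
  assumes "CARD('n) \<le> N"
  shows "integrable lborel (\<lambda>x :: real ^ 'n::finite. 1 / bracket x ^ N)"
proof (rule integrableI_bounded)
  have le: "1 / bracket x ^ N \<le> (\<Prod>i\<in>UNIV. inverse (1 + (x $ i)\<^sup>2))" for x :: "real ^ 'n"
  proof -
    have "(\<Prod>i\<in>UNIV. 1 + (x $ i)\<^sup>2) \<le> (\<Prod>i\<in>(UNIV::'n set). bracket x)"
    proof (rule prod_mono)
      fix i :: 'n
      show "0 \<le> 1 + (x $ i)\<^sup>2 \<and> 1 + (x $ i)\<^sup>2 \<le> bracket x"
        using member_le_sum[of i UNIV "\<lambda>i. (x $ i)\<^sup>2"] by (simp add: bracket_def norm_power2_eq_sum)
    qed
    also have "\<dots> = bracket x ^ CARD('n)" by simp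
    also have "\<dots> \<le> bracket x ^ N" using assms by (intro power_increasing) auto
    finally have "inverse (bracket x ^ N) \<le> inverse (\<Prod>i\<in>UNIV. 1 + (x $ i)\<^sup>2)"
      by (intro le_imp_inverse_le prod_pos) (auto intro: add_pos_nonneg)
    then show ?thesis by (simp add: prod_inversef[symmetric] inverse_eq_divide prod_dividef)
  qed
  have "integrable lborel (\<lambda>x::real. inverse (1 + x\<^sup>2))"
    using integrable_inverse_1_plus_square by (simp add: set_integrable_def)
  then have fin: "(\<integral>\<^sup>+x. ennreal (inverse (1 + x\<^sup>2)) \<partial>lborel) < \<infinity>"
    by (auto simp: integrable_iff_bounded)
  have "(\<integral>\<^sup>+x. ennreal (norm (1 / bracket (x :: real ^ 'n) ^ N)) \<partial>lborel)
      \<le> (\<integral>\<^sup>+x. (\<Prod>i\<in>UNIV. ennreal (inverse (1 + ((x :: real ^ 'n) $ i)\<^sup>2))) \<partial>lborel)"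
  proof (rule nn_integral_mono)
    fix x :: "real ^ 'n"
    show "ennreal (norm (1 / bracket x ^ N)) \<le> (\<Prod>i\<in>UNIV. ennreal (inverse (1 + (x $ i)\<^sup>2)))"
      using le[of x] by (subst prod_ennreal) (auto intro!: ennreal_leI)
  qed
  also have "\<dots> = (\<Prod>i\<in>(UNIV::'n set). \<integral>\<^sup>+x. ennreal (inverse (1 + x\<^sup>2)) \<partial>lborel)"
    by (rule nn_integral_vec_prod) simp
  also have "\<dots> < \<infinity>" using fin by (auto simp: less_top[symmetric] power_eq_top_ennreal)
  finally show "(\<integral>\<^sup>+x. ennreal (norm (1 / bracket (x :: real ^ 'n) ^ N)) \<partial>lborel) < \<infinity>" .
qed measurable

text \<open>Decay of the function itself, with no condition on derivatives. The class is stable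
  under polynomially bounded factors and under averaging over shifts, and it supplies the
  integrability that integration by parts over the whole space needs.\<close>

definition rapid :: "(real ^ 'n::finite \<Rightarrow> real) \<Rightarrow> bool" where
  "rapid f \<longleftrightarrow> continuous_on UNIV f \<and> (\<forall>N. \<exists>C. \<forall>z. \<bar>f z\<bar> * bracket z ^ N \<le> C)"

lemma rapidE:
  assumes "rapid f"
  obtains C where "0 \<le> C" "\<And>z. \<bar>f z\<bar> * bracket z ^ N \<le> C"
proof -
  obtain C where C: "\<And>z. \<bar>f z\<bar> * bracket z ^ N \<le> C" using assms unfolding rapid_def by blast
  have "0 \<le> \<bar>f 0\<bar> * bracket (0 :: real ^ 'a) ^ N" by simp
  then have "0 \<le> C" using C[of 0] by linarith
  then show thesis using C that by blast
qed

lemma rapid_continuous: "rapid f \<Longrightarrow> continuous_on UNIV f"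
  by (simp add: rapid_def)

lemma rapid_measurable: "rapid f \<Longrightarrow> f \<in> borel_measurable borel"
  by (simp add: rapid_continuous borel_measurable_continuous_onI)

lemma rapid_dominated:
  assumes "rapid g" "continuous_on UNIV f" "\<And>z. \<bar>f z\<bar> \<le> C * bracket z ^ k * \<bar>g z\<bar>"
  shows "rapid f"
  unfolding rapid_def
proof (intro conjI allI assms)
  fix N
  obtain D where D: "\<And>z. \<bar>g z\<bar> * bracket z ^ (k + N) \<le> D" using rapidE[OF assms(1)] by blast
  have "\<bar>f z\<bar> * bracket z ^ N \<le> \<bar>C\<bar> * D" for z
  proof -
    have "\<bar>f z\<bar> * bracket z ^ N \<le> (\<bar>C\<bar> * bracket z ^ k * \<bar>g z\<bar>) * bracket z ^ N"
      by (intro mult_right_mono order_trans[OF assms(3)]) auto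
    also have "\<dots> = \<bar>C\<bar> * (\<bar>g z\<bar> * bracket z ^ (k + N))" by (simp add: power_add mult_ac)
    also have "\<dots> \<le> \<bar>C\<bar> * D" using D by (intro mult_left_mono) auto
    finally show ?thesis .
  qed
  then show "\<exists>C. \<forall>z. \<bar>f z\<bar> * bracket z ^ N \<le> C" by blast
qed

lemma rapid_mult:
  assumes "rapid f" "continuous_on UNIV g" "\<And>z. \<bar>g z\<bar> \<le> C * bracket z ^ k"
  shows "rapid (\<lambda>z. f z * g z)"
proof (rule rapid_dominated[OF assms(1), of _ C k])
  show "continuous_on UNIV (\<lambda>z. f z * g z)"
    by (intro continuous_on_mult rapid_continuous assms)
  show "\<bar>f z * g z\<bar> \<le> C * bracket z ^ k * \<bar>f z\<bar>" for z
    using mult_left_mono[OF assms(3)[of z], of "\<bar>f z\<bar>"] by (simp add: abs_mult mult_ac)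
qed

lemma rapid_cmult: "rapid f \<Longrightarrow> rapid (\<lambda>z. c * f z)"
  using rapid_mult[of f "\<lambda>_. c" "\<bar>c\<bar>" 0] by (simp add: mult.commute)

lemma rapid_add:
  assumes "rapid f" "rapid g"
  shows "rapid (\<lambda>z. f z + g z)"
  unfolding rapid_def
proof (intro conjI allI)
  show "continuous_on UNIV (\<lambda>z. f z + g z)"
    using assms by (intro continuous_intros rapid_continuous)
  fix N
  obtain C D where C: "\<And>z. \<bar>f z\<bar> * bracket z ^ N \<le> C" and D: "\<And>z. \<bar>g z\<bar> * bracket z ^ N \<le> D"
    using rapidE[OF assms(1)] rapidE[OF assms(2)] by metis
  have "\<bar>f z + g z\<bar> * bracket z ^ N \<le> C + D" for z
  proof -
    have "\<bar>f z + g z\<bar> * bracket z ^ N \<le> (\<bar>f z\<bar> + \<bar>g z\<bar>) * bracket z ^ N"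
      by (intro mult_right_mono) auto
    then show ?thesis using C[of z] D[of z] by (simp add: algebra_simps)
  qed
  then show "\<exists>C. \<forall>z. \<bar>f z + g z\<bar> * bracket z ^ N \<le> C" by blast
qed

lemma rapid_diff: "rapid f \<Longrightarrow> rapid g \<Longrightarrow> rapid (\<lambda>z. f z - g z)"
  using rapid_add[OF _ rapid_cmult[of g "-1"], of f] by simp

lemma rapid_0: "rapid (\<lambda>_. 0)"
  by (auto simp: rapid_def)

lemma rapid_sum: "finite S \<Longrightarrow> (\<And>k. k \<in> S \<Longrightarrow> rapid (f k)) \<Longrightarrow> rapid (\<lambda>z. \<Sum>k\<in>S. f k z)"
  by (induction S rule: finite_induct) (simp_all add: rapid_0 rapid_add)

lemma rapid_integrable:
  fixes f :: "real ^ 'n::finite \<Rightarrow> real"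
  assumes "rapid f"
  shows "integrable lborel f"
proof -
  obtain C where C: "0 \<le> C" "\<And>z. \<bar>f z\<bar> * bracket z ^ CARD('n) \<le> C" using rapidE[OF assms] by blast
  have "integrable lborel (\<lambda>z :: real ^ 'n. C * (1 / bracket z ^ CARD('n)))"
    by (intro integrable_mult_right integrable_inverse_bracket_power) simp
  then show ?thesis
  proof (rule Bochner_Integration.integrable_bound)
    show "f \<in> borel_measurable lborel" using rapid_measurable[OF assms] by simp
    show "AE z in lborel. norm (f z) \<le> norm (C * (1 / bracket z ^ CARD('n)))"
      using C by (auto simp: pos_le_divide_eq abs_mult)
  qed
qed

text \<open>The density of the centred Gaussian with covariance \<open>u\<close> times the identity:
  \<open>u\<close> is the variance, not the standard deviation.\<close>

definition gauss :: "real \<Rightarrow> real ^ 'n::finite \<Rightarrow> real" where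
  "gauss u w = (1 / sqrt (2 * pi * u)) ^ CARD('n) * exp (- (norm w)\<^sup>2 / (2 * u))"

lemma gauss_eq_prod:
  assumes "0 < u"
  shows "gauss u (w :: real ^ 'n::finite) = (\<Prod>i\<in>UNIV. normal_density 0 (sqrt u) (w $ i))"
proof -
  have "(\<Prod>i\<in>UNIV. normal_density 0 (sqrt u) (w $ i))
      = (\<Prod>i\<in>(UNIV :: 'n set). 1 / sqrt (2 * pi * u)) * exp (\<Sum>i\<in>UNIV. - (w $ i)\<^sup>2 / (2 * u))"
    using assms unfolding normal_density_def exp_sum[OF finite] prod.distrib[symmetric] by simp
  also have "(\<Sum>i\<in>UNIV. - (w $ i)\<^sup>2 / (2 * u)) = - (norm w)\<^sup>2 / (2 * u)"
    by (simp add: norm_power2_eq_sum sum_negf sum_divide_distrib[symmetric])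
  finally show ?thesis by (simp add: gauss_def)
qed

lemma gauss_pos: "0 < u \<Longrightarrow> 0 < gauss u w"
  by (simp add: gauss_def)

lemma gauss_nonneg: "0 < u \<Longrightarrow> 0 \<le> gauss u w"
  by (simp add: gauss_def)

lemma continuous_on_gauss [continuous_intros]:
  "continuous_on S f \<Longrightarrow> continuous_on S (\<lambda>x. gauss u (f x))"
  unfolding gauss_def by (cases "u = 0") (auto intro!: continuous_intros)

lemma borel_measurable_gauss [measurable]: "gauss u \<in> borel_measurable borel"
  by (intro borel_measurable_continuous_onI continuous_intros)

lemma std_gaussian_eq: "std_gaussian = density lborel (\<lambda>x. ennreal (gauss 1 x))"
  by (simp add: std_gaussian_def gauss_eq_prod)

text \<open>For \<open>u\<close> at most 1 the exponential lies below its value at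
  \<open>u = 1\<close>. The variance then enters only through the normalising factor, which is what
  makes the bounds uniform in \<open>c\<close> later.\<close>

lemma gauss_decay:
  assumes "0 < u" "u \<le> 1"
  shows "gauss u (w :: real ^ 'n::finite) * bracket w ^ N
    \<le> (1 / sqrt (2 * pi * u)) ^ CARD('n) * ((2 * real N) ^ N * exp (1 / 2))"
proof -
  have "(norm w)\<^sup>2 / 2 \<le> (norm w)\<^sup>2 / (2 * u)" using assms by (intro divide_left_mono) auto
  then have "bracket w ^ N * exp (- (norm w)\<^sup>2 / (2 * u)) \<le> bracket w ^ N * exp (- (norm w)\<^sup>2 / 2)"
    by (intro mult_left_mono) auto
  also have "\<dots> \<le> (2 * real N) ^ N * exp (1 / 2)" by (rule bracket_power_exp_le)
  finally show ?thesis
    unfolding gauss_def mult.assoc using assms(1) by (intro mult_left_mono) (auto simp: mult.commute)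
qed

lemma rapid_gauss:
  assumes "0 < u" "u \<le> 1"
  shows "rapid (gauss u)"
  unfolding rapid_def
proof (intro conjI allI)
  show "continuous_on UNIV (gauss u)" by (intro continuous_intros)
  show "\<exists>C. \<forall>z. \<bar>gauss u (z :: real ^ 'n)\<bar> * bracket z ^ N \<le> C" for N
    using gauss_decay[OF assms, of _ N, where 'n='n] gauss_nonneg[OF assms(1)]
    by (auto simp: abs_of_nonneg gauss_nonneg[OF assms(1)] simp del: power_mult_distrib)
qed

lemma rapid_times_component: "rapid f \<Longrightarrow> rapid (\<lambda>w. w $ i * f w)"
  using rapid_mult[of f "\<lambda>w. w $ i" 1 1]
  by (simp add: mult.commute component_le_bracket continuous_on_component)

lemma gauss_deriv:
  assumes "0 < u"
  shows "((\<lambda>t. gauss u (w + t *\<^sub>R axis i 1)) has_real_derivative - (w $ i) / u * gauss u w) (at 0)"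
proof -
  have eq: "gauss u (w + t *\<^sub>R axis i 1)
      = (1 / sqrt (2 * pi * u)) ^ CARD('a) * exp (- ((norm w)\<^sup>2 + 2 * t * w $ i + t\<^sup>2) / (2 * u))" for t
  proof -
    have "(norm (w + t *\<^sub>R axis i 1))\<^sup>2 = (norm w)\<^sup>2 + 2 * t * w $ i + t\<^sup>2"
      unfolding power2_norm_eq_inner
      by (simp add: inner_add_left inner_add_right inner_axis inner_axis_axis inner_commute[of "axis i 1"] power2_eq_square algebra_simps)
    then show ?thesis by (simp add: gauss_def)
  qed
  show ?thesis
    unfolding eq using assms
    by (auto intro!: derivative_eq_intros simp: gauss_def field_simps)
qed

lemma nn_integral_gauss:
  assumes "0 < u"
  shows "(\<integral>\<^sup>+ w. ennreal (gauss u (w :: real ^ 'n::finite)) \<partial>lborel) = 1"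
proof -
  have "(\<integral>\<^sup>+ w. ennreal (gauss u (w :: real ^ 'n)) \<partial>lborel)
      = (\<integral>\<^sup>+ w. (\<Prod>i\<in>UNIV. ennreal (normal_density 0 (sqrt u) ((w :: real ^ 'n) $ i))) \<partial>lborel)"
    using assms by (intro nn_integral_cong) (simp add: gauss_eq_prod prod_ennreal)
  also have "\<dots> = (\<Prod>i\<in>(UNIV :: 'n set). \<integral>\<^sup>+x. ennreal (normal_density 0 (sqrt u) x) \<partial>lborel)"
    by (rule nn_integral_vec_prod) simp
  also have "(\<integral>\<^sup>+x. ennreal (normal_density 0 (sqrt u) x) \<partial>lborel) = 1"
    using assms by (subst nn_integral_eq_integral) (auto simp: integrable_normal_density)
  finally show ?thesis by simp
qed

lemma nn_integral_lborel_shift: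
  assumes [measurable]: "f \<in> borel_measurable borel"
  shows "(\<integral>\<^sup>+ z. f (z - a) \<partial>lborel) = (\<integral>\<^sup>+ z. f (z :: 'a::euclidean_space) \<partial>lborel)"
proof -
  have "(\<integral>\<^sup>+ z. f z \<partial>lborel) = (\<integral>\<^sup>+ z. f z \<partial>distr lborel borel ((+) (- a)))"
    by (simp add: lborel_distr_plus)
  also have "\<dots> = (\<integral>\<^sup>+ z. f (z - a) \<partial>lborel)"
    by (subst nn_integral_distr) auto
  finally show ?thesis by simp
qed

lemma integral_gauss: "0 < u \<Longrightarrow> (LINT w|lborel. gauss u (w :: real ^ 'n::finite)) = 1"
  using nn_integral_gauss[of u, where 'n='n]
  by (subst integral_eq_nn_integral) (auto simp: gauss_nonneg)

lemma component_gauss_deriv: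
  assumes "0 < u"
  shows "((\<lambda>t. (w + t *\<^sub>R axis i 1) $ j * gauss u (w + t *\<^sub>R axis i 1)) has_real_derivative
    of_bool (i = j) * gauss u w - 1 / u * (w $ i * (w $ j * gauss u w))) (at 0)"
proof -
  have "((\<lambda>t. (w + t *\<^sub>R axis i 1) $ j) has_real_derivative of_bool (i = j)) (at 0)"
    by (auto simp: axis_def intro!: derivative_eq_intros)
  from DERIV_mult[OF this gauss_deriv[OF assms, of w i]] show ?thesis
    by (simp add: field_simps)
qed

text \<open>The directional derivative of \<open>gauss u\<close> integrates to zero. The second
  moments below arise in the same way from the derivative of a coordinate times
  \<open>gauss u\<close>.\<close>

lemma gauss_first_moment:
  assumes "0 < u" "u \<le> 1"
  shows "(LINT w|lborel. w $ i * gauss u (w :: real ^ 'n::finite)) = 0"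
proof -
  have "(LINT w|lborel. - (w $ i) / u * gauss u (w :: real ^ 'n)) = 0"
  proof (rule integral_directional_derivative_eq_0[where e="axis i 1" and f="gauss u"])
    show "integrable lborel (\<lambda>w :: real ^ 'n. - (w $ i) / u * gauss u w)"
      using integrable_mult_right[OF rapid_integrable[OF rapid_times_component[OF rapid_gauss[OF assms], of i]], of "- 1 / u"]
      by (simp add: mult_ac)
    show "continuous_on UNIV (\<lambda>w :: real ^ 'n. - (w $ i) / u * gauss u w)"
      using assms by (intro continuous_intros) auto
  qed (rule gauss_deriv[OF assms(1)] rapid_integrable[OF rapid_gauss[OF assms]])+
  moreover have "(LINT w|lborel. - (w $ i) / u * gauss u (w :: real ^ 'n))
      = (- 1 / u) * (LINT w|lborel. w $ i * gauss u (w :: real ^ 'n))"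
    by (subst integral_mult_right_zero[symmetric]) (simp add: mult_ac)
  ultimately show ?thesis using assms by simp
qed

lemma gauss_second_moment:
  assumes "0 < u" "u \<le> 1"
  shows "(LINT w|lborel. w $ i * (w $ j * gauss u (w :: real ^ 'n::finite))) = u * of_bool (i = j)"
proof -
  have r: "rapid (\<lambda>w. w $ j * gauss u w)" "rapid (\<lambda>w. w $ i * (w $ j * gauss u w))"
    by (intro rapid_times_component rapid_gauss[OF assms])+
  note [simp] = rapid_integrable[OF r(1)] rapid_integrable[OF r(2)] rapid_integrable[OF rapid_gauss[OF assms]]
  have "(LINT w|lborel. of_bool (i = j) * gauss u (w :: real ^ 'n) - (1 / u) * (w $ i * (w $ j * gauss u w))) = 0"
  proof (rule integral_directional_derivative_eq_0[where e="axis i 1" and f="\<lambda>w. w $ j * gauss u w"])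
    fix z :: "real ^ 'n"
    show "((\<lambda>t. (z + t *\<^sub>R axis i 1) $ j * gauss u (z + t *\<^sub>R axis i 1)) has_real_derivative
        of_bool (i = j) * gauss u z - 1 / u * (z $ i * (z $ j * gauss u z))) (at 0)"
      by (rule component_gauss_deriv[OF assms(1)])
    show "continuous_on UNIV (\<lambda>w. of_bool (i = j) * gauss u w - 1 / u * (w $ i * (w $ j * gauss u w)))"
      by (intro continuous_intros)
  qed auto
  then show ?thesis
    using assms(1) by (simp add: integral_gauss field_simps)
qed

text \<open>The mean of (a + b . W)^2 for a Gaussian W of variance \<open>u\<close>: first moments
  vanish and second moments are diagonal. It is a nonnegative integral because it serves as the
  inner integral after Tonelli.\<close>

lemma nn_integral_gauss_affine_square:
  assumes "0 < u" "u \<le> 1"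
  shows "(\<integral>\<^sup>+ z. ennreal ((a + (\<Sum>j\<in>UNIV. b j * (z - x) $ j))\<^sup>2 * gauss u (z - x :: real ^ 'n::finite)) \<partial>lborel)
    = ennreal (a\<^sup>2 + u * (\<Sum>j\<in>UNIV. (b j)\<^sup>2))"
proof -
  have r1: "rapid (\<lambda>w. w $ j * gauss u w)" for j :: 'n
    by (intro rapid_times_component rapid_gauss[OF assms])
  have r2: "rapid (\<lambda>w. w $ i * (w $ j * gauss u w))" for i j :: 'n
    by (intro rapid_times_component rapid_gauss[OF assms])
  note i0 = rapid_integrable[OF rapid_gauss[OF assms]]
  note i1 = rapid_integrable[OF r1]
  note i2 = rapid_integrable[OF r2]
  have eq: "(a + (\<Sum>j\<in>UNIV. b j * w $ j))\<^sup>2 * gauss u w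
      = a\<^sup>2 * gauss u w + ((\<Sum>j\<in>UNIV. 2 * a * b j * (w $ j * gauss u w))
      + (\<Sum>i\<in>UNIV. \<Sum>j\<in>UNIV. b i * b j * (w $ i * (w $ j * gauss u w))))" for w :: "real ^ 'n"
  proof -
    have "2 * a * (\<Sum>j\<in>UNIV. b j * w $ j) * gauss u w = (\<Sum>j\<in>UNIV. 2 * a * b j * (w $ j * gauss u w))"
      by (simp add: sum_distrib_right sum_distrib_left mult_ac)
    moreover have "(\<Sum>j\<in>UNIV. b j * w $ j)\<^sup>2 * gauss u w
        = (\<Sum>i\<in>UNIV. \<Sum>j\<in>UNIV. b i * b j * (w $ i * (w $ j * gauss u w)))"
      by (simp add: power2_eq_square sum_product sum_distrib_right sum_distrib_left mult_ac)
    ultimately show ?thesis unfolding power2_sum distrib_right by linarith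
  qed
  have j1: "integrable lborel (\<lambda>w. \<Sum>j\<in>UNIV. 2 * a * b j * (w $ j * gauss u (w :: real ^ 'n)))"
    by (intro Bochner_Integration.integrable_sum integrable_mult_right i1)
  have j2: "integrable lborel (\<lambda>w. \<Sum>i\<in>UNIV. \<Sum>j\<in>UNIV. b i * b j * (w $ i * (w $ j * gauss u (w :: real ^ 'n))))"
    by (intro Bochner_Integration.integrable_sum integrable_mult_right i2)
  have j0: "integrable lborel (\<lambda>w. a\<^sup>2 * gauss u (w :: real ^ 'n))"
    by (intro integrable_mult_right i0)
  have int: "integrable lborel (\<lambda>w :: real ^ 'n. (a + (\<Sum>j\<in>UNIV. b j * w $ j))\<^sup>2 * gauss u w)"
    unfolding eq by (intro Bochner_Integration.integrable_add j0 j1 j2)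
  have "(\<integral>\<^sup>+ z. ennreal ((a + (\<Sum>j\<in>UNIV. b j * (z - x) $ j))\<^sup>2 * gauss u (z - x :: real ^ 'n)) \<partial>lborel)
      = (\<integral>\<^sup>+ z. ennreal ((a + (\<Sum>j\<in>UNIV. b j * z $ j))\<^sup>2 * gauss u (z :: real ^ 'n)) \<partial>lborel)"
    by (rule nn_integral_lborel_shift[where f="\<lambda>z. ennreal ((a + (\<Sum>j\<in>UNIV. b j * z $ j))\<^sup>2 * gauss u z)"]) measurable
  also have "\<dots> = ennreal (LINT z|lborel. (a + (\<Sum>j\<in>UNIV. b j * z $ j))\<^sup>2 * gauss u (z :: real ^ 'n))"
    using assms by (intro nn_integral_eq_integral int) (auto simp: gauss_nonneg)
  also have "(LINT z|lborel. (a + (\<Sum>j\<in>UNIV. b j * z $ j))\<^sup>2 * gauss u (z :: real ^ 'n))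
      = a\<^sup>2 + ((\<Sum>j\<in>UNIV. 2 * a * b j * 0) + (\<Sum>i\<in>UNIV. \<Sum>j\<in>UNIV. b i * b j * (u * of_bool (i = j))))"
  proof -
    have "(LINT w|lborel. (\<Sum>j\<in>UNIV. 2 * a * b j * (w $ j * gauss u (w :: real ^ 'n)))) = (\<Sum>j\<in>UNIV. 2 * a * b j * 0)"
      by (subst Bochner_Integration.integral_sum, intro integrable_mult_right i1)
        (simp only: integral_mult_right_zero gauss_first_moment[OF assms])
    moreover have "(LINT w|lborel. (\<Sum>i\<in>UNIV. \<Sum>j\<in>UNIV. b i * b j * (w $ i * (w $ j * gauss u (w :: real ^ 'n)))))
        = (\<Sum>i\<in>UNIV. \<Sum>j\<in>UNIV. b i * b j * (u * of_bool (i = j)))"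
      by (subst Bochner_Integration.integral_sum, intro Bochner_Integration.integrable_sum integrable_mult_right i2,
          subst Bochner_Integration.integral_sum, intro integrable_mult_right i2,
          subst integral_mult_right_zero, subst gauss_second_moment[OF assms], rule refl)
    moreover have "(LINT w|lborel. a\<^sup>2 * gauss u (w :: real ^ 'n)) = a\<^sup>2"
      by (simp add: integral_gauss[OF assms(1)])
    ultimately show ?thesis
      unfolding eq
      by (simp only: Bochner_Integration.integral_add[OF j0 Bochner_Integration.integrable_add[OF j1 j2]]
          Bochner_Integration.integral_add[OF j1 j2])
  qed
  also have "\<dots> = a\<^sup>2 + u * (\<Sum>j\<in>UNIV. (b j)\<^sup>2)"
    by (simp add: of_bool_def if_distrib[of "(*) _"] sum_distrib_left power2_eq_square mult_ac cong: if_cong)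
  finally show ?thesis .
qed

section \<open>Interpolation between a random vector and a standard Gaussian\<close>

text \<open>The analysis of the interpolation depends only on a random vector with moments of all
  orders. The Markov triple enters later, through a sublocale.\<close>

locale random_vector = prob_space M for M :: "'a measure" +
  fixes X :: "'a \<Rightarrow> real ^ 'n::finite"
  assumes X_measurable [measurable]: "X \<in> borel_measurable M"
    and moments: "integrable M (\<lambda>\<omega>. bracket (X \<omega>) ^ N)"
begin

text \<open>The weights for which averaging over shifts by \<open>X\<close> preserves rapid decay:
  by Peetre's inequality each power of \<open>bracket z\<close> costs one power of
  \<open>bracket (X \<omega>)\<close> inside the expectation.\<close>

definition tempered :: "('a \<Rightarrow> real) \<Rightarrow> bool" where
  "tempered Y \<longleftrightarrow> Y \<in> borel_measurable M \<and> (\<forall>N. integrable M (\<lambda>\<omega>. \<bar>Y \<omega>\<bar> * bracket (X \<omega>) ^ N))"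

lemma tempered_measurable: "tempered Y \<Longrightarrow> Y \<in> borel_measurable M"
  by (simp add: tempered_def)

lemma tempered_const: "tempered (\<lambda>_. c)"
  by (auto simp: tempered_def intro!: integrable_mult_right moments)

lemma tempered_component: "tempered (\<lambda>\<omega>. X \<omega> $ i)"
  unfolding tempered_def
proof (intro conjI allI)
  fix N
  show "integrable M (\<lambda>\<omega>. \<bar>X \<omega> $ i\<bar> * bracket (X \<omega>) ^ N)"
    by (rule Bochner_Integration.integrable_bound[OF moments[of "Suc N"]])
      (auto simp: abs_mult intro!: mult_right_mono component_le_bracket)
qed simp

text \<open>From |y| b \<le> y^2 + b^2 and the moments of \<open>X\<close>. This admits the entries
  of \<tau> - Id as weights once the Stein discrepancy is finite.\<close>

lemma tempered_square_integrable:
  assumes [measurable]: "Y \<in> borel_measurable M" and "integrable M (\<lambda>\<omega>. (Y \<omega>)\<^sup>2)"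
  shows "tempered Y"
  unfolding tempered_def
proof (intro conjI allI assms(1))
  fix N
  have le: "\<bar>y\<bar> * b \<le> y\<^sup>2 + b\<^sup>2" for y b :: real
    using zero_le_power2[of "\<bar>y\<bar> - b"] zero_le_power2[of y] zero_le_power2[of b]
    unfolding power2_diff power2_abs by linarith
  have "integrable M (\<lambda>\<omega>. (Y \<omega>)\<^sup>2 + bracket (X \<omega>) ^ (N * 2))"
    by (intro Bochner_Integration.integrable_add assms moments)
  then show "integrable M (\<lambda>\<omega>. \<bar>Y \<omega>\<bar> * bracket (X \<omega>) ^ N)"
    by (rule Bochner_Integration.integrable_bound)
      (auto simp: abs_mult power_mult intro!: le)
qed

text \<open>For \<open>\<Phi>\<close> a Gaussian kernel of variance \<open>1 - c\<^sup>2\<close>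
  this is the density of X_c at \<open>z\<close> times the conditional expectation of
  \<open>Y\<close> given X_c = \<open>z\<close>. Density, flux and their derivatives are all of this
  type, and derivatives in \<open>z\<close> fall on \<open>\<Phi>\<close> alone.\<close>

definition field :: "real \<Rightarrow> ('a \<Rightarrow> real) \<Rightarrow> (real ^ 'n \<Rightarrow> real) \<Rightarrow> real ^ 'n \<Rightarrow> real" where
  "field c Y \<Phi> z = (LINT \<omega>|M. Y \<omega> * \<Phi> (z - c *\<^sub>R X \<omega>))"

lemma field_integrand_bound:
  assumes "\<bar>c\<bar> \<le> 1" "\<And>w. \<bar>\<Phi> w\<bar> * bracket w ^ N \<le> C"
  shows "\<bar>Y \<omega> * \<Phi> (z - c *\<^sub>R X \<omega>)\<bar> * bracket z ^ N \<le> C * 2 ^ N * (\<bar>Y \<omega>\<bar> * bracket (X \<omega>) ^ N)"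
proof -
  have "\<bar>Y \<omega> * \<Phi> (z - c *\<^sub>R X \<omega>)\<bar> * bracket z ^ N
      \<le> \<bar>Y \<omega> * \<Phi> (z - c *\<^sub>R X \<omega>)\<bar> * (bracket (z - c *\<^sub>R X \<omega>) ^ N * (2 * bracket (X \<omega>)) ^ N)"
    by (intro mult_left_mono bracket_power_shift_le assms) auto
  also have "\<dots> = (\<bar>\<Phi> (z - c *\<^sub>R X \<omega>)\<bar> * bracket (z - c *\<^sub>R X \<omega>) ^ N) * (\<bar>Y \<omega>\<bar> * (2 * bracket (X \<omega>)) ^ N)"
    by (simp add: abs_mult mult_ac)
  also have "\<dots> \<le> C * (\<bar>Y \<omega>\<bar> * (2 * bracket (X \<omega>)) ^ N)"
    by (intro mult_right_mono assms) auto
  finally show ?thesis by (simp add: power_mult_distrib mult_ac)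
qed

lemma field_integrable:
  assumes "\<bar>c\<bar> \<le> 1" "rapid \<Phi>" "tempered Y"
  shows "integrable M (\<lambda>\<omega>. Y \<omega> * \<Phi> (z - c *\<^sub>R X \<omega>))"
proof -
  obtain C where C: "\<And>w. \<bar>\<Phi> w\<bar> * bracket w ^ 0 \<le> C" using rapidE[OF assms(2)] by metis
  have "integrable M (\<lambda>\<omega>. C * 2 ^ 0 * (\<bar>Y \<omega>\<bar> * bracket (X \<omega>) ^ 0))"
    using assms(3) unfolding tempered_def by (intro integrable_mult_right) blast
  then show ?thesis
  proof (rule Bochner_Integration.integrable_bound)
    show "(\<lambda>\<omega>. Y \<omega> * \<Phi> (z - c *\<^sub>R X \<omega>)) \<in> borel_measurable M"
      using rapid_measurable[OF assms(2)] tempered_measurable[OF assms(3)] by simp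
    show "AE \<omega> in M. norm (Y \<omega> * \<Phi> (z - c *\<^sub>R X \<omega>)) \<le> norm (C * 2 ^ 0 * (\<bar>Y \<omega>\<bar> * bracket (X \<omega>) ^ 0))"
    proof (intro always_eventually allI)
      fix \<omega>
      show "norm (Y \<omega> * \<Phi> (z - c *\<^sub>R X \<omega>)) \<le> norm (C * 2 ^ 0 * (\<bar>Y \<omega>\<bar> * bracket (X \<omega>) ^ 0))"
        using field_integrand_bound[OF assms(1) C, of Y \<omega> z] by (auto intro: order_trans[OF _ abs_ge_self])
    qed
  qed
qed

lemma field_bound:
  assumes "\<bar>c\<bar> \<le> 1" "rapid \<Phi>" "tempered Y" "\<And>w. \<bar>\<Phi> w\<bar> * bracket w ^ N \<le> C"
  shows "\<bar>field c Y \<Phi> z\<bar> * bracket z ^ N \<le> C * 2 ^ N * (LINT \<omega>|M. \<bar>Y \<omega>\<bar> * bracket (X \<omega>) ^ N)"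
proof -
  have "\<bar>field c Y \<Phi> z\<bar> * bracket z ^ N \<le> (LINT \<omega>|M. \<bar>Y \<omega> * \<Phi> (z - c *\<^sub>R X \<omega>)\<bar>) * bracket z ^ N"
    unfolding field_def by (intro mult_right_mono integral_abs_bound) auto
  also have "\<dots> = (LINT \<omega>|M. \<bar>Y \<omega> * \<Phi> (z - c *\<^sub>R X \<omega>)\<bar> * bracket z ^ N)"
    by simp
  also have "\<dots> \<le> (LINT \<omega>|M. C * 2 ^ N * (\<bar>Y \<omega>\<bar> * bracket (X \<omega>) ^ N))"
  proof (rule integral_mono)
    show "integrable M (\<lambda>\<omega>. \<bar>Y \<omega> * \<Phi> (z - c *\<^sub>R X \<omega>)\<bar> * bracket z ^ N)"
      using field_integrable[OF assms(1-3)] by (intro integrable_mult_left integrable_abs)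
    show "integrable M (\<lambda>\<omega>. C * 2 ^ N * (\<bar>Y \<omega>\<bar> * bracket (X \<omega>) ^ N))"
      using assms(3) unfolding tempered_def by (intro integrable_mult_right) blast
  qed (rule field_integrand_bound[OF assms(1,4)])
  finally show ?thesis by simp
qed

lemma rapid_field:
  assumes "\<bar>c\<bar> \<le> 1" "rapid \<Phi>" "tempered Y"
  shows "rapid (field c Y \<Phi>)"
  unfolding rapid_def
proof (intro conjI allI)
  fix N
  obtain C where "\<And>w. \<bar>\<Phi> w\<bar> * bracket w ^ N \<le> C" using rapidE[OF assms(2)] by blast
  from field_bound[OF assms this]
  show "\<exists>C. \<forall>z. \<bar>field c Y \<Phi> z\<bar> * bracket z ^ N \<le> C" by blast
next
  obtain C where C: "\<And>w. \<bar>\<Phi> w\<bar> * bracket w ^ 0 \<le> C" using rapidE[OF assms(2)] by metis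
  show "continuous_on UNIV (field c Y \<Phi>)"
  proof (intro continuous_at_imp_continuous_on ballI)
    fix z :: "real ^ 'n"
    show "isCont (field c Y \<Phi>) z"
      unfolding continuous_at_sequentially comp_def field_def
    proof (intro allI impI)
      fix S assume S: "S \<longlonglongrightarrow> z"
      show "(\<lambda>n. LINT \<omega>|M. Y \<omega> * \<Phi> (S n - c *\<^sub>R X \<omega>)) \<longlonglongrightarrow> (LINT \<omega>|M. Y \<omega> * \<Phi> (z - c *\<^sub>R X \<omega>))"
      proof (rule integral_dominated_convergence[where w="\<lambda>\<omega>. C * 2 ^ 0 * (\<bar>Y \<omega>\<bar> * bracket (X \<omega>) ^ 0)"])
        show "integrable M (\<lambda>\<omega>. C * 2 ^ 0 * (\<bar>Y \<omega>\<bar> * bracket (X \<omega>) ^ 0))"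
          using assms(3) unfolding tempered_def by (intro integrable_mult_right) blast
        show "AE \<omega> in M. (\<lambda>n. Y \<omega> * \<Phi> (S n - c *\<^sub>R X \<omega>)) \<longlonglongrightarrow> Y \<omega> * \<Phi> (z - c *\<^sub>R X \<omega>)"
        proof (intro always_eventually allI tendsto_mult tendsto_const)
          fix \<omega>
          have "isCont \<Phi> (z - c *\<^sub>R X \<omega>)"
            using rapid_continuous[OF assms(2)] by (simp add: continuous_on_eq_continuous_at)
          then show "(\<lambda>n. \<Phi> (S n - c *\<^sub>R X \<omega>)) \<longlonglongrightarrow> \<Phi> (z - c *\<^sub>R X \<omega>)"
            by (rule isCont_tendsto_compose) (intro tendsto_intros S)
        qed
        show "AE \<omega> in M. norm (Y \<omega> * \<Phi> (S n - c *\<^sub>R X \<omega>)) \<le> C * 2 ^ 0 * (\<bar>Y \<omega>\<bar> * bracket (X \<omega>) ^ 0)" for n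
          using field_integrand_bound[OF assms(1) C, of Y _ "S n"] by auto
      qed (use rapid_measurable[OF assms(2)] tempered_measurable[OF assms(3)] in simp_all)
    qed
  qed
qed

lemma field_derivative:
  assumes c: "\<bar>c\<bar> \<le> 1" and Y: "tempered Y" and \<Phi>: "rapid \<Phi>" "rapid \<Phi>'"
    and der: "\<And>w. ((\<lambda>t. \<Phi> (w + t *\<^sub>R e)) has_real_derivative \<Phi>' w) (at 0)"
  shows "((\<lambda>t. field c Y \<Phi> (z + t *\<^sub>R e)) has_real_derivative field c Y \<Phi>' z) (at 0)"
proof -
  obtain C where C: "\<And>w. \<bar>\<Phi>' w\<bar> * bracket w ^ 0 \<le> C" using rapidE[OF \<Phi>(2)] by metis
  have "((\<lambda>t. LINT \<omega>|M. Y \<omega> * \<Phi> (z + t *\<^sub>R e - c *\<^sub>R X \<omega>)) has_real_derivative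
      (LINT \<omega>|M. Y \<omega> * \<Phi>' (z + 0 *\<^sub>R e - c *\<^sub>R X \<omega>))) (at 0)"
  proof (rule has_real_derivative_integral(1)[where a="-1" and b=1
        and w="\<lambda>\<omega>. C * 2 ^ 0 * (\<bar>Y \<omega>\<bar> * bracket (X \<omega>) ^ 0)"])
    show "integrable M (\<lambda>\<omega>. C * 2 ^ 0 * (\<bar>Y \<omega>\<bar> * bracket (X \<omega>) ^ 0))"
      using Y unfolding tempered_def by (intro integrable_mult_right) blast
    fix t :: real
    show "integrable M (\<lambda>\<omega>. Y \<omega> * \<Phi> (z + t *\<^sub>R e - c *\<^sub>R X \<omega>))"
      by (rule field_integrable[OF c \<Phi>(1) Y])
    fix \<omega>
    show "\<bar>Y \<omega> * \<Phi>' (z + t *\<^sub>R e - c *\<^sub>R X \<omega>)\<bar> \<le> C * 2 ^ 0 * (\<bar>Y \<omega>\<bar> * bracket (X \<omega>) ^ 0)"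
      using field_integrand_bound[OF c C, of Y \<omega> "z + t *\<^sub>R e"] by simp
    have "((\<lambda>t. \<Phi> (z - c *\<^sub>R X \<omega> + t *\<^sub>R e)) has_real_derivative \<Phi>' (z - c *\<^sub>R X \<omega> + t *\<^sub>R e)) (at t)"
      by (rule directional_derivative_shift[OF der])
    from DERIV_cmult[OF this, of "Y \<omega>"]
    show "((\<lambda>t. Y \<omega> * \<Phi> (z + t *\<^sub>R e - c *\<^sub>R X \<omega>)) has_real_derivative Y \<omega> * \<Phi>' (z + t *\<^sub>R e - c *\<^sub>R X \<omega>)) (at t)"
      by (simp add: algebra_simps)
  qed simp
  then show ?thesis unfolding field_def by simp
qed

text \<open>The density of X_c: given \<open>X\<close>, the interpolated vector is Gaussian with
  mean \<open>c X\<close> and variance \<open>1 - c\<^sup>2\<close>.\<close>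

definition dens :: "real \<Rightarrow> real ^ 'n \<Rightarrow> real" where
  "dens c = field c (\<lambda>_. 1) (gauss (1 - c\<^sup>2))"

text \<open>In the variable \<open>c\<close> the density satisfies the continuity equation
  \<open>\<partial>\<^sub>c dens = - div flux\<close>; \<open>dflux c i\<close> is the \<open>i\<close>-th partial derivative of \<open>flux c i\<close>.\<close>

definition flux :: "real \<Rightarrow> 'n \<Rightarrow> real ^ 'n \<Rightarrow> real" where
  "flux c i z = field c (\<lambda>\<omega>. X \<omega> $ i) (gauss (1 - c\<^sup>2)) z
     - c / (1 - c\<^sup>2) * field c (\<lambda>_. 1) (\<lambda>w. w $ i * gauss (1 - c\<^sup>2) w) z"

definition dflux :: "real \<Rightarrow> 'n \<Rightarrow> real ^ 'n \<Rightarrow> real" where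
  "dflux c i z = field c (\<lambda>\<omega>. X \<omega> $ i) (\<lambda>w. - (w $ i) / (1 - c\<^sup>2) * gauss (1 - c\<^sup>2) w) z
     - c / (1 - c\<^sup>2) * field c (\<lambda>_. 1) (\<lambda>w. gauss (1 - c\<^sup>2) w - 1 / (1 - c\<^sup>2) * (w $ i * (w $ i * gauss (1 - c\<^sup>2) w))) z"

definition log_ratio :: "real \<Rightarrow> real ^ 'n \<Rightarrow> real" where
  "log_ratio c z = ln (dens c z) - ln (gauss 1 z)"

definition entropy_at :: "real \<Rightarrow> real" where
  "entropy_at c = (LINT z|lborel. dens c z * log_ratio c z)"

text \<open>By \<open>log_ratio_derivative\<close> the gradient of \<open>log_ratio c\<close> is c
  \<open>flux\<close> / \<open>dens\<close>, so the relative Fisher information is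
  \<open>c\<^sup>2\<close> times this integral. Leaving the factor out keeps the quantity meaningful
  at \<open>c = 0\<close>.\<close>

definition fisher :: "real \<Rightarrow> real" where
  "fisher c = (LINT z|lborel. (\<Sum>i\<in>UNIV. (flux c i z)\<^sup>2 / dens c z))"

definition m2 :: real where "m2 = (LINT \<omega>|M. (norm (X \<omega>))\<^sup>2)"

lemma variance_bounds:
  fixes c :: real
  assumes "\<bar>c\<bar> < 1"
  shows "0 < 1 - c\<^sup>2" "1 - c\<^sup>2 \<le> 1"
  using assms by (auto simp: abs_square_less_1)

lemma rapid_profiles:
  fixes c :: real
  assumes "\<bar>c\<bar> < 1"
  shows "rapid (gauss (1 - c\<^sup>2))" "rapid (\<lambda>w. w $ i * gauss (1 - c\<^sup>2) w)"
    "rapid (\<lambda>w. w $ i * (w $ j * gauss (1 - c\<^sup>2) w))"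
    "rapid (\<lambda>w. - (w $ i) / (1 - c\<^sup>2) * gauss (1 - c\<^sup>2) w)"
    "rapid (\<lambda>w. b * gauss (1 - c\<^sup>2) w - 1 / (1 - c\<^sup>2) * (w $ i * (w $ j * gauss (1 - c\<^sup>2) w)))"
proof -
  note g = rapid_gauss[OF variance_bounds[OF assms]]
  show 1: "rapid (gauss (1 - c\<^sup>2))" by (rule g)
  show 2: "rapid (\<lambda>w. w $ i * gauss (1 - c\<^sup>2) w)" by (intro rapid_times_component g)
  show 3: "rapid (\<lambda>w. w $ i * (w $ j * gauss (1 - c\<^sup>2) w))" by (intro rapid_times_component g)
  show "rapid (\<lambda>w. - (w $ i) / (1 - c\<^sup>2) * gauss (1 - c\<^sup>2) w)"
    using rapid_cmult[OF 2, of "- 1 / (1 - c\<^sup>2)"] by simp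
  show "rapid (\<lambda>w. b * gauss (1 - c\<^sup>2) w - 1 / (1 - c\<^sup>2) * (w $ i * (w $ j * gauss (1 - c\<^sup>2) w)))"
    by (intro rapid_diff rapid_cmult 1 3)
qed

lemma rapid_dens:
  assumes "\<bar>c\<bar> < 1" shows "rapid (dens c)"
  using assms unfolding dens_def by (intro rapid_field rapid_profiles tempered_const) auto

lemma rapid_flux:
  assumes "\<bar>c\<bar> < 1" shows "rapid (flux c i)"
  using assms unfolding flux_def[abs_def]
  by (intro rapid_diff rapid_cmult rapid_field rapid_profiles tempered_const tempered_component) auto

lemma rapid_dflux:
  assumes "\<bar>c\<bar> < 1" shows "rapid (dflux c i)"
proof -
  have "\<bar>c\<bar> \<le> 1" using assms by simp
  note f = rapid_field[OF this]
  show ?thesis unfolding dflux_def[abs_def]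
    using f[OF rapid_profiles(5)[OF assms, of 1 i i] tempered_const[of 1]]
    by (intro rapid_diff rapid_cmult f[OF rapid_profiles(4)[OF assms] tempered_component]) simp
qed

lemma flux_derivative:
  assumes "\<bar>c\<bar> < 1"
  shows "((\<lambda>t. flux c i (z + t *\<^sub>R axis i 1)) has_real_derivative dflux c i z) (at 0)"
proof -
  note u = variance_bounds(1)[OF assms]
  have c: "\<bar>c\<bar> \<le> 1" using assms by simp
  have 1: "((\<lambda>t. field c (\<lambda>\<omega>. X \<omega> $ i) (gauss (1 - c\<^sup>2)) (z + t *\<^sub>R axis i 1)) has_real_derivative
      field c (\<lambda>\<omega>. X \<omega> $ i) (\<lambda>w. - (w $ i) / (1 - c\<^sup>2) * gauss (1 - c\<^sup>2) w) z) (at 0)"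
    by (rule field_derivative[OF c tempered_component rapid_profiles(1)[OF assms] rapid_profiles(4)[OF assms] gauss_deriv[OF u]])
  have "((\<lambda>t. field c (\<lambda>_. 1) (\<lambda>w. w $ i * gauss (1 - c\<^sup>2) w) (z + t *\<^sub>R axis i 1)) has_real_derivative
      field c (\<lambda>_. 1) (\<lambda>w. of_bool (i = i) * gauss (1 - c\<^sup>2) w - 1 / (1 - c\<^sup>2) * (w $ i * (w $ i * gauss (1 - c\<^sup>2) w))) z) (at 0)"
    by (rule field_derivative[OF c tempered_const rapid_profiles(2)[OF assms] rapid_profiles(5)[OF assms] component_gauss_deriv[OF u]])
  then have 2: "((\<lambda>t. field c (\<lambda>_. 1) (\<lambda>w. w $ i * gauss (1 - c\<^sup>2) w) (z + t *\<^sub>R axis i 1)) has_real_derivative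
      field c (\<lambda>_. 1) (\<lambda>w. gauss (1 - c\<^sup>2) w - 1 / (1 - c\<^sup>2) * (w $ i * (w $ i * gauss (1 - c\<^sup>2) w))) z) (at 0)"
    by simp
  show ?thesis unfolding flux_def[abs_def] dflux_def by (intro DERIV_diff 1 DERIV_cmult 2)
qed

lemma m2_integrable: "integrable M (\<lambda>\<omega>. (norm (X \<omega>))\<^sup>2)"
  using Bochner_Integration.integrable_diff[OF moments[of 1] integrable_const[of 1]]
  by (simp add: bracket_def)

lemma m2_nonneg: "0 \<le> m2"
  by (simp add: m2_def)

text \<open>The lower bound is Jensen's inequality for exp, applied through the tangent line e^m (1
  + y - m) at the mean m of the exponent. It keeps the logarithm of the density quadratically
  bounded, so that it is harmless against rapidly decreasing factors.\<close>

lemma dens_bounds: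
  assumes "\<bar>c\<bar> < 1"
  shows "(1 / sqrt (2 * pi)) ^ CARD('n) * exp (- ((norm z)\<^sup>2 + m2) / (1 - c\<^sup>2)) \<le> dens c z"
    and "dens c z \<le> (1 / sqrt (2 * pi * (1 - c\<^sup>2))) ^ CARD('n)"
proof -
  define u where "u = 1 - c\<^sup>2"
  note u = variance_bounds[OF assms, folded u_def]
  \<comment> \<open>Since |z - c x|^2 \<le> 2 (|z|^2 + |x|^2), the exponent of the kernel is at
    least -(|z|^2 + |X|^2)/u, whose mean is \<open>m\<close>.\<close>
  define m where "m = - ((norm z)\<^sup>2 + m2) / u"
  have int: "integrable M (\<lambda>\<omega>. gauss u (z - c *\<^sub>R X \<omega>))"
    using field_integrable[OF _ rapid_gauss[OF u] tempered_const[of 1], of c z] assms by simp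
  have int_m: "integrable M (\<lambda>\<omega>. - ((norm z)\<^sup>2 + (norm (X \<omega>))\<^sup>2) / u)"
    by (intro integrable_divide Bochner_Integration.integrable_minus Bochner_Integration.integrable_add m2_integrable integrable_const)
  have le: "(1 / sqrt (2 * pi)) ^ CARD('n) * (exp m * (1 + (- ((norm z)\<^sup>2 + (norm (X \<omega>))\<^sup>2) / u) - m))
      \<le> gauss u (z - c *\<^sub>R X \<omega>)" for \<omega>
  proof -
    define y where "y = - ((norm z)\<^sup>2 + (norm (X \<omega>))\<^sup>2) / u"
    have "norm (z - c *\<^sub>R X \<omega>) \<le> norm z + 1 * norm (X \<omega>)"
      using norm_triangle_ineq4[of z "c *\<^sub>R X \<omega>"] mult_right_mono[of "\<bar>c\<bar>" 1 "norm (X \<omega>)"] assms by simp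
    then have "(norm (z - c *\<^sub>R X \<omega>))\<^sup>2 \<le> (norm z + norm (X \<omega>))\<^sup>2" by (intro power_mono) auto
    also have "\<dots> \<le> 2 * ((norm z)\<^sup>2 + (norm (X \<omega>))\<^sup>2)"
    proof -
      have "(norm z + norm (X \<omega>))\<^sup>2 = 2 * ((norm z)\<^sup>2 + (norm (X \<omega>))\<^sup>2) - (norm z - norm (X \<omega>))\<^sup>2"
        by (simp add: power2_sum power2_diff)
      then show ?thesis by simp
    qed
    finally have "(norm (z - c *\<^sub>R X \<omega>))\<^sup>2 / (2 * u) \<le> 2 * ((norm z)\<^sup>2 + (norm (X \<omega>))\<^sup>2) / (2 * u)"
      using u by (intro divide_right_mono) auto
    moreover have "y = - (2 * ((norm z)\<^sup>2 + (norm (X \<omega>))\<^sup>2) / (2 * u))"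
      unfolding y_def using u(1) by (simp add: field_simps)
    ultimately have ey: "y \<le> - (norm (z - c *\<^sub>R X \<omega>))\<^sup>2 / (2 * u)"
      by (simp only: minus_divide_left[symmetric] neg_le_iff_le)
    have "exp m * (1 + y - m) \<le> exp m * exp (y - m)"
      using exp_ge_add_one_self[of "y - m"] by (intro mult_left_mono) (auto simp: algebra_simps)
    also have "\<dots> = exp y" by (simp add: exp_add[symmetric])
    also have "\<dots> \<le> exp (- (norm (z - c *\<^sub>R X \<omega>))\<^sup>2 / (2 * u))" using ey by simp
    finally have 1: "exp m * (1 + y - m) \<le> exp (- (norm (z - c *\<^sub>R X \<omega>))\<^sup>2 / (2 * u))" .
    have "1 / sqrt (2 * pi) \<le> 1 / sqrt (2 * pi * u)"
      using u by (intro divide_left_mono) (auto intro!: real_sqrt_le_mono mult_left_le)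
    then have 2: "(1 / sqrt (2 * pi)) ^ CARD('n) \<le> (1 / sqrt (2 * pi * u)) ^ CARD('n)"
      by (intro power_mono) auto
    have "(1 / sqrt (2 * pi)) ^ CARD('n) * (exp m * (1 + y - m))
        \<le> (1 / sqrt (2 * pi)) ^ CARD('n) * exp (- (norm (z - c *\<^sub>R X \<omega>))\<^sup>2 / (2 * u))"
      by (intro mult_left_mono 1) auto
    also have "\<dots> \<le> gauss u (z - c *\<^sub>R X \<omega>)"
      unfolding gauss_def by (intro mult_right_mono 2) auto
    finally show ?thesis unfolding y_def .
  qed
  have "(1 / sqrt (2 * pi)) ^ CARD('n) * exp m
      = (LINT \<omega>|M. (1 / sqrt (2 * pi)) ^ CARD('n) * (exp m * (1 + (- ((norm z)\<^sup>2 + (norm (X \<omega>))\<^sup>2) / u) - m)))"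
  proof -
    have "(LINT \<omega>|M. - ((norm z)\<^sup>2 + (norm (X \<omega>))\<^sup>2) / u) = m"
      using m2_integrable by (simp add: m_def m2_def prob_space)
    then have "(LINT \<omega>|M. 1 + (- ((norm z)\<^sup>2 + (norm (X \<omega>))\<^sup>2) / u) - m) = 1"
      using Bochner_Integration.integral_diff[OF Bochner_Integration.integrable_add[OF integrable_const[of 1] int_m] integrable_const[of m]]
        Bochner_Integration.integral_add[OF integrable_const[of 1] int_m]
      by (simp add: prob_space)
    then show ?thesis by (simp only: integral_mult_right_zero mult_1_right)
  qed
  also have "\<dots> \<le> (LINT \<omega>|M. gauss u (z - c *\<^sub>R X \<omega>))"
    by (intro integral_mono integrable_mult_right int le Bochner_Integration.integrable_diff Bochner_Integration.integrable_add
        integrable_const int_m)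
  finally show "(1 / sqrt (2 * pi)) ^ CARD('n) * exp (- ((norm z)\<^sup>2 + m2) / (1 - c\<^sup>2)) \<le> dens c z"
    by (simp add: dens_def field_def m_def u_def)
  have "(LINT \<omega>|M. gauss u (z - c *\<^sub>R X \<omega>)) \<le> (LINT \<omega>|M. (1 / sqrt (2 * pi * u)) ^ CARD('n))"
  proof (rule integral_mono[OF int integrable_const])
    fix \<omega>
    have "gauss u (z - c *\<^sub>R X \<omega>) \<le> (1 / sqrt (2 * pi * u)) ^ CARD('n) * 1"
      unfolding gauss_def using u by (intro mult_left_mono) auto
    then show "gauss u (z - c *\<^sub>R X \<omega>) \<le> (1 / sqrt (2 * pi * u)) ^ CARD('n)" by simp
  qed
  then show "dens c z \<le> (1 / sqrt (2 * pi * (1 - c\<^sup>2))) ^ CARD('n)"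
    by (simp add: dens_def field_def u_def prob_space)
qed

lemma dens_pos:
  assumes "\<bar>c\<bar> < 1" shows "0 < dens c z"
  by (rule less_le_trans[OF _ dens_bounds(1)[OF assms]]) simp

lemma ln_gauss_1: "ln (gauss 1 (z :: real ^ 'n)) = real CARD('n) * ln (1 / sqrt (2 * pi)) - (norm z)\<^sup>2 / 2"
  unfolding gauss_def by (subst ln_mult) (auto simp: ln_realpow simp del: ln_div)

text \<open>The constant depends on \<open>c\<close> only through the inverse of
  \<open>1 - c\<^sup>2\<close>, so the bound is uniform on every interval that stays away from 1.
  For the upper half, ln(1/sqrt u) is at most 1/sqrt u - 1, hence at most 1/u.\<close>

lemma log_ratio_bound:
  assumes "\<bar>c\<bar> < 1"
  shows "\<bar>log_ratio c z\<bar> \<le> (2 + m2 + real CARD('n)) / (1 - c\<^sup>2) * bracket z"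
proof -
  define u where "u = 1 - c\<^sup>2"
  note u = variance_bounds[OF assms, folded u_def]
  have b: "(norm z)\<^sup>2 = bracket z - 1" by (simp add: bracket_def)
  have "ln ((1 / sqrt (2 * pi)) ^ CARD('n) * exp (- ((norm z)\<^sup>2 + m2) / u)) \<le> ln (dens c z)"
    using dens_bounds(1)[OF assms, of z] unfolding u_def by (intro ln_mono) auto
  then have lo: "real CARD('n) * ln (1 / sqrt (2 * pi)) - ((norm z)\<^sup>2 + m2) / u \<le> ln (dens c z)"
    by (subst (asm) ln_mult) (auto simp: ln_realpow add_divide_distrib diff_divide_distrib simp del: ln_div)
  have "ln (dens c z) \<le> ln ((1 / sqrt (2 * pi * u)) ^ CARD('n))"
    using dens_bounds(2)[OF assms, of z] dens_pos[OF assms] unfolding u_def by (intro ln_mono) auto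
  also have "\<dots> = real CARD('n) * ln ((1 / sqrt (2 * pi)) * (1 / sqrt u))"
    using u by (simp add: ln_realpow real_sqrt_mult)
  also have "\<dots> = real CARD('n) * (ln (1 / sqrt (2 * pi)) + ln (1 / sqrt u))"
    using u by (subst ln_mult) auto
  also have "ln (1 / sqrt u) \<le> 1 / sqrt u - 1" using u by (intro ln_le_minus_one) auto
  also have "1 / sqrt u - 1 \<le> 1 / u"
  proof -
    have "u \<le> sqrt u" using u by (simp add: real_le_rsqrt power2_eq_square mult_left_le)
    then have "1 / sqrt u \<le> 1 / u" using u by (intro divide_left_mono) auto
    then show ?thesis by simp
  qed
  finally have up: "ln (dens c z) \<le> real CARD('n) * (ln (1 / sqrt (2 * pi)) + 1 / u)" by simp
  have 1: "(norm z)\<^sup>2 \<le> bracket z / u"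
  proof -
    have "bracket z \<le> bracket z / u" using u by (simp add: pos_le_divide_eq mult_left_le)
    then show ?thesis unfolding b by linarith
  qed
  have 2: "0 \<le> m2 * (bracket z - 1) / u" "0 \<le> real CARD('n) * (bracket z - 1) / u" "0 \<le> bracket z / u"
    using u m2_nonneg by auto
  have e: "(2 + m2 + real CARD('n)) / u * bracket z
      = 2 * (bracket z / u) + m2 * (bracket z - 1) / u + m2 / u + real CARD('n) * (bracket z - 1) / u + real CARD('n) / u"
    using u by (simp add: field_simps)
  have 3: "0 \<le> m2 / u" "0 \<le> real CARD('n) / u" using u m2_nonneg by auto
  have 4: "((norm z)\<^sup>2 + m2) / u \<le> bracket z / u + m2 / u"
    using u by (simp add: b divide_right_mono add_divide_distrib[symmetric])
  have r: "log_ratio c z = ln (dens c z) - real CARD('n) * ln (1 / sqrt (2 * pi)) + (norm z)\<^sup>2 / 2"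
    by (simp only: log_ratio_def ln_gauss_1)
  have "log_ratio c z \<le> real CARD('n) / u + bracket z / u"
  proof -
    have "ln (dens c z) \<le> real CARD('n) * ln (1 / sqrt (2 * pi)) + real CARD('n) / u"
      using up by (simp add: distrib_left)
    then show ?thesis using 1 zero_le_power2[of "norm z"] unfolding r by linarith
  qed
  moreover have "- (bracket z / u + m2 / u) \<le> log_ratio c z"
    using lo 4 zero_le_power2[of "norm z"] unfolding r by linarith
  ultimately have "\<bar>log_ratio c z\<bar> \<le> (2 + m2 + real CARD('n)) / u * bracket z"
    unfolding e using 2 3 by linarith
  then show ?thesis unfolding u_def .
qed

lemma log_ratio_plus_1_bound:
  assumes "\<bar>c\<bar> < 1"
  shows "\<bar>log_ratio c z + 1\<bar> \<le> ((2 + m2 + real CARD('n)) / (1 - c\<^sup>2) + 1) * bracket z ^ 1"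
  using log_ratio_bound[OF assms, of z] bracket_ge_1[of z] abs_triangle_ineq[of "log_ratio c z" 1]
  unfolding distrib_right power_one_right mult_1 by linarith

lemma continuous_log_ratio:
  assumes "\<bar>c\<bar> < 1" shows "continuous_on UNIV (log_ratio c)"
  unfolding log_ratio_def[abs_def]
  using rapid_continuous[OF rapid_dens[OF assms]] dens_pos[OF assms]
  by (auto intro!: continuous_on_diff continuous_on_ln continuous_on_gauss continuous_on_id
      simp: less_imp_neq[symmetric] gauss_pos less_imp_neq[OF gauss_pos[of 1], symmetric] dest: less_imp_neq)

text \<open>The Gaussian density contributes z_i to the derivative. Writing z = (z - c X) + c X
  inside the expectation expresses z_i times the density through the two terms of the flux, and c^2
  = 1 - u makes the coefficients match.\<close>

lemma log_ratio_derivative: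
  assumes "\<bar>c\<bar> < 1"
  shows "((\<lambda>t. log_ratio c (z + t *\<^sub>R axis i 1)) has_real_derivative c * flux c i z / dens c z) (at 0)"
proof -
  define u where "u = 1 - c\<^sup>2"
  note u = variance_bounds[OF assms, folded u_def]
  have c: "\<bar>c\<bar> \<le> 1" using assms by simp
  have d1: "((\<lambda>t. dens c (z + t *\<^sub>R axis i 1)) has_real_derivative
      field c (\<lambda>_. 1) (\<lambda>w. - (w $ i) / u * gauss u w) z) (at 0)"
    unfolding dens_def u_def
    by (rule field_derivative[OF c tempered_const rapid_profiles(1)[OF assms] rapid_profiles(4)[OF assms]
          gauss_deriv[OF variance_bounds(1)[OF assms]]])
  have f1: "field c (\<lambda>_. 1) (\<lambda>w. - (w $ i) / u * gauss u w) z
      = - (1 / u) * field c (\<lambda>_. 1) (\<lambda>w. w $ i * gauss u w) z"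
  proof -
    have "1 * (- (w $ i) / u * gauss u w) = - (1 / u) * (1 * (w $ i * gauss u w))" for w :: "real ^ 'n" by simp
    then show ?thesis unfolding field_def by (simp only: integral_mult_right_zero)
  qed
  have f2: "z $ i * dens c z = field c (\<lambda>_. 1) (\<lambda>w. w $ i * gauss u w) z + c * field c (\<lambda>\<omega>. X \<omega> $ i) (gauss u) z"
  proof -
    have "z $ i * dens c z = (LINT \<omega>|M. 1 * ((z - c *\<^sub>R X \<omega>) $ i * gauss u (z - c *\<^sub>R X \<omega>)) + c * (X \<omega> $ i * gauss u (z - c *\<^sub>R X \<omega>)))"
      unfolding dens_def field_def u_def
      by (subst integral_mult_right_zero[symmetric]) (simp add: algebra_simps)
    also have "\<dots> = field c (\<lambda>_. 1) (\<lambda>w. w $ i * gauss u w) z + c * field c (\<lambda>\<omega>. X \<omega> $ i) (gauss u) z"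
      unfolding field_def
      by (subst Bochner_Integration.integral_add, rule field_integrable[OF c rapid_profiles(2)[OF assms, folded u_def] tempered_const],
          intro integrable_mult_right, rule field_integrable[OF c rapid_profiles(1)[OF assms, folded u_def] tempered_component]) simp
    finally show ?thesis .
  qed
  have eq: "- (1 / u) * field c (\<lambda>_. 1) (\<lambda>w. w $ i * gauss u w) z + z $ i * dens c z = c * flux c i z"
  proof -
    have cc: "c * (c / u) = 1 / u - 1" using u by (simp add: field_simps power2_eq_square u_def)
    have "c * flux c i z = c * field c (\<lambda>\<omega>. X \<omega> $ i) (gauss u) z - c * (c / u) * field c (\<lambda>_. 1) (\<lambda>w. w $ i * gauss u w) z"
      by (simp add: flux_def u_def algebra_simps)
    then show ?thesis unfolding f2 cc by (simp add: algebra_simps)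
  qed
  have p: "0 < dens c z" by (rule dens_pos[OF assms])
  have l1: "((\<lambda>t. ln (dens c (z + t *\<^sub>R axis i 1))) has_real_derivative
      (- (1 / u) * field c (\<lambda>_. 1) (\<lambda>w. w $ i * gauss u w) z) / dens c z) (at 0)"
  proof -
    have "((\<lambda>t. ln (dens c (z + t *\<^sub>R axis i 1))) has_real_derivative 1 / dens c (z + 0 *\<^sub>R axis i 1) *
        (- (1 / u) * field c (\<lambda>_. 1) (\<lambda>w. w $ i * gauss u w) z)) (at 0)"
      by (rule DERIV_chain2[OF DERIV_ln_divide d1[unfolded f1]]) (simp add: p)
    then show ?thesis by (simp add: mult.commute)
  qed
  have l2: "((\<lambda>t. ln (gauss 1 (z + t *\<^sub>R axis i 1))) has_real_derivative - (z $ i)) (at 0)"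
    using DERIV_ln_divide[THEN DERIV_chain2, OF _ gauss_deriv[of 1 z i]] gauss_pos[of 1 z] by simp
  have "((\<lambda>t. log_ratio c (z + t *\<^sub>R axis i 1)) has_real_derivative
      (- (1 / u) * field c (\<lambda>_. 1) (\<lambda>w. w $ i * gauss u w) z) / dens c z - - (z $ i)) (at 0)"
    unfolding log_ratio_def by (intro DERIV_diff l1 l2)
  moreover have "(- (1 / u) * field c (\<lambda>_. 1) (\<lambda>w. w $ i * gauss u w) z) / dens c z - - (z $ i) = c * flux c i z / dens c z"
    using p unfolding eq[symmetric] by (simp add: add_divide_distrib diff_divide_distrib)
  ultimately show ?thesis by simp
qed

text \<open>\<open>log_ratio + 1\<close> is the first variation of the entropy, and its gradient is
  c \<open>flux\<close> / \<open>dens\<close>. The product of \<open>G\<close> with it is still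
  rapidly decreasing, but division by \<open>dens\<close> may spoil the decay of the other term,
  hence the separate integrability assumption.\<close>

lemma integral_deriv_log_ratio:
  assumes c: "\<bar>c\<bar> < 1" and G: "rapid G" "rapid dG"
    and der: "\<And>z. ((\<lambda>t. G (z + t *\<^sub>R axis i 1)) has_real_derivative dG z) (at 0)"
    and int: "integrable lborel (\<lambda>z. G z * flux c i z / dens c z)"
  shows "(LINT z|lborel. dG z * (log_ratio c z + 1)) = - c * (LINT z|lborel. G z * flux c i z / dens c z)"
    and "integrable lborel (\<lambda>z. dG z * (log_ratio c z + 1))"
proof -
  note bd = log_ratio_plus_1_bound[OF c]
  have cl: "continuous_on UNIV (\<lambda>z. log_ratio c z + 1)"
    by (intro continuous_intros continuous_log_ratio[OF c])
  have int1: "integrable lborel (\<lambda>z. G z * (log_ratio c z + 1))"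
    by (rule rapid_integrable[OF rapid_mult[OF G(1) cl bd]])
  show int2: "integrable lborel (\<lambda>z. dG z * (log_ratio c z + 1))"
    by (rule rapid_integrable[OF rapid_mult[OF G(2) cl bd]])
  have "(LINT z|lborel. dG z * (log_ratio c z + 1) + c * (G z * flux c i z / dens c z)) = 0"
  proof (rule integral_directional_derivative_eq_0[OF _ _ int1, where e="axis i 1"])
    show "integrable lborel (\<lambda>z. dG z * (log_ratio c z + 1) + c * (G z * flux c i z / dens c z))"
      by (intro Bochner_Integration.integrable_add int2 integrable_mult_right int)
    show "continuous_on UNIV (\<lambda>z. dG z * (log_ratio c z + 1) + c * (G z * flux c i z / dens c z))"
      by (intro continuous_intros continuous_log_ratio[OF c] rapid_continuous G rapid_flux[OF c] rapid_dens[OF c])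
        (metis dens_pos[OF c] less_irrefl)
    fix z
    have "((\<lambda>t. log_ratio c (z + t *\<^sub>R axis i 1) + 1) has_real_derivative c * flux c i z / dens c z + 0) (at 0)"
      by (intro DERIV_add log_ratio_derivative[OF c] DERIV_const)
    from DERIV_mult[OF der this]
    show "((\<lambda>t. G (z + t *\<^sub>R axis i 1) * (log_ratio c (z + t *\<^sub>R axis i 1) + 1)) has_real_derivative
        dG z * (log_ratio c z + 1) + c * (G z * flux c i z / dens c z)) (at 0)"
      by (simp add: mult_ac)
  qed
  then show "(LINT z|lborel. dG z * (log_ratio c z + 1)) = - c * (LINT z|lborel. G z * flux c i z / dens c z)"
    using int2 int by (simp del: times_divide_eq_right)
qed

end

section \<open>Cauchy-Schwarz bounds for fields over the density\<close>

lemma weighted_Cauchy_Schwarz: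
  fixes g Y :: "'a \<Rightarrow> real"
  assumes g: "integrable M g" "\<And>x. 0 \<le> g x" "0 < (LINT x|M. g x)" and Y [measurable]: "Y \<in> borel_measurable M"
  shows "ennreal ((LINT x|M. g x * Y x)\<^sup>2 / (LINT x|M. g x)) \<le> (\<integral>\<^sup>+x. ennreal (g x * (Y x)\<^sup>2) \<partial>M)"
proof (cases "(\<integral>\<^sup>+x. ennreal (g x * (Y x)\<^sup>2) \<partial>M) = \<infinity>")
  case False
  have [measurable]: "g \<in> borel_measurable M" using g(1) by simp
  have i2: "integrable M (\<lambda>x. g x * (Y x)\<^sup>2)"
    by (rule integrableI_nonneg) (use False g in \<open>auto simp: less_top\<close>)
  have i1: "integrable M (\<lambda>x. g x * Y x)"
  proof (rule Bochner_Integration.integrable_bound[OF Bochner_Integration.integrable_add[OF g(1) i2]])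
    show "AE x in M. norm (g x * Y x) \<le> norm (g x + g x * (Y x)\<^sup>2)"
    proof (intro always_eventually allI)
      fix x
      have "\<bar>Y x\<bar> \<le> 1 + (Y x)\<^sup>2" using norm_le_bracket[of "Y x"] by (simp add: bracket_def)
      then have "g x * \<bar>Y x\<bar> \<le> g x * (1 + (Y x)\<^sup>2)" by (intro mult_left_mono g)
      then show "norm (g x * Y x) \<le> norm (g x + g x * (Y x)\<^sup>2)" using g(2)[of x] by (simp add: abs_mult distrib_left)
    qed
  qed simp
  define G where "G = (LINT x|M. g x)"
  \<comment> \<open>The weighted mean of \<open>Y\<close>; the inequality is the nonnegativity of
    the weighted variance around it. Where the right-hand side is infinite nothing is claimed, so
    \<open>Y\<close> only has to be measurable.\<close>
  define m where "m = (LINT x|M. g x * Y x) / G"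
  have "0 \<le> (LINT x|M. g x * (Y x - m)\<^sup>2)" using g by simp
  also have "(LINT x|M. g x * (Y x - m)\<^sup>2) = (LINT x|M. g x * (Y x)\<^sup>2 - (2 * m) * (g x * Y x) + m\<^sup>2 * g x)"
    by (rule Bochner_Integration.integral_cong) (simp_all add: power2_eq_square algebra_simps)
  also have "\<dots> = (LINT x|M. g x * (Y x)\<^sup>2) - (2 * m) * (LINT x|M. g x * Y x) + m\<^sup>2 * G"
    using i1 i2 g(1) by (simp add: G_def)
  also have "\<dots> = (LINT x|M. g x * (Y x)\<^sup>2) - (LINT x|M. g x * Y x)\<^sup>2 / G"
    using g(3) by (simp add: m_def G_def[symmetric] field_simps power2_eq_square)
  finally have "(LINT x|M. g x * Y x)\<^sup>2 / G \<le> (LINT x|M. g x * (Y x)\<^sup>2)" by simp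
  then show ?thesis
    using i2 g by (subst nn_integral_eq_integral) (auto simp: G_def intro!: ennreal_leI)
qed simp

context random_vector
begin

text \<open>\<open>G i z / dens c z\<close> is the conditional expectation of a_i + b_i . (z - c X)
  given X_c = z, and conditioning decreases the norm in L^2. Given \<open>X\<close>, the vector z -
  c X is centred Gaussian of variance u, which leaves |a|^2 + u |b|^2. Every estimate of the Fisher
  information below is an instance.\<close>

lemma integral_square_over_dens_le:
  fixes a :: "'n \<Rightarrow> 'a \<Rightarrow> real" and b :: "'n \<Rightarrow> 'n \<Rightarrow> 'a \<Rightarrow> real"
  assumes c: "\<bar>c\<bar> < 1"
    and [measurable]: "\<And>i. a i \<in> borel_measurable M" "\<And>i j. b i j \<in> borel_measurable M"
    and G: "\<And>i z. G i z = (LINT \<omega>|M. gauss (1 - c\<^sup>2) (z - c *\<^sub>R X \<omega>)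
              * (a i \<omega> + (\<Sum>j\<in>UNIV. b i j \<omega> * (z - c *\<^sub>R X \<omega>) $ j)))"
    and Gm [measurable]: "\<And>i. G i \<in> borel_measurable borel"
    and int: "integrable M (\<lambda>\<omega>. \<Sum>i\<in>UNIV. (a i \<omega>)\<^sup>2 + (1 - c\<^sup>2) * (\<Sum>j\<in>UNIV. (b i j \<omega>)\<^sup>2))"
  shows "(LINT z|lborel. (\<Sum>i\<in>UNIV. (G i z)\<^sup>2 / dens c z))
      \<le> (LINT \<omega>|M. (\<Sum>i\<in>UNIV. (a i \<omega>)\<^sup>2 + (1 - c\<^sup>2) * (\<Sum>j\<in>UNIV. (b i j \<omega>)\<^sup>2)))"
    and "integrable lborel (\<lambda>z. (G i z)\<^sup>2 / dens c z)"
proof -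
  define u where "u = 1 - c\<^sup>2"
  note u = variance_bounds[OF c, folded u_def]
  have dens_eq: "dens c z = (LINT \<omega>|M. gauss u (z - c *\<^sub>R X \<omega>))" for z
    by (simp add: dens_def field_def u_def)
  have [measurable]: "dens c \<in> borel_measurable borel" by (rule rapid_measurable[OF rapid_dens[OF c]])
  have pos: "0 < dens c z" for z by (rule dens_pos[OF c])
  define R where "R = (LINT \<omega>|M. (\<Sum>i\<in>UNIV. (a i \<omega>)\<^sup>2 + u * (\<Sum>j\<in>UNIV. (b i j \<omega>)\<^sup>2)))"
  define Y where "Y i z \<omega> = a i \<omega> + (\<Sum>j\<in>UNIV. b i j \<omega> * (z - c *\<^sub>R X \<omega>) $ j)" for i z \<omega>
  have Ym [measurable]: "(\<lambda>(\<omega>, z). ennreal (gauss u (z - c *\<^sub>R X \<omega>) * (Y i z \<omega>)\<^sup>2)) \<in> borel_measurable (M \<Otimes>\<^sub>M lborel)" for i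
    unfolding Y_def by measurable
  have "(\<integral>\<^sup>+z. ennreal (\<Sum>i\<in>UNIV. (G i z)\<^sup>2 / dens c z) \<partial>lborel)
      \<le> (\<integral>\<^sup>+z. (\<Sum>i\<in>UNIV. \<integral>\<^sup>+\<omega>. ennreal (gauss u (z - c *\<^sub>R X \<omega>) * (Y i z \<omega>)\<^sup>2) \<partial>M) \<partial>lborel)"
  proof (rule nn_integral_mono)
    fix z
    have "ennreal ((G i z)\<^sup>2 / dens c z) \<le> (\<integral>\<^sup>+\<omega>. ennreal (gauss u (z - c *\<^sub>R X \<omega>) * (Y i z \<omega>)\<^sup>2) \<partial>M)" for i
      unfolding G dens_eq u_def[symmetric] Y_def[symmetric]
    proof (rule weighted_Cauchy_Schwarz)
      show "integrable M (\<lambda>\<omega>. gauss u (z - c *\<^sub>R X \<omega>))"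
        using field_integrable[OF _ rapid_gauss[OF u] tempered_const[of 1], of c z] c by simp
      show "0 < (LINT \<omega>|M. gauss u (z - c *\<^sub>R X \<omega>))" using pos[of z] by (simp add: dens_eq)
      show "(\<lambda>\<omega>. Y i z \<omega>) \<in> borel_measurable M" unfolding Y_def by measurable
    qed (rule gauss_nonneg[OF u(1)])
    then have "(\<Sum>i\<in>UNIV. ennreal ((G i z)\<^sup>2 / dens c z))
        \<le> (\<Sum>i\<in>UNIV. \<integral>\<^sup>+\<omega>. ennreal (gauss u (z - c *\<^sub>R X \<omega>) * (Y i z \<omega>)\<^sup>2) \<partial>M)"
      by (intro sum_mono)
    then show "ennreal (\<Sum>i\<in>UNIV. (G i z)\<^sup>2 / dens c z)
        \<le> (\<Sum>i\<in>UNIV. \<integral>\<^sup>+\<omega>. ennreal (gauss u (z - c *\<^sub>R X \<omega>) * (Y i z \<omega>)\<^sup>2) \<partial>M)"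
      using pos[of z] by (subst sum_ennreal[symmetric]) auto
  qed
  also have "\<dots> = (\<Sum>i\<in>UNIV. \<integral>\<^sup>+z. \<integral>\<^sup>+\<omega>. ennreal (gauss u (z - c *\<^sub>R X \<omega>) * (Y i z \<omega>)\<^sup>2) \<partial>M \<partial>lborel)"
  proof (rule nn_integral_sum)
    fix i
    have "(\<lambda>(z, \<omega>). ennreal (gauss u (z - c *\<^sub>R X \<omega>) * (Y i z \<omega>)\<^sup>2)) \<in> borel_measurable (lborel \<Otimes>\<^sub>M M)"
      unfolding Y_def by measurable
    then show "(\<lambda>z. \<integral>\<^sup>+\<omega>. ennreal (gauss u (z - c *\<^sub>R X \<omega>) * (Y i z \<omega>)\<^sup>2) \<partial>M) \<in> borel_measurable lborel"
      by (rule borel_measurable_nn_integral)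
  qed
  also have "\<dots> = (\<Sum>i\<in>UNIV. \<integral>\<^sup>+\<omega>. ennreal ((a i \<omega>)\<^sup>2 + u * (\<Sum>j\<in>UNIV. (b i j \<omega>)\<^sup>2)) \<partial>M)"
  proof (rule sum.cong[OF refl])
    fix i
    interpret pair_sigma_finite M lborel ..
    have "(\<integral>\<^sup>+z. \<integral>\<^sup>+\<omega>. ennreal (gauss u (z - c *\<^sub>R X \<omega>) * (Y i z \<omega>)\<^sup>2) \<partial>M \<partial>lborel)
        = (\<integral>\<^sup>+\<omega>. \<integral>\<^sup>+z. ennreal (gauss u (z - c *\<^sub>R X \<omega>) * (Y i z \<omega>)\<^sup>2) \<partial>lborel \<partial>M)"
      by (rule Fubini'[OF Ym])
    also have "\<dots> = (\<integral>\<^sup>+\<omega>. ennreal ((a i \<omega>)\<^sup>2 + u * (\<Sum>j\<in>UNIV. (b i j \<omega>)\<^sup>2)) \<partial>M)"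
      unfolding Y_def mult.commute[of "gauss u _"]
      by (intro nn_integral_cong nn_integral_gauss_affine_square[OF u])
    finally show "(\<integral>\<^sup>+z. \<integral>\<^sup>+\<omega>. ennreal (gauss u (z - c *\<^sub>R X \<omega>) * (Y i z \<omega>)\<^sup>2) \<partial>M \<partial>lborel)
        = (\<integral>\<^sup>+\<omega>. ennreal ((a i \<omega>)\<^sup>2 + u * (\<Sum>j\<in>UNIV. (b i j \<omega>)\<^sup>2)) \<partial>M)" .
  qed
  also have "\<dots> = (\<integral>\<^sup>+\<omega>. (\<Sum>i\<in>UNIV. ennreal ((a i \<omega>)\<^sup>2 + u * (\<Sum>j\<in>UNIV. (b i j \<omega>)\<^sup>2))) \<partial>M)"
    by (rule nn_integral_sum[symmetric]) measurable
  also have "\<dots> = (\<integral>\<^sup>+\<omega>. ennreal (\<Sum>i\<in>UNIV. (a i \<omega>)\<^sup>2 + u * (\<Sum>j\<in>UNIV. (b i j \<omega>)\<^sup>2)) \<partial>M)"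
    using u by (intro nn_integral_cong sum_ennreal) (auto intro!: add_nonneg_nonneg mult_nonneg_nonneg sum_nonneg)
  also have "\<dots> = ennreal R"
    unfolding R_def using u int[folded u_def]
    by (intro nn_integral_eq_integral) (auto intro!: always_eventually sum_nonneg add_nonneg_nonneg mult_nonneg_nonneg)
  finally have nn: "(\<integral>\<^sup>+z. ennreal (\<Sum>i\<in>UNIV. (G i z)\<^sup>2 / dens c z) \<partial>lborel) \<le> ennreal R" .
  have R: "0 \<le> R"
    unfolding R_def using u
    by (intro Bochner_Integration.integral_nonneg) (auto intro!: sum_nonneg add_nonneg_nonneg mult_nonneg_nonneg)
  have nneg: "0 \<le> (G i z)\<^sup>2 / dens c z" for i z using pos[of z] by simp
  have int_sum: "integrable lborel (\<lambda>z. \<Sum>i\<in>UNIV. (G i z)\<^sup>2 / dens c z)"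
    using nn by (intro integrableI_nonneg) (auto intro!: always_eventually sum_nonneg nneg simp: le_less_trans)
  show "integrable lborel (\<lambda>z. (G i z)\<^sup>2 / dens c z)" for i
  proof (rule Bochner_Integration.integrable_bound[OF int_sum])
    show "AE z in lborel. norm ((G i z)\<^sup>2 / dens c z) \<le> norm (\<Sum>i\<in>UNIV. (G i z)\<^sup>2 / dens c z)"
    proof (intro always_eventually allI)
      fix z
      have "(G i z)\<^sup>2 / dens c z \<le> (\<Sum>i\<in>UNIV. (G i z)\<^sup>2 / dens c z)"
        by (rule member_le_sum) (auto intro: nneg)
      then show "norm ((G i z)\<^sup>2 / dens c z) \<le> norm (\<Sum>i\<in>UNIV. (G i z)\<^sup>2 / dens c z)"
        using nneg[of i z] by (simp only: real_norm_def abs_of_nonneg)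
    qed
  qed measurable
  have "(LINT z|lborel. (\<Sum>i\<in>UNIV. (G i z)\<^sup>2 / dens c z)) = enn2real (\<integral>\<^sup>+z. ennreal (\<Sum>i\<in>UNIV. (G i z)\<^sup>2 / dens c z) \<partial>lborel)"
    by (rule integral_eq_nn_integral) (auto intro!: always_eventually sum_nonneg nneg)
  also have "\<dots> \<le> R" using enn2real_mono[OF nn] R by simp
  finally show "(LINT z|lborel. (\<Sum>i\<in>UNIV. (G i z)\<^sup>2 / dens c z))
      \<le> (LINT \<omega>|M. (\<Sum>i\<in>UNIV. (a i \<omega>)\<^sup>2 + (1 - c\<^sup>2) * (\<Sum>j\<in>UNIV. (b i j \<omega>)\<^sup>2)))"
    by (simp add: R_def u_def)
qed

lemma flux_eq:
  assumes "\<bar>c\<bar> < 1"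
  shows "flux c i z = (LINT \<omega>|M. gauss (1 - c\<^sup>2) (z - c *\<^sub>R X \<omega>)
     * (X \<omega> $ i + (\<Sum>j\<in>UNIV. (- c / (1 - c\<^sup>2) * of_bool (i = j)) * (z - c *\<^sub>R X \<omega>) $ j)))"
proof -
  have c: "\<bar>c\<bar> \<le> 1" using assms by simp
  have "flux c i z = (LINT \<omega>|M. X \<omega> $ i * gauss (1 - c\<^sup>2) (z - c *\<^sub>R X \<omega>)
      - c / (1 - c\<^sup>2) * (1 * ((z - c *\<^sub>R X \<omega>) $ i * gauss (1 - c\<^sup>2) (z - c *\<^sub>R X \<omega>))))"
    unfolding flux_def field_def
    by (simp only: integral_mult_right_zero
        Bochner_Integration.integral_diff[OF field_integrable[OF c rapid_profiles(1)[OF assms] tempered_component]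
          integrable_mult_right[OF field_integrable[OF c rapid_profiles(2)[OF assms] tempered_const]]])
  also have "\<dots> = (LINT \<omega>|M. gauss (1 - c\<^sup>2) (z - c *\<^sub>R X \<omega>)
     * (X \<omega> $ i + (\<Sum>j\<in>UNIV. (- c / (1 - c\<^sup>2) * of_bool (i = j)) * (z - c *\<^sub>R X \<omega>) $ j)))"
  proof (rule Bochner_Integration.integral_cong[OF refl])
    fix \<omega>
    have "(\<Sum>j\<in>UNIV. (- c / (1 - c\<^sup>2) * of_bool (i = j)) * (z - c *\<^sub>R X \<omega>) $ j)
        = (\<Sum>j\<in>UNIV. if j = i then (- c / (1 - c\<^sup>2)) * (z - c *\<^sub>R X \<omega>) $ i else 0)"
      by (intro sum.cong) auto
    also have "\<dots> = (- c / (1 - c\<^sup>2)) * (z - c *\<^sub>R X \<omega>) $ i" by simp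
    finally have e: "(\<Sum>j\<in>UNIV. (- c / (1 - c\<^sup>2) * of_bool (i = j)) * (z - c *\<^sub>R X \<omega>) $ j) = (- c / (1 - c\<^sup>2)) * (z - c *\<^sub>R X \<omega>) $ i" .
    show "X \<omega> $ i * gauss (1 - c\<^sup>2) (z - c *\<^sub>R X \<omega>)
      - c / (1 - c\<^sup>2) * (1 * ((z - c *\<^sub>R X \<omega>) $ i * gauss (1 - c\<^sup>2) (z - c *\<^sub>R X \<omega>)))
      = gauss (1 - c\<^sup>2) (z - c *\<^sub>R X \<omega>)
     * (X \<omega> $ i + (\<Sum>j\<in>UNIV. (- c / (1 - c\<^sup>2) * of_bool (i = j)) * (z - c *\<^sub>R X \<omega>) $ j))"
      unfolding e by (simp add: algebra_simps)
  qed
  finally show ?thesis .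
qed

lemma flux_square_integrable:
  assumes "\<bar>c\<bar> < 1"
  shows "integrable lborel (\<lambda>z. (flux c i z)\<^sup>2 / dens c z)"
proof (rule integral_square_over_dens_le(2)[OF assms _ _ flux_eq[OF assms]])
  show "integrable M (\<lambda>\<omega>. \<Sum>i\<in>UNIV. (X \<omega> $ i)\<^sup>2 + (1 - c\<^sup>2) * (\<Sum>j\<in>UNIV. (- c / (1 - c\<^sup>2) * of_bool (i = j))\<^sup>2))"
    using m2_integrable unfolding sum.distrib norm_power2_eq_sum
    by (intro Bochner_Integration.integrable_add integrable_const)
qed (auto intro: rapid_measurable[OF rapid_flux[OF assms]])

text \<open>Two fields with the same divergence have the same pairing with the gradient of \<open>log_ratio\<close>, and
  for \<open>flux\<close> this pairing is the Fisher information; Cauchy-Schwarz then compares the two norms.\<close>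

lemma fisher_le_same_divergence:
  assumes c: "\<bar>c\<bar> < 1" "c \<noteq> 0" and K: "\<And>i. rapid (K i)" "\<And>i. rapid (dK i)"
    and der: "\<And>i z. ((\<lambda>t. K i (z + t *\<^sub>R axis i 1)) has_real_derivative dK i z) (at 0)"
    and div_eq: "\<And>z. (\<Sum>i\<in>UNIV. dK i z) = (\<Sum>i\<in>UNIV. dflux c i z)"
    and int: "\<And>i. integrable lborel (\<lambda>z. (K i z)\<^sup>2 / dens c z)"
  shows "fisher c \<le> (LINT z|lborel. (\<Sum>i\<in>UNIV. (K i z)\<^sup>2 / dens c z))"
proof -
  have pos: "0 < dens c z" for z by (rule dens_pos[OF c(1)])
  have [measurable]: "dens c \<in> borel_measurable borel" "K i \<in> borel_measurable borel" "flux c i \<in> borel_measurable borel" for i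
    by (intro rapid_measurable rapid_dens rapid_flux c K)+
  note fint = flux_square_integrable[OF c(1)]
  have cs: "2 * \<bar>K i z * flux c i z / dens c z\<bar> \<le> (K i z)\<^sup>2 / dens c z + (flux c i z)\<^sup>2 / dens c z" for i z
  proof -
    have "2 * \<bar>K i z * flux c i z\<bar> \<le> (K i z)\<^sup>2 + (flux c i z)\<^sup>2"
      using sum_squares_bound[of "\<bar>K i z\<bar>" "\<bar>flux c i z\<bar>"] by (simp add: abs_mult)
    then have "2 * \<bar>K i z * flux c i z\<bar> / dens c z \<le> ((K i z)\<^sup>2 + (flux c i z)\<^sup>2) / dens c z"
      by (rule divide_right_mono) (use pos[of z] in simp)
    then show ?thesis using pos[of z] by (simp add: abs_divide add_divide_distrib)
  qed
  have Kint: "integrable lborel (\<lambda>z. K i z * flux c i z / dens c z)" for i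
  proof (rule Bochner_Integration.integrable_bound[OF Bochner_Integration.integrable_add[OF int[of i] fint[of i]]])
    show "AE z in lborel. norm (K i z * flux c i z / dens c z) \<le> norm ((K i z)\<^sup>2 / dens c z + (flux c i z)\<^sup>2 / dens c z)"
    proof (intro always_eventually allI)
      fix z
      show "norm (K i z * flux c i z / dens c z) \<le> norm ((K i z)\<^sup>2 / dens c z + (flux c i z)\<^sup>2 / dens c z)"
        using cs[of i z] unfolding real_norm_def by linarith
    qed
  qed measurable
  have fint': "integrable lborel (\<lambda>z. flux c i z * flux c i z / dens c z)" for i
    using fint[of i] by (simp add: power2_eq_square)
  note kd = integral_deriv_log_ratio[OF c(1) K der Kint]
  note fd = integral_deriv_log_ratio[OF c(1) rapid_flux[OF c(1)] rapid_dflux[OF c(1)] flux_derivative[OF c(1)] fint']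
  have "(LINT z|lborel. (\<Sum>i\<in>UNIV. dK i z) * (log_ratio c z + 1)) = - c * (\<Sum>i\<in>UNIV. LINT z|lborel. K i z * flux c i z / dens c z)"
    unfolding sum_distrib_right
    by (subst Bochner_Integration.integral_sum, rule kd(2)) (simp only: kd(1) sum_distrib_left)
  moreover have "(LINT z|lborel. (\<Sum>i\<in>UNIV. dflux c i z) * (log_ratio c z + 1)) = - c * (\<Sum>i\<in>UNIV. LINT z|lborel. flux c i z * flux c i z / dens c z)"
    unfolding sum_distrib_right
    by (subst Bochner_Integration.integral_sum, rule fd(2)) (simp only: fd(1) sum_distrib_left)
  \<comment> \<open>Both divergences give -c times the respective pairing with the flux, so c
    \<noteq> 0 makes the pairings equal. The claim then follows from 2ab \<le> a^2 + b^2 by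
    cancelling one copy of the Fisher information.\<close>
  ultimately have eq: "(\<Sum>i\<in>UNIV. LINT z|lborel. K i z * flux c i z / dens c z) = (\<Sum>i\<in>UNIV. LINT z|lborel. (flux c i z)\<^sup>2 / dens c z)"
    using c(2) unfolding div_eq by (simp add: power2_eq_square)
  have "2 * (\<Sum>i\<in>UNIV. LINT z|lborel. K i z * flux c i z / dens c z)
      \<le> (\<Sum>i\<in>UNIV. LINT z|lborel. (K i z)\<^sup>2 / dens c z) + (\<Sum>i\<in>UNIV. LINT z|lborel. (flux c i z)\<^sup>2 / dens c z)"
    unfolding sum_distrib_left sum.distrib[symmetric]
  proof (rule sum_mono)
    fix i
    have "2 * (LINT z|lborel. K i z * flux c i z / dens c z) = (LINT z|lborel. 2 * (K i z * flux c i z / dens c z))"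
      by (simp only: integral_mult_right_zero)
    also have "\<dots> \<le> (LINT z|lborel. (K i z)\<^sup>2 / dens c z + (flux c i z)\<^sup>2 / dens c z)"
    proof (rule integral_mono)
      fix z
      show "2 * (K i z * flux c i z / dens c z) \<le> (K i z)\<^sup>2 / dens c z + (flux c i z)\<^sup>2 / dens c z"
        using cs[of i z] by linarith
    qed (intro integrable_mult_right Kint Bochner_Integration.integrable_add int fint)+
    finally show "2 * (LINT z|lborel. K i z * flux c i z / dens c z)
      \<le> (LINT z|lborel. (K i z)\<^sup>2 / dens c z) + (LINT z|lborel. (flux c i z)\<^sup>2 / dens c z)"
      by (simp only: Bochner_Integration.integral_add[OF int fint])
  qed
  then show ?thesis
    unfolding eq fisher_def by (simp add: Bochner_Integration.integral_sum int fint)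
qed

end

section \<open>Differentiation in the interpolation parameter and integration of the Fisher
  bounds\<close>

definition gauss_const :: "'n::finite itself \<Rightarrow> real \<Rightarrow> nat \<Rightarrow> real" where
  "gauss_const _ u N = (1 / sqrt (2 * pi * u)) ^ CARD('n) * ((2 * real N) ^ N * exp (1 / 2))"

text \<open>The constant depends only on a lower bound \<open>v\<close> of the variance.
  Differentiating in \<open>c\<close> under an integral needs one dominating function for a whole
  interval of parameters.\<close>

lemma gauss_decay_uniform:
  assumes "0 < v" "v \<le> u" "u \<le> 1"
  shows "gauss u (w :: real ^ 'n::finite) * bracket w ^ N \<le> gauss_const TYPE('n) v N"
proof -
  have "1 / sqrt (2 * pi * u) \<le> 1 / sqrt (2 * pi * v)"
    using assms by (intro divide_left_mono) auto
  then have "(1 / sqrt (2 * pi * u)) ^ CARD('n) \<le> (1 / sqrt (2 * pi * v)) ^ CARD('n)"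
    using assms by (intro power_mono) auto
  then have "(1 / sqrt (2 * pi * u)) ^ CARD('n) * ((2 * real N) ^ N * exp (1 / 2)) \<le> gauss_const TYPE('n) v N"
    unfolding gauss_const_def by (intro mult_right_mono) auto
  then show ?thesis using gauss_decay[of u w N] assms by linarith
qed

lemma gauss_const_nonneg: "0 < v \<Longrightarrow> 0 \<le> gauss_const T v N"
  by (simp add: gauss_const_def)

text \<open>A single exponential, so that differentiating in the variance is one chain rule and no
  derivative of a power of a square root appears.\<close>

lemma gauss_eq_exp:
  assumes "0 < u"
  shows "gauss u (w :: real ^ 'n::finite) = exp (- (real CARD('n) / 2) * ln (2 * pi * u) - (norm w)\<^sup>2 / (2 * u))"
proof -
  have "1 / sqrt (2 * pi * u) = exp (- ln (2 * pi * u) / 2)"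
    using assms by (simp add: ln_sqrt[symmetric] exp_minus inverse_eq_divide del: ln_sqrt)
  then have "(1 / sqrt (2 * pi * u)) ^ CARD('n) = exp (real CARD('n) * (- ln (2 * pi * u) / 2))"
    by (simp only: exp_of_nat_mult)
  then show ?thesis by (simp add: gauss_def exp_add[symmetric])
qed

text \<open>The derivative is arranged as a sum over coordinates because it has to agree, under the
  expectation, with minus the divergence of the flux (\<open>dflux_sum\<close>).\<close>

lemma gauss_param_deriv:
  fixes z x :: "real ^ 'n::finite"
  assumes "\<bar>c\<bar> < 1"
  shows "((\<lambda>c. gauss (1 - c\<^sup>2) (z - c *\<^sub>R x)) has_real_derivative
    gauss (1 - c\<^sup>2) (z - c *\<^sub>R x) * (\<Sum>i\<in>UNIV. c / (1 - c\<^sup>2) + (z - c *\<^sub>R x) $ i * x $ i / (1 - c\<^sup>2)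
      - c * ((z - c *\<^sub>R x) $ i)\<^sup>2 / (1 - c\<^sup>2)\<^sup>2)) (at c)"
proof -
  define d where "d = real CARD('n)"
  define N where "N s = (norm z)\<^sup>2 - 2 * s * (z \<bullet> x) + s\<^sup>2 * (norm x)\<^sup>2" for s
  have N: "(norm (z - s *\<^sub>R x))\<^sup>2 = N s" for s
    unfolding N_def power2_norm_eq_inner by (simp add: inner_diff_left inner_diff_right inner_commute power2_eq_square algebra_simps)
  define E where "E s = exp (- (d / 2) * ln (2 * pi * (1 - s\<^sup>2)) - N s / (2 * (1 - s\<^sup>2)))" for s
  have u: "0 < 1 - c\<^sup>2" using assms by (simp add: abs_square_less_1)
  have u': "1 - c\<^sup>2 \<noteq> 0" "1 - c * c \<noteq> 0" using u by (auto simp: power2_eq_square)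
  have dE: "(E has_real_derivative E c * (d * c / (1 - c\<^sup>2) + ((z \<bullet> x) - c * (norm x)\<^sup>2) / (1 - c\<^sup>2) - c * N c / (1 - c\<^sup>2)\<^sup>2)) (at c)"
  proof -
    have d1: "((\<lambda>s. ln (2 * pi * (1 - s\<^sup>2))) has_real_derivative - 2 * c / (1 - c\<^sup>2)) (at c)"
      using u u' by (auto intro!: derivative_eq_intros simp: field_simps)
    have d2: "(N has_real_derivative - 2 * (z \<bullet> x) + 2 * c * (norm x)\<^sup>2) (at c)"
      unfolding N_def by (auto intro!: derivative_eq_intros)
    have d3: "((\<lambda>s. N s / (2 * (1 - s\<^sup>2))) has_real_derivative
        ((- 2 * (z \<bullet> x) + 2 * c * (norm x)\<^sup>2) * (2 * (1 - c\<^sup>2)) - N c * (2 * (- 2 * c))) / ((2 * (1 - c\<^sup>2)) * (2 * (1 - c\<^sup>2)))) (at c)"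
      using u' by (intro DERIV_divide d2) (auto intro!: derivative_eq_intros)
    have "(E has_real_derivative E c * (- (d / 2) * (- 2 * c / (1 - c\<^sup>2))
        - ((- 2 * (z \<bullet> x) + 2 * c * (norm x)\<^sup>2) * (2 * (1 - c\<^sup>2)) - N c * (2 * (- 2 * c))) / ((2 * (1 - c\<^sup>2)) * (2 * (1 - c\<^sup>2))))) (at c)"
      unfolding E_def by (intro DERIV_fun_exp DERIV_diff DERIV_cmult d1 d3)
    moreover have eq: "- (d / 2) * (- 2 * c / (1 - c\<^sup>2))
        - ((- 2 * (z \<bullet> x) + 2 * c * (norm x)\<^sup>2) * (2 * (1 - c\<^sup>2)) - N c * (2 * (- 2 * c))) / ((2 * (1 - c\<^sup>2)) * (2 * (1 - c\<^sup>2)))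
        = d * c / (1 - c\<^sup>2) + ((z \<bullet> x) - c * (norm x)\<^sup>2) / (1 - c\<^sup>2) - c * N c / (1 - c\<^sup>2)\<^sup>2"
    proof -
      have "((- 2 * (z \<bullet> x) + 2 * c * (norm x)\<^sup>2) * (2 * t) - n * (2 * (- 2 * c))) / ((2 * t) * (2 * t))
          = - (((z \<bullet> x) - c * (norm x)\<^sup>2) / t - c * n / t\<^sup>2)" if "t \<noteq> 0" for t n
        using that by (simp add: field_simps power2_eq_square)
      from this[OF u'(1)] show ?thesis by (simp add: mult.commute)
    qed
    ultimately show ?thesis by (simp only: eq)
  qed
  have eqs: "d * c / (1 - c\<^sup>2) + ((z \<bullet> x) - c * (norm x)\<^sup>2) / (1 - c\<^sup>2) - c * N c / (1 - c\<^sup>2)\<^sup>2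
      = (\<Sum>i\<in>UNIV. c / (1 - c\<^sup>2) + (z - c *\<^sub>R x) $ i * x $ i / (1 - c\<^sup>2)
      - c * ((z - c *\<^sub>R x) $ i)\<^sup>2 / (1 - c\<^sup>2)\<^sup>2)"
  proof -
    have 1: "(\<Sum>i\<in>UNIV. (z - c *\<^sub>R x) $ i * x $ i) = (z \<bullet> x) - c * (norm x)\<^sup>2"
      unfolding power2_norm_eq_inner inner_scaleR_left[symmetric] inner_diff_left[symmetric]
      by (simp add: inner_vec_def)
    have 2: "(\<Sum>i\<in>UNIV. ((z - c *\<^sub>R x) $ i)\<^sup>2) = N c"
      unfolding N[symmetric] norm_power2_eq_sum ..
    show ?thesis
      unfolding sum_subtractf sum.distrib sum_divide_distrib[symmetric] sum_distrib_left[symmetric] 1 2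
      by (simp add: d_def)
  qed
  \<comment> \<open>The exponential form represents the kernel only where the variance is positive,
    so the derivative is transferred within the open interval.\<close>
  have Eg: "E s = gauss (1 - s\<^sup>2) (z - s *\<^sub>R x)" if "s \<in> {-1<..<1}" for s
  proof -
    have "0 < 1 - s\<^sup>2" using that by (simp add: abs_square_less_1 abs_less_iff)
    then show ?thesis by (simp only: gauss_eq_exp E_def d_def N)
  qed
  have c1: "c \<in> {-1<..<1}" using assms by auto
  show ?thesis
    unfolding eqs[symmetric] Eg[OF c1, symmetric]
    by (rule has_field_derivative_transform_within_open[OF dE _ c1 Eg]) auto
qed

context random_vector
begin

lemma dflux_sum:
  assumes "\<bar>c\<bar> < 1"
  shows "- (\<Sum>i\<in>UNIV. dflux c i z) = (LINT \<omega>|M. gauss (1 - c\<^sup>2) (z - c *\<^sub>R X \<omega>)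
     * (\<Sum>i\<in>UNIV. c / (1 - c\<^sup>2) + (z - c *\<^sub>R X \<omega>) $ i * X \<omega> $ i / (1 - c\<^sup>2)
      - c * ((z - c *\<^sub>R X \<omega>) $ i)\<^sup>2 / (1 - c\<^sup>2)\<^sup>2))"
proof -
  define u where "u = 1 - c\<^sup>2"
  note u = variance_bounds[OF assms, folded u_def]
  have c: "\<bar>c\<bar> \<le> 1" using assms by simp
  note r4 = rapid_profiles(4)[OF assms, folded u_def]
  note r5 = rapid_profiles(5)[OF assms, of 1, folded u_def, unfolded mult_1]
  note i1 = field_integrable[OF c r4 tempered_component]
  note i2 = integrable_mult_right[OF field_integrable[OF c r5 tempered_const[of 1]]]
  have "dflux c i z = (LINT \<omega>|M. X \<omega> $ i * (- ((z - c *\<^sub>R X \<omega>) $ i) / u * gauss u (z - c *\<^sub>R X \<omega>))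
      - c / u * (1 * (gauss u (z - c *\<^sub>R X \<omega>) - 1 / u * ((z - c *\<^sub>R X \<omega>) $ i * ((z - c *\<^sub>R X \<omega>) $ i * gauss u (z - c *\<^sub>R X \<omega>))))))" for i
    unfolding dflux_def field_def u_def[symmetric]
    by (simp only: integral_mult_right_zero Bochner_Integration.integral_diff[OF i1 i2])
  then have "- (\<Sum>i\<in>UNIV. dflux c i z) = - (LINT \<omega>|M. (\<Sum>i\<in>UNIV. X \<omega> $ i * (- ((z - c *\<^sub>R X \<omega>) $ i) / u * gauss u (z - c *\<^sub>R X \<omega>))
      - c / u * (1 * (gauss u (z - c *\<^sub>R X \<omega>) - 1 / u * ((z - c *\<^sub>R X \<omega>) $ i * ((z - c *\<^sub>R X \<omega>) $ i * gauss u (z - c *\<^sub>R X \<omega>)))))))"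
    by (simp only: Bochner_Integration.integral_sum[OF Bochner_Integration.integrable_diff[OF i1 i2]])
  also have "\<dots> = (LINT \<omega>|M. - (\<Sum>i\<in>UNIV. X \<omega> $ i * (- ((z - c *\<^sub>R X \<omega>) $ i) / u * gauss u (z - c *\<^sub>R X \<omega>))
      - c / u * (1 * (gauss u (z - c *\<^sub>R X \<omega>) - 1 / u * ((z - c *\<^sub>R X \<omega>) $ i * ((z - c *\<^sub>R X \<omega>) $ i * gauss u (z - c *\<^sub>R X \<omega>)))))))"
    by (rule integral_minus[symmetric])
  also have "\<dots> = (LINT \<omega>|M. gauss u (z - c *\<^sub>R X \<omega>)
     * (\<Sum>i\<in>UNIV. c / u + (z - c *\<^sub>R X \<omega>) $ i * X \<omega> $ i / u - c * ((z - c *\<^sub>R X \<omega>) $ i)\<^sup>2 / u\<^sup>2))"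
  proof (rule Bochner_Integration.integral_cong[OF refl])
    have "- (x * (- w / u * g) - c / u * (1 * (g - 1 / u * (w * (w * g))))) = g * (c / u + w * x / u - c * w\<^sup>2 / u\<^sup>2)" for x w g
      using u(1) by (simp add: field_simps power2_eq_square)
    then show "- (\<Sum>i\<in>UNIV. X \<omega> $ i * (- ((z - c *\<^sub>R X \<omega>) $ i) / u * gauss u (z - c *\<^sub>R X \<omega>))
      - c / u * (1 * (gauss u (z - c *\<^sub>R X \<omega>) - 1 / u * ((z - c *\<^sub>R X \<omega>) $ i * ((z - c *\<^sub>R X \<omega>) $ i * gauss u (z - c *\<^sub>R X \<omega>))))))
      = gauss u (z - c *\<^sub>R X \<omega>)
     * (\<Sum>i\<in>UNIV. c / u + (z - c *\<^sub>R X \<omega>) $ i * X \<omega> $ i / u - c * ((z - c *\<^sub>R X \<omega>) $ i)\<^sup>2 / u\<^sup>2)" for \<omega>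
      unfolding sum_negf[symmetric] sum_distrib_left by (intro sum.cong refl)
  qed
  finally show ?thesis unfolding u_def .
qed

lemma variance_mono:
  fixes c c1 :: real
  assumes "\<bar>c\<bar> \<le> c1" "c1 < 1"
  shows "0 < 1 - c1\<^sup>2" "1 - c1\<^sup>2 \<le> 1 - c\<^sup>2" "1 - c\<^sup>2 \<le> 1" "\<bar>c\<bar> < 1"
proof -
  show "0 < 1 - c1\<^sup>2" using assms by (simp add: abs_square_less_1)
  show "1 - c1\<^sup>2 \<le> 1 - c\<^sup>2" using assms abs_le_square_iff[of c c1] by simp
qed (use assms in auto)

lemma dens_param_deriv:
  assumes "\<bar>c\<bar> < 1"
  shows "((\<lambda>c. dens c z) has_real_derivative - (\<Sum>i\<in>UNIV. dflux c i z)) (at c)"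
proof -
  \<comment> \<open>Halfway between |c| and 1: for |t| \<le> c1 the variance stays above the fixed
    positive number \<open>v\<close>.\<close>
  define c1 where "c1 = (1 + \<bar>c\<bar>) / 2"
  have c1: "\<bar>c\<bar> < c1" "c1 < 1" using assms by (auto simp: c1_def)
  define v where "v = 1 - c1\<^sup>2"
  define Q where "Q = gauss_const TYPE('n) v 2"
  have v: "0 < v" "v \<le> 1" using variance_mono[of c1 c1] c1 by (auto simp: v_def)
  have Q: "0 \<le> Q" unfolding Q_def by (rule gauss_const_nonneg[OF v(1)])
  show ?thesis
    unfolding dflux_sum[OF assms] dens_def field_def mult_1
  proof (rule has_real_derivative_integral(1)[where a="-c1" and b=c1 and w="\<lambda>\<omega>. real CARD('n) * (Q * (3 / v\<^sup>2) * bracket (X \<omega>) ^ 1)"])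
    show "c \<in> {-c1<..<c1}" using c1 by auto
    show "integrable M (\<lambda>\<omega>. real CARD('n) * (Q * (3 / v\<^sup>2) * bracket (X \<omega>) ^ 1))"
      by (intro integrable_mult_right moments)
    fix t assume "t \<in> {-c1<..<c1}"
    then have t: "\<bar>t\<bar> \<le> c1" by auto
    note tv = variance_mono[OF t c1(2), folded v_def]
    show "integrable M (\<lambda>\<omega>. gauss (1 - t\<^sup>2) (z - t *\<^sub>R X \<omega>))"
      using field_integrable[OF _ rapid_profiles(1)[OF tv(4)] tempered_const[of 1], of t z] tv(4) by simp
    fix \<omega>
    show "((\<lambda>c. gauss (1 - c\<^sup>2) (z - c *\<^sub>R X \<omega>)) has_real_derivative
        gauss (1 - t\<^sup>2) (z - t *\<^sub>R X \<omega>) * (\<Sum>i\<in>UNIV. t / (1 - t\<^sup>2) + (z - t *\<^sub>R X \<omega>) $ i * X \<omega> $ i / (1 - t\<^sup>2)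
         - t * ((z - t *\<^sub>R X \<omega>) $ i)\<^sup>2 / (1 - t\<^sup>2)\<^sup>2)) (at t)"
      by (rule gauss_param_deriv[OF tv(4)])
    define u where "u = 1 - t\<^sup>2"
    define w where "w = z - t *\<^sub>R X \<omega>"
    have u: "0 < u" "v \<le> u" "u \<le> 1" using tv by (auto simp: u_def)
    have iu: "1 / u \<le> 1 / v\<^sup>2" "1 / u\<^sup>2 \<le> 1 / v\<^sup>2"
    proof -
      have "v\<^sup>2 \<le> u\<^sup>2" using u v by (intro power_mono) auto
      then show "1 / u\<^sup>2 \<le> 1 / v\<^sup>2" using v u by (intro divide_left_mono) auto
      have "v\<^sup>2 \<le> v" using v by (simp add: power2_eq_square mult_left_le)
      then have "v\<^sup>2 \<le> u" using u by linarith
      then show "1 / u \<le> 1 / v\<^sup>2" using v u by (intro divide_left_mono) auto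
    qed
    \<comment> \<open>Each of the three terms is at most v^-2 times this weight, whence the 3. The
      square of \<open>bracket w\<close> is then absorbed by the decay of the Gaussian, which is why
      \<open>Q\<close> was taken with exponent 2.\<close>
    have summand: "\<bar>t / u + w $ i * X \<omega> $ i / u - t * (w $ i)\<^sup>2 / u\<^sup>2\<bar> \<le> 3 / v\<^sup>2 * (bracket w ^ 2 * bracket (X \<omega>))" for i
    proof -
      have b1: "1 \<le> bracket w ^ 2 * bracket (X \<omega>)" by (intro mult_ge1_I one_le_power) auto
      have "\<bar>w $ i\<bar> * \<bar>X \<omega> $ i\<bar> \<le> bracket w * bracket (X \<omega>)"
        by (intro mult_mono component_le_bracket) auto
      also have "\<dots> \<le> bracket w ^ 2 * bracket (X \<omega>)"
        by (intro mult_right_mono) (auto simp: power2_eq_square mult_le_cancel_left1)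
      finally have b2: "\<bar>w $ i\<bar> * \<bar>X \<omega> $ i\<bar> \<le> bracket w ^ 2 * bracket (X \<omega>)" .
      have "\<bar>w $ i\<bar>\<^sup>2 \<le> (bracket w)\<^sup>2" by (intro power_mono component_le_bracket) auto
      also have "\<dots> \<le> bracket w ^ 2 * bracket (X \<omega>)" by (simp add: mult_le_cancel_left1)
      finally have b3: "(w $ i)\<^sup>2 \<le> bracket w ^ 2 * bracket (X \<omega>)" by simp
      have t1: "\<bar>t / u\<bar> \<le> 1 / v\<^sup>2 * (bracket w ^ 2 * bracket (X \<omega>))"
      proof -
        have "\<bar>t / u\<bar> = \<bar>t\<bar> * (1 / u)" using u by (simp add: abs_divide)
        also have "\<dots> \<le> 1 * (1 / v\<^sup>2)" using tv(4) iu(1) u by (intro mult_mono) auto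
        also have "\<dots> \<le> 1 / v\<^sup>2 * (bracket w ^ 2 * bracket (X \<omega>))"
          using b1 v by (simp only: mult_1) (rule mult_le_cancel_left1[THEN iffD2], auto)
        finally show ?thesis .
      qed
      have t2: "\<bar>w $ i * X \<omega> $ i / u\<bar> \<le> 1 / v\<^sup>2 * (bracket w ^ 2 * bracket (X \<omega>))"
      proof -
        have "\<bar>w $ i * X \<omega> $ i / u\<bar> = (1 / u) * (\<bar>w $ i\<bar> * \<bar>X \<omega> $ i\<bar>)" using u by (simp add: abs_mult abs_divide)
        also have "\<dots> \<le> 1 / v\<^sup>2 * (bracket w ^ 2 * bracket (X \<omega>))"
          by (rule mult_mono[OF iu(1) b2]) (use v in auto)
        finally show ?thesis .
      qed
      have t3: "\<bar>t * (w $ i)\<^sup>2 / u\<^sup>2\<bar> \<le> 1 / v\<^sup>2 * (bracket w ^ 2 * bracket (X \<omega>))"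
      proof -
        have "\<bar>t * (w $ i)\<^sup>2 / u\<^sup>2\<bar> = (1 / u\<^sup>2) * (\<bar>t\<bar> * (w $ i)\<^sup>2)" using u by (simp add: abs_mult abs_divide)
        also have "\<dots> \<le> 1 / v\<^sup>2 * (1 * (bracket w ^ 2 * bracket (X \<omega>)))"
          by (rule mult_mono[OF iu(2) mult_mono[OF _ b3]]) (use v tv(4) in auto)
        finally show ?thesis by simp
      qed
      note tri = abs_triangle_ineq4[of "t / u + w $ i * X \<omega> $ i / u" "t * (w $ i)\<^sup>2 / u\<^sup>2"]
        abs_triangle_ineq[of "t / u" "w $ i * X \<omega> $ i / u"]
      have three: "3 / v\<^sup>2 * Z = 1 / v\<^sup>2 * Z + 1 / v\<^sup>2 * Z + 1 / v\<^sup>2 * Z" for Z by (simp add: field_simps)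
      show ?thesis using t1 t2 t3 tri unfolding three by linarith
    qed
    have "\<bar>gauss u w * (\<Sum>i\<in>UNIV. t / u + w $ i * X \<omega> $ i / u - t * (w $ i)\<^sup>2 / u\<^sup>2)\<bar>
        \<le> gauss u w * (\<Sum>i\<in>(UNIV :: 'n set). 3 / v\<^sup>2 * (bracket w ^ 2 * bracket (X \<omega>)))"
      unfolding abs_mult abs_of_nonneg[OF gauss_nonneg[OF u(1)]]
      by (intro mult_left_mono order_trans[OF sum_abs] sum_mono summand gauss_nonneg u)
    also have "\<dots> = real CARD('n) * ((gauss u w * bracket w ^ 2) * (3 / v\<^sup>2 * bracket (X \<omega>)))" by simp
    also have "\<dots> \<le> real CARD('n) * (Q * (3 / v\<^sup>2 * bracket (X \<omega>)))"
      using gauss_decay_uniform[OF v(1) u(2,3), of w 2] v unfolding Q_def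
      by (intro mult_left_mono mult_right_mono) auto
    finally show "\<bar>gauss (1 - t\<^sup>2) (z - t *\<^sub>R X \<omega>) * (\<Sum>i\<in>UNIV. t / (1 - t\<^sup>2) + (z - t *\<^sub>R X \<omega>) $ i * X \<omega> $ i / (1 - t\<^sup>2)
         - t * ((z - t *\<^sub>R X \<omega>) $ i)\<^sup>2 / (1 - t\<^sup>2)\<^sup>2)\<bar> \<le> real CARD('n) * (Q * (3 / v\<^sup>2) * bracket (X \<omega>) ^ 1)"
      by (simp add: u_def w_def mult.assoc)
  qed
qed

text \<open>Rapid decay uniformly in \<open>c\<close>; this is the majorant for differentiating the
  entropy under the integral in \<open>z\<close>.\<close>

lemma dflux_bound_uniform:
  assumes "c1 < 1" "0 \<le> c1"
  obtains C where "0 \<le> C" "\<And>c z. \<bar>c\<bar> \<le> c1 \<Longrightarrow> \<bar>dflux c i z\<bar> * bracket z ^ N \<le> C"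
proof -
  define v where "v = 1 - c1\<^sup>2"
  \<comment> \<open>One power more than \<open>N\<close>, to absorb the factors w_i and w_i^2, each
    of which is at most \<open>bracket w\<close>.\<close>
  define Q where "Q = gauss_const TYPE('n) v (Suc N)"
  have v: "0 < v" "v \<le> 1" using variance_mono[of c1 c1] assms by (auto simp: v_def)
  have Q: "0 \<le> Q" unfolding Q_def by (rule gauss_const_nonneg[OF v(1)])
  define mX where "mX = (LINT \<omega>|M. \<bar>X \<omega> $ i\<bar> * bracket (X \<omega>) ^ N)"
  define m1 where "m1 = (LINT \<omega>|M. \<bar>1\<bar> * bracket (X \<omega>) ^ N)"
  have E: "0 \<le> mX" "0 \<le> m1" by (auto simp: mX_def m1_def)
  show thesis
  proof (rule that[of "(1 / v * Q) * 2 ^ N * mX + 1 / v * (((1 + 1 / v) * Q) * 2 ^ N * m1)"])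
    show "0 \<le> (1 / v * Q) * 2 ^ N * mX + 1 / v * (((1 + 1 / v) * Q) * 2 ^ N * m1)"
      using v Q E by simp
    fix c z assume c: "\<bar>c\<bar> \<le> c1"
    note cv = variance_mono[OF c assms(1), folded v_def]
    define u where "u = 1 - c\<^sup>2"
    have u: "0 < u" "v \<le> u" "u \<le> 1" using cv by (auto simp: u_def)
    have c': "\<bar>c\<bar> \<le> 1" using cv(4) by simp
    have iu: "1 / u \<le> 1 / v" using v u by (intro divide_left_mono) auto
    have gb: "gauss u w * bracket w ^ Suc N \<le> Q" for w :: "real ^ 'n"
      unfolding Q_def by (rule gauss_decay_uniform[OF v(1) u(2,3)])
    have cb: "x * gauss u w * bracket w ^ N \<le> Q" if "0 \<le> x" "x \<le> bracket w" for x and w :: "real ^ 'n"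
    proof -
      have "x * (gauss u w * bracket w ^ N) \<le> bracket w * (gauss u w * bracket w ^ N)"
        using that gauss_nonneg[OF u(1), of w] by (intro mult_right_mono) auto
      then show ?thesis using gb[of w] by (simp add: mult_ac)
    qed
    have b1: "\<bar>- (w $ i) / u * gauss u w\<bar> * bracket w ^ N \<le> 1 / v * Q" for w
    proof -
      have "\<bar>- (w $ i) / u * gauss u w\<bar> * bracket w ^ N = 1 / u * (\<bar>w $ i\<bar> * gauss u w * bracket w ^ N)"
        using u gauss_nonneg[OF u(1), of w] by (simp add: abs_mult)
      also have "\<dots> \<le> 1 / v * Q"
        using cb[of "\<bar>w $ i\<bar>" w] component_le_bracket[of w i] iu v gauss_nonneg[OF u(1), of w] by (intro mult_mono) auto
      finally show ?thesis .
    qed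
    have b2: "\<bar>gauss u w - 1 / u * (w $ i * (w $ i * gauss u w))\<bar> * bracket w ^ N \<le> (1 + 1 / v) * Q" for w
    proof -
      have g: "0 \<le> gauss u w" by (rule gauss_nonneg[OF u(1)])
      have "\<bar>gauss u w - 1 / u * (w $ i * (w $ i * gauss u w))\<bar> \<le> \<bar>gauss u w\<bar> + \<bar>1 / u * (w $ i * (w $ i * gauss u w))\<bar>"
        by (rule abs_triangle_ineq4)
      also have "\<dots> = 1 * gauss u w + 1 / u * ((w $ i)\<^sup>2 * gauss u w)"
        using g u by (simp add: abs_mult power2_eq_square)
      finally have "\<bar>gauss u w - 1 / u * (w $ i * (w $ i * gauss u w))\<bar> * bracket w ^ N
          \<le> (1 * gauss u w + 1 / u * ((w $ i)\<^sup>2 * gauss u w)) * bracket w ^ N" by (rule mult_right_mono) simp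
      also have "\<dots> = 1 * gauss u w * bracket w ^ N + 1 / u * ((w $ i)\<^sup>2 * gauss u w * bracket w ^ N)"
        by (simp add: algebra_simps)
      also have "\<dots> \<le> Q + 1 / v * Q"
      proof (intro add_mono cb mult_mono iu)
        have "\<bar>w $ i\<bar> \<le> norm w" by (rule component_le_norm_cart)
        then have "\<bar>w $ i\<bar>\<^sup>2 \<le> (norm w)\<^sup>2" by (intro power_mono) auto
        then show "(w $ i)\<^sup>2 \<le> bracket w" by (simp add: bracket_def)
      qed (use v g Q in auto)
      finally show ?thesis by (simp add: algebra_simps)
    qed
    have p2: "rapid (\<lambda>w :: real ^ 'n. gauss u w - 1 / u * (w $ i * (w $ i * gauss u w)))"
      using rapid_profiles(5)[OF cv(4), of 1 i i] by (simp add: u_def)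
    have f1: "\<bar>field c (\<lambda>\<omega>. X \<omega> $ i) (\<lambda>w. - (w $ i) / u * gauss u w) z\<bar> * bracket z ^ N \<le> (1 / v * Q) * 2 ^ N * mX"
      unfolding mX_def
      by (rule field_bound[OF c' rapid_profiles(4)[OF cv(4), folded u_def] tempered_component b1])
    have f2: "\<bar>field c (\<lambda>_. 1) (\<lambda>w. gauss u w - 1 / u * (w $ i * (w $ i * gauss u w))) z\<bar> * bracket z ^ N \<le> ((1 + 1 / v) * Q) * 2 ^ N * m1"
      unfolding m1_def by (rule field_bound[OF c' p2 tempered_const b2])
    have "\<bar>dflux c i z\<bar> \<le> \<bar>field c (\<lambda>\<omega>. X \<omega> $ i) (\<lambda>w. - (w $ i) / u * gauss u w) z\<bar>
        + \<bar>c / u\<bar> * \<bar>field c (\<lambda>_. 1) (\<lambda>w. gauss u w - 1 / u * (w $ i * (w $ i * gauss u w))) z\<bar>"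
      unfolding dflux_def u_def[symmetric] abs_mult[symmetric] by (rule abs_triangle_ineq4)
    then have "\<bar>dflux c i z\<bar> * bracket z ^ N \<le> (\<bar>field c (\<lambda>\<omega>. X \<omega> $ i) (\<lambda>w. - (w $ i) / u * gauss u w) z\<bar>
        + \<bar>c / u\<bar> * \<bar>field c (\<lambda>_. 1) (\<lambda>w. gauss u w - 1 / u * (w $ i * (w $ i * gauss u w))) z\<bar>) * bracket z ^ N"
      by (rule mult_right_mono) simp
    also have "\<dots> = \<bar>field c (\<lambda>\<omega>. X \<omega> $ i) (\<lambda>w. - (w $ i) / u * gauss u w) z\<bar> * bracket z ^ N
        + \<bar>c / u\<bar> * (\<bar>field c (\<lambda>_. 1) (\<lambda>w. gauss u w - 1 / u * (w $ i * (w $ i * gauss u w))) z\<bar> * bracket z ^ N)"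
      by (simp only: distrib_right mult.assoc)
    also have "\<dots> \<le> (1 / v * Q) * 2 ^ N * mX + 1 / v * (((1 + 1 / v) * Q) * 2 ^ N * m1)"
    proof (rule add_mono[OF f1 mult_mono[OF _ f2]])
      have "\<bar>c / u\<bar> = \<bar>c\<bar> * (1 / u)" using u by (simp add: abs_divide)
      also have "\<dots> \<le> 1 * (1 / v)" using iu c' u by (intro mult_mono) auto
      finally show "\<bar>c / u\<bar> \<le> 1 / v" by simp
    qed (use v in auto)
    finally show "\<bar>dflux c i z\<bar> * bracket z ^ N \<le> (1 / v * Q) * 2 ^ N * mX + 1 / v * (((1 + 1 / v) * Q) * 2 ^ N * m1)" .
  qed
qed

text \<open>De Bruijn's identity in the parameter \<open>c\<close>: the continuity equation turns
  the derivative into minus the integral of div flux against \<open>log_ratio + 1\<close>, and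
  integration by parts pairs the flux with the gradient c \<open>flux\<close> /
  \<open>dens\<close>.\<close>

lemma entropy_deriv:
  assumes "\<bar>c\<bar> < 1"
  shows "(entropy_at has_real_derivative c * fisher c) (at c)"
proof -
  define c1 where "c1 = (1 + \<bar>c\<bar>) / 2"
  have c1: "\<bar>c\<bar> < c1" "c1 < 1" "0 \<le> c1" using assms by (auto simp: c1_def)
  define v where "v = 1 - c1\<^sup>2"
  have v: "0 < v" using variance_mono[of c1 c1] c1 by (auto simp: v_def)
  define D where "D = CARD('n)"
  \<comment> \<open>Decay of order d + 1 is requested: one power pays for the growth of
    \<open>log_ratio + 1\<close>, and the remaining d make the majorant integrable.\<close>
  have "\<exists>C. 0 \<le> C \<and> (\<forall>c z. \<bar>c\<bar> \<le> c1 \<longrightarrow> \<bar>dflux c i z\<bar> * bracket z ^ Suc D \<le> C)" for i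
    using dflux_bound_uniform[OF c1(2,3), of i "Suc D"] by metis
  then obtain C where C: "\<And>i. 0 \<le> C i" "\<And>i c z. \<bar>c\<bar> \<le> c1 \<Longrightarrow> \<bar>dflux c i z\<bar> * bracket z ^ Suc D \<le> C i"
    by metis
  define B where "B = (2 + m2 + real CARD('n)) / v + 1"
  have B: "0 \<le> B" using v m2_nonneg by (simp add: B_def)
  have "(entropy_at has_real_derivative (LINT z|lborel. - (\<Sum>i\<in>UNIV. dflux c i z) * (log_ratio c z + 1))) (at c)"
    unfolding entropy_at_def[abs_def]
  proof (rule has_real_derivative_integral(1)[where a="-c1" and b=c1 and w="\<lambda>z. ((\<Sum>i\<in>UNIV. C i) * B) * (1 / bracket z ^ D)"])
    show "c \<in> {-c1<..<c1}" using c1 by auto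
    show "integrable lborel (\<lambda>z :: real ^ 'n. ((\<Sum>i\<in>UNIV. C i) * B) * (1 / bracket z ^ D))"
      by (intro integrable_mult_right integrable_inverse_bracket_power) (simp add: D_def)
    fix t assume "t \<in> {-c1<..<c1}"
    then have t: "\<bar>t\<bar> \<le> c1" by auto
    note tv = variance_mono[OF t c1(2), folded v_def]
    show "integrable lborel (\<lambda>z. dens t z * log_ratio t z)"
      by (rule rapid_integrable[OF rapid_mult[OF rapid_dens[OF tv(4)] continuous_log_ratio[OF tv(4)],
              of "(2 + m2 + real CARD('n)) / (1 - t\<^sup>2)" 1]])
        (use log_ratio_bound[OF tv(4)] in simp)
    fix z :: "real ^ 'n"
    have p: "0 < dens t z" by (rule dens_pos[OF tv(4)])
    note d = dens_param_deriv[OF tv(4), of z]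
    have l: "((\<lambda>c. log_ratio c z) has_real_derivative 1 / dens t z * - (\<Sum>i\<in>UNIV. dflux t i z) - 0) (at t)"
      unfolding log_ratio_def by (intro DERIV_diff DERIV_chain2[OF DERIV_ln_divide d] DERIV_const p)
    show "((\<lambda>c. dens c z * log_ratio c z) has_real_derivative - (\<Sum>i\<in>UNIV. dflux t i z) * (log_ratio t z + 1)) (at t)"
      using DERIV_mult[OF d l] p by (simp add: algebra_simps)
    have s: "\<bar>\<Sum>i\<in>UNIV. dflux t i z\<bar> * bracket z ^ Suc D \<le> (\<Sum>i\<in>UNIV. C i)"
    proof -
      have "\<bar>\<Sum>i\<in>UNIV. dflux t i z\<bar> * bracket z ^ Suc D \<le> (\<Sum>i\<in>UNIV. \<bar>dflux t i z\<bar>) * bracket z ^ Suc D"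
        by (intro mult_right_mono sum_abs) (auto intro: zero_le_power)
      also have "\<dots> \<le> (\<Sum>i\<in>UNIV. C i)"
        unfolding sum_distrib_right by (intro sum_mono C t)
      finally show ?thesis .
    qed
    have lb: "\<bar>log_ratio t z + 1\<bar> \<le> B * bracket z"
    proof -
      have "\<bar>log_ratio t z + 1\<bar> \<le> ((2 + m2 + real CARD('n)) / (1 - t\<^sup>2) + 1) * bracket z ^ 1"
        by (rule log_ratio_plus_1_bound[OF tv(4)])
      also have "\<dots> \<le> B * bracket z ^ 1"
        unfolding B_def using tv v m2_nonneg by (intro mult_right_mono add_right_mono divide_left_mono) auto
      finally show ?thesis by simp
    qed
    have "\<bar>- (\<Sum>i\<in>UNIV. dflux t i z) * (log_ratio t z + 1)\<bar> \<le> \<bar>\<Sum>i\<in>UNIV. dflux t i z\<bar> * (B * bracket z)"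
      unfolding abs_mult abs_minus_cancel by (intro mult_left_mono lb) auto
    also have "\<dots> = B * (\<bar>\<Sum>i\<in>UNIV. dflux t i z\<bar> * bracket z ^ Suc D) * (1 / bracket z ^ D)"
      by simp
    also have "\<dots> \<le> B * (\<Sum>i\<in>UNIV. C i) * (1 / bracket z ^ D)"
      by (intro mult_right_mono mult_left_mono s B) (auto intro: zero_le_power)
    finally show "\<bar>- (\<Sum>i\<in>UNIV. dflux t i z) * (log_ratio t z + 1)\<bar> \<le> (\<Sum>i\<in>UNIV. C i) * B * (1 / bracket z ^ D)"
      by (simp add: mult.commute)
  qed
  moreover have "(LINT z|lborel. - (\<Sum>i\<in>UNIV. dflux c i z) * (log_ratio c z + 1)) = c * fisher c"
  proof -
    note fint = flux_square_integrable[OF assms]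
    have fint': "integrable lborel (\<lambda>z. flux c i z * flux c i z / dens c z)" for i
      using fint[of i] by (simp add: power2_eq_square)
    note fd = integral_deriv_log_ratio[OF assms rapid_flux[OF assms] rapid_dflux[OF assms] flux_derivative[OF assms] fint']
    have "(LINT z|lborel. - (\<Sum>i\<in>UNIV. dflux c i z) * (log_ratio c z + 1))
        = - (LINT z|lborel. (\<Sum>i\<in>UNIV. dflux c i z * (log_ratio c z + 1)))"
      by (simp add: sum_distrib_right)
    also have "\<dots> = - (\<Sum>i\<in>UNIV. - c * (LINT z|lborel. flux c i z * flux c i z / dens c z))"
      by (simp only: Bochner_Integration.integral_sum[OF fd(2)] fd(1))
    also have "\<dots> = c * fisher c"
      unfolding fisher_def power2_eq_square
      by (simp add: Bochner_Integration.integral_sum[OF fint'] sum_distrib_left sum_negf)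
    finally show ?thesis .
  qed
  ultimately show ?thesis by simp
qed

lemma entropy_at_0: "entropy_at 0 = 0"
  by (simp add: entropy_at_def log_ratio_def dens_def field_def prob_space)

text \<open>The derivative bounds are integrated by comparison with antiderivatives: x S/(1 - x^2)
  is minus the derivative of (S/2) ln(1 - x^2), and 2 x K (1 - x^2)^(\<beta>-1) is minus that of
  (K/\<beta>)(1 - x^2)^\<beta>. Monotonicity suffices, so no integrability of \<open>fisher\<close>
  in \<open>c\<close> enters.\<close>

lemma entropy_bound:
  assumes \<beta>: "0 < \<beta>" and K: "0 \<le> K"
    and b1: "\<And>c. 0 < c \<Longrightarrow> c < 1 \<Longrightarrow> fisher c \<le> 2 * K * (1 - c\<^sup>2) powr (\<beta> - 1)"
    and b2: "\<And>c. 0 < c \<Longrightarrow> c < 1 \<Longrightarrow> fisher c \<le> c\<^sup>2 * S / (1 - c\<^sup>2)" and S: "0 \<le> S"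
    and r: "0 < r" "r < 1" and c: "0 < c" "c < 1" "1 - c\<^sup>2 \<le> r"
  shows "entropy_at c \<le> K * r powr \<beta> / \<beta> - S / 2 * ln r"
proof -
  \<comment> \<open>The switching point, where 1 - x^2 equals \<open>r\<close>.\<close>
  define s where "s = sqrt (1 - r)"
  have s2: "s\<^sup>2 = 1 - r" using r by (simp add: s_def)
  have s: "0 < s" "s < 1" using r by (auto simp: s_def)
  have sc: "s \<le> c" unfolding s_def using c by (intro real_le_lsqrt) auto
  have "entropy_at s + S / 2 * ln (1 - s\<^sup>2) \<le> entropy_at 0 + S / 2 * ln (1 - 0\<^sup>2)"
  proof (rule DERIV_nonpos_imp_nonincreasing[of 0 s])
    fix x assume x: "0 \<le> x" "x \<le> s"
    then have x1: "\<bar>x\<bar> < 1" using s by auto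
    note u = variance_bounds(1)[OF x1]
    have "((\<lambda>x. S / 2 * ln (1 - x\<^sup>2)) has_real_derivative S / 2 * (- 2 * x / (1 - x\<^sup>2))) (at x)"
    proof (rule DERIV_cmult)
      show "((\<lambda>x. ln (1 - x\<^sup>2)) has_real_derivative - 2 * x / (1 - x\<^sup>2)) (at x)"
        using u by (auto intro!: derivative_eq_intros)
    qed
    from DERIV_add[OF entropy_deriv[OF x1] this]
    have "((\<lambda>x. entropy_at x + S / 2 * ln (1 - x\<^sup>2)) has_real_derivative x * fisher x + S / 2 * (- 2 * x / (1 - x\<^sup>2))) (at x)" .
    moreover have "x * fisher x + S / 2 * (- 2 * x / (1 - x\<^sup>2)) \<le> 0"
    \<comment> \<open>The bounds on \<open>fisher\<close> are assumed for positive parameters only;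
      at 0 both terms vanish through their factor x.\<close>
    proof (cases "x = 0")
      case False
      have "fisher x \<le> x\<^sup>2 * S / (1 - x\<^sup>2)" using b2[of x] x1 x False by auto
      also have "\<dots> \<le> S / (1 - x\<^sup>2)"
        using u S by (intro divide_right_mono) (auto intro: mult_left_le_one_le)
      finally have "x * fisher x \<le> x * (S / (1 - x\<^sup>2))" using x by (intro mult_left_mono)
      moreover have "S / 2 * (- 2 * x / (1 - x\<^sup>2)) = - (x * (S / (1 - x\<^sup>2)))" by simp
      ultimately show ?thesis by linarith
    qed simp
    ultimately show "\<exists>y. ((\<lambda>x. entropy_at x + S / 2 * ln (1 - x\<^sup>2)) has_real_derivative y) (at x) \<and> y \<le> 0" by blast
  qed (use s in auto)
  then have 1: "entropy_at s \<le> - (S / 2 * ln r)" by (simp add: entropy_at_0 s2)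
  have "entropy_at c + K / \<beta> * (1 - c\<^sup>2) powr \<beta> \<le> entropy_at s + K / \<beta> * (1 - s\<^sup>2) powr \<beta>"
  proof (rule DERIV_nonpos_imp_nonincreasing[OF sc])
    fix x assume x: "s \<le> x" "x \<le> c"
    then have x0: "0 < x" "x < 1" and x1: "\<bar>x\<bar> < 1" using s c by auto
    note u = variance_bounds(1)[OF x1]
    have "((\<lambda>x. (1 - x\<^sup>2) powr \<beta>) has_real_derivative (\<beta> * (1 - x\<^sup>2) powr (\<beta> - 1)) * (- 2 * x)) (at x)"
    proof (rule DERIV_chain2[where f="\<lambda>y. y powr \<beta>" and g="\<lambda>x. 1 - x\<^sup>2"])
      show "((\<lambda>y. y powr \<beta>) has_real_derivative \<beta> * (1 - x\<^sup>2) powr (\<beta> - 1)) (at (1 - x\<^sup>2))"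
        by (rule has_real_derivative_powr[OF u])
    qed (auto intro!: derivative_eq_intros)
    from DERIV_add[OF entropy_deriv[OF x1] DERIV_cmult[OF this, of "K / \<beta>"]]
    have "((\<lambda>x. entropy_at x + K / \<beta> * (1 - x\<^sup>2) powr \<beta>) has_real_derivative
        x * fisher x + K / \<beta> * ((\<beta> * (1 - x\<^sup>2) powr (\<beta> - 1)) * (- 2 * x))) (at x)" .
    moreover have "x * fisher x + K / \<beta> * ((\<beta> * (1 - x\<^sup>2) powr (\<beta> - 1)) * (- 2 * x)) \<le> 0"
    proof -
      have "x * fisher x \<le> x * (2 * K * (1 - x\<^sup>2) powr (\<beta> - 1))"
        using b1[OF x0] x0 by (intro mult_left_mono) auto
      then show ?thesis using \<beta> by (simp add: mult_ac)
    qed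
    ultimately show "\<exists>y. ((\<lambda>x. entropy_at x + K / \<beta> * (1 - x\<^sup>2) powr \<beta>) has_real_derivative y) (at x) \<and> y \<le> 0" by blast
  qed
  moreover have "0 \<le> K / \<beta> * (1 - c\<^sup>2) powr \<beta>" using K \<beta> by simp
  ultimately show ?thesis using 1 s2 by simp
qed

end

section \<open>Passage to the limit in the entropy\<close>

lemma entropy_function_nonneg:
  fixes r :: real
  assumes "0 \<le> r" shows "0 \<le> r * ln r - r + 1"
proof (cases "r = 0")
  case False
  then have r: "0 < r" using assms by simp
  have "ln (1 / r) \<le> 1 / r - 1" using r by (intro ln_le_minus_one) auto
  then have "r * (1 - 1 / r) \<le> r * ln r" using r by (intro mult_left_mono) (auto simp: ln_div)
  then show ?thesis using r by (simp add: algebra_simps)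
qed simp

text \<open>The density may vanish, so continuity of r ln r at 0 is required. It follows from -ln x
  = 2 ln(1/sqrt x) \<le> 2/sqrt x.\<close>

lemma tendsto_mult_ln:
  fixes q :: "nat \<Rightarrow> real"
  assumes q: "q \<longlonglongrightarrow> r" "\<And>n. 0 \<le> q n"
  shows "(\<lambda>n. q n * ln (q n)) \<longlonglongrightarrow> r * ln r"
proof (cases "r = 0")
  case False
  then show ?thesis by (intro tendsto_mult tendsto_ln q) auto
next
  case True
  have bd: "\<bar>x * ln x\<bar> \<le> 2 * sqrt x" if "0 \<le> x" "x < 1" for x :: real
  proof (cases "x = 0")
    case False
    then have x: "0 < x" using that by simp
    have "- ln x = 2 * ln (1 / sqrt x)" using x by (simp add: ln_div ln_sqrt)
    also have "ln (1 / sqrt x) \<le> 1 / sqrt x" using x ln_le_minus_one[of "1 / sqrt x"] by auto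
    finally have "x * (- ln x) \<le> x * (2 * (1 / sqrt x))" using x by (intro mult_left_mono) auto
    also have "\<dots> = 2 * sqrt x" using x real_div_sqrt[of x] by (simp add: field_simps)
    finally show ?thesis using x that(2) ln_less_zero[OF x that(2)] by (simp add: abs_mult)
  qed simp
  have "eventually (\<lambda>n. q n < 1) sequentially"
    using order_tendstoD(2)[OF q(1), of 1] True by simp
  then have "eventually (\<lambda>n. norm (q n * ln (q n)) \<le> 2 * sqrt (q n)) sequentially"
    by eventually_elim (use bd q(2) in auto)
  moreover have "(\<lambda>n. 2 * sqrt (q n)) \<longlonglongrightarrow> 0"
    using tendsto_mult[OF tendsto_const[of 2] tendsto_real_sqrt[OF q(1)]] True by simp
  ultimately show ?thesis using True by (simp add: Lim_null_comparison)
qed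

text \<open>At distance 1/4 the exponent is at most -r with r = 1/(32 u). Taking N = d + 1 in
  exp(-r) \<le> (N/r)^N outweighs the normalising factor, which is at most u^-d, and leaves one
  factor \<open>u\<close> that tends to zero.\<close>

lemma gauss_far_le:
  fixes w :: "real ^ 'n::finite"
  assumes u: "0 < u" "u \<le> 1" and w: "1 / 4 \<le> norm w"
  shows "gauss u w \<le> (32 * real (Suc CARD('n))) ^ Suc CARD('n) * u"
proof -
  define N where "N = Suc CARD('n)"
  define r where "r = 1 / (32 * u)"
  have r: "0 < r" using u by (simp add: r_def)
  have N: "0 < N" by (simp add: N_def)
  have "(r / real N) ^ N \<le> (1 + r / real N) ^ N" using r by (intro power_mono) auto
  also have "\<dots> \<le> exp r" using r N by (intro exp_ge_one_plus_x_over_n_power_n) auto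
  finally have "inverse (exp r) \<le> inverse ((r / real N) ^ N)"
    using r N by (intro le_imp_inverse_le) auto
  then have e: "exp (- r) \<le> (32 * real N) ^ N * u ^ N"
    by (simp add: exp_minus r_def power_divide power_mult_distrib field_simps)
  have "(1 / 4)\<^sup>2 \<le> (norm w)\<^sup>2" using w by (intro power_mono) auto
  then have "1 / 16 / (2 * u) \<le> (norm w)\<^sup>2 / (2 * u)" using u by (intro divide_right_mono) (auto simp: power2_eq_square)
  then have ex: "exp (- (norm w)\<^sup>2 / (2 * u)) \<le> exp (- r)" by (simp add: r_def)
  have "u * 1 \<le> sqrt (2 * pi * u)"
  proof (rule real_le_rsqrt)
    have "u * u \<le> 1 * u" using u by (intro mult_right_mono) auto
    also have "\<dots> \<le> (2 * pi) * u" using u pi_ge_two by (intro mult_right_mono) auto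
    finally show "(u * 1)\<^sup>2 \<le> 2 * pi * u" by (simp add: power2_eq_square)
  qed
  then have "1 / sqrt (2 * pi * u) \<le> 1 / u" using u by (intro divide_left_mono) auto
  then have "(1 / sqrt (2 * pi * u)) ^ CARD('n) \<le> (1 / u) ^ CARD('n)" using u by (intro power_mono) auto
  then have "gauss u w \<le> (1 / u) ^ CARD('n) * ((32 * real N) ^ N * u ^ N)"
    unfolding gauss_def using order_trans[OF ex e] u by (intro mult_mono) auto
  also have "\<dots> = (32 * real N) ^ N * u" using u by (simp add: N_def power_divide)
  finally show ?thesis by (simp only: N_def)
qed

lemma gauss_scale:
  assumes "0 < u"
  shows "gauss u (- (sqrt u *\<^sub>R y) :: real ^ 'n::finite) = (1 / sqrt u) ^ CARD('n) * gauss 1 y"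
  using assms by (simp add: gauss_def real_sqrt_mult power_divide power_mult_distrib)

lemma integral_lborel_affine:
  fixes k :: "'b::euclidean_space \<Rightarrow> real"
  assumes "s \<noteq> 0" and [measurable]: "k \<in> borel_measurable borel"
  shows "(LINT x|lborel. k x) = \<bar>s\<bar> ^ DIM('b) * (LINT y|lborel. k (t + s *\<^sub>R y))"
proof -
  have "(LINT x|lborel. k x) = (LINT x|density (distr lborel borel (\<lambda>x. t + s *\<^sub>R x)) (\<lambda>_. ennreal (\<bar>s\<bar> ^ DIM('b))). k x)"
    using lborel_affine[OF assms(1), of t] by (simp add: ennreal_power)
  also have "\<dots> = (LINT y|lborel. \<bar>s\<bar> ^ DIM('b) * k (t + s *\<^sub>R y))"
    by (subst integral_density) (auto simp: integral_distr)
  finally show ?thesis by simp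
qed

context random_vector
begin

text \<open>The kernels form an approximate identity, but \<open>f\<close> need not be bounded. A
  cutoff around \<open>z\<close> separates a near part, where \<open>f\<close> is bounded and
  dominated convergence applies, from a far part, where the kernel itself is uniformly small and
  only the total mass 1 of the law matters.\<close>

lemma dens_tendsto_density:
  assumes law: "distr M borel X = density lborel (\<lambda>x. ennreal (f x))"
    and f: "continuous_on UNIV f" "\<And>x. 0 \<le> f x"
    and C: "\<And>n. 0 < C n" "\<And>n. C n < 1" "C \<longlonglongrightarrow> 1"
  shows "(\<lambda>n. dens (C n) z) \<longlonglongrightarrow> f z"
proof -
  have fm [measurable]: "f \<in> borel_measurable borel" by (rule borel_measurable_continuous_onI[OF f(1)])
  \<comment> \<open>Continuous, equal to 1 within distance 1 of \<open>z\<close> and to 0 beyond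
    distance 2.\<close>
  define \<eta> where "\<eta> x = max 0 (min 1 (2 - dist x z))" for x
  have \<eta>c: "continuous_on UNIV \<eta>" unfolding \<eta>_def by (intro continuous_intros)
  have \<eta>m [measurable]: "\<eta> \<in> borel_measurable borel" by (rule borel_measurable_continuous_onI[OF \<eta>c])
  have \<eta>01: "0 \<le> \<eta> x" "\<eta> x \<le> 1" for x by (auto simp: \<eta>_def)
  define u where "u n = 1 - (C n)\<^sup>2" for n
  have u: "0 < u n" "u n \<le> 1" for n
    using variance_bounds[of "C n"] C(1,2)[of n] by (auto simp: u_def)
  have u_lim: "u \<longlonglongrightarrow> 0"
    using tendsto_diff[OF tendsto_const[of 1] tendsto_power[OF C(3), of 2]] by (simp add: u_def[abs_def])
  define T1 where "T1 n = (LINT \<omega>|M. gauss (u n) (z - C n *\<^sub>R X \<omega>) * \<eta> (X \<omega>))" for n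
  define T2 where "T2 n = (LINT \<omega>|M. gauss (u n) (z - C n *\<^sub>R X \<omega>) * (1 - \<eta> (X \<omega>)))" for n
  have gi: "integrable M (\<lambda>\<omega>. gauss (u n) (z - C n *\<^sub>R X \<omega>))" for n
    using field_integrable[OF _ rapid_gauss[OF u] tempered_const[of 1], of "C n" n z] C(1,2)[of n] by simp
  have gi1: "integrable M (\<lambda>\<omega>. gauss (u n) (z - C n *\<^sub>R X \<omega>) * \<eta> (X \<omega>))"
    and gi2: "integrable M (\<lambda>\<omega>. gauss (u n) (z - C n *\<^sub>R X \<omega>) * (1 - \<eta> (X \<omega>)))" for n
    by (rule Bochner_Integration.integrable_bound[OF gi[of n]];
        use \<eta>01 in \<open>auto simp: abs_mult intro!: mult_left_le\<close>)+
  have split: "dens (C n) z = T1 n + T2 n" for n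
  proof -
    have "dens (C n) z = (LINT \<omega>|M. gauss (u n) (z - C n *\<^sub>R X \<omega>) * \<eta> (X \<omega>) + gauss (u n) (z - C n *\<^sub>R X \<omega>) * (1 - \<eta> (X \<omega>)))"
      unfolding dens_def field_def u_def by (simp add: algebra_simps)
    then show ?thesis unfolding T1_def T2_def by (simp only: Bochner_Integration.integral_add[OF gi1 gi2])
  qed
  have T2_lim: "T2 \<longlonglongrightarrow> 0"
  proof (rule Lim_null_comparison)
    show "(\<lambda>n. (32 * real (Suc CARD('n))) ^ Suc CARD('n) * u n) \<longlonglongrightarrow> 0"
      using tendsto_mult_right_zero[OF u_lim] by simp
    \<comment> \<open>For |z - x| > 1 these two conditions give |z - C x| \<ge> C |z - x| - (1 - C)
      |z| > 1/2 - 1/4, the distance required by \<open>gauss_far_le\<close>.\<close>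
    have "eventually (\<lambda>n. (1 - C n) * norm z < 1 / 4) sequentially"
      using order_tendstoD(2)[OF tendsto_mult[OF tendsto_diff[OF tendsto_const[of 1] C(3)] tendsto_const[of "norm z"]], of "1 / 4"] by simp
    moreover have "eventually (\<lambda>n. 1 / 2 < C n) sequentially"
      by (rule order_tendstoD(1)[OF C(3)]) simp
    ultimately show "eventually (\<lambda>n. norm (T2 n) \<le> (32 * real (Suc CARD('n))) ^ Suc CARD('n) * u n) sequentially"
    proof eventually_elim
      case (elim n)
      have le: "gauss (u n) (z - C n *\<^sub>R x) * (1 - \<eta> x) \<le> (32 * real (Suc CARD('n))) ^ Suc CARD('n) * u n" for x
      proof (cases "dist x z \<le> 1")
        case True
        then have "\<eta> x = 1" by (simp add: \<eta>_def)
        then show ?thesis using u(1)[of n] by simp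
      next
        case False
        have "C n * norm (z - x) = norm (C n *\<^sub>R (z - x))" using C(1)[of n] by simp
        also have "C n *\<^sub>R (z - x) = (z - C n *\<^sub>R x) - (1 - C n) *\<^sub>R z" by (simp add: algebra_simps)
        also have "norm \<dots> \<le> norm (z - C n *\<^sub>R x) + norm ((1 - C n) *\<^sub>R z)" by (rule norm_triangle_ineq4)
        also have "norm ((1 - C n) *\<^sub>R z) = (1 - C n) * norm z" using C(2)[of n] by simp
        finally have "C n * norm (z - x) \<le> norm (z - C n *\<^sub>R x) + (1 - C n) * norm z" .
        moreover have "1 / 2 * 1 \<le> C n * norm (z - x)"
          using elim(2) False C(1)[of n] by (intro mult_mono) (auto simp: dist_norm norm_minus_commute)
        ultimately have "1 / 4 \<le> norm (z - C n *\<^sub>R x)" using elim(1) by linarith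
        from gauss_far_le[OF u this]
        have "gauss (u n) (z - C n *\<^sub>R x) \<le> (32 * real (Suc CARD('n))) ^ Suc CARD('n) * u n" .
        moreover have "gauss (u n) (z - C n *\<^sub>R x) * (1 - \<eta> x) \<le> gauss (u n) (z - C n *\<^sub>R x)"
          using \<eta>01[of x] gauss_nonneg[OF u(1)[of n], of "z - C n *\<^sub>R x"] by (intro mult_left_le) auto
        ultimately show ?thesis by linarith
      qed
      have "T2 n \<le> (LINT \<omega>|M. (32 * real (Suc CARD('n))) ^ Suc CARD('n) * u n)"
        unfolding T2_def by (intro integral_mono gi2 integrable_const le)
      moreover have "0 \<le> T2 n"
        unfolding T2_def using \<eta>01 by (intro Bochner_Integration.integral_nonneg mult_nonneg_nonneg gauss_nonneg u) (auto simp: algebra_simps)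
      ultimately show ?case by (simp add: prob_space)
    qed
  qed
  define f1 where "f1 x = f x * \<eta> x" for x
  have f1c: "continuous_on UNIV f1" unfolding f1_def by (intro continuous_intros f \<eta>c)
  have f1m [measurable]: "f1 \<in> borel_measurable borel" by (rule borel_measurable_continuous_onI[OF f1c])
  obtain B where B: "\<And>x. \<bar>f1 x\<bar> \<le> B"
  proof -
    have "compact (f ` cball z 2)" using f(1) by (intro compact_continuous_image) (auto intro: continuous_on_subset)
    then have "bounded (f ` cball z 2)" by (rule compact_imp_bounded)
    then obtain B where B: "\<And>x. x \<in> cball z 2 \<Longrightarrow> norm (f x) \<le> B" unfolding bounded_iff by blast
    have "\<bar>f1 x\<bar> \<le> \<bar>B\<bar>" for x
    proof (cases "x \<in> cball z 2")
      case True
      have "\<bar>f1 x\<bar> = \<bar>f x\<bar> * \<eta> x" using \<eta>01 by (simp add: f1_def abs_mult)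
      also have "\<dots> \<le> \<bar>f x\<bar>" using \<eta>01 by (intro mult_left_le) auto
      also have "\<dots> \<le> \<bar>B\<bar>" using B[OF True] by simp
      finally show ?thesis .
    next
      case False
      then have "\<eta> x = 0" by (simp add: \<eta>_def dist_commute)
      then show ?thesis by (simp add: f1_def)
    qed
    then show thesis using that by blast
  qed
  \<comment> \<open>The substitution x = z/C + (sqrt u / C) y turns the moving kernel into the fixed
    standard Gaussian. Its Jacobian cancels the normalising factor up to C^-d.\<close>
  have T1_eq: "T1 n = (1 / C n) ^ CARD('n) * (LINT y|lborel. gauss 1 y * f1 ((1 / C n) *\<^sub>R z + (sqrt (u n) / C n) *\<^sub>R y))" for n
  proof -
    define s where "s = sqrt (u n) / C n"
    have c0: "C n \<noteq> 0" "0 < C n" using C(1)[of n] by auto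
    have s: "0 < s" using u(1)[of n] c0 by (simp add: s_def)
    have shift: "z - C n *\<^sub>R ((1 / C n) *\<^sub>R z + s *\<^sub>R y) = - (sqrt (u n) *\<^sub>R y)" for y
      using c0 by (simp add: s_def scaleR_add_right)
    have "T1 n = (LINT x|distr M borel X. gauss (u n) (z - C n *\<^sub>R x) * \<eta> x)"
      unfolding T1_def by (subst integral_distr) auto
    also have "\<dots> = (LINT x|lborel. f x *\<^sub>R (gauss (u n) (z - C n *\<^sub>R x) * \<eta> x))"
      unfolding law using f(2) by (subst integral_density) auto
    also have "\<dots> = (LINT x|lborel. gauss (u n) (z - C n *\<^sub>R x) * f1 x)"
      by (simp add: f1_def mult_ac)
    also have "\<dots> = \<bar>s\<bar> ^ DIM(real ^ 'n) * (LINT y|lborel. gauss (u n) (z - C n *\<^sub>R ((1 / C n) *\<^sub>R z + s *\<^sub>R y)) * f1 ((1 / C n) *\<^sub>R z + s *\<^sub>R y))"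
      using s by (intro integral_lborel_affine) auto
    also have "\<dots> = (\<bar>s\<bar> ^ CARD('n) * (1 / sqrt (u n)) ^ CARD('n)) * (LINT y|lborel. gauss 1 y * f1 ((1 / C n) *\<^sub>R z + s *\<^sub>R y))"
      unfolding shift gauss_scale[OF u(1)] mult.assoc by simp
    also have "\<bar>s\<bar> ^ CARD('n) * (1 / sqrt (u n)) ^ CARD('n) = (1 / C n) ^ CARD('n)"
      using c0 u(1)[of n] s by (simp add: power_mult_distrib[symmetric] s_def)
    finally show ?thesis by (simp only: s_def)
  qed
  have "(\<lambda>n. LINT y|lborel. gauss 1 y * f1 ((1 / C n) *\<^sub>R z + (sqrt (u n) / C n) *\<^sub>R y)) \<longlonglongrightarrow> (LINT y|lborel. gauss 1 (y :: real ^ 'n) * f1 z)"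
  proof (rule integral_dominated_convergence[where w="\<lambda>y. B * gauss 1 y"])
    show "integrable lborel (\<lambda>y :: real ^ 'n. B * gauss 1 y)"
      by (intro integrable_mult_right rapid_integrable rapid_gauss) auto
    show "AE y in lborel. (\<lambda>n. gauss 1 y * f1 ((1 / C n) *\<^sub>R z + (sqrt (u n) / C n) *\<^sub>R y)) \<longlonglongrightarrow> gauss 1 y * f1 z"
    proof (intro always_eventually allI tendsto_mult tendsto_const)
      fix y
      have l: "(\<lambda>n. (1 / C n) *\<^sub>R z + (sqrt (u n) / C n) *\<^sub>R y) \<longlonglongrightarrow> (1 / 1) *\<^sub>R z + (sqrt 0 / 1) *\<^sub>R y"
        by (intro tendsto_intros C(3) u_lim) auto
      have c: "isCont f1 ((1 / 1) *\<^sub>R z + (sqrt 0 / 1) *\<^sub>R y)"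
        by (rule continuous_on_interior[OF f1c]) simp
      show "(\<lambda>n. f1 ((1 / C n) *\<^sub>R z + (sqrt (u n) / C n) *\<^sub>R y)) \<longlonglongrightarrow> f1 z"
        using isCont_tendsto_compose[OF c l] by simp
    qed
    show "AE y in lborel. norm (gauss 1 y * f1 ((1 / C n) *\<^sub>R z + (sqrt (u n) / C n) *\<^sub>R y)) \<le> B * gauss 1 y" for n
      using B by (intro always_eventually) (auto simp: abs_mult abs_of_nonneg[OF gauss_nonneg] mult.commute[of B] intro!: mult_left_mono gauss_nonneg)
  qed measurable
  moreover have "(\<lambda>n. (1 / C n) ^ CARD('n)) \<longlonglongrightarrow> (1 / 1) ^ CARD('n)"
    by (intro tendsto_intros C(3)) auto
  ultimately have "T1 \<longlonglongrightarrow> (1 / 1) ^ CARD('n) * (LINT y|lborel. gauss 1 (y :: real ^ 'n) * f1 z)"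
    unfolding T1_eq[abs_def] by (intro tendsto_mult)
  moreover have "f1 z = f z" by (simp add: f1_def \<eta>_def)
  ultimately have "T1 \<longlonglongrightarrow> f z" by (simp add: integral_gauss)
  from tendsto_add[OF this T2_lim] show ?thesis by (simp add: split[abs_def])
qed

lemma integral_dens:
  assumes "\<bar>c\<bar> < 1" shows "(LINT z|lborel. dens c z) = 1"
proof -
  define u where "u = 1 - c\<^sup>2"
  note u = variance_bounds[OF assms, folded u_def]
  interpret pair_sigma_finite M "lborel :: (real ^ 'n) measure" ..
  have gi: "integrable M (\<lambda>\<omega>. gauss u (z - c *\<^sub>R X \<omega>))" for z
    using field_integrable[OF _ rapid_gauss[OF u] tempered_const[of 1], of c z] assms by simp
  have m: "(\<lambda>(\<omega>, z). ennreal (gauss u (z - c *\<^sub>R X \<omega>))) \<in> borel_measurable (M \<Otimes>\<^sub>M lborel)" by measurable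
  have "(\<integral>\<^sup>+z. ennreal (dens c z) \<partial>lborel) = (\<integral>\<^sup>+z. \<integral>\<^sup>+\<omega>. ennreal (gauss u (z - c *\<^sub>R X \<omega>)) \<partial>M \<partial>lborel)"
    unfolding dens_def field_def u_def[symmetric] mult_1
    by (intro nn_integral_cong nn_integral_eq_integral[symmetric] gi) (auto intro: gauss_nonneg[OF u(1)])
  also have "\<dots> = (\<integral>\<^sup>+\<omega>. \<integral>\<^sup>+z. ennreal (gauss u (z - c *\<^sub>R X \<omega>)) \<partial>lborel \<partial>M)"
    by (rule Fubini'[OF m])
  also have "\<dots> = 1"
    by (subst nn_integral_lborel_shift[where f="\<lambda>z. ennreal (gauss u z)"]) (auto simp: nn_integral_gauss[OF u(1)] emeasure_space_1)
  finally show ?thesis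
    using rapid_measurable[OF rapid_dens[OF assms]] dens_pos[OF assms]
    by (subst integral_eq_nn_integral) (auto intro: less_imp_le)
qed

text \<open>Fatou's lemma needs a nonnegative integrand, so r ln r is replaced by r ln r - r + 1.
  Against the Gaussian the two have the same integral for every probability density, here both for
  the interpolations and for the limit.\<close>

lemma relative_entropy_le:
  assumes law: "distr M borel X = density std_gaussian (\<lambda>x. ennreal (h x))"
    and h: "continuous_on UNIV h" "\<And>x. 0 \<le> h x"
    and bd: "\<And>c. c0 < c \<Longrightarrow> c < 1 \<Longrightarrow> entropy_at c \<le> b" and c0: "0 \<le> c0" "c0 < 1"
  shows "integrable std_gaussian (\<lambda>y. h y * ln (h y))" "relative_entropy h \<le> b" "0 \<le> relative_entropy h"
proof -
  have hm [measurable]: "h \<in> borel_measurable borel" by (rule borel_measurable_continuous_onI[OF h(1)])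
  have g1: "0 < gauss 1 (z :: real ^ 'n)" for z by (rule gauss_pos) simp
  define f where "f x = gauss 1 x * h x" for x
  have law': "distr M borel X = density lborel (\<lambda>x. ennreal (f x))"
    unfolding law std_gaussian_eq f_def using g1 h(2)
    by (subst density_density_eq) (auto simp: ennreal_mult less_imp_le)
  have fc: "continuous_on UNIV f" unfolding f_def by (intro continuous_intros h)
  have f0: "0 \<le> f x" for x using g1[of x] h(2)[of x] by (simp add: f_def less_imp_le)
  \<comment> \<open>A sequence increasing to 1; the shift by 2 keeps it strictly above
    \<open>c0\<close>, where the entropy bound is available.\<close>
  define C where "C n = 1 - (1 - c0) / real (n + 2)" for n
  have C: "c0 < C n" "C n < 1" for n
  proof -
    have "(1 - c0) / real (n + 2) < 1 - c0" using c0 by (simp add: divide_less_eq)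
    then show "c0 < C n" unfolding C_def by linarith
    show "C n < 1" unfolding C_def using c0 by simp
  qed
  then have C0: "0 < C n" for n using c0 by (meson le_less_trans)
  have C1: "\<bar>C n\<bar> < 1" for n using C0[of n] C(2)[of n] by simp
  have "(\<lambda>n. 1 - (1 - c0) * (1 / real (n + 2))) \<longlonglongrightarrow> 1 - (1 - c0) * 0"
    using LIMSEQ_ignore_initial_segment[OF lim_1_over_n, of 2] by (intro tendsto_intros) simp
  then have C_lim: "C \<longlonglongrightarrow> 1" by (simp add: C_def[abs_def])
  define \<psi> where "\<psi> r = r * ln r - r + 1" for r :: real
  have \<psi>: "0 \<le> \<psi> r" if "0 \<le> r" for r unfolding \<psi>_def by (rule entropy_function_nonneg[OF that])
  have [measurable]: "\<psi> \<in> borel_measurable borel" unfolding \<psi>_def by measurable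
  define q where "q n z = dens (C n) z / gauss 1 z" for n z
  have q0: "0 < q n z" for n z unfolding q_def using dens_pos[OF C1] g1 by simp
  have q_lim: "(\<lambda>n. q n z) \<longlonglongrightarrow> h z" for z
  proof -
    have "(\<lambda>n. dens (C n) z / gauss 1 z) \<longlonglongrightarrow> f z / gauss 1 z"
      using g1[of z] by (intro tendsto_divide dens_tendsto_density[OF law' fc f0 C0 C(2) C_lim] tendsto_const) auto
    then show ?thesis using g1[of z] by (simp add: q_def f_def)
  qed
  have \<psi>_lim: "(\<lambda>n. \<psi> (q n z)) \<longlonglongrightarrow> \<psi> (h z)" for z
    unfolding \<psi>_def using q_lim q0 by (intro tendsto_intros tendsto_mult_ln) (auto intro: less_imp_le)
  have dm [measurable]: "dens (C n) \<in> borel_measurable borel" for n by (rule rapid_measurable[OF rapid_dens[OF C1]])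
  have [measurable]: "q n \<in> borel_measurable borel" for n unfolding q_def by measurable
  have ent: "integrable lborel (\<lambda>z. gauss 1 z * \<psi> (q n z))"
      "(LINT z|lborel. gauss 1 z * \<psi> (q n z)) = entropy_at (C n)" for n
  proof -
    have e: "gauss 1 z * \<psi> (q n z) = dens (C n) z * log_ratio (C n) z - dens (C n) z + gauss 1 z" for z
    proof -
      have "ln (q n z) = log_ratio (C n) z"
        unfolding q_def log_ratio_def using dens_pos[OF C1, of n z] g1[of z] by (simp add: ln_div)
      then show ?thesis using g1[of z] by (simp add: \<psi>_def q_def algebra_simps)
    qed
    have i1: "integrable lborel (\<lambda>z. dens (C n) z * log_ratio (C n) z)"
      by (rule rapid_integrable[OF rapid_mult[OF rapid_dens[OF C1[of n]] continuous_log_ratio[OF C1[of n]],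
              of "(2 + m2 + real CARD('n)) / (1 - (C n)\<^sup>2)" 1]])
        (use log_ratio_bound[OF C1] in simp)
    have i2: "integrable lborel (dens (C n))" by (rule rapid_integrable[OF rapid_dens[OF C1]])
    have i3: "integrable lborel (gauss 1 :: real ^ 'n \<Rightarrow> real)" by (rule rapid_integrable[OF rapid_gauss]) auto
    show int: "integrable lborel (\<lambda>z. gauss 1 z * \<psi> (q n z))"
      unfolding e by (intro Bochner_Integration.integrable_add Bochner_Integration.integrable_diff i1 i2 i3)
    show "(LINT z|lborel. gauss 1 z * \<psi> (q n z)) = entropy_at (C n)"
      unfolding e entropy_at_def
      by (simp add: i1 i2 i3 integral_dens[OF C1] integral_gauss)
  qed
  have gq: "0 \<le> gauss 1 z * \<psi> (q n z)" for n z
    using g1[of z] \<psi>[of "q n z"] q0[of n z] by simp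
  have nn: "(\<integral>\<^sup>+z. ennreal (gauss 1 z * \<psi> (q n z)) \<partial>lborel) = ennreal (entropy_at (C n))" for n
    unfolding ent(2)[symmetric] by (intro nn_integral_eq_integral ent) (auto intro: gq)
  have H: "entropy_at (C n) \<le> b" for n using bd C by blast
  have nn_h: "(\<integral>\<^sup>+z. ennreal (gauss 1 z * \<psi> (h z)) \<partial>lborel) \<le> ennreal b"
  proof -
    have "liminf (\<lambda>n. ennreal (gauss 1 z * \<psi> (q n z))) = ennreal (gauss 1 z * \<psi> (h z))" for z
      by (intro lim_imp_Liminf tendsto_intros tendsto_ennrealI \<psi>_lim) simp
    then have "(\<integral>\<^sup>+z. ennreal (gauss 1 z * \<psi> (h z)) \<partial>lborel)
        = (\<integral>\<^sup>+z. liminf (\<lambda>n. ennreal (gauss 1 z * \<psi> (q n z))) \<partial>lborel)" by simp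
    also have "\<dots> \<le> liminf (\<lambda>n. \<integral>\<^sup>+z. ennreal (gauss 1 z * \<psi> (q n z)) \<partial>lborel)"
      by (rule nn_integral_liminf) measurable
    also have "\<dots> \<le> liminf (\<lambda>n. ennreal b)"
      unfolding nn by (intro Liminf_mono always_eventually allI ennreal_leI H)
    finally show ?thesis by (simp add: Liminf_const)
  qed
  have int_\<psi>: "integrable lborel (\<lambda>z. gauss 1 z * \<psi> (h z))"
    using nn_h g1 \<psi> h(2) by (intro integrableI_nonneg) (auto simp: less_imp_le le_less_trans)
  interpret D: prob_space "distr M borel X" by (rule prob_space_distr) simp
  have "(\<integral>\<^sup>+z. ennreal (f z) \<partial>lborel) = 1"
    using D.emeasure_space_1 borel_measurable_continuous_onI[OF fc] unfolding law' by (simp add: emeasure_density)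
  then have int_f: "integrable lborel f" and f1: "(LINT z|lborel. f z) = 1"
    using f0 borel_measurable_continuous_onI[OF fc]
    by (auto intro!: integrableI_nonneg simp: integral_eq_nn_integral)
  have i3: "integrable lborel (gauss 1 :: real ^ 'n \<Rightarrow> real)" by (rule rapid_integrable[OF rapid_gauss]) auto
  have e: "gauss 1 z * (h z * ln (h z)) = gauss 1 z * \<psi> (h z) + f z - gauss 1 z" for z
    by (simp add: \<psi>_def f_def algebra_simps)
  have i4: "integrable lborel (\<lambda>z. gauss 1 z * (h z * ln (h z)))"
    unfolding e by (intro Bochner_Integration.integrable_add Bochner_Integration.integrable_diff int_\<psi> int_f i3)
  show "integrable std_gaussian (\<lambda>y. h y * ln (h y))"
    unfolding std_gaussian_eq using i4 g1 by (subst integrable_density) (auto simp: less_imp_le)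
  have "relative_entropy h = (LINT z|lborel. gauss 1 z * (h z * ln (h z)))"
    unfolding relative_entropy_def std_gaussian_eq using g1 by (subst integral_density) (auto simp: less_imp_le)
  also have "\<dots> = (LINT z|lborel. gauss 1 z * \<psi> (h z))"
    unfolding e using int_\<psi> int_f i3 f1 by (simp add: integral_gauss)
  finally have re: "relative_entropy h = (LINT z|lborel. gauss 1 z * \<psi> (h z))" .
  show r0: "0 \<le> relative_entropy h"
    unfolding re using g1 \<psi> h(2) by (intro Bochner_Integration.integral_nonneg) (auto simp: less_imp_le)
  have "ennreal (relative_entropy h) \<le> ennreal b"
    using nn_h g1 \<psi> h(2) unfolding re by (subst (asm) nn_integral_eq_integral[OF int_\<psi>]) (auto simp: less_imp_le)
  \<comment> \<open>The comparison was made in \<open>ennreal\<close>, where a negative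
    \<open>b\<close> would have been truncated to 0.\<close>
  moreover have "0 \<le> b"
    using order_trans[OF Bochner_Integration.integral_nonneg[OF gq] H[of 0, folded ent(2)]] .
  ultimately show "relative_entropy h \<le> b" by (simp add: ennreal_le_iff)
qed

end

section \<open>Chain rule and integration by parts in a Markov triple\<close>

lemma smooth_in_local:
  assumes "smooth_in I \<psi>" "\<And>i. i \<in> I \<Longrightarrow> x i = y i"
  shows "\<psi> x = \<psi> y"
proof -
  have "(\<forall>i\<in>I. x i = y i) \<longrightarrow> \<psi> x = \<psi> y"
    using assms(1) unfolding smooth_in_def by (elim conjE allE)
  then show ?thesis using assms(2) by blast
qed

lemma has_partial_partial_deriv:
  assumes "smooth_in I \<psi>" "js \<in> lists I" "i \<in> I"
  shows "has_partial i (foldr partial_deriv js \<psi>) (partial_deriv i (foldr partial_deriv js \<psi>))"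
  using assms unfolding has_partial_def partial_deriv_def smooth_in_def
  by (auto simp: DERIV_deriv_iff_real_differentiable)

lemma iterated_partial_local:
  assumes "\<And>x y. (\<And>i. i \<in> I \<Longrightarrow> x i = y i) \<Longrightarrow> \<psi> x = \<psi> y" "js \<in> lists I"
    and "\<And>i. i \<in> I \<Longrightarrow> x i = y i"
  shows "foldr partial_deriv js \<psi> x = foldr partial_deriv js \<psi> y"
  using assms(2,3)
proof (induction js arbitrary: x y)
  case Nil
  then show ?case using assms(1)[of x y] by simp
next
  case (Cons j js)
  have "foldr partial_deriv js \<psi> (x(j := t)) = foldr partial_deriv js \<psi> (y(j := t))" for t
    using Cons by (intro Cons.IH) auto
  moreover have "x j = y j" using Cons.hyps Cons.prems by blast
  ultimately show ?case unfolding foldr.simps o_apply partial_deriv_def[of j] by simp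
qed

lemma has_partial_independent:
  assumes "\<And>x t. f (x(k := t)) = f x"
  shows "has_partial k f (\<lambda>_. 0)"
  using assms by (simp add: has_partial_def)

text \<open>The fresh coordinate will carry a further element f of the algebra. The diffusion rule
  for L applied to f times \<psi>(u) is what yields the chain rule for the carre du champ.\<close>

lemma smooth_poly_growth_times_coord:
  fixes \<psi> :: "('i \<Rightarrow> real) \<Rightarrow> real"
  assumes \<psi>: "smooth_poly_growth_in I \<psi>" and I: "finite I" "k \<notin> I"
  shows "smooth_poly_growth_in (insert k I) (\<lambda>x. x k * \<psi> x)"
proof -
  \<comment> \<open>All iterated partials of \<psi> serve as generators, so closure under partials
    in \<open>I\<close> is immediate; in the direction \<open>k\<close> they are constant.\<close>
  define B where "B = insert (\<lambda>x. x k) {foldr partial_deriv js \<psi> |js. js \<in> lists I}"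
  have sm: "smooth_in I \<psi>" using \<psi> by (simp add: smooth_poly_growth_in_def)
  have loc: "\<psi> x = \<psi> y" if "\<And>i. i \<in> I \<Longrightarrow> x i = y i" for x y
    by (rule smooth_in_local[OF sm]) (use that in auto)
  have loc': "foldr partial_deriv js \<psi> x = foldr partial_deriv js \<psi> y"
    if "js \<in> lists I" "\<And>i. i \<in> I \<Longrightarrow> x i = y i" for js x y
    by (rule iterated_partial_local[OF loc that]) assumption
  show ?thesis
  proof (rule function_ring_smooth_poly_growth[where B=B])
    fix b and x y :: "'i \<Rightarrow> real" assume "b \<in> B" and xy: "\<And>i. i \<in> insert k I \<Longrightarrow> x i = y i"
    then consider "b = (\<lambda>x. x k)" | js where "js \<in> lists I" "b = foldr partial_deriv js \<psi>" by (auto simp: B_def)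
    then show "b x = b y" by cases (auto intro: loc' xy)
  next
    fix b assume "b \<in> B"
    then show "continuous_on UNIV b"
      using sm by (auto simp: B_def smooth_in_def intro!: continuous_on_product_coordinates)
  next
    fix b i assume b: "b \<in> B" and i: "i \<in> insert k I"
    show "\<exists>b'. function_ring B b' \<and> has_partial i b b'"
    proof (cases "b = (\<lambda>x. x k)")
      case True
      show ?thesis unfolding True
        by (intro exI[of _ "\<lambda>_. of_bool (i = k)"] conjI has_partial_coord function_ring.const)
    next
      case False
      then obtain js where js: "js \<in> lists I" "b = foldr partial_deriv js \<psi>" using b by (auto simp: B_def)
      show ?thesis
      proof (cases "i = k")
        case True
        have "b (x(k := t)) = b x" for x t
          unfolding js(2) by (rule loc'[OF js(1)]) (use I in auto)
        then have "has_partial k b (\<lambda>_. 0)" by (rule has_partial_independent)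
        then show ?thesis unfolding True by (intro exI[of _ "\<lambda>_. 0"] conjI function_ring.const)
      next
        case False
        then have i: "i \<in> I" using i by simp
        have "has_partial i b (partial_deriv i b)"
          unfolding js(2) by (rule has_partial_partial_deriv[OF sm js(1) i])
        moreover have "partial_deriv i b \<in> B"
          unfolding B_def js(2) using js(1) i by (intro insertI2 CollectI exI[of _ "i # js"]) simp
        ultimately show ?thesis by (intro exI[of _ "partial_deriv i b"] conjI function_ring.gen)
      qed
    qed
  next
    fix b assume "b \<in> B"
    then consider "b = (\<lambda>x. x k)" | js where "js \<in> lists I" "b = foldr partial_deriv js \<psi>" by (auto simp: B_def)
    then show "poly_bounded (insert k I) b"
    proof cases
      case 1
      then show ?thesis using I by (simp add: coord_poly_bounded)
    next
      case 2
      then obtain C m where C: "\<And>x. \<bar>b x\<bar> \<le> C * (1 + (\<Sum>i\<in>I. \<bar>x i\<bar>)) ^ m"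
        using \<psi> unfolding smooth_poly_growth_in_def by blast
      have C0: "0 \<le> C" using order_trans[OF abs_ge_zero C[of "\<lambda>_. 0"]] by simp
      show ?thesis
      proof (rule poly_boundedI)
        fix x :: "'i \<Rightarrow> real"
        have "(\<Sum>i\<in>I. \<bar>x i\<bar>) \<le> (\<Sum>i\<in>insert k I. \<bar>x i\<bar>)" using I by (intro sum_mono2) auto
        then have "C * (1 + (\<Sum>i\<in>I. \<bar>x i\<bar>)) ^ m \<le> C * (1 + (\<Sum>i\<in>insert k I. \<bar>x i\<bar>)) ^ m"
          using C0 by (intro mult_left_mono power_mono) (auto intro: add_nonneg_nonneg sum_nonneg)
        then show "\<bar>b x\<bar> \<le> C * (1 + (\<Sum>i\<in>insert k I. \<bar>x i\<bar>)) ^ m" using C[of x] by linarith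
      qed
    qed
  next
    have "\<psi> \<in> B" unfolding B_def by (intro insertI2 CollectI exI[of _ "[]"]) simp
    then show "function_ring B (\<lambda>x. x k * \<psi> x)"
      by (intro function_ring.mult function_ring.gen) (auto simp: B_def)
  qed
qed

text \<open>The polynomials in the coordinates.\<close>

lemma smooth_poly_growth_coords:
  fixes f :: "('i \<Rightarrow> real) \<Rightarrow> real"
  assumes "finite I" "function_ring ((\<lambda>i x. x i) ` I) f"
  shows "smooth_poly_growth_in I f"
proof (rule function_ring_smooth_poly_growth[OF _ _ _ _ assms(2)])
  fix b :: "('i \<Rightarrow> real) \<Rightarrow> real" and i assume "b \<in> (\<lambda>i x. x i) ` I" "i \<in> I"
  then obtain j where j: "b = (\<lambda>x. x j)" by auto
  show "\<exists>b'. function_ring ((\<lambda>i x. x i) ` I) b' \<and> has_partial i b b'"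
    unfolding j by (intro exI[of _ "\<lambda>_. of_bool (i = j)"] conjI has_partial_coord function_ring.const)
qed (auto intro: coord_poly_bounded assms(1) continuous_on_product_coordinates)

context markov_triple
begin

lemma A_measurable: "f \<in> A \<Longrightarrow> f \<in> borel_measurable M"
  and A_square_integrable: "f \<in> A \<Longrightarrow> integrable M (\<lambda>x. (f x)\<^sup>2)"
  and L_measurable: "f \<in> A \<Longrightarrow> L f \<in> borel_measurable M"
  and L_square_integrable: "f \<in> A \<Longrightarrow> integrable M (\<lambda>x. (L f x)\<^sup>2)"
  using generator[of f] by (auto simp: has_generator_value_def L2_def)

lemma integrable_mult_L2:
  fixes f g :: "'a \<Rightarrow> real"
  assumes [measurable]: "f \<in> borel_measurable M" "g \<in> borel_measurable M"
    and "integrable M (\<lambda>x. (f x)\<^sup>2)" "integrable M (\<lambda>x. (g x)\<^sup>2)"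
  shows "integrable M (\<lambda>x. f x * g x)"
proof (rule Bochner_Integration.integrable_bound[OF Bochner_Integration.integrable_add[OF assms(3,4)]])
  show "AE x in M. norm (f x * g x) \<le> norm ((f x)\<^sup>2 + (g x)\<^sup>2)"
  proof (intro always_eventually allI)
    fix x
    have "2 * (\<bar>f x\<bar> * \<bar>g x\<bar>) \<le> (f x)\<^sup>2 + (g x)\<^sup>2"
      using sum_squares_bound[of "\<bar>f x\<bar>" "\<bar>g x\<bar>"] by simp
    moreover have "0 \<le> \<bar>f x\<bar> * \<bar>g x\<bar>" by simp
    ultimately show "norm (f x * g x) \<le> norm ((f x)\<^sup>2 + (g x)\<^sup>2)"
      unfolding real_norm_def abs_mult by linarith
  qed
qed measurable

lemma A_integrable_mult: "f \<in> A \<Longrightarrow> g \<in> A \<Longrightarrow> integrable M (\<lambda>x. f x * g x)"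
  by (intro integrable_mult_L2 A_measurable A_square_integrable)

lemma A_integrable: "f \<in> A \<Longrightarrow> integrable M f"
  using A_integrable_mult[OF const_closed[of 1], of f] by simp

lemma A_integrable_mult_L: "f \<in> A \<Longrightarrow> g \<in> A \<Longrightarrow> integrable M (\<lambda>x. f x * L g x)"
  by (intro integrable_mult_L2 A_measurable A_square_integrable L_measurable L_square_integrable)

lemma sum_closed: "finite S \<Longrightarrow> (\<And>i. i \<in> S \<Longrightarrow> f i \<in> A) \<Longrightarrow> (\<lambda>x. \<Sum>i\<in>S. f i x) \<in> A"
  by (induction S rule: finite_induct) (simp_all add: const_closed add_closed)

lemma prod_closed: "finite S \<Longrightarrow> (\<And>i. i \<in> S \<Longrightarrow> f i \<in> A) \<Longrightarrow> (\<lambda>x. \<Prod>i\<in>S. f i x) \<in> A"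
  by (induction S rule: finite_induct) (simp_all add: const_closed mult_closed)

lemma cmult_closed: "f \<in> A \<Longrightarrow> (\<lambda>x. c * f x) \<in> A"
  by (rule mult_closed[OF const_closed])

lemma power_closed: "f \<in> A \<Longrightarrow> (\<lambda>x. f x ^ n) \<in> A"
  by (induction n) (simp_all add: const_closed mult_closed)

lemma det_closed:
  fixes B :: "'a \<Rightarrow> real ^ 'n ^ 'n::finite"
  assumes "\<And>i j. (\<lambda>x. B x $ i $ j) \<in> A"
  shows "(\<lambda>x. det (B x)) \<in> A"
  unfolding det_def by (intro sum_closed cmult_closed prod_closed assms finite_permutations) auto

lemma adjugate_closed:
  fixes B :: "'a \<Rightarrow> real ^ 'n ^ 'n::finite"
  assumes "\<And>i j. (\<lambda>x. B x $ i $ j) \<in> A"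
  shows "(\<lambda>x. adjugate (B x) $ i $ j) \<in> A"
proof -
  have "(\<lambda>x. det (\<chi> k l. if l = i then axis j 1 $ k else B x $ k $ l)) \<in> A"
  proof (rule det_closed)
    fix k l
    show "(\<lambda>x. (\<chi> k l. if l = i then axis j 1 $ k else B x $ k $ l) $ k $ l) \<in> A"
      by (cases "l = i") (simp_all add: const_closed assms)
  qed
  then show ?thesis by (simp add: adjugate_def)
qed

lemma carre_du_champ_commute: "carre_du_champ L f g = carre_du_champ L g f"
  by (simp add: carre_du_champ_def fun_eq_iff mult.commute)

text \<open>The carre du champ is half of L(f \<psi>(u)) - f L\<psi>(u) - \<psi>(u) Lf. Expanding
  the first two terms by the diffusion rule cancels everything except the second order terms that
  mix f with one of the u_i.\<close>

lemma carre_du_champ_chain: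
  assumes \<psi>: "smooth_poly_growth_in {..<k::nat} \<psi>" and u: "\<And>i. i < k \<Longrightarrow> u i \<in> A" and f: "f \<in> A"
  shows "AE x in M. carre_du_champ L f (\<lambda>y. \<psi> (\<lambda>i. u i y)) x
    = (\<Sum>i<k. partial_deriv i \<psi> (\<lambda>l. u l x) * carre_du_champ L f (u i) x)"
proof -
  \<comment> \<open>The slot \<open>k\<close>, the first one that \<psi> does not read, holds
    f.\<close>
  define \<phi> where "\<phi> = (\<lambda>x. x k * \<psi> x)"
  define v where "v i = (if i < k then u i else f)" for i
  have sm: "smooth_in {..<k} \<psi>" using \<psi> by (simp add: smooth_poly_growth_in_def)
  have loc: "\<psi> x = \<psi> y" if eq: "\<And>i. i < k \<Longrightarrow> x i = y i" for x y
  proof (rule smooth_in_local[OF sm])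
    fix i assume "i \<in> {..<k}"
    then have "i < k" by simp
    then show "x i = y i" by (rule eq)
  qed
  have locs: "foldr partial_deriv js \<psi> x = foldr partial_deriv js \<psi> y"
    if js: "js \<in> lists {..<k}" and eq: "\<And>i. i < k \<Longrightarrow> x i = y i" for x y js
  proof (rule iterated_partial_local[OF _ js])
    show "\<psi> a = \<psi> b" if "\<And>i. i \<in> {..<k} \<Longrightarrow> a i = b i" for a b
      by (rule smooth_in_local[OF sm that])
    show "x i = y i" if "i \<in> {..<k}" for i
      by (rule eq) (use that in simp)
  qed
  have locd: "partial_deriv j \<psi> x = partial_deriv j \<psi> y"
    if j: "j < k" and eq: "\<And>i. i < k \<Longrightarrow> x i = y i" for x y j
    using locs[of "[j]" x y, OF _ eq] j by simp
  have locdd: "partial_deriv l (partial_deriv j \<psi>) x = partial_deriv l (partial_deriv j \<psi>) y"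
    if j: "j < k" "l < k" and eq: "\<And>i. i < k \<Longrightarrow> x i = y i" for x y j l
    using locs[of "[l, j]" x y, OF _ eq] j by simp
  have \<phi>: "smooth_poly_growth_in {..<Suc k} \<phi>"
    using smooth_poly_growth_times_coord[OF \<psi>, of k] by (simp add: \<phi>_def lessThan_Suc)
  have coord0: "has_partial i (\<lambda>x. x k) (\<lambda>_. 0)" if "i < k" for i
    using has_partial_coord[of i k] that by simp
  have coord1: "has_partial k (\<lambda>x. x k) (\<lambda>_. 1)"
    using has_partial_coord[of k k] by simp
  have p1: "has_partial i \<psi> (partial_deriv i \<psi>)" if "i < k" for i
    using has_partial_partial_deriv[OF sm, of "[]" i] that by simp
  have p2: "has_partial i (partial_deriv j \<psi>) (partial_deriv i (partial_deriv j \<psi>))" if "i < k" "j < k" for i j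
    using has_partial_partial_deriv[OF sm, of "[j]" i] that by simp
  have q1: "has_partial k \<psi> (\<lambda>_. 0)" by (rule has_partial_independent, rule loc) simp
  have q2: "has_partial k (partial_deriv j \<psi>) (\<lambda>_. 0)" if "j < k" for j
    by (rule has_partial_independent, rule locd) (use that in auto)
  have d1: "partial_deriv i \<phi> = (\<lambda>x. x k * partial_deriv i \<psi> x)" if "i < k" for i
    using has_partial_mult[OF coord0[OF that] p1[OF that]] partial_deriv_eq[of i \<phi>] by (simp add: \<phi>_def mult.commute)
  have d2: "partial_deriv k \<phi> = \<psi>"
    using has_partial_mult[OF coord1 q1] partial_deriv_eq[of k \<phi> \<psi>] by (simp add: \<phi>_def)
  have d11: "partial_deriv i (partial_deriv j \<phi>) = (\<lambda>x. x k * partial_deriv i (partial_deriv j \<psi>) x)" if "i < k" "j < k" for i j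
    using has_partial_mult[OF coord0[OF that(1)] p2[OF that]] partial_deriv_eq[of i "partial_deriv j \<phi>"]
    by (simp add: d1[OF that(2)] mult.commute)
  have d21: "partial_deriv k (partial_deriv j \<phi>) = partial_deriv j \<psi>" if "j < k" for j
    using has_partial_mult[OF coord1 q2[OF that]] partial_deriv_eq[of k "partial_deriv j \<phi>" "partial_deriv j \<psi>"]
    by (simp add: d1[OF that])
  have d22: "partial_deriv k (partial_deriv k \<phi>) = (\<lambda>_. 0)" unfolding d2 by (rule partial_deriv_eq[OF q1])
  have v: "v i \<in> A" if "i < Suc k" for i using u f by (simp add: v_def)
  have uv: "\<psi> (\<lambda>i. v i y) = \<psi> (\<lambda>i. u i y)" for y by (rule loc) (simp add: v_def)
  have uvd: "partial_deriv j \<psi> (\<lambda>i. v i y) = partial_deriv j \<psi> (\<lambda>i. u i y)" if "j < k" for y j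
    by (rule locd[OF that]) (simp add: v_def)
  have uvdd: "partial_deriv l (partial_deriv j \<psi>) (\<lambda>i. v i y) = partial_deriv l (partial_deriv j \<psi>) (\<lambda>i. u i y)"
    if "j < k" "l < k" for y j l
    by (rule locdd[OF that]) (simp add: v_def)
  have vk: "v k = f" "\<And>i. i < k \<Longrightarrow> v i = u i" by (auto simp: v_def)
  have fun_eq: "(\<lambda>y. \<phi> (\<lambda>i. v i y)) = (\<lambda>y. f y * \<psi> (\<lambda>i. u i y))"
    by (simp add: \<phi>_def uv vk)
  have a1: "AE x in M. L (\<lambda>y. f y * \<psi> (\<lambda>i. u i y)) x =
      (\<Sum>i<Suc k. partial_deriv i \<phi> (\<lambda>l. v l x) * L (v i) x) +
      (\<Sum>i<Suc k. \<Sum>j<Suc k. partial_deriv i (partial_deriv j \<phi>) (\<lambda>l. v l x) * carre_du_champ L (v i) (v j) x)"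
    using diffusion[where \<psi>=\<phi> and u=v, OF \<phi> v] unfolding fun_eq by blast
  have a2: "AE x in M. L (\<lambda>y. \<psi> (\<lambda>i. u i y)) x =
      (\<Sum>i<k. partial_deriv i \<psi> (\<lambda>l. u l x) * L (u i) x) +
      (\<Sum>i<k. \<Sum>j<k. partial_deriv i (partial_deriv j \<psi>) (\<lambda>l. u l x) * carre_du_champ L (u i) (u j) x)"
    by (rule diffusion[OF \<psi> u])
  from a1 a2 show ?thesis
  proof eventually_elim
    case (elim x)
    define S1 where "S1 = (\<Sum>i<k. partial_deriv i \<psi> (\<lambda>l. u l x) * L (u i) x)"
    define S2 where "S2 = (\<Sum>i<k. \<Sum>j<k. partial_deriv i (partial_deriv j \<psi>) (\<lambda>l. u l x) * carre_du_champ L (u i) (u j) x)"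
    define S3 where "S3 = (\<Sum>i<k. partial_deriv i \<psi> (\<lambda>l. u l x) * carre_du_champ L f (u i) x)"
    have 1: "(\<Sum>i<Suc k. partial_deriv i \<phi> (\<lambda>l. v l x) * L (v i) x) = f x * S1 + \<psi> (\<lambda>i. u i x) * L f x"
      unfolding S1_def by (simp add: d1 d2 uv uvd vk sum_distrib_left mult_ac)
    have 2: "(\<Sum>i<k. \<Sum>j<k. partial_deriv i (partial_deriv j \<phi>) (\<lambda>l. v l x) * carre_du_champ L (v i) (v j) x) = f x * S2"
      unfolding S2_def sum_distrib_left by (intro sum.cong refl) (simp add: d11 uvdd vk mult_ac)
    have 3: "(\<Sum>i<k. partial_deriv i (partial_deriv k \<phi>) (\<lambda>l. v l x) * carre_du_champ L (v i) (v k) x) = S3"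
      unfolding S3_def by (intro sum.cong refl) (simp add: d2 uvd vk carre_du_champ_commute[of f])
    have 4: "(\<Sum>j<k. partial_deriv k (partial_deriv j \<phi>) (\<lambda>l. v l x) * carre_du_champ L (v k) (v j) x) = S3"
      unfolding S3_def by (intro sum.cong refl) (simp add: d21 uvd vk)
    \<comment> \<open>The mixed terms occur once in the last row and once in the last column; this
      factor 2 cancels the 1/2 in the carre du champ.\<close>
    have "(\<Sum>i<Suc k. \<Sum>j<Suc k. partial_deriv i (partial_deriv j \<phi>) (\<lambda>l. v l x) * carre_du_champ L (v i) (v j) x)
        = f x * S2 + 2 * S3"
      by (simp add: sum.distrib 2 3 4 d22)
    then have "L (\<lambda>y. f y * \<psi> (\<lambda>i. u i y)) x = f x * S1 + \<psi> (\<lambda>i. u i x) * L f x + (f x * S2 + 2 * S3)"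
      using elim(1) 1 by simp
    moreover have "L (\<lambda>y. \<psi> (\<lambda>i. u i y)) x = S1 + S2" using elim(2) by (simp add: S1_def S2_def)
    ultimately show ?case unfolding S3_def[symmetric] by (simp add: carre_du_champ_def algebra_simps)
  qed
qed

lemma carre_du_champ_mult:
  assumes "f \<in> A" "g \<in> A" "k \<in> A"
  shows "AE x in M. carre_du_champ L f (\<lambda>y. g y * k y) x
    = g x * carre_du_champ L f k x + k x * carre_du_champ L f g x"
proof -
  define \<psi> where "\<psi> x = x 0 * x 1" for x :: "nat \<Rightarrow> real"
  define u where "u i = (if i = 0 then g else k)" for i :: nat
  have "function_ring ((\<lambda>i x. x i) ` {..<2::nat}) \<psi>"
    unfolding \<psi>_def by (intro function_ring.mult function_ring.gen) auto
  then have sm: "smooth_poly_growth_in {..<2::nat} \<psi>" by (intro smooth_poly_growth_coords) auto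
  have d: "partial_deriv i \<psi> = (\<lambda>x. of_bool (i = 0) * x 1 + of_bool (i = 1) * x 0)" for i
    unfolding \<psi>_def by (rule partial_deriv_eq[OF has_partial_mult[OF has_partial_coord has_partial_coord]])
  have "AE x in M. carre_du_champ L f (\<lambda>y. \<psi> (\<lambda>i. u i y)) x
      = (\<Sum>i<2. partial_deriv i \<psi> (\<lambda>l. u l x) * carre_du_champ L f (u i) x)"
    using assms by (intro carre_du_champ_chain[OF sm]) (auto simp: u_def)
  then show ?thesis by (simp add: \<psi>_def[symmetric] d numeral_2_eq_2, simp add: \<psi>_def u_def add.commute)
qed

text \<open>Integration by parts for f and the product a g, followed by the Leibniz rule. It frees g
  from the carre du champ; g will be a Gaussian kernel of F, and a an entry of the regularised
  inverse matrix.\<close>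

lemma weighted_integration_by_parts:
  assumes "f \<in> A" "g \<in> A" "a \<in> A"
  shows "(LINT x|M. a x * carre_du_champ L f g x) = - (LINT x|M. g x * (carre_du_champ L f a x + a x * L f x))"
proof -
  note ag = mult_closed[OF assms(3,2)]
  note Gfg = Gamma_closed[OF assms(1,2)] and Gfa = Gamma_closed[OF assms(1,3)]
  have i1: "integrable M (\<lambda>x. a x * carre_du_champ L f g x)" by (rule A_integrable_mult[OF assms(3) Gfg])
  have i2: "integrable M (\<lambda>x. g x * carre_du_champ L f a x)" by (rule A_integrable_mult[OF assms(2) Gfa])
  have i3: "integrable M (\<lambda>x. a x * g x * L f x)" by (rule A_integrable_mult_L[OF ag assms(1)])
  have "(LINT x|M. a x * g x * L f x) = - (LINT x|M. carre_du_champ L f (\<lambda>y. a y * g y) x)"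
    using integration_by_parts[OF ag assms(1)] by (simp add: carre_du_champ_commute[of _ f])
  also have "(LINT x|M. carre_du_champ L f (\<lambda>y. a y * g y) x)
      = (LINT x|M. a x * carre_du_champ L f g x + g x * carre_du_champ L f a x)"
    using carre_du_champ_mult[OF assms(1,3,2)]
    by (intro integral_cong_AE A_measurable[OF Gamma_closed[OF assms(1) ag]]) (use i1 i2 in auto)
  also have "\<dots> = (LINT x|M. a x * carre_du_champ L f g x) + (LINT x|M. g x * carre_du_champ L f a x)"
    using i1 i2 by simp
  finally have "(LINT x|M. a x * carre_du_champ L f g x)
      = - ((LINT x|M. g x * carre_du_champ L f a x) + (LINT x|M. a x * g x * L f x))" by linarith
  also have "(LINT x|M. g x * carre_du_champ L f a x) + (LINT x|M. a x * g x * L f x)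
      = (LINT x|M. g x * carre_du_champ L f a x + a x * g x * L f x)"
    using i2 i3 by simp
  finally show ?thesis by (simp add: algebra_simps)
qed

end

section \<open>Integration by parts with the regularised inverse of the Gamma matrix\<close>

lemma regularised_inverse_deriv:
  assumes "0 < \<epsilon>"
  shows "((\<lambda>r. r / (r\<^sup>2 + \<epsilon>\<^sup>2)) has_real_derivative (\<epsilon>\<^sup>2 - r\<^sup>2) / (r\<^sup>2 + \<epsilon>\<^sup>2)\<^sup>2) (at (r :: real))"
proof -
  have p: "0 < r\<^sup>2 + \<epsilon>\<^sup>2" using assms by (intro add_nonneg_pos) auto
  have "((\<lambda>r. r / (r\<^sup>2 + \<epsilon>\<^sup>2)) has_real_derivative (1 * (r\<^sup>2 + \<epsilon>\<^sup>2) - r * (2 * r)) / ((r\<^sup>2 + \<epsilon>\<^sup>2) * (r\<^sup>2 + \<epsilon>\<^sup>2))) (at r)"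
    using p by (intro DERIV_divide) (auto intro!: derivative_eq_intros)
  then show ?thesis by (simp add: power2_eq_square algebra_simps)
qed

text \<open>1/r is neither smooth at 0 nor of polynomial growth, so it cannot be composed with
  elements of the algebra, whereas r/(r^2 + \<epsilon>^2) can. The coordinate and \<rho> = 1/(r^2 +
  \<epsilon>^2) generate a suitable ring because \<rho>' = -2 r \<rho>^2.\<close>

lemma regularised_inverse_smooth:
  assumes "0 < \<epsilon>"
  shows "smooth_poly_growth_in {..<1::nat} (\<lambda>x. x 0 / ((x 0)\<^sup>2 + \<epsilon>\<^sup>2))"
proof -
  define \<rho> where "\<rho> x = 1 / ((x 0)\<^sup>2 + \<epsilon>\<^sup>2)" for x :: "nat \<Rightarrow> real"
  define B where "B = {\<lambda>x :: nat \<Rightarrow> real. x 0, \<rho>}"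
  have p: "0 < r\<^sup>2 + \<epsilon>\<^sup>2" for r using assms by (intro add_nonneg_pos) auto
  have g0: "function_ring B (\<lambda>x. x 0)" and g1: "function_ring B \<rho>"
    by (auto simp: B_def intro!: function_ring.gen)
  have d: "has_partial 0 \<rho> (\<lambda>x. - 2 * x 0 * (\<rho> x * \<rho> x))"
  proof -
    have "((\<lambda>r. 1 / (r\<^sup>2 + \<epsilon>\<^sup>2)) has_real_derivative - (2 * y) / ((y\<^sup>2 + \<epsilon>\<^sup>2) * (y\<^sup>2 + \<epsilon>\<^sup>2))) (at y)" for y
      using p[of y] by (auto intro!: derivative_eq_intros simp: power2_eq_square)
    from has_partial_compose[OF has_partial_coord this, of 0 0]
    show ?thesis by (simp add: \<rho>_def[abs_def] mult_ac)
  qed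
  have "smooth_poly_growth_in {..<1::nat} (\<lambda>x. x 0 * \<rho> x)"
  proof (rule function_ring_smooth_poly_growth[where B=B])
    fix b and x y :: "nat \<Rightarrow> real" assume "b \<in> B" "\<And>i. i \<in> {..<1} \<Longrightarrow> x i = y i"
    then show "b x = b y" by (auto simp: B_def \<rho>_def)
  next
    fix b assume "b \<in> B"
    moreover have "continuous_on UNIV \<rho>" unfolding \<rho>_def
      using p by (intro continuous_intros) (auto dest: less_imp_neq simp: less_imp_neq[symmetric])
    ultimately show "continuous_on UNIV b" by (auto simp: B_def intro: continuous_on_product_coordinates)
  next
    fix b and i :: nat assume b: "b \<in> B" and "i \<in> {..<1}"
    then have i: "i = 0" by simp
    consider "b = (\<lambda>x. x 0)" | "b = \<rho>" using b by (auto simp: B_def)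
    then show "\<exists>b'. function_ring B b' \<and> has_partial i b b'"
    proof cases
      case 1
      show ?thesis unfolding 1 by (intro exI[of _ "\<lambda>_. of_bool (i = 0)"] conjI has_partial_coord function_ring.const)
    next
      case 2
      have "function_ring B (\<lambda>x. - 2 * x 0 * (\<rho> x * \<rho> x))"
        by (rule function_ring.mult[OF function_ring.mult[OF function_ring.const g0] function_ring.mult[OF g1 g1]])
      then show ?thesis unfolding 2 i using d by (intro exI conjI)
    qed
  next
    fix b assume "b \<in> B"
    moreover have "poly_bounded {..<1} \<rho>"
    proof (rule bounded_imp_poly_bounded)
      show "\<bar>\<rho> x\<bar> \<le> 1 / \<epsilon>\<^sup>2" for x
        using p[of "x 0"] assms by (simp add: \<rho>_def divide_left_mono)
    qed
    ultimately show "poly_bounded {..<1} b" by (auto simp: B_def intro: coord_poly_bounded)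
  qed (rule function_ring.mult[OF g0 g1])
  then show ?thesis by (simp add: \<rho>_def)
qed

text \<open>The diffusion rule uses variables numbered by naturals, while the components of F are
  indexed by the type \<open>'n\<close>; the enumeration translates between the two.\<close>

lemma enumeration_exists:
  obtains e :: "nat \<Rightarrow> 'n::finite" and e' where "\<And>k. k < CARD('n) \<Longrightarrow> e' (e k) = k" "\<And>i. e (e' i) = i" "\<And>i. e' i < CARD('n)"
    "bij_betw e {..<CARD('n)} UNIV"
proof -
  obtain e :: "nat \<Rightarrow> 'n" where e: "bij_betw e {..<CARD('n)} UNIV"
    using ex_bij_betw_nat_finite[of "UNIV :: 'n set"] by (auto simp: atLeast0LessThan)
  define e' where "e' = inv_into {..<CARD('n)} e"
  show thesis
  proof (rule that[of e' e])
    show "e' (e k) = k" if "k < CARD('n)" for k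
      using bij_betw_inv_into_left[OF e] that by (simp add: e'_def)
    show "e (e' i) = i" for i using bij_betw_inv_into_right[OF e] by (simp add: e'_def)
    show "e' i < CARD('n)" for i
      using bij_betw_inv_into[OF e] by (auto simp: e'_def bij_betw_def)
  qed (rule e)
qed

text \<open>Each partial derivative of the kernel is a polynomial times the kernel, so the kernel
  and the coordinates generate a ring closed under partials. The kernel of F therefore belongs to
  the algebra.\<close>

lemma gauss_kernel_smooth:
  fixes z :: "real ^ 'n::finite" and c u :: real
  assumes u: "0 < u" and e: "\<And>k. k < CARD('n) \<Longrightarrow> e' (e k) = k" "\<And>i. e (e' i) = i" "\<And>i. e' i < CARD('n)"
  defines "\<Phi> \<equiv> \<lambda>y :: nat \<Rightarrow> real. gauss u (z - c *\<^sub>R (\<chi> i. y (e' i)))"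
  shows "smooth_poly_growth_in {..<CARD('n)} \<Phi>"
    and "\<And>k. k < CARD('n) \<Longrightarrow> has_partial k \<Phi> (\<lambda>y. c / u * (z $ e k - c * y k) * \<Phi> y)"
proof -
  define B where "B = insert \<Phi> ((\<lambda>i y. y i) ` {..<CARD('n)})"
  show d: "has_partial k \<Phi> (\<lambda>y. c / u * (z $ e k - c * y k) * \<Phi> y)" if k: "k < CARD('n)" for k
    unfolding has_partial_def
  proof
    fix y :: "nat \<Rightarrow> real"
    define w where "w = z - c *\<^sub>R (\<chi> i. y (e' i))"
    have upd: "(z - c *\<^sub>R (\<chi> i. (y(k := t)) (e' i))) = w + (- c * (t - y k)) *\<^sub>R axis (e k) 1" for t
      using e(1)[OF k] e(2) by (auto simp: vec_eq_iff w_def axis_def algebra_simps)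
    have "((\<lambda>t. gauss u (w + (- c * (t - y k)) *\<^sub>R axis (e k) 1)) has_real_derivative
        (- (w $ e k) / u * gauss u w) * (- c)) (at (y k))"
      by (rule DERIV_chain2[of "\<lambda>s. gauss u (w + s *\<^sub>R axis (e k) 1)" _ "\<lambda>t. - c * (t - y k)" "y k"])
        (use gauss_deriv[OF u, of w "e k"] in \<open>auto intro!: derivative_eq_intros\<close>)
    moreover have "(- (w $ e k) / u * gauss u w) * (- c) = c / u * (z $ e k - c * y k) * \<Phi> y"
    proof -
      have wk: "z $ e k - c * y k = w $ e k" using e(1)[OF k] by (simp add: w_def)
      have "\<Phi> y = gauss u w" by (simp add: \<Phi>_def w_def)
      then show ?thesis unfolding wk by simp
    qed
    ultimately show "((\<lambda>t. \<Phi> (y(k := t))) has_real_derivative c / u * (z $ e k - c * y k) * \<Phi> y) (at (y k))"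
      by (simp only: \<Phi>_def upd)
  qed
  have g: "function_ring B \<Phi>" by (rule function_ring.gen) (simp add: B_def)
  show "smooth_poly_growth_in {..<CARD('n)} \<Phi>"
  proof (rule function_ring_smooth_poly_growth[where B=B, OF _ _ _ _ g])
    fix b and x y :: "nat \<Rightarrow> real" assume "b \<in> B" and xy: "\<And>i. i \<in> {..<CARD('n)} \<Longrightarrow> x i = y i"
    moreover have "\<Phi> x = \<Phi> y"
    proof -
      have "x (e' i) = y (e' i)" for i using xy[of "e' i"] e(3) by simp
      then show ?thesis by (simp add: \<Phi>_def)
    qed
    ultimately show "b x = b y" by (auto simp: B_def)
  next
    fix b assume "b \<in> B"
    moreover have "continuous_on UNIV \<Phi>" unfolding \<Phi>_def
      by (intro continuous_intros continuous_on_vec_lambda continuous_on_product_coordinates)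
    ultimately show "continuous_on UNIV b" by (auto simp: B_def intro: continuous_on_product_coordinates)
  next
    fix b and k assume b: "b \<in> B" and "k \<in> {..<CARD('n)}"
    then have k: "k < CARD('n)" by simp
    consider "b = \<Phi>" | j where "b = (\<lambda>y. y j)" using b by (auto simp: B_def)
    then show "\<exists>b'. function_ring B b' \<and> has_partial k b b'"
    proof cases
      case 1
      have "function_ring B (\<lambda>y. y k)" using k by (auto intro: function_ring.gen simp: B_def)
      from function_ring.mult[OF function_ring_cmult[OF function_ring_diff[OF function_ring.const function_ring_cmult[OF this]]] g]
      have "function_ring B (\<lambda>y. c / u * (z $ e k - c * y k) * \<Phi> y)" .
      then show ?thesis unfolding 1 using d[OF k] by (intro exI conjI)
    next
      case 2
      show ?thesis unfolding 2 by (intro exI[of _ "\<lambda>_. of_bool (k = j)"] conjI has_partial_coord function_ring.const)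
    qed
  next
    fix b assume "b \<in> B"
    moreover have "poly_bounded {..<CARD('n)} \<Phi>"
    proof (rule bounded_imp_poly_bounded)
      fix y
      have "gauss u w \<le> (1 / sqrt (2 * pi * u)) ^ CARD('n) * 1" for w :: "real ^ 'n"
        unfolding gauss_def using u by (intro mult_left_mono) auto
      then show "\<bar>\<Phi> y\<bar> \<le> (1 / sqrt (2 * pi * u)) ^ CARD('n)"
        unfolding \<Phi>_def abs_of_nonneg[OF gauss_nonneg[OF u]] by simp
    qed
    ultimately show "poly_bounded {..<CARD('n)} b" by (auto simp: B_def intro: coord_poly_bounded)
  qed
qed

lemma adjugate_mult:
  fixes B :: "real ^ 'n ^ 'n::finite"
  assumes "det B \<noteq> 0"
  shows "adjugate B ** B = det B *\<^sub>R mat 1"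
proof -
  have "matrix_inv B ** B = mat 1"
    using assms unfolding invertible_det_nz[symmetric] invertible_def matrix_inv_def
    by (metis (mono_tags, lifting) someI_ex)
  moreover have "(det B *\<^sub>R matrix_inv B) ** B = det B *\<^sub>R (matrix_inv B ** B)"
    by (simp add: matrix_matrix_mult_def vec_eq_iff sum_distrib_left mult_ac)
  ultimately show ?thesis by (simp add: adjugate_eq_det_inverse[OF assms])
qed

text \<open>Integration by parts contracts LF with the first index of the adjugate, as in
  \<open>V1\<close> and \<open>V2\<close>, while the matrix-vector product in the functional A
  contracts the second. Symmetry identifies them.\<close>

lemma adjugate_symmetric:
  fixes B :: "real ^ 'n ^ 'n::finite"
  assumes nz: "det B \<noteq> 0" and sym: "transpose B = B"
  shows "adjugate B $ i $ j = adjugate B $ j $ i"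
proof -
  have l: "matrix_inv B ** B = mat 1" and r: "B ** matrix_inv B = mat 1"
    using nz unfolding invertible_det_nz[symmetric] invertible_def matrix_inv_def
    by (metis (mono_tags, lifting) someI_ex)+
  have t: "B ** transpose (matrix_inv B) = mat 1"
    using arg_cong[OF l, of transpose] by (simp add: matrix_transpose_mul sym)
  have "transpose (matrix_inv B) = (matrix_inv B ** B) ** transpose (matrix_inv B)" by (simp add: l)
  also have "\<dots> = matrix_inv B" by (simp add: matrix_mul_assoc[symmetric] t)
  finally have "matrix_inv B $ i $ j = matrix_inv B $ j $ i"
    by (metis transpose_def vec_lambda_beta)
  then show ?thesis by (simp add: adjugate_eq_det_inverse[OF nz])
qed

context stein_vector
begin

lemma F_measurable [measurable]: "F i \<in> borel_measurable M"
  by (rule A_measurable[OF F_in_A])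

lemma vec_of_measurable: "vec_of F \<in> borel_measurable M"
  unfolding vec_of_def[abs_def]
  by (subst borel_measurable_euclidean_space) (auto simp: Basis_vec_def inner_axis intro: F_measurable)

lemma bracket_vec_of: "bracket (vec_of F \<omega>) = 1 + (\<Sum>i\<in>UNIV. F i \<omega> ^ 2)"
  by (simp add: bracket_def norm_power2_eq_sum vec_of_def)

text \<open>The square norm of F is a polynomial in the F_i, so every power of
  \<open>bracket\<close> of F lies in the algebra, whose elements are integrable.\<close>

sublocale random_vector M "vec_of F"
proof
  show "vec_of F \<in> borel_measurable M" by (rule vec_of_measurable)
  show "integrable M (\<lambda>\<omega>. bracket (vec_of F \<omega>) ^ N)" for N
    unfolding bracket_vec_of
    by (intro A_integrable power_closed add_closed const_closed sum_closed F_in_A) auto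
qed

definition detG :: "'a \<Rightarrow> real" where "detG \<omega> = det (Gamma_matrix L F \<omega>)"

definition adjG :: "'n \<Rightarrow> 'n \<Rightarrow> 'a \<Rightarrow> real" where "adjG i j \<omega> = adjugate (Gamma_matrix L F \<omega>) $ i $ j"

lemma Gamma_matrix_closed: "(\<lambda>\<omega>. Gamma_matrix L F \<omega> $ i $ j) \<in> A"
  by (simp add: Gamma_matrix_def Gamma_closed F_in_A)

lemma detG_closed: "detG \<in> A"
  unfolding detG_def[abs_def] by (rule det_closed[OF Gamma_matrix_closed])

lemma adjG_closed: "adjG i j \<in> A"
  unfolding adjG_def[abs_def] by (rule adjugate_closed[OF Gamma_matrix_closed])

lemma V1_component_closed: "(\<lambda>\<omega>. V1 L F \<omega> $ j) \<in> A"
  unfolding V1_def using Gamma_closed[OF F_in_A adjG_closed]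
  by (simp add: adjG_def[abs_def] sum_closed)

lemma V2_component_closed: "(\<lambda>\<omega>. V2 L F \<omega> $ j) \<in> A"
  unfolding V2_def using mult_closed[OF adjG_closed Gamma_closed[OF F_in_A detG_closed]]
  by (simp add: adjG_def[abs_def] detG_def[abs_def] sum_closed)

lemma B_integrand_measurable:
  "(\<lambda>\<omega>. 1 / ennreal (det (Gamma_matrix L F \<omega>) powr \<alpha>)) \<in> borel_measurable M"
  using A_measurable[OF detG_closed] unfolding detG_def[abs_def] by measurable

text \<open>Where the determinant vanishes the integrand of \<open>B_functional\<close> is 1/0,
  which is infinite in \<open>ennreal\<close>; a finite integral confines this to a null
  set.\<close>

lemma AE_detG: "AE \<omega> in M. detG \<omega> \<noteq> 0"
proof -
  have "AE \<omega> in M. 1 / ennreal (det (Gamma_matrix L F \<omega>) powr \<alpha>) \<noteq> \<infinity>"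
    using B_finite unfolding B_functional_def
    by (intro nn_integral_PInf_AE B_integrand_measurable) auto
  then show ?thesis by eventually_elim (auto simp: detG_def)
qed

lemma Gamma_matrix_symmetric: "transpose (Gamma_matrix L F \<omega>) = Gamma_matrix L F \<omega>"
  unfolding vec_eq_iff transpose_def Gamma_matrix_def vec_lambda_beta
  by (intro allI fun_cong[OF carre_du_champ_commute])

lemma AE_adjG:
  "AE \<omega> in M. \<forall>i j. adjG i j \<omega> = adjG j i \<omega> \<and>
    (\<Sum>k\<in>UNIV. adjG k i \<omega> * carre_du_champ L (F k) (F j) \<omega>) = detG \<omega> * of_bool (i = j)"
  using AE_detG
proof eventually_elim
  case (elim \<omega>)
  have nz: "det (Gamma_matrix L F \<omega>) \<noteq> 0" using elim by (simp add: detG_def)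
  have sym: "adjG i j \<omega> = adjG j i \<omega>" for i j
    unfolding adjG_def by (rule adjugate_symmetric[OF nz Gamma_matrix_symmetric])
  have "(adjugate (Gamma_matrix L F \<omega>) ** Gamma_matrix L F \<omega>) $ i $ j = detG \<omega> * of_bool (i = j)" for i j
    unfolding adjugate_mult[OF nz] by (simp add: mat_def detG_def)
  then have m: "(\<Sum>k\<in>UNIV. adjG i k \<omega> * carre_du_champ L (F k) (F j) \<omega>) = detG \<omega> * of_bool (i = j)" for i j
    by (simp add: matrix_matrix_mult_def Gamma_matrix_def adjG_def)
  show ?case
  proof (intro allI conjI sym)
    fix i j
    have "(\<Sum>k\<in>UNIV. adjG k i \<omega> * carre_du_champ L (F k) (F j) \<omega>) = (\<Sum>k\<in>UNIV. adjG i k \<omega> * carre_du_champ L (F k) (F j) \<omega>)"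
      by (rule sum.cong[OF refl]) (simp only: sym[of _ i])
    then show "(\<Sum>k\<in>UNIV. adjG k i \<omega> * carre_du_champ L (F k) (F j) \<omega>) = detG \<omega> * of_bool (i = j)"
      unfolding m .
  qed
qed

definition adjLF :: "'n \<Rightarrow> 'a \<Rightarrow> real" where
  "adjLF j \<omega> = (adjugate (Gamma_matrix L F \<omega>) *v vec_of (\<lambda>i. L (F i)) \<omega>) $ j"

text \<open>With r(D) = D/(D^2 + \<epsilon>^2), the two fractions are r and r' at the determinant.
  The weight is minus the sum over i of \<Gamma>(F_i, a_i) + a_i LF_i for a_i = r adj_ij, as in
  Malliavin calculus.\<close>

definition score_weight :: "real \<Rightarrow> 'n \<Rightarrow> 'a \<Rightarrow> real" where
  "score_weight \<epsilon> j \<omega> = - (detG \<omega> / ((detG \<omega>)\<^sup>2 + \<epsilon>\<^sup>2) * V1 L F \<omega> $ j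
     + (\<epsilon>\<^sup>2 - (detG \<omega>)\<^sup>2) / ((detG \<omega>)\<^sup>2 + \<epsilon>\<^sup>2)\<^sup>2 * V2 L F \<omega> $ j
     + detG \<omega> / ((detG \<omega>)\<^sup>2 + \<epsilon>\<^sup>2) * adjLF j \<omega>)"

lemma regularised_closed:
  assumes "0 < \<epsilon>" shows "(\<lambda>\<omega>. detG \<omega> / ((detG \<omega>)\<^sup>2 + \<epsilon>\<^sup>2)) \<in> A"
  by (rule smooth_closed[where u="\<lambda>_. detG", OF regularised_inverse_smooth[OF assms]]) (rule detG_closed)

lemma regularised_chain:
  assumes "0 < \<epsilon>" "f \<in> A"
  shows "AE \<omega> in M. carre_du_champ L f (\<lambda>y. detG y / ((detG y)\<^sup>2 + \<epsilon>\<^sup>2)) \<omega>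
    = (\<epsilon>\<^sup>2 - (detG \<omega>)\<^sup>2) / ((detG \<omega>)\<^sup>2 + \<epsilon>\<^sup>2)\<^sup>2 * carre_du_champ L f detG \<omega>"
proof -
  have p: "partial_deriv 0 (\<lambda>x. x 0 / ((x 0)\<^sup>2 + \<epsilon>\<^sup>2)) = (\<lambda>x :: nat \<Rightarrow> real. (\<epsilon>\<^sup>2 - (x 0)\<^sup>2) / ((x 0)\<^sup>2 + \<epsilon>\<^sup>2)\<^sup>2)"
    using partial_deriv_eq[OF has_partial_compose[OF has_partial_coord[of 0 0] regularised_inverse_deriv[OF assms(1)]]] by simp
  show ?thesis
    using carre_du_champ_chain[where u="\<lambda>_. detG", OF regularised_inverse_smooth[OF assms(1)] detG_closed assms(2)]
    by (simp add: p)
qed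

text \<open>By the chain rule \<Gamma>(F_i, g(F)) is the Gamma matrix applied to the gradient of g.
  Contraction with r adj_ij inverts the matrix up to the factor r D = D^2/(D^2 + \<epsilon>^2) and
  isolates the j-th partial derivative of g, which integration by parts replaces by the
  weight.\<close>

lemma score_integration_by_parts:
  assumes u: "0 < u" and \<epsilon>: "0 < \<epsilon>"
  shows "(LINT \<omega>|M. (detG \<omega>)\<^sup>2 / ((detG \<omega>)\<^sup>2 + \<epsilon>\<^sup>2) * (c / u * (z - c *\<^sub>R vec_of F \<omega>) $ j) * gauss u (z - c *\<^sub>R vec_of F \<omega>))
    = (LINT \<omega>|M. gauss u (z - c *\<^sub>R vec_of F \<omega>) * score_weight \<epsilon> j \<omega>)"
    and "integrable M (\<lambda>\<omega>. gauss u (z - c *\<^sub>R vec_of F \<omega>) * score_weight \<epsilon> j \<omega>)"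
proof -
  obtain e :: "nat \<Rightarrow> 'n" and e' where e: "\<And>k. k < CARD('n) \<Longrightarrow> e' (e k) = k" "\<And>i. e (e' i) = i" "\<And>i. e' i < CARD('n)"
    "bij_betw e {..<CARD('n)} UNIV" using enumeration_exists by metis
  define \<Phi> where "\<Phi> = (\<lambda>y :: nat \<Rightarrow> real. gauss u (z - c *\<^sub>R (\<chi> i. y (e' i))))"
  have sm1: "smooth_poly_growth_in {..<CARD('n)} \<Phi>"
    unfolding \<Phi>_def by (rule gauss_kernel_smooth(1)[OF u]) (use e in auto)
  have sm2: "has_partial k \<Phi> (\<lambda>y. c / u * (z $ e k - c * y k) * \<Phi> y)" if "k < CARD('n)" for k
    unfolding \<Phi>_def by (rule gauss_kernel_smooth(2)[OF u _ _ _ that]) (use e in auto)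
  define G where "G = (\<lambda>\<omega>. gauss u (z - c *\<^sub>R vec_of F \<omega>))"
  have G_eq: "(\<lambda>\<omega>. \<Phi> (\<lambda>k. F (e k) \<omega>)) = G" by (simp add: \<Phi>_def G_def vec_of_def e(2))
  have GA: "G \<in> A" using smooth_closed[where u="\<lambda>k. F (e k)", OF sm1 F_in_A] unfolding G_eq .
  define r where "r = (\<lambda>\<omega>. detG \<omega> / ((detG \<omega>)\<^sup>2 + \<epsilon>\<^sup>2))"
  define r' where "r' = (\<lambda>\<omega>. (\<epsilon>\<^sup>2 - (detG \<omega>)\<^sup>2) / ((detG \<omega>)\<^sup>2 + \<epsilon>\<^sup>2)\<^sup>2)"
  have rA: "r \<in> A" unfolding r_def by (rule regularised_closed[OF \<epsilon>])
  define a where "a i = (\<lambda>\<omega>. adjG i j \<omega> * r \<omega>)" for i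
  have aA: "a i \<in> A" for i unfolding a_def by (rule mult_closed[OF adjG_closed rA])
  have chainG: "AE \<omega> in M. carre_du_champ L (F i) G \<omega>
      = (\<Sum>k\<in>UNIV. c / u * (z - c *\<^sub>R vec_of F \<omega>) $ k * G \<omega> * carre_du_champ L (F i) (F k) \<omega>)" for i
    using carre_du_champ_chain[where u="\<lambda>k. F (e k)", OF sm1 F_in_A F_in_A[of i]] unfolding G_eq
  proof eventually_elim
    case (elim \<omega>)
    have "(\<Sum>k<CARD('n). partial_deriv k \<Phi> (\<lambda>l. F (e l) \<omega>) * carre_du_champ L (F i) (F (e k)) \<omega>)
        = (\<Sum>k<CARD('n). c / u * (z - c *\<^sub>R vec_of F \<omega>) $ e k * G \<omega> * carre_du_champ L (F i) (F (e k)) \<omega>)"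
    proof (rule sum.cong[OF refl])
      fix k assume "k \<in> {..<CARD('n)}"
      then have "partial_deriv k \<Phi> = (\<lambda>y. c / u * (z $ e k - c * y k) * \<Phi> y)"
        using partial_deriv_eq[OF sm2] by simp
      then show "partial_deriv k \<Phi> (\<lambda>l. F (e l) \<omega>) * carre_du_champ L (F i) (F (e k)) \<omega>
          = c / u * (z - c *\<^sub>R vec_of F \<omega>) $ e k * G \<omega> * carre_du_champ L (F i) (F (e k)) \<omega>"
        using fun_cong[OF G_eq, of \<omega>] by (simp add: vec_of_def)
    qed
    also have "\<dots> = (\<Sum>k\<in>UNIV. c / u * (z - c *\<^sub>R vec_of F \<omega>) $ k * G \<omega> * carre_du_champ L (F i) (F k) \<omega>)"
      by (rule sum.reindex_bij_betw[OF e(4)])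
    finally show ?case using elim by simp
  qed
  have chaina: "AE \<omega> in M. carre_du_champ L (F i) (a i) \<omega>
      = adjG i j \<omega> * (r' \<omega> * carre_du_champ L (F i) detG \<omega>) + r \<omega> * carre_du_champ L (F i) (adjG i j) \<omega>" for i
    using carre_du_champ_mult[OF F_in_A[of i] adjG_closed[of i j] rA] regularised_chain[OF \<epsilon> F_in_A[of i], folded r_def]
    unfolding a_def by eventually_elim (simp add: r'_def)
  have iGam: "integrable M (\<lambda>\<omega>. a i \<omega> * carre_du_champ L (F i) G \<omega>)" for i
    by (rule A_integrable_mult[OF aA Gamma_closed[OF F_in_A GA]])
  have irhs: "integrable M (\<lambda>\<omega>. G \<omega> * (carre_du_champ L (F i) (a i) \<omega> + a i \<omega> * L (F i) \<omega>))" for i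
  proof -
    have "integrable M (\<lambda>\<omega>. G \<omega> * carre_du_champ L (F i) (a i) \<omega> + (G \<omega> * a i \<omega>) * L (F i) \<omega>)"
      by (intro Bochner_Integration.integrable_add A_integrable_mult A_integrable_mult_L mult_closed GA aA Gamma_closed F_in_A)
    then show ?thesis by (simp add: algebra_simps)
  qed
  \<comment> \<open>The adjugate times the Gamma matrix is the determinant times the identity, so
    only the term k = j survives.\<close>
  have sumL: "AE \<omega> in M. (\<Sum>i\<in>UNIV. a i \<omega> * carre_du_champ L (F i) G \<omega>)
      = (detG \<omega>)\<^sup>2 / ((detG \<omega>)\<^sup>2 + \<epsilon>\<^sup>2) * (c / u * (z - c *\<^sub>R vec_of F \<omega>) $ j) * G \<omega>"
  proof -
    have "AE \<omega> in M. \<forall>i\<in>UNIV. carre_du_champ L (F i) G \<omega>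
      = (\<Sum>k\<in>UNIV. c / u * (z - c *\<^sub>R vec_of F \<omega>) $ k * G \<omega> * carre_du_champ L (F i) (F k) \<omega>)"
      by (rule AE_finite_allI) (use chainG in auto)
    then show ?thesis using AE_adjG
    proof eventually_elim
      case (elim \<omega>)
      define w where "w k = c / u * (z - c *\<^sub>R vec_of F \<omega>) $ k * G \<omega>" for k
      have "(\<Sum>i\<in>UNIV. a i \<omega> * carre_du_champ L (F i) G \<omega>)
          = (\<Sum>i\<in>UNIV. a i \<omega> * (\<Sum>k\<in>UNIV. w k * carre_du_champ L (F i) (F k) \<omega>))"
        using elim(1) by (simp add: w_def)
      also have "\<dots> = (\<Sum>i\<in>UNIV. \<Sum>k\<in>UNIV. r \<omega> * w k * (adjG i j \<omega> * carre_du_champ L (F i) (F k) \<omega>))"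
        unfolding sum_distrib_left a_def by (intro sum.cong refl) (simp add: mult_ac)
      also have "\<dots> = (\<Sum>k\<in>UNIV. r \<omega> * w k * (\<Sum>i\<in>UNIV. adjG i j \<omega> * carre_du_champ L (F i) (F k) \<omega>))"
        unfolding sum_distrib_left by (rule sum.swap)
      also have "\<dots> = (\<Sum>k\<in>UNIV. if k = j then r \<omega> * w k * detG \<omega> else 0)"
        using elim(2) by (intro sum.cong refl) auto
      also have "\<dots> = r \<omega> * w j * detG \<omega>" by simp
      finally show ?case by (simp add: r_def w_def power2_eq_square mult_ac)
    qed
  qed
  \<comment> \<open>The Leibniz rule splits \<Gamma>(F_i, a_i) into a derivative of the adjugate,
    summing to \<open>V1\<close>, and a derivative of r(det), summing to \<open>V2\<close>.\<close>
  have sumR: "AE \<omega> in M. (\<Sum>i\<in>UNIV. G \<omega> * (carre_du_champ L (F i) (a i) \<omega> + a i \<omega> * L (F i) \<omega>))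
      = - (G \<omega> * score_weight \<epsilon> j \<omega>)"
  proof -
    have "AE \<omega> in M. \<forall>i\<in>UNIV. carre_du_champ L (F i) (a i) \<omega>
      = adjG i j \<omega> * (r' \<omega> * carre_du_champ L (F i) detG \<omega>) + r \<omega> * carre_du_champ L (F i) (adjG i j) \<omega>"
      by (rule AE_finite_allI) (use chaina in auto)
    then show ?thesis using AE_adjG
    proof eventually_elim
      case (elim \<omega>)
      have v1: "V1 L F \<omega> $ j = (\<Sum>i\<in>UNIV. carre_du_champ L (F i) (adjG i j) \<omega>)"
        by (simp add: V1_def adjG_def[abs_def])
      have v2: "V2 L F \<omega> $ j = (\<Sum>i\<in>UNIV. adjG i j \<omega> * carre_du_champ L (F i) detG \<omega>)"
        by (simp add: V2_def adjG_def detG_def[abs_def])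
      have v3: "adjLF j \<omega> = (\<Sum>i\<in>UNIV. adjG i j \<omega> * L (F i) \<omega>)"
      proof -
        have "adjLF j \<omega> = (\<Sum>i\<in>UNIV. adjG j i \<omega> * L (F i) \<omega>)"
          by (simp add: adjLF_def matrix_vector_mult_def adjG_def vec_of_def)
        also have "\<dots> = (\<Sum>i\<in>UNIV. adjG i j \<omega> * L (F i) \<omega>)"
        proof (rule sum.cong[OF refl])
          fix i
          have "adjG j i \<omega> = adjG i j \<omega>" using elim(2) by blast
          then show "adjG j i \<omega> * L (F i) \<omega> = adjG i j \<omega> * L (F i) \<omega>" by (simp only:)
        qed
        finally show ?thesis .
      qed
      have "(\<Sum>i\<in>UNIV. G \<omega> * (carre_du_champ L (F i) (a i) \<omega> + a i \<omega> * L (F i) \<omega>))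
          = (\<Sum>i\<in>UNIV. G \<omega> * (r' \<omega> * (adjG i j \<omega> * carre_du_champ L (F i) detG \<omega>)
              + r \<omega> * carre_du_champ L (F i) (adjG i j) \<omega> + r \<omega> * (adjG i j \<omega> * L (F i) \<omega>)))"
        using elim(1) by (intro sum.cong refl) (simp add: a_def algebra_simps)
      also have "\<dots> = G \<omega> * (r' \<omega> * V2 L F \<omega> $ j + r \<omega> * V1 L F \<omega> $ j + r \<omega> * adjLF j \<omega>)"
        unfolding v1 v2 v3 sum_distrib_left sum.distrib[symmetric] ..
      finally show ?case by (simp add: score_weight_def r_def r'_def algebra_simps)
    qed
  qed
  have LHSm: "(\<lambda>\<omega>. (detG \<omega>)\<^sup>2 / ((detG \<omega>)\<^sup>2 + \<epsilon>\<^sup>2) * (c / u * (z - c *\<^sub>R vec_of F \<omega>) $ j) * G \<omega>) \<in> borel_measurable M"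
    using A_measurable[OF detG_closed] A_measurable[OF GA] by measurable
  have swm: "(\<lambda>\<omega>. G \<omega> * score_weight \<epsilon> j \<omega>) \<in> borel_measurable M"
  proof -
    have "adjLF j = (\<lambda>\<omega>. \<Sum>i\<in>UNIV. adjG j i \<omega> * L (F i) \<omega>)"
      by (simp add: adjLF_def matrix_vector_mult_def adjG_def vec_of_def fun_eq_iff)
    moreover have "(\<lambda>\<omega>. \<Sum>i\<in>UNIV. adjG j i \<omega> * L (F i) \<omega>) \<in> borel_measurable M"
      by (intro borel_measurable_sum borel_measurable_times A_measurable[OF adjG_closed] L_measurable F_in_A)
    ultimately have [measurable]: "adjLF j \<in> borel_measurable M" by simp
    show ?thesis
      unfolding score_weight_def
      using A_measurable[OF detG_closed] A_measurable[OF GA] A_measurable[OF V1_component_closed[of j]] A_measurable[OF V2_component_closed[of j]]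
      by measurable
  qed
  have isum: "integrable M (\<lambda>\<omega>. \<Sum>i\<in>UNIV. G \<omega> * (carre_du_champ L (F i) (a i) \<omega> + a i \<omega> * L (F i) \<omega>))"
    by (intro Bochner_Integration.integrable_sum irhs)
  have "integrable M (\<lambda>\<omega>. - (G \<omega> * score_weight \<epsilon> j \<omega>))"
    by (rule Bochner_Integration.integrable_cong_AE_imp[OF isum]) (use swm sumR in auto)
  then show isw: "integrable M (\<lambda>\<omega>. gauss u (z - c *\<^sub>R vec_of F \<omega>) * score_weight \<epsilon> j \<omega>)"
    by (simp add: G_def)
  have "(LINT \<omega>|M. (detG \<omega>)\<^sup>2 / ((detG \<omega>)\<^sup>2 + \<epsilon>\<^sup>2) * (c / u * (z - c *\<^sub>R vec_of F \<omega>) $ j) * G \<omega>)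
      = (LINT \<omega>|M. (\<Sum>i\<in>UNIV. a i \<omega> * carre_du_champ L (F i) G \<omega>))"
    by (intro integral_cong_AE LHSm borel_measurable_integrable Bochner_Integration.integrable_sum iGam)
      (use sumL in auto)
  also have "\<dots> = (\<Sum>i\<in>UNIV. LINT \<omega>|M. a i \<omega> * carre_du_champ L (F i) G \<omega>)"
    by (rule Bochner_Integration.integral_sum[OF iGam])
  also have "\<dots> = (\<Sum>i\<in>UNIV. - (LINT \<omega>|M. G \<omega> * (carre_du_champ L (F i) (a i) \<omega> + a i \<omega> * L (F i) \<omega>)))"
    by (intro sum.cong refl weighted_integration_by_parts F_in_A GA aA)
  also have "\<dots> = - (LINT \<omega>|M. (\<Sum>i\<in>UNIV. G \<omega> * (carre_du_champ L (F i) (a i) \<omega> + a i \<omega> * L (F i) \<omega>)))"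
    by (simp add: sum_negf Bochner_Integration.integral_sum[OF irhs])
  also have "(LINT \<omega>|M. (\<Sum>i\<in>UNIV. G \<omega> * (carre_du_champ L (F i) (a i) \<omega> + a i \<omega> * L (F i) \<omega>)))
      = (LINT \<omega>|M. - (G \<omega> * score_weight \<epsilon> j \<omega>))"
    by (intro integral_cong_AE borel_measurable_integrable[OF isum]) (use swm sumR in auto)
  finally show "(LINT \<omega>|M. (detG \<omega>)\<^sup>2 / ((detG \<omega>)\<^sup>2 + \<epsilon>\<^sup>2) * (c / u * (z - c *\<^sub>R vec_of F \<omega>) $ j) * gauss u (z - c *\<^sub>R vec_of F \<omega>))
    = (LINT \<omega>|M. gauss u (z - c *\<^sub>R vec_of F \<omega>) * score_weight \<epsilon> j \<omega>)"
    by (simp add: G_def)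
qed

end

section \<open>Finiteness of the functional A and the Fisher bound under non-degeneracy\<close>

lemma L2_add:
  assumes "f \<in> L2 M" "g \<in> L2 M" shows "(\<lambda>x. f x + g x) \<in> L2 M"
proof -
  have [measurable]: "f \<in> borel_measurable M" "g \<in> borel_measurable M"
    and i: "integrable M (\<lambda>x. (f x)\<^sup>2)" "integrable M (\<lambda>x. (g x)\<^sup>2)" using assms by (auto simp: L2_def)
  have "integrable M (\<lambda>x. (f x + g x)\<^sup>2)"
  proof (rule Bochner_Integration.integrable_bound)
    show "integrable M (\<lambda>x. 2 * (f x)\<^sup>2 + 2 * (g x)\<^sup>2)"
      by (intro Bochner_Integration.integrable_add integrable_mult_right i)
    show "AE x in M. norm ((f x + g x)\<^sup>2) \<le> norm (2 * (f x)\<^sup>2 + 2 * (g x)\<^sup>2)"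
    proof (intro always_eventually allI)
      fix x
      have "(f x + g x)\<^sup>2 = 2 * (f x)\<^sup>2 + 2 * (g x)\<^sup>2 - (f x - g x)\<^sup>2"
        by (simp add: power2_sum power2_diff)
      then have "(f x + g x)\<^sup>2 \<le> 2 * (f x)\<^sup>2 + 2 * (g x)\<^sup>2" using zero_le_power2[of "f x - g x"] by linarith
      then show "norm ((f x + g x)\<^sup>2) \<le> norm (2 * (f x)\<^sup>2 + 2 * (g x)\<^sup>2)" by simp
    qed
  qed measurable
  then show ?thesis by (simp add: L2_def)
qed

lemma L2_0: "(\<lambda>_. 0) \<in> L2 M"
  by (simp add: L2_def)

lemma L2_sum: "finite S \<Longrightarrow> (\<And>i. i \<in> S \<Longrightarrow> f i \<in> L2 M) \<Longrightarrow> (\<lambda>x. \<Sum>i\<in>S. f i x) \<in> L2 M"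
  by (induction S rule: finite_induct) (simp_all add: L2_0 L2_add)

lemma L2_norm:
  fixes v :: "'a \<Rightarrow> real ^ 'n::finite"
  assumes "\<And>i. (\<lambda>x. v x $ i) \<in> L2 M" shows "(\<lambda>x. norm (v x)) \<in> L2 M"
proof -
  have [measurable]: "(\<lambda>x. v x $ i) \<in> borel_measurable M"
    and i: "integrable M (\<lambda>x. (v x $ i)\<^sup>2)" for i using assms[of i] by (auto simp: L2_def)
  have "(\<lambda>x. norm (v x)) = (\<lambda>x. sqrt (\<Sum>i\<in>UNIV. (v x $ i)\<^sup>2))"
    by (simp add: norm_vec_def L2_set_def)
  then have "(\<lambda>x. norm (v x)) \<in> borel_measurable M" by simp
  moreover have "integrable M (\<lambda>x. (norm (v x))\<^sup>2)"
    unfolding norm_power2_eq_sum by (intro Bochner_Integration.integrable_sum i)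
  ultimately show ?thesis by (simp add: L2_def)
qed

text \<open>\<open>powr\<close> is even in a real base, so the comparison with
  \<open>B_functional\<close> can be made without determining the sign of the determinant.\<close>

lemma powr_abs_base: "x powr a = \<bar>x\<bar> powr (a :: real)"
  by (cases "x < 0") (simp_all add: powr_def ln_minus)

text \<open>The fraction is at most 1 and at most q^2 with q = \<epsilon>/|D|. Its square is thus at
  most the minimum of 1 and q^4, hence at most q^s for s in [0, 4]. Finally |D|^-s \<le> 1 +
  |D|^-\<alpha> because s \<le> \<alpha>.\<close>

lemma regularised_defect_le:
  fixes D :: real
  assumes \<epsilon>: "0 < \<epsilon>" and D: "D \<noteq> 0" and s: "0 \<le> s" "s \<le> 4" "s \<le> \<alpha>"
  shows "(\<epsilon>\<^sup>2 / (D\<^sup>2 + \<epsilon>\<^sup>2))\<^sup>2 \<le> \<epsilon> powr s * (1 + 1 / D powr \<alpha>)"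
proof -
  define q where "q = \<epsilon> / \<bar>D\<bar>"
  have q: "0 < q" using \<epsilon> D by (simp add: q_def)
  define t where "t = \<epsilon>\<^sup>2 / (D\<^sup>2 + \<epsilon>\<^sup>2)"
  have pos: "0 < D\<^sup>2 + \<epsilon>\<^sup>2" using \<epsilon> by (intro add_nonneg_pos) auto
  have t: "0 \<le> t" "t \<le> 1" using pos by (auto simp: t_def)
  have tq: "t \<le> q\<^sup>2"
    unfolding t_def q_def power_divide power2_abs using D pos by (intro divide_left_mono) auto
  have 1: "t\<^sup>2 \<le> q powr s"
  proof (cases "q \<le> 1")
    case True
    have "t\<^sup>2 \<le> (q\<^sup>2)\<^sup>2" using t tq by (intro power_mono) auto
    also have "\<dots> = q powr 4" using q by (simp add: powr_numeral power_mult[symmetric])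
    also have "\<dots> \<le> q powr s" using q True s by (intro powr_mono') auto
    finally show ?thesis .
  next
    case False
    have "t\<^sup>2 \<le> 1" using t by (simp add: power_le_one)
    also have "1 \<le> q powr s" using False s by (intro ge_one_powr_ge_zero) auto
    finally show ?thesis .
  qed
  have 2: "q powr s = \<epsilon> powr s * (1 / \<bar>D\<bar> powr s)"
    using \<epsilon> by (simp add: q_def powr_divide)
  have 3: "1 / \<bar>D\<bar> powr s \<le> 1 + 1 / \<bar>D\<bar> powr \<alpha>"
  proof (cases "1 \<le> \<bar>D\<bar>")
    case True
    then have "1 \<le> \<bar>D\<bar> powr s" using s by (intro ge_one_powr_ge_zero)
    then have "1 / \<bar>D\<bar> powr s \<le> 1" using D by (simp only: divide_le_eq_1) simp
    then show ?thesis using powr_ge_zero[of "\<bar>D\<bar>" \<alpha>] by (smt (verit) divide_nonneg_nonneg)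
  next
    case False
    then have "\<bar>D\<bar> powr \<alpha> \<le> \<bar>D\<bar> powr s" using s D by (intro powr_mono') auto
    then have "1 / \<bar>D\<bar> powr s \<le> 1 / \<bar>D\<bar> powr \<alpha>" using D by (intro divide_left_mono) auto
    then show ?thesis by simp
  qed
  have "t\<^sup>2 \<le> \<epsilon> powr s * (1 + 1 / \<bar>D\<bar> powr \<alpha>)"
    using 1 mult_left_mono[OF 3, of "\<epsilon> powr s"] unfolding 2 by simp
  then show ?thesis by (simp add: t_def powr_abs_base[of D])
qed

text \<open>The coefficients of the score weight. The common bound 1/\<epsilon>^2, which for
  \<epsilon> \<le> 1 also covers the coefficient 1 of F, lets the whole sum be compared with the
  integrand of the functional A.\<close>

lemma regularised_inverse_bounds:
  fixes D :: real
  assumes \<epsilon>: "0 < \<epsilon>" "\<epsilon> \<le> 1"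
  shows "\<bar>D / (D\<^sup>2 + \<epsilon>\<^sup>2)\<bar> \<le> 1 / \<epsilon>\<^sup>2" "\<bar>(\<epsilon>\<^sup>2 - D\<^sup>2) / (D\<^sup>2 + \<epsilon>\<^sup>2)\<^sup>2\<bar> \<le> 1 / \<epsilon>\<^sup>2" "1 \<le> 1 / \<epsilon>\<^sup>2"
proof -
  have pos: "0 < D\<^sup>2 + \<epsilon>\<^sup>2" using \<epsilon> by (intro add_nonneg_pos) auto
  have "\<epsilon>\<^sup>2 \<le> \<epsilon>" using \<epsilon> by (simp add: power2_eq_square mult_left_le)
  then have "\<bar>D\<bar> * \<epsilon>\<^sup>2 \<le> \<bar>D\<bar> * \<epsilon>" by (intro mult_left_mono) auto
  also have "\<dots> \<le> D\<^sup>2 + \<epsilon>\<^sup>2"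
  proof -
    have "2 * (\<bar>D\<bar> * \<epsilon>) \<le> D\<^sup>2 + \<epsilon>\<^sup>2" using sum_squares_bound[of "\<bar>D\<bar>" \<epsilon>] by simp
    moreover have "0 \<le> \<bar>D\<bar> * \<epsilon>" using \<epsilon> by simp
    ultimately show ?thesis by linarith
  qed
  finally have "\<bar>D\<bar> * \<epsilon>\<^sup>2 \<le> D\<^sup>2 + \<epsilon>\<^sup>2" .
  then show "\<bar>D / (D\<^sup>2 + \<epsilon>\<^sup>2)\<bar> \<le> 1 / \<epsilon>\<^sup>2"
    using pos \<epsilon> by (simp add: abs_divide field_simps)
  have "\<bar>\<epsilon>\<^sup>2 - D\<^sup>2\<bar> \<le> D\<^sup>2 + \<epsilon>\<^sup>2" by (simp add: abs_le_iff)
  then have "\<bar>\<epsilon>\<^sup>2 - D\<^sup>2\<bar> / (D\<^sup>2 + \<epsilon>\<^sup>2)\<^sup>2 \<le> (D\<^sup>2 + \<epsilon>\<^sup>2) / (D\<^sup>2 + \<epsilon>\<^sup>2)\<^sup>2" by (intro divide_right_mono) auto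
  also have "\<dots> = 1 / (D\<^sup>2 + \<epsilon>\<^sup>2)" using pos by (simp add: power2_eq_square)
  also have "\<dots> \<le> 1 / \<epsilon>\<^sup>2" using pos \<epsilon> by (intro divide_left_mono) auto
  finally show "\<bar>(\<epsilon>\<^sup>2 - D\<^sup>2) / (D\<^sup>2 + \<epsilon>\<^sup>2)\<^sup>2\<bar> \<le> 1 / \<epsilon>\<^sup>2" by (simp add: abs_divide)
  show "1 \<le> 1 / \<epsilon>\<^sup>2" using \<epsilon> by (simp add: power_le_one)
qed

context stein_vector
begin

lemma A_in_L2: "f \<in> A \<Longrightarrow> f \<in> L2 M"
  using A_measurable A_square_integrable by (simp add: L2_def)

lemma adjLF_eq: "adjLF j = (\<lambda>\<omega>. \<Sum>i\<in>UNIV. adjG j i \<omega> * L (F i) \<omega>)"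
  by (simp add: adjLF_def matrix_vector_mult_def adjG_def vec_of_def fun_eq_iff)

text \<open>The generator maps the algebra into L^2, and the algebra is not assumed stable under it.
  The product is square integrable because the adjugate entries and LF are both in L^4, the latter
  by \<open>LF_Lp\<close> with p = 4.\<close>

lemma adjLF_L2: "adjLF j \<in> L2 M"
  unfolding adjLF_eq
proof (rule L2_sum[OF finite])
  fix i
  have [measurable]: "adjG j i \<in> borel_measurable M" "L (F i) \<in> borel_measurable M"
    by (intro A_measurable adjG_closed L_measurable F_in_A)+
  have i1: "integrable M (\<lambda>\<omega>. ((adjG j i \<omega>)\<^sup>2)\<^sup>2)"
    by (intro A_square_integrable power_closed adjG_closed)
  have "integrable M (\<lambda>\<omega>. \<bar>L (F i) \<omega>\<bar> powr 4)"
    by (rule LF_Lp[unfolded in_all_Lp_def, THEN conjunct2, rule_format]) simp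
  then have i2: "integrable M (\<lambda>\<omega>. ((L (F i) \<omega>)\<^sup>2)\<^sup>2)"
    by (simp add: powr_numeral power_mult[symmetric])
  have "integrable M (\<lambda>\<omega>. (adjG j i \<omega>)\<^sup>2 * (L (F i) \<omega>)\<^sup>2)"
    by (rule integrable_mult_L2[OF _ _ i1 i2]) measurable
  then show "(\<lambda>\<omega>. adjG j i \<omega> * L (F i) \<omega>) \<in> L2 M" by (simp add: L2_def power_mult_distrib)
qed

definition A_integrand :: "'a \<Rightarrow> real" where
  "A_integrand \<omega> = norm (adjugate (Gamma_matrix L F \<omega>) *v vec_of (\<lambda>i. L (F i)) \<omega>) +
       norm (V1 L F \<omega>) + norm (V2 L F \<omega>) + norm (vec_of F \<omega>)"

lemma A_integrand_L2: "A_integrand \<in> L2 M"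
  unfolding A_integrand_def[abs_def]
proof (intro L2_add L2_norm)
  fix i
  show "(\<lambda>\<omega>. (adjugate (Gamma_matrix L F \<omega>) *v vec_of (\<lambda>i. L (F i)) \<omega>) $ i) \<in> L2 M"
    using adjLF_L2[of i] unfolding adjLF_def[abs_def] .
  show "(\<lambda>\<omega>. V1 L F \<omega> $ i) \<in> L2 M" by (intro A_in_L2 V1_component_closed)
  show "(\<lambda>\<omega>. V2 L F \<omega> $ i) \<in> L2 M" by (intro A_in_L2 V2_component_closed)
  show "(\<lambda>\<omega>. vec_of F \<omega> $ i) \<in> L2 M" by (simp add: vec_of_def A_in_L2 F_in_A)
qed

lemma A_functional_eq: "A_functional M L F = ennreal (LINT \<omega>|M. (A_integrand \<omega>)\<^sup>2)"
  unfolding A_functional_def A_integrand_def[symmetric]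
  using A_integrand_L2 by (intro nn_integral_eq_integral) (auto simp: L2_def)

lemma A_functional_finite: "A_functional M L F < \<infinity>"
  by (simp add: A_functional_eq)

lemma defect_integral_le:
  assumes \<epsilon>: "0 < \<epsilon>" and s: "0 \<le> s" "s \<le> 4" "s \<le> \<alpha>"
  shows "(LINT \<omega>|M. (\<epsilon>\<^sup>2 / ((detG \<omega>)\<^sup>2 + \<epsilon>\<^sup>2))\<^sup>2) \<le> \<epsilon> powr s * (enn2real (B_functional M L F \<alpha>) + 1)"
proof -
  have [measurable]: "detG \<in> borel_measurable M" by (rule A_measurable[OF detG_closed])
  have "AE \<omega> in M. ennreal ((\<epsilon>\<^sup>2 / ((detG \<omega>)\<^sup>2 + \<epsilon>\<^sup>2))\<^sup>2)
      \<le> ennreal (\<epsilon> powr s) * (1 + 1 / ennreal (det (Gamma_matrix L F \<omega>) powr \<alpha>))"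
    using AE_detG
  proof eventually_elim
    case (elim \<omega>)
    have p: "0 < detG \<omega> powr \<alpha>" using elim by simp
    have "ennreal ((\<epsilon>\<^sup>2 / ((detG \<omega>)\<^sup>2 + \<epsilon>\<^sup>2))\<^sup>2) \<le> ennreal (\<epsilon> powr s * (1 + 1 / detG \<omega> powr \<alpha>))"
      by (intro ennreal_leI regularised_defect_le \<epsilon> elim s)
    also have "\<dots> = ennreal (\<epsilon> powr s) * (1 + 1 / ennreal (detG \<omega> powr \<alpha>))"
      using p by (simp add: ennreal_mult ennreal_plus divide_ennreal[symmetric])
    finally show ?case by (simp add: detG_def)
  qed
  then have "(\<integral>\<^sup>+\<omega>. ennreal ((\<epsilon>\<^sup>2 / ((detG \<omega>)\<^sup>2 + \<epsilon>\<^sup>2))\<^sup>2) \<partial>M)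
      \<le> (\<integral>\<^sup>+\<omega>. ennreal (\<epsilon> powr s) * (1 + 1 / ennreal (det (Gamma_matrix L F \<omega>) powr \<alpha>)) \<partial>M)"
    by (rule nn_integral_mono_AE)
  also have "\<dots> = ennreal (\<epsilon> powr s) * (1 + B_functional M L F \<alpha>)"
    unfolding B_functional_def
    by (subst nn_integral_cmult, use B_integrand_measurable in simp, subst nn_integral_add)
      (use B_integrand_measurable in \<open>auto simp: emeasure_space_1\<close>)
  also have "\<dots> = ennreal (\<epsilon> powr s * (enn2real (B_functional M L F \<alpha>) + 1))"
  proof -
    have "1 + B_functional M L F \<alpha> = ennreal (enn2real (B_functional M L F \<alpha>) + 1)"
      using B_finite by (simp add: ennreal_plus add.commute)
    then show ?thesis by (simp only: ennreal_mult'' powr_ge_zero enn2real_nonneg add_nonneg_nonneg zero_le_one)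
  qed
  finally have "(\<integral>\<^sup>+\<omega>. ennreal ((\<epsilon>\<^sup>2 / ((detG \<omega>)\<^sup>2 + \<epsilon>\<^sup>2))\<^sup>2) \<partial>M) \<le> ennreal (\<epsilon> powr s * (enn2real (B_functional M L F \<alpha>) + 1))" .
  from enn2real_mono[OF this] show ?thesis
    by (subst integral_eq_nn_integral) (auto simp: enn2real_nonneg)
qed

text \<open>The flux has coefficient -c/u on z - c F. Split 1 = \<theta> + \<eta> with \<theta> =
  D^2/(D^2 + \<epsilon>^2): integration by parts turns the \<theta>-part into a weight of size
  \<epsilon>^-2, which gives \<epsilon>^-4 after squaring, and the \<eta>-part keeps the singular
  coefficient but is small where the determinant is not.\<close>

lemma fisher_le_regularised:
  assumes c: "0 < c" "c < 1" and \<epsilon>: "0 < \<epsilon>" "\<epsilon> \<le> 1" and s: "0 \<le> s" "s \<le> 4" "s \<le> \<alpha>"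
  shows "fisher c \<le> enn2real (A_functional M L F) / \<epsilon> ^ 4
    + real CARD('n) / (1 - c\<^sup>2) * (\<epsilon> powr s * (enn2real (B_functional M L F \<alpha>) + 1))"
proof -
  have c': "\<bar>c\<bar> < 1" "\<bar>c\<bar> \<le> 1" using c by auto
  define u where "u = 1 - c\<^sup>2"
  note u = variance_bounds[OF c'(1), folded u_def]
  define \<theta> where "\<theta> \<omega> = (detG \<omega>)\<^sup>2 / ((detG \<omega>)\<^sup>2 + \<epsilon>\<^sup>2)" for \<omega>
  define \<eta> where "\<eta> \<omega> = \<epsilon>\<^sup>2 / ((detG \<omega>)\<^sup>2 + \<epsilon>\<^sup>2)" for \<omega>
  have pos: "0 < D\<^sup>2 + \<epsilon>\<^sup>2" for D using \<epsilon> by (intro add_nonneg_pos) auto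
  have \<theta>\<eta>: "1 - \<theta> \<omega> = \<eta> \<omega>" for \<omega>
  proof -
    have "(detG \<omega>)\<^sup>2 + \<epsilon>\<^sup>2 \<noteq> 0" using pos[of "detG \<omega>"] by linarith
    then show ?thesis by (simp add: \<theta>_def \<eta>_def diff_divide_eq_iff eq_divide_eq)
  qed
  have [measurable]: "detG \<in> borel_measurable M" by (rule A_measurable[OF detG_closed])
  have \<theta>m [measurable]: "\<theta> \<in> borel_measurable M" and \<eta>m [measurable]: "\<eta> \<in> borel_measurable M"
    unfolding \<theta>_def[abs_def] \<eta>_def[abs_def] by measurable
  have \<eta>01: "0 \<le> \<eta> \<omega>" "\<eta> \<omega> \<le> 1" and \<theta>01: "0 \<le> \<theta> \<omega>" "\<theta> \<omega> \<le> 1" for \<omega>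
    using pos[of "detG \<omega>"] by (auto simp: \<eta>_def \<theta>_def)
  \<comment> \<open>The representation passed to \<open>integral_square_over_dens_le\<close>:
    \<open>a\<close> gathers F and the weight, \<open>b\<close> is the part of -(c/u) Id that
    integration by parts leaves behind.\<close>
  define a where "a i \<omega> = F i \<omega> - score_weight \<epsilon> i \<omega>" for i \<omega>
  define b where "b i j \<omega> = - c / u * of_bool (i = j) * \<eta> \<omega>" for i j :: 'n and \<omega>
  have V1m [measurable]: "(\<lambda>\<omega>. V1 L F \<omega> $ j) \<in> borel_measurable M" and V2m [measurable]: "(\<lambda>\<omega>. V2 L F \<omega> $ j) \<in> borel_measurable M"
    for j by (intro A_measurable V1_component_closed V2_component_closed)+
  have [measurable]: "adjLF j \<in> borel_measurable M" for j using adjLF_L2[of j] by (simp add: L2_def)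
  have am [measurable]: "a i \<in> borel_measurable M" for i
    unfolding a_def[abs_def] score_weight_def by measurable
  have bm [measurable]: "b i j \<in> borel_measurable M" for i j unfolding b_def[abs_def] by measurable
  have a_le: "(\<Sum>i\<in>UNIV. (a i \<omega>)\<^sup>2) \<le> (A_integrand \<omega>)\<^sup>2 / \<epsilon> ^ 4" for \<omega>
  proof -
    define p where "p = detG \<omega> / ((detG \<omega>)\<^sup>2 + \<epsilon>\<^sup>2)"
    define p' where "p' = (\<epsilon>\<^sup>2 - (detG \<omega>)\<^sup>2) / ((detG \<omega>)\<^sup>2 + \<epsilon>\<^sup>2)\<^sup>2"
    note pb = regularised_inverse_bounds(1,2)[OF \<epsilon>, where D="detG \<omega>", folded p_def p'_def]
      regularised_inverse_bounds(3)[OF \<epsilon>]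
    define W where "W = adjugate (Gamma_matrix L F \<omega>) *v vec_of (\<lambda>i. L (F i)) \<omega>"
    have a_eq: "a i \<omega> = vec_of F \<omega> $ i + p * V1 L F \<omega> $ i + p' * V2 L F \<omega> $ i + p * W $ i" for i
      unfolding a_def score_weight_def p_def[symmetric] p'_def[symmetric] W_def adjLF_def by (simp add: vec_of_def)
    have s_eq: "(\<Sum>i\<in>UNIV. (a i \<omega>)\<^sup>2) = (norm (vec_of F \<omega> + p *\<^sub>R V1 L F \<omega> + p' *\<^sub>R V2 L F \<omega> + p *\<^sub>R W))\<^sup>2"
      unfolding norm_power2_eq_sum a_eq by simp
    have "norm (vec_of F \<omega> + p *\<^sub>R V1 L F \<omega> + p' *\<^sub>R V2 L F \<omega> + p *\<^sub>R W)
        \<le> norm (vec_of F \<omega>) + norm (p *\<^sub>R V1 L F \<omega>) + norm (p' *\<^sub>R V2 L F \<omega>) + norm (p *\<^sub>R W)"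
      by (intro order_trans[OF norm_triangle_ineq] add_right_mono order_refl)
    also have "\<dots> \<le> 1 / \<epsilon>\<^sup>2 * norm (vec_of F \<omega>) + 1 / \<epsilon>\<^sup>2 * norm (V1 L F \<omega>) + 1 / \<epsilon>\<^sup>2 * norm (V2 L F \<omega>) + 1 / \<epsilon>\<^sup>2 * norm W"
      unfolding norm_scaleR using mult_right_mono[OF pb(3), of "norm (vec_of F \<omega>)"]
      by (intro add_mono mult_right_mono pb) auto
    also have "\<dots> = 1 / \<epsilon>\<^sup>2 * A_integrand \<omega>"
      by (simp add: A_integrand_def W_def add_divide_distrib)
    finally have "(\<Sum>i\<in>UNIV. (a i \<omega>)\<^sup>2) \<le> (1 / \<epsilon>\<^sup>2 * A_integrand \<omega>)\<^sup>2"
      unfolding s_eq by (rule power_mono) simp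
    also have "\<dots> = (A_integrand \<omega>)\<^sup>2 / \<epsilon> ^ 4" by (simp add: power_mult_distrib power_divide power_mult[symmetric])
    finally show ?thesis .
  qed
  have iA: "integrable M (\<lambda>\<omega>. (A_integrand \<omega>)\<^sup>2 / \<epsilon> ^ 4)"
    using A_integrand_L2 by (simp add: L2_def)
  have ia: "integrable M (\<lambda>\<omega>. \<Sum>i\<in>UNIV. (a i \<omega>)\<^sup>2)"
    by (rule Bochner_Integration.integrable_bound[OF iA]) (use a_le in \<open>auto simp: sum_nonneg\<close>)
  have sb: "(\<Sum>i\<in>UNIV. u * (\<Sum>j\<in>UNIV. (b i j \<omega>)\<^sup>2)) = real CARD('n) * c\<^sup>2 / u * (\<eta> \<omega>)\<^sup>2" for \<omega>
  proof -
    have "(\<Sum>j\<in>UNIV. (b i j \<omega>)\<^sup>2) = c\<^sup>2 / u\<^sup>2 * (\<eta> \<omega>)\<^sup>2" for i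
    proof -
      have "(\<Sum>j\<in>UNIV. (b i j \<omega>)\<^sup>2) = (\<Sum>j\<in>UNIV. if j = i then c\<^sup>2 / u\<^sup>2 * (\<eta> \<omega>)\<^sup>2 else 0)"
        by (intro sum.cong refl) (auto simp: b_def power_mult_distrib power_divide)
      then show ?thesis by simp
    qed
    then show ?thesis using u by (simp add: power2_eq_square)
  qed
  have i\<eta>: "integrable M (\<lambda>\<omega>. (\<eta> \<omega>)\<^sup>2)"
    by (rule Bochner_Integration.integrable_bound[OF integrable_const[of "1 :: real"]]) (use \<eta>01 in \<open>auto simp: power_le_one\<close>)
  have int: "integrable M (\<lambda>\<omega>. \<Sum>i\<in>UNIV. (a i \<omega>)\<^sup>2 + u * (\<Sum>j\<in>UNIV. (b i j \<omega>)\<^sup>2))"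
    unfolding sum.distrib sb by (intro Bochner_Integration.integrable_add ia integrable_mult_right i\<eta>)
  have flux: "flux c i z = (LINT \<omega>|M. gauss u (z - c *\<^sub>R vec_of F \<omega>) * (a i \<omega> + (\<Sum>j\<in>UNIV. b i j \<omega> * (z - c *\<^sub>R vec_of F \<omega>) $ j)))" for i z
  proof -
    define g where "g \<omega> = gauss u (z - c *\<^sub>R vec_of F \<omega>)" for \<omega>
    define w where "w \<omega> = (z - c *\<^sub>R vec_of F \<omega>) $ i" for \<omega>
    have i1: "integrable M (\<lambda>\<omega>. g \<omega> * F i \<omega>)"
      using field_integrable[OF c'(2) rapid_gauss[OF u] tempered_component[of i], of z] by (simp add: g_def vec_of_def mult.commute)
    have i2: "integrable M (\<lambda>\<omega>. w \<omega> * g \<omega>)"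
      using field_integrable[OF c'(2) rapid_times_component[OF rapid_gauss[OF u]] tempered_const[of 1], of z i] by (simp add: g_def w_def)
    have [measurable]: "g \<in> borel_measurable M" "w \<in> borel_measurable M"
      unfolding g_def[abs_def] w_def[abs_def] by measurable
    have i3: "integrable M (\<lambda>\<omega>. \<theta> \<omega> * (w \<omega> * g \<omega>))"
      by (rule Bochner_Integration.integrable_bound[OF i2])
        (use \<theta>01 in \<open>auto simp: abs_mult intro!: mult_left_le_one_le\<close>)
    have i4: "integrable M (\<lambda>\<omega>. \<theta> \<omega> * (c / u * w \<omega>) * g \<omega>)"
      using integrable_mult_right[OF i3, of "c / u"] by (simp add: mult_ac)
    note ibp = score_integration_by_parts[OF u(1) \<epsilon>(1), where c=c and z=z and j=i, folded g_def w_def \<theta>_def]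
    have s1: "(\<Sum>j\<in>UNIV. - c / u * of_bool (i = j) * k * (z - c *\<^sub>R vec_of F \<omega>) $ j) = - c / u * k * w \<omega>" for k \<omega>
    proof -
      have "(\<Sum>j\<in>UNIV. - c / u * of_bool (i = j) * k * (z - c *\<^sub>R vec_of F \<omega>) $ j)
          = (\<Sum>j\<in>UNIV. if j = i then - c / u * k * w \<omega> else 0)"
        by (intro sum.cong refl) (auto simp: w_def)
      then show ?thesis by simp
    qed
    have "flux c i z = (LINT \<omega>|M. g \<omega> * (F i \<omega> + - c / u * w \<omega>))"
      using flux_eq[OF c'(1), of i z] s1[of 1] unfolding g_def u_def[symmetric] by (simp add: vec_of_def)
    also have "\<dots> = (LINT \<omega>|M. g \<omega> * F i \<omega> - c / u * (w \<omega> * g \<omega>))"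
      by (simp add: algebra_simps)
    \<comment> \<open>The two sides of the integration by parts are subtracted and added.\<close>
    also have "\<dots> = (LINT \<omega>|M. g \<omega> * F i \<omega> - c / u * (w \<omega> * g \<omega>)) - (LINT \<omega>|M. g \<omega> * score_weight \<epsilon> i \<omega>)
        + (LINT \<omega>|M. \<theta> \<omega> * (c / u * w \<omega>) * g \<omega>)"
      unfolding ibp(1) by simp
    also have "\<dots> = (LINT \<omega>|M. g \<omega> * F i \<omega> - c / u * (w \<omega> * g \<omega>) - g \<omega> * score_weight \<epsilon> i \<omega>
        + \<theta> \<omega> * (c / u * w \<omega>) * g \<omega>)"
      using i1 i2 i4 ibp(2) by simp
    also have "\<dots> = (LINT \<omega>|M. g \<omega> * (a i \<omega> + - c / u * \<eta> \<omega> * w \<omega>))"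
      by (intro Bochner_Integration.integral_cong refl) (simp add: a_def \<theta>\<eta>[symmetric] algebra_simps)
    finally show ?thesis unfolding b_def s1 unfolding g_def .
  qed
  have "fisher c \<le> (LINT \<omega>|M. (\<Sum>i\<in>UNIV. (a i \<omega>)\<^sup>2 + u * (\<Sum>j\<in>UNIV. (b i j \<omega>)\<^sup>2)))"
    unfolding fisher_def u_def
    by (rule integral_square_over_dens_le(1)[OF c'(1) am bm flux[unfolded u_def] rapid_measurable[OF rapid_flux[OF c'(1)]] int[unfolded u_def]])
  also have "\<dots> = (LINT \<omega>|M. (\<Sum>i\<in>UNIV. (a i \<omega>)\<^sup>2)) + real CARD('n) * c\<^sup>2 / u * (LINT \<omega>|M. (\<eta> \<omega>)\<^sup>2)"
    unfolding sum.distrib sb using ia i\<eta> by simp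
  also have "(LINT \<omega>|M. (\<Sum>i\<in>UNIV. (a i \<omega>)\<^sup>2)) \<le> (LINT \<omega>|M. (A_integrand \<omega>)\<^sup>2 / \<epsilon> ^ 4)"
    by (intro integral_mono ia iA a_le)
  also have "\<dots> = enn2real (A_functional M L F) / \<epsilon> ^ 4"
    unfolding A_functional_eq by simp
  also have "real CARD('n) * c\<^sup>2 / u * (LINT \<omega>|M. (\<eta> \<omega>)\<^sup>2)
      \<le> real CARD('n) / u * (\<epsilon> powr s * (enn2real (B_functional M L F \<alpha>) + 1))"
  proof (rule mult_mono)
    have "c\<^sup>2 \<le> 1" using c by (simp add: power_le_one)
    then have "real CARD('n) * c\<^sup>2 \<le> real CARD('n)" by (intro mult_left_le) auto
    then show "real CARD('n) * c\<^sup>2 / u \<le> real CARD('n) / u" using u by (intro divide_right_mono) auto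
    show "(LINT \<omega>|M. (\<eta> \<omega>)\<^sup>2) \<le> \<epsilon> powr s * (enn2real (B_functional M L F \<alpha>) + 1)"
      unfolding \<eta>_def by (rule defect_integral_le[OF \<epsilon>(1) s])
  qed (use u in auto)
  finally show ?thesis unfolding u_def by simp
qed

text \<open>The two contributions are of order \<epsilon>^-4 and \<epsilon>^s/u. They agree when
  \<epsilon>^(s+4) = u, that is for \<epsilon> = u^\<kappa> with \<kappa> = 1/(s + 4), and both then
  equal u^(-4\<kappa>).\<close>

lemma fisher_le_nondegenerate:
  assumes c: "0 < c" "c < 1" and \<kappa>: "\<kappa> = (2 + \<alpha>) / (2 * (4 + 3 * \<alpha>))"
  shows "fisher c \<le> (enn2real (A_functional M L F) + real CARD('n) * (enn2real (B_functional M L F \<alpha>) + 1))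
    * (1 - c\<^sup>2) powr ((1 - 4 * \<kappa>) - 1)"
proof -
  define u where "u = 1 - c\<^sup>2"
  have u: "0 < u" "u \<le> 1" using variance_bounds[of c] c by (auto simp: u_def)
  \<comment> \<open>The value for which 1/(s + 4) is the exponent \<kappa> of the theorem. Its
    positivity is what makes 4\<kappa> < 1, and s \<le> \<alpha> is required by the comparison with
    \<open>B_functional\<close>.\<close>
  define s where "s = 2 * \<alpha> / (2 + \<alpha>)"
  have s: "0 \<le> s" "s \<le> 4" "s \<le> \<alpha>" using alpha_pos by (auto simp: s_def field_simps)
  have \<kappa>0: "0 < \<kappa>" using alpha_pos by (simp add: \<kappa>)
  define \<epsilon> where "\<epsilon> = u powr \<kappa>"
  have \<epsilon>: "0 < \<epsilon>" "\<epsilon> \<le> 1" using u \<kappa>0 powr_le1[of \<kappa> u] by (auto simp: \<epsilon>_def)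
  have \<kappa>s: "\<kappa> * s - 1 = - 4 * \<kappa>"
  proof -
    have "\<kappa> * (s + 4) = 1"
    proof -
      have "s + 4 = 2 * (4 + 3 * \<alpha>) / (2 + \<alpha>)" using alpha_pos by (simp add: s_def field_simps)
      then show ?thesis using alpha_pos by (simp add: \<kappa>)
    qed
    then show ?thesis by (simp add: algebra_simps)
  qed
  have e1: "1 / \<epsilon> ^ 4 = u powr (- 4 * \<kappa>)"
  proof -
    have "\<epsilon> ^ 4 = u powr (4 * \<kappa>)" using u by (simp add: \<epsilon>_def powr_powr powr_realpow[symmetric] mult.commute)
    then show ?thesis by (simp add: powr_minus_divide)
  qed
  have e2: "1 / u * \<epsilon> powr s = u powr (- 4 * \<kappa>)"
  proof -
    have "1 / u * \<epsilon> powr s = u powr (\<kappa> * s) / u powr 1" using u by (simp add: \<epsilon>_def powr_powr)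
    also have "\<dots> = u powr (\<kappa> * s - 1)" by (simp only: powr_diff)
    finally show ?thesis by (simp only: \<kappa>s)
  qed
  have "fisher c \<le> enn2real (A_functional M L F) / \<epsilon> ^ 4
    + real CARD('n) / u * (\<epsilon> powr s * (enn2real (B_functional M L F \<alpha>) + 1))"
    unfolding u_def by (rule fisher_le_regularised[OF c \<epsilon> s])
  also have "\<dots> = enn2real (A_functional M L F) * (1 / \<epsilon> ^ 4)
    + real CARD('n) * (enn2real (B_functional M L F \<alpha>) + 1) * (1 / u * \<epsilon> powr s)"
    by (simp add: mult_ac)
  also have "\<dots> = (enn2real (A_functional M L F) + real CARD('n) * (enn2real (B_functional M L F \<alpha>) + 1)) * u powr (- 4 * \<kappa>)"
    unfolding e1 e2 by (simp add: algebra_simps)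
  finally show ?thesis by (simp add: u_def)
qed

end

section \<open>Testing the Stein kernel against Gaussian kernels\<close>

text \<open>The classical flat function exp(-1/t), divided by powers of t to make the family closed
  under differentiation.\<close>

definition bump :: "nat \<Rightarrow> real \<Rightarrow> real" where
  "bump k t = (if 0 < t then exp (- 1 / t) / t ^ k else 0)"

text \<open>The quadratic bound makes the difference quotient at 0 tend to 0, for every k at
  once.\<close>

lemma bump_le_square:
  assumes "0 < t" shows "exp (- 1 / t) / t ^ k \<le> real (k + 2) ^ (k + 2) * t\<^sup>2"
proof -
  define N where "N = k + 2"
  have N: "0 < N" by (simp add: N_def)
  have "(1 / t / real N) ^ N \<le> (1 + 1 / t / real N) ^ N" using assms by (intro power_mono) auto
  also have "\<dots> \<le> exp (1 / t)" using assms N order_trans[of "- real N" 0 "1 / t"] by (intro exp_ge_one_plus_x_over_n_power_n) auto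
  finally have "inverse (exp (1 / t)) \<le> inverse ((1 / t / real N) ^ N)"
    using assms N by (intro le_imp_inverse_le) auto
  then have "exp (- 1 / t) \<le> real N ^ N * t ^ N"
    by (simp add: exp_minus power_divide power_mult_distrib field_simps)
  then have "exp (- 1 / t) / t ^ k \<le> real N ^ N * t ^ N / t ^ k" using assms by (intro divide_right_mono) auto
  also have "\<dots> = real N ^ N * t\<^sup>2" using assms by (simp add: N_def power_add power2_eq_square)
  finally show ?thesis by (simp add: N_def)
qed

lemma bump_deriv: "(bump k has_real_derivative - real k * bump (Suc k) t + bump (k + 2) t) (at t)"
proof -
  consider "0 < t" | "t < 0" | "t = 0" by linarith
  then show ?thesis
  proof cases
    case 1
    have d1: "((\<lambda>t. exp (- 1 / t)) has_real_derivative exp (- 1 / t) * (1 / t\<^sup>2)) (at t)"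
      using 1 by (auto intro!: derivative_eq_intros simp: power2_eq_square)
    have d2: "((\<lambda>t. t ^ k) has_real_derivative real k * t ^ (k - 1)) (at t)"
      using DERIV_pow[of k t] by simp
    have "((\<lambda>t. exp (- 1 / t) / t ^ k) has_real_derivative
        (exp (- 1 / t) * (1 / t\<^sup>2) * t ^ k - exp (- 1 / t) * (real k * t ^ (k - 1))) / (t ^ k * t ^ k)) (at t)"
      using 1 by (intro DERIV_divide d1 d2) auto
    moreover have "(exp (- 1 / t) * (1 / t\<^sup>2) * t ^ k - exp (- 1 / t) * (real k * t ^ (k - 1))) / (t ^ k * t ^ k)
        = - real k * bump (Suc k) t + bump (k + 2) t"
    proof -
      have "real k * t ^ (k - 1) * t = real k * t ^ k" by (cases k) auto
      then show ?thesis using 1 by (auto simp add: bump_def field_simps power2_eq_square)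
    qed
    ultimately have "((\<lambda>t. exp (- 1 / t) / t ^ k) has_real_derivative - real k * bump (Suc k) t + bump (k + 2) t) (at t)" by simp
    then show ?thesis
      by (rule has_field_derivative_transform_within_open[of _ _ _ "{0<..}"]) (use 1 in \<open>auto simp: bump_def\<close>)
  next
    case 2
    have "((\<lambda>t. 0) has_real_derivative - real k * bump (Suc k) t + bump (k + 2) t) (at t)"
      using 2 by (simp add: bump_def)
    then show ?thesis
      by (rule has_field_derivative_transform_within_open[of _ _ _ "{..<0}"]) (use 2 in \<open>auto simp: bump_def\<close>)
  next
    case 3
    define C where "C = real (k + 2) ^ (k + 2)"
    have "((\<lambda>h. (bump k (0 + h) - bump k 0) / h) \<longlongrightarrow> 0) (at 0)"
    proof (rule Lim_null_comparison)
      show "((\<lambda>h. C * \<bar>h\<bar>) \<longlongrightarrow> 0) (at 0)" by (auto intro!: tendsto_eq_intros)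
      show "\<forall>\<^sub>F h in at 0. norm ((bump k (0 + h) - bump k 0) / h) \<le> C * \<bar>h\<bar>"
      proof (rule eventually_at_filter[THEN iffD2], intro always_eventually allI impI)
        fix h :: real assume h: "h \<noteq> 0"
        have "\<bar>bump k h\<bar> \<le> C * h\<^sup>2"
          using bump_le_square[of h k] by (auto simp: bump_def C_def)
        then have "\<bar>bump k h\<bar> / \<bar>h\<bar> \<le> C * h\<^sup>2 / \<bar>h\<bar>" by (intro divide_right_mono) auto
        also have "\<dots> = C * \<bar>h\<bar>" using h by (simp add: power2_eq_square abs_if)
        finally show "norm ((bump k (0 + h) - bump k 0) / h) \<le> C * \<bar>h\<bar>" by (simp add: bump_def[of k 0] abs_divide)
      qed
    qed
    then show ?thesis using 3 by (simp add: DERIV_def bump_def)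
  qed
qed

text \<open>A compactly supported approximation of \<open>exp (- q)\<close>: for \<open>q < R\<close> the value of \<open>cutoff 0 R q\<close> is
  \<open>exp (- q / (1 - q / R))\<close>. The family in \<open>k\<close> is closed under differentiation in \<open>q\<close>.\<close>

definition cutoff :: "nat \<Rightarrow> real \<Rightarrow> real \<Rightarrow> real" where
  "cutoff k R q = exp R * bump k ((R - q) / R\<^sup>2) / R ^ k"

lemma cutoff_deriv:
  assumes "0 < R"
  shows "(cutoff k R has_real_derivative real k / R * cutoff (Suc k) R q - cutoff (k + 2) R q) (at q)"
proof -
  have "((\<lambda>q. (R - q) / R\<^sup>2) has_real_derivative - 1 / R\<^sup>2) (at q)"
    by (rule DERIV_cdivide) (auto intro!: derivative_eq_intros)
  from DERIV_chain2[OF bump_deriv this]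
  have "((\<lambda>q. bump k ((R - q) / R\<^sup>2)) has_real_derivative
      (- real k * bump (Suc k) ((R - q) / R\<^sup>2) + bump (k + 2) ((R - q) / R\<^sup>2)) * (- 1 / R\<^sup>2)) (at q)" .
  from DERIV_cmult[OF this, of "exp R / R ^ k"]
  have "((\<lambda>q. exp R / R ^ k * bump k ((R - q) / R\<^sup>2)) has_real_derivative
      exp R / R ^ k * ((- real k * bump (Suc k) ((R - q) / R\<^sup>2) + bump (k + 2) ((R - q) / R\<^sup>2)) * (- 1 / R\<^sup>2))) (at q)" .
  moreover have "exp R / R ^ k * ((- real k * bump (Suc k) ((R - q) / R\<^sup>2) + bump (k + 2) ((R - q) / R\<^sup>2)) * (- 1 / R\<^sup>2))
      = real k / R * cutoff (Suc k) R q - cutoff (k + 2) R q"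
    using assms by (simp add: cutoff_def field_simps power2_eq_square power4_eq_xxxx)
  ultimately show ?thesis by (simp add: cutoff_def[abs_def])
qed

lemma cutoff_eq:
  assumes "0 < R" "q < R"
  shows "cutoff k R q = (R / (R - q)) ^ k * exp (- (R * q / (R - q)))"
proof -
  have "- 1 / ((R - q) / R\<^sup>2) = - R - R * q / (R - q)"
    using assms by (simp add: field_simps power2_eq_square)
  then have "exp R * exp (- 1 / ((R - q) / R\<^sup>2)) = exp (- (R * q / (R - q)))"
    by (simp add: exp_add[symmetric])
  moreover have "((R - q) / R\<^sup>2) ^ k * R ^ k = ((R - q) / R) ^ k"
    using assms by (simp add: power_mult_distrib[symmetric] power2_eq_square)
  moreover have "cutoff k R q = exp R * exp (- 1 / ((R - q) / R\<^sup>2)) / (((R - q) / R\<^sup>2) ^ k * R ^ k)"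
    using assms by (simp add: cutoff_def bump_def)
  ultimately show ?thesis by (simp add: power_divide)
qed

lemma cutoff_eq_0: "0 < R \<Longrightarrow> R \<le> q \<Longrightarrow> cutoff k R q = 0"
  using divide_nonpos_pos[of "R - q" "R\<^sup>2"] by (auto simp add: cutoff_def bump_def)

lemma power_exp_minus_le:
  assumes "0 \<le> (y :: real)" shows "(1 + y) ^ k * exp (- y) \<le> real k ^ k * exp 1"
proof (cases "k = 0")
  case False
  have "((1 + y) / real k) ^ k \<le> (1 + (1 + y) / real k) ^ k" using assms by (intro power_mono) auto
  also have "\<dots> \<le> exp (1 + y)"
    using assms False order_trans[of "- real k" 0 "1 + y"] by (intro exp_ge_one_plus_x_over_n_power_n) auto
  finally have "(1 + y) ^ k \<le> real k ^ k * (exp 1 * exp y)"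
    using False by (simp add: power_divide divide_le_eq exp_add mult.commute)
  then have "(1 + y) ^ k * exp (- y) \<le> real k ^ k * (exp 1 * exp y) * exp (- y)" by (intro mult_right_mono) auto
  also have "\<dots> = real k ^ k * exp 1" by (simp add: exp_minus)
  finally show ?thesis .
next
  case True
  have "exp (- y) \<le> exp 1" using assms by simp
  then show ?thesis using True by simp
qed

text \<open>A majorant that does not depend on R. The factor 1 + q is included because second
  derivatives of the kernel bring in two components of z - c x, whose product is of the order of
  q.\<close>

lemma cutoff_bound:
  assumes "1 \<le> R" "0 \<le> q"
  shows "0 \<le> cutoff k R q" "(1 + q) * cutoff k R q \<le> real (Suc k) ^ Suc k * exp 1"
proof -
  show nn: "0 \<le> cutoff k R q" using assms by (simp add: cutoff_def bump_def)
  show "(1 + q) * cutoff k R q \<le> real (Suc k) ^ Suc k * exp 1"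
  proof (cases "q < R")
    case True
    \<comment> \<open>Minus the exponent in \<open>cutoff_eq\<close>. It dominates q, and 1 + y
      dominates the base R/(R - q), so a one-variable bound in y remains.\<close>
    define y where "y = R * q / (R - q)"
    have qy: "q \<le> y" unfolding y_def using True assms by (simp add: pos_le_divide_eq algebra_simps)
    have y: "0 \<le> y" using qy assms by simp
    have "R / (R - q) = 1 + y / R" using True assms by (simp add: y_def field_simps)
    also have "y / R \<le> y" using y assms by (simp add: pos_divide_le_eq mult_le_cancel_left1)
    finally have l: "R / (R - q) \<le> 1 + y" by simp
    have "(1 + q) * cutoff k R q = (1 + q) * ((R / (R - q)) ^ k * exp (- y))"
      using cutoff_eq[of R q k] True assms by (simp add: y_def)
    also have "\<dots> \<le> (1 + y) * ((1 + y) ^ k * exp (- y))"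
      using l qy y True assms by (intro mult_mono power_mono mult_right_mono) auto
    also have "\<dots> = (1 + y) ^ Suc k * exp (- y)" by simp
    also have "\<dots> \<le> real (Suc k) ^ Suc k * exp 1" by (rule power_exp_minus_le[OF y])
    finally show ?thesis .
  next
    case False
    then show ?thesis using cutoff_eq_0[of R q k] assms by simp
  qed
qed

text \<open>The limit is the same for every k. As the coefficients k/R in
  \<open>cutoff_deriv\<close> vanish, the derivatives of the cutoffs converge to those of exp(-q) as
  well.\<close>

lemma cutoff_tendsto:
  assumes "0 \<le> q" shows "(\<lambda>n. cutoff k (real (Suc n)) q) \<longlonglongrightarrow> exp (- q)"
proof -
  define r where "r n = real (Suc n) / (real (Suc n) - q)" for n
  have lim: "r \<longlonglongrightarrow> 1"
  proof -
    have "(\<lambda>n. 1 / (1 - q * (1 / real (Suc n)))) \<longlonglongrightarrow> 1 / (1 - q * 0)"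
      by (intro tendsto_intros LIMSEQ_Suc[OF lim_1_over_n]) simp
    then have l: "(\<lambda>n. 1 / (1 - q * (1 / real (Suc n)))) \<longlonglongrightarrow> 1" by simp
    have "1 / (1 - q * (1 / real (Suc n))) = r n" for n by (simp add: r_def field_simps)
    then show ?thesis using l by simp
  qed
  have ev: "\<forall>\<^sub>F n in sequentially. r n ^ k * exp (- (q * r n)) = cutoff k (real (Suc n)) q"
  proof -
    obtain N :: nat where N: "q < real N" using reals_Archimedean2 by blast
    have "\<forall>\<^sub>F n in sequentially. N \<le> n" by (rule eventually_ge_at_top)
    then show ?thesis
    proof eventually_elim
      case (elim n)
      then have "q < real (Suc n)" using N by simp
      then show ?case using cutoff_eq[of "real (Suc n)" q k] by (simp add: r_def mult.commute)
    qed
  qed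
  have "(\<lambda>n. r n ^ k * exp (- (q * r n))) \<longlonglongrightarrow> 1 ^ k * exp (- (q * 1))"
    by (intro tendsto_intros lim)
  then have "(\<lambda>n. r n ^ k * exp (- (q * r n))) \<longlonglongrightarrow> exp (- q)" by simp
  then show ?thesis by (rule Lim_transform_eventually[OF _ ev])
qed

text \<open>A compactly supported substitute for the unnormalised Gaussian kernel as a function of
  x, since the Stein identity is available for compactly supported test functions only.\<close>

definition cutoff_kernel :: "real \<Rightarrow> real \<Rightarrow> real ^ 'n::finite \<Rightarrow> real \<Rightarrow> real ^ 'n \<Rightarrow> real" where
  "cutoff_kernel c u z R x = cutoff 0 R ((norm (z - c *\<^sub>R x))\<^sup>2 / (2 * u))"

text \<open>With q = |z - c x|^2/(2u), the derivative of q in x_i is -(c/u)(z - c x)_i, and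
  differentiating \<open>cutoff\<close> raises its index by one or two. This produces the indices 2,
  3 and 4.\<close>

lemma cutoff_kernel_smooth:
  fixes z :: "real ^ 'n::finite"
  assumes R: "0 < R" and u: "0 < u"
  shows "smooth (cutoff_kernel c u z R)"
    and "gradient (cutoff_kernel c u z R) x = (\<chi> i. cutoff 2 R ((norm (z - c *\<^sub>R x))\<^sup>2 / (2 * u)) * (c / u * (z - c *\<^sub>R x) $ i))"
    and "hessian (cutoff_kernel c u z R) x = (\<chi> i j.
      (cutoff 4 R ((norm (z - c *\<^sub>R x))\<^sup>2 / (2 * u)) - 2 / R * cutoff 3 R ((norm (z - c *\<^sub>R x))\<^sup>2 / (2 * u)))
         * (c / u * (z - c *\<^sub>R x) $ i) * (c / u * (z - c *\<^sub>R x) $ j)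
      - cutoff 2 R ((norm (z - c *\<^sub>R x))\<^sup>2 / (2 * u)) * (c\<^sup>2 / u * of_bool (i = j)))"
proof -
  define Q where "Q y = (\<Sum>i\<in>UNIV. (z $ i - c * y i) * (z $ i - c * y i)) / (2 * u)" for y :: "'n \<Rightarrow> real"
  define \<beta> where "\<beta> k y = cutoff k R (Q y)" for k y
  have f_eq: "cutoff_kernel c u z R \<circ> vec_lambda = \<beta> 0"
    by (simp add: fun_eq_iff cutoff_kernel_def \<beta>_def Q_def norm_power2_eq_sum power2_eq_square[symmetric])
  have Q_eq: "Q (vec_nth x) = (norm (z - c *\<^sub>R x))\<^sup>2 / (2 * u)" for x
    by (simp add: Q_def norm_power2_eq_sum power2_eq_square[symmetric])
  have dw: "has_partial i (\<lambda>y. z $ j - c * y j) (\<lambda>y. - c * of_bool (i = j))" for i j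
    using has_partial_add[OF has_partial_const[of i "z $ j"] has_partial_mult[OF has_partial_const[of i "- c"] has_partial_coord[of i j]]]
    by (simp add: mult.commute)
  have dQ: "has_partial i Q (\<lambda>y. - (c / u * (z $ i - c * y i)))" for i
  proof -
    have "has_partial i (\<lambda>y. \<Sum>j\<in>UNIV. (z $ j - c * y j) * (z $ j - c * y j))
        (\<lambda>y. \<Sum>j\<in>UNIV. (- c * of_bool (i = j)) * (z $ j - c * y j) + (- c * of_bool (i = j)) * (z $ j - c * y j))"
      by (intro has_partial_sum finite has_partial_mult dw)
    moreover have "(\<Sum>j\<in>UNIV. (- c * of_bool (i = j)) * (z $ j - c * y j) + (- c * of_bool (i = j)) * (z $ j - c * y j))
        = - 2 * c * (z $ i - c * y i)" for y
    proof -
      have "(\<Sum>j\<in>UNIV. (- c * of_bool (i = j)) * (z $ j - c * y j) + (- c * of_bool (i = j)) * (z $ j - c * y j))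
          = (\<Sum>j\<in>UNIV. if j = i then - 2 * c * (z $ i - c * y i) else 0)" by (intro sum.cong) auto
      then show ?thesis by simp
    qed
    ultimately have "has_partial i (\<lambda>y. \<Sum>j\<in>UNIV. (z $ j - c * y j) * (z $ j - c * y j)) (\<lambda>y. - 2 * c * (z $ i - c * y i))"
      by simp
    from has_partial_mult[OF this has_partial_const[of i "1 / (2 * u)"]]
    show ?thesis by (simp add: Q_def[abs_def])
  qed
  have d\<beta>: "has_partial i (\<beta> k) (\<lambda>y. (real k / R * \<beta> (Suc k) y - \<beta> (k + 2) y) * - (c / u * (z $ i - c * y i)))" for i k
    using has_partial_compose[OF dQ cutoff_deriv[OF R], of i k] by (simp add: \<beta>_def[abs_def])
  define B where "B = range \<beta> \<union> range (\<lambda>i y. y i)"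
  have g\<beta>: "function_ring B (\<beta> k)" for k by (rule function_ring.gen) (simp add: B_def)
  have gc: "function_ring B (\<lambda>y. y i)" for i by (rule function_ring.gen) (auto simp: B_def)
  have contQ: "continuous_on UNIV Q" unfolding Q_def using u
    by (intro continuous_intros continuous_on_product_coordinates) auto
  have "smooth_in UNIV (\<beta> 0)"
  proof (rule function_ring_smooth[where B=B, OF _ _ _ g\<beta>])
    fix b and x y :: "'n \<Rightarrow> real" assume "\<And>i. i \<in> UNIV \<Longrightarrow> x i = y i"
    then have "x = y" by (simp add: fun_eq_iff)
    then show "b x = b y" by simp
  next
    fix b assume "b \<in> B"
    moreover have "continuous_on UNIV (\<beta> k)" for k
    proof -
      have "continuous_on UNIV (cutoff k R)"
        using cutoff_deriv[OF R] by (intro DERIV_continuous_on) (auto intro: has_field_derivative_at_within)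
      then show ?thesis unfolding \<beta>_def by (rule continuous_on_compose2[OF _ contQ]) auto
    qed
    ultimately show "continuous_on UNIV b" by (auto simp: B_def intro: continuous_on_product_coordinates)
  next
    fix b and i :: 'n assume "b \<in> B"
    then consider k where "b = \<beta> k" | j where "b = (\<lambda>y. y j)" by (auto simp: B_def)
    then show "\<exists>b'. function_ring B b' \<and> has_partial i b b'"
    proof cases
      case 1
      have a1: "function_ring B (\<lambda>y. real k / R * \<beta> (Suc k) y - \<beta> (k + 2) y)"
        by (rule function_ring_diff[OF function_ring_cmult[OF g\<beta>] g\<beta>])
      have a2: "function_ring B (\<lambda>y. - (c / u) * (z $ i - c * y i))"
        by (rule function_ring_cmult[OF function_ring_diff[OF function_ring.const function_ring_cmult[OF gc]]])
      have "function_ring B (\<lambda>y. (real k / R * \<beta> (Suc k) y - \<beta> (k + 2) y) * - (c / u * (z $ i - c * y i)))"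
        using function_ring.mult[OF a1 a2] by simp
      then show ?thesis unfolding 1 using d\<beta> by (intro exI conjI)
    next
      case 2
      show ?thesis unfolding 2 by (intro exI[of _ "\<lambda>_. of_bool (i = j)"] conjI has_partial_coord function_ring.const)
    qed
  qed
  then show "smooth (cutoff_kernel c u z R)" by (simp add: smooth_def f_eq)
  have p1: "partial_deriv i (\<beta> 0) = (\<lambda>y. \<beta> 2 y * (c / u * (z $ i - c * y i)))" for i
    using partial_deriv_eq[OF d\<beta>[of i 0]] by (simp add: numeral_2_eq_2)
  show "gradient (cutoff_kernel c u z R) x = (\<chi> i. cutoff 2 R ((norm (z - c *\<^sub>R x))\<^sup>2 / (2 * u)) * (c / u * (z - c *\<^sub>R x) $ i))"
    unfolding gradient_def f_eq p1 \<beta>_def Q_eq by simp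
  have p2: "partial_deriv i (partial_deriv j (\<beta> 0)) = (\<lambda>y.
      (\<beta> 4 y - 2 / R * \<beta> 3 y) * (c / u * (z $ i - c * y i)) * (c / u * (z $ j - c * y j)) - \<beta> 2 y * (c\<^sup>2 / u * of_bool (i = j)))" for i j
  proof -
    have "has_partial i (\<lambda>y. c / u * (z $ j - c * y j)) (\<lambda>y. - (c\<^sup>2 / u * of_bool (i = j)))"
      using has_partial_mult[OF has_partial_const[of i "c / u"] dw[of i j]] by (simp add: power2_eq_square mult_ac)
    from partial_deriv_eq[OF has_partial_mult[OF d\<beta>[of i 2] this]]
    have raw: "partial_deriv i (partial_deriv j (\<beta> 0)) = (\<lambda>y. (real 2 / R * \<beta> (Suc 2) y - \<beta> (2 + 2) y) * - (c / u * (z $ i - c * y i))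
        * (c / u * (z $ j - c * y j)) + - (c\<^sup>2 / u * of_bool (i = j)) * \<beta> 2 y)"
      unfolding p1 .
    have alg: "(p - q) * - a * b + - k * s = (q - p) * a * b - s * k" for p q a b k s :: real
      by (simp add: algebra_simps)
    have "Suc 2 = 3" "2 + 2 = (4 :: nat)" "real 2 = 2" by simp_all
    then show ?thesis unfolding raw alg by (simp only:)
  qed
  show "hessian (cutoff_kernel c u z R) x = (\<chi> i j.
      (cutoff 4 R ((norm (z - c *\<^sub>R x))\<^sup>2 / (2 * u)) - 2 / R * cutoff 3 R ((norm (z - c *\<^sub>R x))\<^sup>2 / (2 * u)))
         * (c / u * (z - c *\<^sub>R x) $ i) * (c / u * (z - c *\<^sub>R x) $ j)
      - cutoff 2 R ((norm (z - c *\<^sub>R x))\<^sup>2 / (2 * u)) * (c\<^sup>2 / u * of_bool (i = j)))"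
    unfolding hessian_def f_eq p2 \<beta>_def Q_eq by simp
qed

lemma cutoff_kernel_compact_support:
  fixes z :: "real ^ 'n::finite"
  assumes R: "0 < R" and u: "0 < u" and c: "0 < c"
  shows "compact (closure {x. cutoff_kernel c u z R x \<noteq> 0})"
proof -
  have "{x. cutoff_kernel c u z R x \<noteq> 0} \<subseteq> cball 0 ((norm z + sqrt (2 * u * R)) / c)"
  proof
    fix x assume "x \<in> {x. cutoff_kernel c u z R x \<noteq> 0}"
    then have "(norm (z - c *\<^sub>R x))\<^sup>2 / (2 * u) < R"
      using cutoff_eq_0[OF R] by (auto simp: cutoff_kernel_def not_le[symmetric])
    then have "(norm (z - c *\<^sub>R x))\<^sup>2 \<le> 2 * u * R" using u by (simp add: pos_divide_less_eq mult_ac)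
    then have "norm (z - c *\<^sub>R x) \<le> sqrt (2 * u * R)" by (rule real_le_rsqrt)
    moreover have "norm (c *\<^sub>R x) \<le> norm z + norm (z - c *\<^sub>R x)"
      using norm_triangle_ineq4[of z "z - c *\<^sub>R x"] by simp
    ultimately have "c * norm x \<le> norm z + sqrt (2 * u * R)" using c by simp
    then show "x \<in> cball 0 ((norm z + sqrt (2 * u * R)) / c)" using c by (simp add: pos_le_divide_eq mult.commute)
  qed
  then have "bounded {x. cutoff_kernel c u z R x \<noteq> 0}" by (rule bounded_subset[OF bounded_cball])
  then show ?thesis by (simp add: compact_closure)
qed

context stein_vector
begin

lemma law_density: "distr M borel (vec_of F) = density std_gaussian (\<lambda>y. ennreal (h y))"
  using h_density by (simp add: law_def)

text \<open>The Stein identity for the cutoff kernels, in the limit R to infinity. By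
  \<open>cutoff_bound\<close> the integrands are dominated by multiples of |x_i| and of the entries
  |\<tau>_ij|, which are integrable under the law.\<close>

lemma stein_identity_gauss:
  assumes u: "0 < u" "u \<le> 1" and c: "0 < c"
  shows "(LINT x|law M F. (\<Sum>i\<in>UNIV. x $ i * (c / u * (z - c *\<^sub>R x) $ i)) * gauss u (z - c *\<^sub>R x))
    = (LINT x|law M F. (\<Sum>i\<in>UNIV. \<Sum>j\<in>UNIV. \<tau> x $ i $ j *
        ((c / u * (z - c *\<^sub>R x) $ i) * (c / u * (z - c *\<^sub>R x) $ j) - c\<^sup>2 / u * of_bool (i = j))) * gauss u (z - c *\<^sub>R x))"
proof -
  define q where "q x = (norm (z - c *\<^sub>R x))\<^sup>2 / (2 * u)" for x
  define w where "w i x = c / u * (z - c *\<^sub>R x) $ i" for i x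
  have q0: "0 \<le> q x" for x using u by (simp add: q_def)
  have sets_law [measurable_cong]: "sets (law M F) = sets borel" by (simp add: law_def)
  have [measurable]: "\<tau> \<in> borel_measurable borel" and \<tau>i: "integrable (law M F) (\<lambda>x. \<tau> x $ i $ j)"
    and st: "smooth \<phi> \<Longrightarrow> compact (closure {x. \<phi> x \<noteq> 0}) \<Longrightarrow>
        (LINT x|law M F. x \<bullet> gradient \<phi> x) = (LINT x|law M F. \<tau> x \<bullet> hessian \<phi> x)" for i j \<phi>
    using kernel by (auto simp: stein_kernel_def)
  have tm: "(\<lambda>x. \<tau> x $ i $ j) \<in> borel_measurable borel" for i j
    using borel_measurable_integrable[OF \<tau>i[of i j]] by (simp add: law_def)
  have wm [measurable]: "w i \<in> borel_measurable borel" for i unfolding w_def[abs_def] by measurable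
  have qm [measurable]: "q \<in> borel_measurable borel" unfolding q_def[abs_def] by measurable
  have cm [measurable]: "cutoff k (real (Suc n)) \<in> borel_measurable borel" for k n
  proof (rule borel_measurable_continuous_onI)
    show "continuous_on UNIV (cutoff k (real (Suc n)))"
      by (rule DERIV_continuous_on[OF has_field_derivative_at_within[OF cutoff_deriv]]) simp
  qed
  have xi: "integrable (law M F) (\<lambda>x. \<bar>x $ i\<bar>)" for i
    unfolding law_def using A_integrable[OF F_in_A[of i]]
    by (subst integrable_distr_eq) (auto simp: vec_of_def)
  define D where "D = c / u"
  have D: "0 < D" using c u by (simp add: D_def)
  \<comment> \<open>The square of |z - c x| is 2 u q and u \<le> 1, so the factor 1 + q in
    \<open>cutoff_bound\<close> absorbs this growth.\<close>
  have w_sq: "\<bar>w i x\<bar> * \<bar>w j x\<bar> \<le> D\<^sup>2 * (2 * (1 + q x))" for i j x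
  proof -
    have "\<bar>w i x\<bar> * \<bar>w j x\<bar> = D\<^sup>2 * (\<bar>(z - c *\<^sub>R x) $ i\<bar> * \<bar>(z - c *\<^sub>R x) $ j\<bar>)"
      using D by (simp only: w_def D_def[symmetric] abs_mult) (simp add: power2_eq_square mult_ac)
    also have "\<bar>(z - c *\<^sub>R x) $ i\<bar> * \<bar>(z - c *\<^sub>R x) $ j\<bar> \<le> norm (z - c *\<^sub>R x) * norm (z - c *\<^sub>R x)"
      by (intro mult_mono component_le_norm_cart) auto
    also have "\<dots> = 2 * u * q x" using u by (simp add: q_def power2_eq_square)
    also have "\<dots> \<le> 2 * (1 + q x)" using u q0[of x] mult_right_mono[of u 1 "q x"] by simp
    finally show ?thesis using D by (simp add: mult_left_mono)
  qed
  have w_le: "\<bar>w i x\<bar> \<le> 2 * D * (1 + q x)" for i x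
  proof -
    have "\<bar>(z - c *\<^sub>R x) $ i\<bar> \<le> norm (z - c *\<^sub>R x)" by (rule component_le_norm_cart)
    also have "\<dots> \<le> 1 + q x * (2 * u)" using norm_le_bracket[of "z - c *\<^sub>R x"] u by (simp add: bracket_def q_def)
    also have "\<dots> \<le> 2 * (1 + q x)" using u q0[of x] mult_right_mono[of u 1 "q x"] by (simp add: mult_ac)
    finally have "D * \<bar>(z - c *\<^sub>R x) $ i\<bar> \<le> D * (2 * (1 + q x))" using D by (intro mult_left_mono) auto
    then show ?thesis using D by (simp only: w_def D_def[symmetric] abs_mult abs_of_pos[OF D] mult_ac)
  qed
  define K where "K k = real (Suc k) ^ Suc k * exp 1" for k
  have cb: "0 \<le> cutoff k (real (Suc n)) (q x)" "(1 + q x) * cutoff k (real (Suc n)) (q x) \<le> K k" for k n x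
    unfolding K_def by (intro cutoff_bound q0, simp)+
  have cb1: "cutoff k (real (Suc n)) (q x) \<le> K k" for k n x
    using cb(1)[of k n x] cb(2)[of x k n] q0[of x] mult_right_mono[of 1 "1 + q x" "cutoff k (real (Suc n)) (q x)"] by simp
  have K0: "0 \<le> K k" for k by (simp add: K_def)
  define l where "l n x = cutoff 2 (real (Suc n)) (q x) * (\<Sum>i\<in>UNIV. x $ i * w i x)" for n x
  define r where "r n x = (\<Sum>i\<in>UNIV. \<Sum>j\<in>UNIV. \<tau> x $ i $ j *
      ((cutoff 4 (real (Suc n)) (q x) - 2 / real (Suc n) * cutoff 3 (real (Suc n)) (q x)) * w i x * w j x
        - cutoff 2 (real (Suc n)) (q x) * (c\<^sup>2 / u * of_bool (i = j))))" for n x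
  have eq: "(LINT x|law M F. l n x) = (LINT x|law M F. r n x)" for n
  proof -
    have R: "0 < real (Suc n)" by simp
    note sm = cutoff_kernel_smooth[OF R u(1), where z=z and c=c]
    have "(LINT x|law M F. x \<bullet> gradient (cutoff_kernel c u z (real (Suc n))) x)
        = (LINT x|law M F. \<tau> x \<bullet> hessian (cutoff_kernel c u z (real (Suc n))) x)"
      by (rule st[OF sm(1) cutoff_kernel_compact_support[OF R u(1) c]])
    moreover have "x \<bullet> gradient (cutoff_kernel c u z (real (Suc n))) x = l n x" for x
      unfolding sm(2) l_def inner_vec_def w_def q_def sum_distrib_left by (intro sum.cong refl) (simp add: mult_ac)
    moreover have "\<tau> x \<bullet> hessian (cutoff_kernel c u z (real (Suc n))) x = r n x" for x
      unfolding sm(3) r_def by (simp add: inner_vec_def w_def q_def)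
    ultimately show ?thesis by simp
  qed
  have l_lim: "(\<lambda>n. LINT x|law M F. l n x) \<longlonglongrightarrow> (LINT x|law M F. exp (- q x) * (\<Sum>i\<in>UNIV. x $ i * w i x))"
  proof (rule integral_dominated_convergence[where w="\<lambda>x. \<Sum>i\<in>UNIV. 2 * D * K 2 * \<bar>x $ i\<bar>"])
    show "integrable (law M F) (\<lambda>x. \<Sum>i\<in>UNIV. 2 * D * K 2 * \<bar>x $ i\<bar>)"
      by (intro Bochner_Integration.integrable_sum integrable_mult_right xi)
    show "AE x in law M F. (\<lambda>n. l n x) \<longlonglongrightarrow> exp (- q x) * (\<Sum>i\<in>UNIV. x $ i * w i x)"
      unfolding l_def by (intro always_eventually allI tendsto_mult tendsto_const cutoff_tendsto q0)
    show "AE x in law M F. norm (l n x) \<le> (\<Sum>i\<in>UNIV. 2 * D * K 2 * \<bar>x $ i\<bar>)" for n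
    proof (intro always_eventually allI)
      fix x
      have "\<bar>cutoff 2 (real (Suc n)) (q x) * (x $ i * w i x)\<bar> \<le> 2 * D * K 2 * \<bar>x $ i\<bar>" for i
      proof -
        have "\<bar>cutoff 2 (real (Suc n)) (q x) * (x $ i * w i x)\<bar> = \<bar>x $ i\<bar> * (\<bar>w i x\<bar> * cutoff 2 (real (Suc n)) (q x))"
          using cb(1)[of 2 n x] by (simp add: abs_mult)
        also have "\<dots> \<le> \<bar>x $ i\<bar> * (2 * D * K 2)"
        proof (rule mult_left_mono)
          have "\<bar>w i x\<bar> * cutoff 2 (real (Suc n)) (q x) \<le> 2 * D * (1 + q x) * cutoff 2 (real (Suc n)) (q x)"
            by (intro mult_right_mono w_le cb)
          also have "\<dots> \<le> 2 * D * K 2"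
            using cb(2)[of x 2 n] D by (simp add: mult.assoc)
          finally show "\<bar>w i x\<bar> * cutoff 2 (real (Suc n)) (q x) \<le> 2 * D * K 2" .
        qed simp
        finally show ?thesis by (simp only: mult.commute)
      qed
      then show "norm (l n x) \<le> (\<Sum>i\<in>UNIV. 2 * D * K 2 * \<bar>x $ i\<bar>)"
        unfolding l_def sum_distrib_left real_norm_def by (intro order_trans[OF sum_abs] sum_mono)
    qed
    show "(\<lambda>x. l n x) \<in> borel_measurable (law M F)" for n unfolding l_def by measurable
    show "(\<lambda>x. exp (- q x) * (\<Sum>i\<in>UNIV. x $ i * w i x)) \<in> borel_measurable (law M F)" by measurable
  qed
  define E where "E = D\<^sup>2 * 2 * K 4 + 2 * (D\<^sup>2 * 2 * K 3) + K 2 * (c\<^sup>2 / u)"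
  \<comment> \<open>The coefficient 0 is the limit of 2/R. It is kept so that the limit has the same
    shape as \<open>r\<close> and can be taken term by term.\<close>
  have r_lim: "(\<lambda>n. LINT x|law M F. r n x) \<longlonglongrightarrow> (LINT x|law M F. (\<Sum>i\<in>UNIV. \<Sum>j\<in>UNIV. \<tau> x $ i $ j *
      ((exp (- q x) - 0 * exp (- q x)) * w i x * w j x - exp (- q x) * (c\<^sup>2 / u * of_bool (i = j)))))"
  proof (rule integral_dominated_convergence[where w="\<lambda>x. \<Sum>i\<in>UNIV. \<Sum>j\<in>UNIV. \<bar>\<tau> x $ i $ j\<bar> * E"])
    show "integrable (law M F) (\<lambda>x. \<Sum>i\<in>UNIV. \<Sum>j\<in>UNIV. \<bar>\<tau> x $ i $ j\<bar> * E)"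
      by (intro Bochner_Integration.integrable_sum integrable_mult_left integrable_abs \<tau>i)
    have "(\<lambda>n. 2 / real (Suc n)) \<longlonglongrightarrow> 0"
      using tendsto_mult_right_zero[OF LIMSEQ_Suc[OF lim_1_over_n], of 2] by simp
    then show "AE x in law M F. (\<lambda>n. r n x) \<longlonglongrightarrow> (\<Sum>i\<in>UNIV. \<Sum>j\<in>UNIV. \<tau> x $ i $ j *
      ((exp (- q x) - 0 * exp (- q x)) * w i x * w j x - exp (- q x) * (c\<^sup>2 / u * of_bool (i = j))))"
      unfolding r_def by (intro always_eventually allI tendsto_sum tendsto_mult tendsto_diff tendsto_const cutoff_tendsto q0)
    show "AE x in law M F. norm (r n x) \<le> (\<Sum>i\<in>UNIV. \<Sum>j\<in>UNIV. \<bar>\<tau> x $ i $ j\<bar> * E)" for n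
    proof (intro always_eventually allI)
      fix x
      have "\<bar>(cutoff 4 (real (Suc n)) (q x) - 2 / real (Suc n) * cutoff 3 (real (Suc n)) (q x)) * w i x * w j x
        - cutoff 2 (real (Suc n)) (q x) * (c\<^sup>2 / u * of_bool (i = j))\<bar> \<le> E" for i j
      proof -
        define a where "a k = cutoff k (real (Suc n)) (q x)" for k
        have a: "0 \<le> a k" "a k \<le> K k" "(1 + q x) * a k \<le> K k" for k
          using cb(1)[of k n x] cb1[of k n x] cb(2)[of x k n] by (simp_all add: a_def)
        have aw: "a k * (\<bar>w i x\<bar> * \<bar>w j x\<bar>) \<le> D\<^sup>2 * 2 * K k" for k
        proof -
          have "a k * (\<bar>w i x\<bar> * \<bar>w j x\<bar>) \<le> a k * (D\<^sup>2 * (2 * (1 + q x)))"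
            by (intro mult_left_mono w_sq a)
          also have "\<dots> = D\<^sup>2 * 2 * ((1 + q x) * a k)" by simp
          also have "\<dots> \<le> D\<^sup>2 * 2 * K k" by (intro mult_left_mono a) auto
          finally show ?thesis .
        qed
        have "2 / real (Suc n) \<le> 2" by (simp add: divide_le_eq)
        have "\<bar>(a 4 - 2 / real (Suc n) * a 3) * w i x * w j x - a 2 * (c\<^sup>2 / u * of_bool (i = j))\<bar>
            \<le> \<bar>a 4 * (w i x * w j x)\<bar> + \<bar>2 / real (Suc n) * (a 3 * (w i x * w j x))\<bar> + \<bar>a 2 * (c\<^sup>2 / u * of_bool (i = j))\<bar>"
        proof -
          have tri: "\<bar>x - y - v\<bar> \<le> \<bar>x\<bar> + \<bar>y\<bar> + \<bar>v\<bar>" for x y v :: real by linarith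
          have e: "(a 4 - 2 / real (Suc n) * a 3) * w i x * w j x = a 4 * (w i x * w j x) - 2 / real (Suc n) * (a 3 * (w i x * w j x))"
            by (simp only: left_diff_distrib mult.assoc)
          show ?thesis unfolding e by (rule tri)
        qed
        also have "\<dots> = a 4 * (\<bar>w i x\<bar> * \<bar>w j x\<bar>) + 2 / real (Suc n) * (a 3 * (\<bar>w i x\<bar> * \<bar>w j x\<bar>)) + a 2 * (c\<^sup>2 / u * of_bool (i = j))"
          using a(1) u by (simp add: abs_mult)
        also have "\<dots> \<le> D\<^sup>2 * 2 * K 4 + 2 * (D\<^sup>2 * 2 * K 3) + K 2 * (c\<^sup>2 / u)"
          using a u \<open>2 / real (Suc n) \<le> 2\<close> D K0 by (intro add_mono aw mult_mono) (auto simp: of_bool_def)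
        finally show ?thesis by (simp only: a_def E_def)
      qed
      then have "\<bar>\<tau> x $ i $ j * ((cutoff 4 (real (Suc n)) (q x) - 2 / real (Suc n) * cutoff 3 (real (Suc n)) (q x)) * w i x * w j x
        - cutoff 2 (real (Suc n)) (q x) * (c\<^sup>2 / u * of_bool (i = j)))\<bar> \<le> \<bar>\<tau> x $ i $ j\<bar> * E" for i j
        unfolding abs_mult[of "\<tau> x $ i $ j"] by (intro mult_left_mono) auto
      then show "norm (r n x) \<le> (\<Sum>i\<in>UNIV. \<Sum>j\<in>UNIV. \<bar>\<tau> x $ i $ j\<bar> * E)"
        unfolding r_def real_norm_def by (intro order_trans[OF sum_abs] sum_mono order_trans[OF sum_abs])
    qed
    note [measurable] = tm
    show "(\<lambda>x. r n x) \<in> borel_measurable (law M F)" for n unfolding r_def by measurable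
    show "(\<lambda>x. \<Sum>i\<in>UNIV. \<Sum>j\<in>UNIV. \<tau> x $ i $ j *
      ((exp (- q x) - 0 * exp (- q x)) * w i x * w j x - exp (- q x) * (c\<^sup>2 / u * of_bool (i = j)))) \<in> borel_measurable (law M F)"
      by measurable
  qed
  have "(LINT x|law M F. exp (- q x) * (\<Sum>i\<in>UNIV. x $ i * w i x)) = (LINT x|law M F. (\<Sum>i\<in>UNIV. \<Sum>j\<in>UNIV. \<tau> x $ i $ j *
      ((exp (- q x) - 0 * exp (- q x)) * w i x * w j x - exp (- q x) * (c\<^sup>2 / u * of_bool (i = j)))))"
    using LIMSEQ_unique[OF l_lim] r_lim unfolding eq by simp
  from arg_cong[OF this, of "\<lambda>y. (1 / sqrt (2 * pi * u)) ^ CARD('n) * y"]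
  have fin: "(LINT x|law M F. (1 / sqrt (2 * pi * u)) ^ CARD('n) * (exp (- q x) * (\<Sum>i\<in>UNIV. x $ i * w i x)))
      = (LINT x|law M F. (1 / sqrt (2 * pi * u)) ^ CARD('n) * (\<Sum>i\<in>UNIV. \<Sum>j\<in>UNIV. \<tau> x $ i $ j *
      ((exp (- q x) - 0 * exp (- q x)) * w i x * w j x - exp (- q x) * (c\<^sup>2 / u * of_bool (i = j)))))"
    by (simp only: integral_mult_right_zero)
  have g: "gauss u (z - c *\<^sub>R x) = (1 / sqrt (2 * pi * u)) ^ CARD('n) * exp (- q x)" for x
    by (simp add: gauss_def q_def)
  have a: "(1 / sqrt (2 * pi * u)) ^ CARD('n) * (exp (- q x) * (\<Sum>i\<in>UNIV. x $ i * w i x))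
      = (\<Sum>i\<in>UNIV. x $ i * w i x) * gauss u (z - c *\<^sub>R x)" for x
    unfolding g by (simp only: mult_ac)
  have b: "(1 / sqrt (2 * pi * u)) ^ CARD('n) * (\<Sum>i\<in>UNIV. \<Sum>j\<in>UNIV. \<tau> x $ i $ j *
      ((exp (- q x) - 0 * exp (- q x)) * w i x * w j x - exp (- q x) * (c\<^sup>2 / u * of_bool (i = j))))
      = (\<Sum>i\<in>UNIV. \<Sum>j\<in>UNIV. \<tau> x $ i $ j * (w i x * w j x - c\<^sup>2 / u * of_bool (i = j))) * gauss u (z - c *\<^sub>R x)" for x
    unfolding g sum_distrib_left sum_distrib_right by (intro sum.cong refl) (simp add: right_diff_distrib left_diff_distrib mult_ac)
  show ?thesis using fin unfolding a b unfolding w_def .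
qed

definition kernel_defect :: "'n \<Rightarrow> 'n \<Rightarrow> 'a \<Rightarrow> real" where
  "kernel_defect i j \<omega> = \<tau> (vec_of F \<omega>) $ i $ j - of_bool (i = j)"

lemma kernel_measurable: "(\<lambda>\<omega>. \<tau> (vec_of F \<omega>) $ i $ j) \<in> borel_measurable M"
proof -
  have "(\<lambda>x. \<tau> x $ i $ j) \<in> borel_measurable (law M F)"
    using kernel unfolding stein_kernel_def by (intro borel_measurable_integrable) blast
  then have "(\<lambda>x. \<tau> x $ i $ j) \<in> borel_measurable borel" by (simp add: law_def)
  then show ?thesis by (rule measurable_compose[OF vec_of_measurable])
qed

lemma kernel_defect_norm: "(norm (\<tau> (vec_of F \<omega>) - mat 1))\<^sup>2 = (\<Sum>i\<in>UNIV. \<Sum>j\<in>UNIV. (kernel_defect i j \<omega>)\<^sup>2)"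
  unfolding power2_norm_eq_inner inner_vec_def
  by (simp add: kernel_defect_def mat_def power2_eq_square of_bool_def)

lemma kernel_defect_measurable [measurable]: "kernel_defect i j \<in> borel_measurable M"
  unfolding kernel_defect_def[abs_def] using kernel_measurable by simp

lemma stein_discrepancy_eq:
  assumes "stein_discrepancy_sq \<tau> (law M F) < \<infinity>"
  shows "integrable M (\<lambda>\<omega>. \<Sum>i\<in>UNIV. \<Sum>j\<in>UNIV. (kernel_defect i j \<omega>)\<^sup>2)"
    and "(stein_discrepancy \<tau> (law M F))\<^sup>2 = (LINT \<omega>|M. (\<Sum>i\<in>UNIV. \<Sum>j\<in>UNIV. (kernel_defect i j \<omega>)\<^sup>2))"
proof -
  have [measurable]: "\<tau> \<in> borel_measurable borel" using kernel by (simp add: stein_kernel_def)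
  have e: "stein_discrepancy_sq \<tau> (law M F) = (\<integral>\<^sup>+\<omega>. ennreal (\<Sum>i\<in>UNIV. \<Sum>j\<in>UNIV. (kernel_defect i j \<omega>)\<^sup>2) \<partial>M)"
    unfolding stein_discrepancy_sq_def law_def kernel_defect_norm[symmetric]
    by (rule nn_integral_distr[OF vec_of_measurable]) measurable
  show "integrable M (\<lambda>\<omega>. \<Sum>i\<in>UNIV. \<Sum>j\<in>UNIV. (kernel_defect i j \<omega>)\<^sup>2)"
    using assms unfolding e by (intro integrableI_nonneg) (auto intro!: always_eventually sum_nonneg)
  have "(LINT \<omega>|M. (\<Sum>i\<in>UNIV. \<Sum>j\<in>UNIV. (kernel_defect i j \<omega>)\<^sup>2)) = enn2real (stein_discrepancy_sq \<tau> (law M F))"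
    unfolding e by (rule integral_eq_nn_integral) (auto intro!: always_eventually sum_nonneg)
  then show "(stein_discrepancy \<tau> (law M F))\<^sup>2 = (LINT \<omega>|M. (\<Sum>i\<in>UNIV. \<Sum>j\<in>UNIV. (kernel_defect i j \<omega>)\<^sup>2))"
    by (simp add: stein_discrepancy_def)
qed

lemma kernel_defect_tempered:
  assumes "stein_discrepancy_sq \<tau> (law M F) < \<infinity>"
  shows "tempered (kernel_defect i j)"
proof (rule tempered_square_integrable)
  show "integrable M (\<lambda>\<omega>. (kernel_defect i j \<omega>)\<^sup>2)"
  proof (rule Bochner_Integration.integrable_bound[OF stein_discrepancy_eq(1)[OF assms]])
    show "AE \<omega> in M. norm ((kernel_defect i j \<omega>)\<^sup>2) \<le> norm (\<Sum>i\<in>UNIV. \<Sum>j\<in>UNIV. (kernel_defect i j \<omega>)\<^sup>2)"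
    proof (intro always_eventually allI)
      fix \<omega>
      have "(kernel_defect i j \<omega>)\<^sup>2 \<le> (\<Sum>j\<in>UNIV. (kernel_defect i j \<omega>)\<^sup>2)"
        by (rule member_le_sum) auto
      also have "\<dots> \<le> (\<Sum>i\<in>UNIV. \<Sum>j\<in>UNIV. (kernel_defect i j \<omega>)\<^sup>2)"
        by (rule member_le_sum) (auto intro: sum_nonneg)
      finally have "(kernel_defect i j \<omega>)\<^sup>2 \<le> (\<Sum>i\<in>UNIV. \<Sum>j\<in>UNIV. (kernel_defect i j \<omega>)\<^sup>2)" .
      from order_trans[OF this abs_ge_self]
      show "norm ((kernel_defect i j \<omega>)\<^sup>2) \<le> norm (\<Sum>i\<in>UNIV. \<Sum>j\<in>UNIV. (kernel_defect i j \<omega>)\<^sup>2)"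
        unfolding real_norm_def abs_of_nonneg[OF zero_le_power2] .
    qed
  qed measurable
qed measurable

text \<open>In the divergence of the flux the contribution of F is E[F . grad g], which the Stein
  identity rewrites with \<tau> and the Hessian of g; the remaining term is the same expression with
  Id in place of \<tau>. The divergence is therefore that of the field (c/u)
  E[(\<tau> - Id)(z - c F) g], whose norm is governed by the discrepancy. The fields themselves need
  not agree, hence the use of \<open>fisher_le_same_divergence\<close>.\<close>

lemma fisher_le_stein:
  assumes S: "stein_discrepancy_sq \<tau> (law M F) < \<infinity>" and c: "0 < c" "c < 1"
  shows "fisher c \<le> c\<^sup>2 * (stein_discrepancy \<tau> (law M F))\<^sup>2 / (1 - c\<^sup>2)"
proof -
  have c': "\<bar>c\<bar> < 1" "\<bar>c\<bar> \<le> 1" using c by auto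
  define u where "u = 1 - c\<^sup>2"
  note u = variance_bounds[OF c'(1), folded u_def]
  note T = kernel_defect_tempered[OF S]
  define \<Phi> where "\<Phi> j = (\<lambda>w :: real ^ 'n. w $ j * gauss u w)" for j
  define \<Phi>' where "\<Phi>' i j = (\<lambda>w :: real ^ 'n. of_bool (i = j) * gauss u w - 1 / u * (w $ i * (w $ j * gauss u w)))" for i j
  have \<Phi>: "rapid (\<Phi> j)" "rapid (\<Phi>' i j)" for i j
    unfolding \<Phi>_def \<Phi>'_def by (intro rapid_times_component rapid_diff rapid_cmult rapid_gauss u)+
  define K where "K i z = (\<Sum>j\<in>UNIV. c / u * field c (kernel_defect i j) (\<Phi> j) z)" for i z
  define dK where "dK i z = (\<Sum>j\<in>UNIV. c / u * field c (kernel_defect i j) (\<Phi>' i j) z)" for i z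
  have K: "rapid (K i)" "rapid (dK i)" for i
    unfolding K_def[abs_def] dK_def[abs_def] by (intro rapid_sum finite rapid_cmult rapid_field c' \<Phi> T)+
  have der: "((\<lambda>t. K i (z + t *\<^sub>R axis i 1)) has_real_derivative dK i z) (at 0)" for i z
    unfolding K_def dK_def
  proof (intro DERIV_sum DERIV_cmult field_derivative[OF c'(2) T \<Phi>])
    show "((\<lambda>t. \<Phi> j (w + t *\<^sub>R axis i 1)) has_real_derivative \<Phi>' i j w) (at 0)" for j w
      unfolding \<Phi>_def \<Phi>'_def by (rule component_gauss_deriv[OF u(1)])
  qed
  have K_eq: "K i z = (LINT \<omega>|M. gauss u (z - c *\<^sub>R vec_of F \<omega>)
      * (0 + (\<Sum>j\<in>UNIV. c / u * kernel_defect i j \<omega> * (z - c *\<^sub>R vec_of F \<omega>) $ j)))" for i z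
  proof -
    have "K i z = (LINT \<omega>|M. (\<Sum>j\<in>UNIV. c / u * (kernel_defect i j \<omega> * \<Phi> j (z - c *\<^sub>R vec_of F \<omega>))))"
      unfolding K_def field_def
      by (simp only: integral_mult_right_zero Bochner_Integration.integral_sum[OF integrable_mult_right[OF field_integrable[OF c'(2) \<Phi>(1) T]]])
    also have "\<dots> = (LINT \<omega>|M. gauss u (z - c *\<^sub>R vec_of F \<omega>)
      * (0 + (\<Sum>j\<in>UNIV. c / u * kernel_defect i j \<omega> * (z - c *\<^sub>R vec_of F \<omega>) $ j)))"
      unfolding \<Phi>_def add_0_left sum_distrib_left by (intro Bochner_Integration.integral_cong refl sum.cong) (simp only: mult_ac)
    finally show ?thesis .
  qed
  have b_eq: "(\<Sum>i\<in>UNIV. 0\<^sup>2 + (1 - c\<^sup>2) * (\<Sum>j\<in>UNIV. (c / u * kernel_defect i j \<omega>)\<^sup>2))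
      = c\<^sup>2 / u * (\<Sum>i\<in>UNIV. \<Sum>j\<in>UNIV. (kernel_defect i j \<omega>)\<^sup>2)" for \<omega>
  proof -
    have "u * (\<Sum>j\<in>UNIV. (c / u * kernel_defect i j \<omega>)\<^sup>2) = c\<^sup>2 / u * (\<Sum>j\<in>UNIV. (kernel_defect i j \<omega>)\<^sup>2)" for i
      unfolding sum_distrib_left using u by (intro sum.cong refl) (simp add: field_simps power2_eq_square)
    then show ?thesis by (simp add: u_def sum_distrib_left)
  qed
  have int: "integrable M (\<lambda>\<omega>. \<Sum>i\<in>UNIV. 0\<^sup>2 + (1 - c\<^sup>2) * (\<Sum>j\<in>UNIV. (c / u * kernel_defect i j \<omega>)\<^sup>2))"
    unfolding b_eq by (intro integrable_mult_right stein_discrepancy_eq(1)[OF S])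
  have cm: "(\<lambda>\<omega>. c / u * kernel_defect i j \<omega>) \<in> borel_measurable M" for i j by measurable
  note sq = integral_square_over_dens_le[where a="\<lambda>_ _. 0", OF c'(1) borel_measurable_const cm[unfolded u_def] K_eq[unfolded u_def] rapid_measurable[OF K(1)] int[unfolded u_def]]
  have div_eq: "(\<Sum>i\<in>UNIV. dK i z) = (\<Sum>i\<in>UNIV. dflux c i z)" for z
  proof -
    define g where "g \<omega> = gauss u (z - c *\<^sub>R vec_of F \<omega>)" for \<omega>
    define w where "w i \<omega> = (z - c *\<^sub>R vec_of F \<omega>) $ i" for i \<omega>
    define t where "t i j \<omega> = \<tau> (vec_of F \<omega>) $ i $ j" for i j \<omega>
    have ig: "integrable M g"
      using field_integrable[OF c'(2) rapid_gauss[OF u] tempered_const[of 1], of z] by (simp add: g_def[abs_def])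
    have igww: "integrable M (\<lambda>\<omega>. w i \<omega> * (w j \<omega> * g \<omega>))" for i j
      using field_integrable[OF c'(2) rapid_times_component[OF rapid_times_component[OF rapid_gauss[OF u], of j], of i] tempered_const[of 1], of z]
      by (simp add: g_def w_def)
    have igwF: "integrable M (\<lambda>\<omega>. F i \<omega> * (w i \<omega> * g \<omega>))" for i
      using field_integrable[OF c'(2) rapid_times_component[OF rapid_gauss[OF u], of i] tempered_component[of i], of z]
      by (simp add: g_def w_def vec_of_def)
    have iK: "integrable M (\<lambda>\<omega>. kernel_defect i j \<omega> * (of_bool (i = j) * g \<omega> - 1 / u * (w i \<omega> * (w j \<omega> * g \<omega>))))" for i j
      using field_integrable[OF c'(2) \<Phi>(2)[of i j] T[of i j], of z] by (simp add: \<Phi>'_def g_def w_def)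
    define X1 where "X1 = (LINT \<omega>|M. (\<Sum>i\<in>UNIV. F i \<omega> * (c / u * w i \<omega>)) * g \<omega>)"
    \<comment> \<open>The i-th partial derivative in z of w_j g.\<close>
    define k where "k i j \<omega> = (of_bool (i = j) * g \<omega> - 1 / u * (w i \<omega> * (w j \<omega> * g \<omega>)))" for i j \<omega>
    have ik: "integrable M (k i j)" for i j
      unfolding k_def[abs_def] by (intro Bochner_Integration.integrable_diff integrable_mult_right ig igww)
    have stein: "X1 = (LINT \<omega>|M. (\<Sum>i\<in>UNIV. \<Sum>j\<in>UNIV. t i j \<omega> * ((c / u * w i \<omega>) * (c / u * w j \<omega>) - c\<^sup>2 / u * of_bool (i = j))) * g \<omega>)"
    proof -
      have tm: "(\<lambda>x. \<tau> x $ i $ j) \<in> borel_measurable borel" for i j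
        using kernel borel_measurable_integrable[of "law M F" "\<lambda>x. \<tau> x $ i $ j"] by (simp add: stein_kernel_def law_def)
      have "(LINT x|law M F. (\<Sum>i\<in>UNIV. x $ i * (c / u * (z - c *\<^sub>R x) $ i)) * gauss u (z - c *\<^sub>R x)) = X1"
        unfolding X1_def law_def g_def w_def by (subst integral_distr[OF vec_of_measurable]) (auto simp: vec_of_def)
      moreover have "(LINT x|law M F. (\<Sum>i\<in>UNIV. \<Sum>j\<in>UNIV. \<tau> x $ i $ j *
          ((c / u * (z - c *\<^sub>R x) $ i) * (c / u * (z - c *\<^sub>R x) $ j) - c\<^sup>2 / u * of_bool (i = j))) * gauss u (z - c *\<^sub>R x))
        = (LINT \<omega>|M. (\<Sum>i\<in>UNIV. \<Sum>j\<in>UNIV. t i j \<omega> * ((c / u * w i \<omega>) * (c / u * w j \<omega>) - c\<^sup>2 / u * of_bool (i = j))) * g \<omega>)"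
        unfolding law_def g_def w_def t_def
        by (rule integral_distr[OF vec_of_measurable]) (use tm in measurable)
      ultimately show ?thesis using stein_identity_gauss[OF u c(1), of z] by simp
    qed
    have X1_eq: "X1 = - (c\<^sup>2 / u) * (LINT \<omega>|M. (\<Sum>i\<in>UNIV. \<Sum>j\<in>UNIV. t i j \<omega> * k i j \<omega>))"
    proof -
      have "(\<Sum>i\<in>UNIV. \<Sum>j\<in>UNIV. t i j \<omega> * ((c / u * w i \<omega>) * (c / u * w j \<omega>) - c\<^sup>2 / u * of_bool (i = j))) * g \<omega>
          = - (c\<^sup>2 / u) * (\<Sum>i\<in>UNIV. \<Sum>j\<in>UNIV. t i j \<omega> * k i j \<omega>)" for \<omega>
      proof -
        have "t * ((c / u * a) * (c / u * b) - c\<^sup>2 / u * s) * y = - (c\<^sup>2 / u) * (t * (s * y - 1 / u * (a * (b * y))))" for t a b s y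
          using u(1) by (simp add: field_simps power2_eq_square)
        then show ?thesis unfolding sum_distrib_left sum_distrib_right k_def by (intro sum.cong refl)
      qed
      then show ?thesis unfolding stein by (simp only: integral_mult_right_zero)
    qed
    have "(\<Sum>i\<in>UNIV. dK i z) = (\<Sum>i\<in>UNIV. \<Sum>j\<in>UNIV. c / u * (LINT \<omega>|M. kernel_defect i j \<omega> * k i j \<omega>))"
      unfolding dK_def field_def \<Phi>'_def k_def g_def w_def ..
    also have "\<dots> = c / u * (LINT \<omega>|M. (\<Sum>i\<in>UNIV. \<Sum>j\<in>UNIV. kernel_defect i j \<omega> * k i j \<omega>))"
      using iK[folded k_def] by (simp add: Bochner_Integration.integral_sum sum_distrib_left)
    also have "(LINT \<omega>|M. (\<Sum>i\<in>UNIV. \<Sum>j\<in>UNIV. kernel_defect i j \<omega> * k i j \<omega>))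
        = (LINT \<omega>|M. (\<Sum>i\<in>UNIV. \<Sum>j\<in>UNIV. t i j \<omega> * k i j \<omega>) - (\<Sum>i\<in>UNIV. k i i \<omega>))"
    proof (rule Bochner_Integration.integral_cong[OF refl])
      fix \<omega>
      have d: "(\<Sum>j\<in>UNIV. of_bool (i = j) * k i j \<omega>) = k i i \<omega>" for i
      proof -
        have "(\<Sum>j\<in>UNIV. of_bool (i = j) * k i j \<omega>) = (\<Sum>j\<in>UNIV. if j = i then k i i \<omega> else 0)" by (intro sum.cong) auto
        then show ?thesis by simp
      qed
      have "kernel_defect i j \<omega> * k i j \<omega> = t i j \<omega> * k i j \<omega> - of_bool (i = j) * k i j \<omega>" for i j
        by (simp only: kernel_defect_def t_def left_diff_distrib)
      then show "(\<Sum>i\<in>UNIV. \<Sum>j\<in>UNIV. kernel_defect i j \<omega> * k i j \<omega>) = (\<Sum>i\<in>UNIV. \<Sum>j\<in>UNIV. t i j \<omega> * k i j \<omega>) - (\<Sum>i\<in>UNIV. k i i \<omega>)"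
        by (simp only: sum_subtractf d)
    qed
    also have "\<dots> = (LINT \<omega>|M. (\<Sum>i\<in>UNIV. \<Sum>j\<in>UNIV. t i j \<omega> * k i j \<omega>)) - (LINT \<omega>|M. (\<Sum>i\<in>UNIV. k i i \<omega>))"
    proof (rule Bochner_Integration.integral_diff)
      have "integrable M (\<lambda>\<omega>. kernel_defect i j \<omega> * k i j \<omega> + of_bool (i = j) * k i j \<omega>)" for i j
        using iK[of i j, folded k_def] ik by (intro Bochner_Integration.integrable_add integrable_mult_right)
      then have "integrable M (\<lambda>\<omega>. t i j \<omega> * k i j \<omega>)" for i j
        by (simp add: kernel_defect_def t_def distrib_right[symmetric])
      then show "integrable M (\<lambda>\<omega>. \<Sum>i\<in>UNIV. \<Sum>j\<in>UNIV. t i j \<omega> * k i j \<omega>)"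
        by (intro Bochner_Integration.integrable_sum)
      show "integrable M (\<lambda>\<omega>. \<Sum>i\<in>UNIV. k i i \<omega>)" by (intro Bochner_Integration.integrable_sum ik)
    qed
    finally have dK_eq: "(\<Sum>i\<in>UNIV. dK i z) = c / u * ((LINT \<omega>|M. (\<Sum>i\<in>UNIV. \<Sum>j\<in>UNIV. t i j \<omega> * k i j \<omega>)) - (LINT \<omega>|M. (\<Sum>i\<in>UNIV. k i i \<omega>)))" .
    \<comment> \<open>Here the kernel term of div K becomes the F term of div flux, by the Stein
      identity.\<close>
    have cancel: "c / u * (LINT \<omega>|M. (\<Sum>i\<in>UNIV. \<Sum>j\<in>UNIV. t i j \<omega> * k i j \<omega>)) = - X1 / c"
      unfolding X1_eq using c u by (simp add: power2_eq_square)
    have X1': "X1 / c = (LINT \<omega>|M. (\<Sum>i\<in>UNIV. 1 / u * (F i \<omega> * (w i \<omega> * g \<omega>))))"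
    proof -
      have "X1 = (LINT \<omega>|M. c * (\<Sum>i\<in>UNIV. 1 / u * (F i \<omega> * (w i \<omega> * g \<omega>))))"
        unfolding X1_def sum_distrib_left sum_distrib_right by (intro Bochner_Integration.integral_cong refl sum.cong) simp
      then show ?thesis using c by simp
    qed
    have "(\<Sum>i\<in>UNIV. dflux c i z) = - (LINT \<omega>|M. g \<omega> * (\<Sum>i\<in>UNIV. c / u + w i \<omega> * F i \<omega> / u - c * (w i \<omega>)\<^sup>2 / u\<^sup>2))"
      using dflux_sum[OF c'(1), of z] unfolding g_def w_def u_def by (simp add: vec_of_def)
    also have "(LINT \<omega>|M. g \<omega> * (\<Sum>i\<in>UNIV. c / u + w i \<omega> * F i \<omega> / u - c * (w i \<omega>)\<^sup>2 / u\<^sup>2))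
        = (LINT \<omega>|M. (\<Sum>i\<in>UNIV. 1 / u * (F i \<omega> * (w i \<omega> * g \<omega>))) + c / u * (\<Sum>i\<in>UNIV. k i i \<omega>))"
    proof (rule Bochner_Integration.integral_cong[OF refl])
      fix \<omega>
      have "y * (c / u + a * f / u - c * a\<^sup>2 / u\<^sup>2) = 1 / u * (f * (a * y)) + c / u * (of_bool True * y - 1 / u * (a * (a * y)))" for y a f
        using u(1) by (simp add: field_simps power2_eq_square)
      then show "g \<omega> * (\<Sum>i\<in>UNIV. c / u + w i \<omega> * F i \<omega> / u - c * (w i \<omega>)\<^sup>2 / u\<^sup>2)
          = (\<Sum>i\<in>UNIV. 1 / u * (F i \<omega> * (w i \<omega> * g \<omega>))) + c / u * (\<Sum>i\<in>UNIV. k i i \<omega>)"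
        unfolding sum_distrib_left k_def sum.distrib[symmetric] by (intro sum.cong refl) simp
    qed
    also have "\<dots> = X1 / c + c / u * (LINT \<omega>|M. (\<Sum>i\<in>UNIV. k i i \<omega>))"
    proof -
      have "integrable M (\<lambda>\<omega>. \<Sum>i\<in>UNIV. 1 / u * (F i \<omega> * (w i \<omega> * g \<omega>)))"
        by (intro Bochner_Integration.integrable_sum integrable_mult_right igwF)
      moreover have "integrable M (\<lambda>\<omega>. c / u * (\<Sum>i\<in>UNIV. k i i \<omega>))"
        by (intro integrable_mult_right Bochner_Integration.integrable_sum ik)
      ultimately show ?thesis unfolding X1' by (simp only: Bochner_Integration.integral_add integral_mult_right_zero)
    qed
    finally show ?thesis unfolding dK_eq right_diff_distrib cancel by simp
  qed
  have "fisher c \<le> (LINT z|lborel. (\<Sum>i\<in>UNIV. (K i z)\<^sup>2 / dens c z))"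
    using c by (intro fisher_le_same_divergence[OF c'(1) _ K der div_eq sq(2)]) auto
  also have "\<dots> \<le> (LINT \<omega>|M. (\<Sum>i\<in>UNIV. 0\<^sup>2 + (1 - c\<^sup>2) * (\<Sum>j\<in>UNIV. (c / u * kernel_defect i j \<omega>)\<^sup>2)))"
    using sq(1) unfolding u_def .
  also have "\<dots> = c\<^sup>2 / u * (stein_discrepancy \<tau> (law M F))\<^sup>2"
    unfolding b_eq stein_discrepancy_eq(2)[OF S] by simp
  finally show ?thesis by (simp add: u_def)
qed

end

section \<open>The entropy estimate\<close>

lemma smooth_imp_continuous:
  fixes f :: "real ^ 'n::finite \<Rightarrow> real"
  assumes "smooth f" shows "continuous_on UNIV f"
proof -
  have c: "continuous_on UNIV (f \<circ> vec_lambda)"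
    using assms unfolding smooth_def smooth_in_def
    by (elim conjE) (drule bspec[of _ _ "[]"], auto)
  have v: "continuous_on UNIV (vec_nth :: real ^ 'n \<Rightarrow> 'n \<Rightarrow> real)"
    by (intro continuous_on_coordinatewise_then_product continuous_intros)
  have "continuous_on UNIV (\<lambda>x. (f \<circ> vec_lambda) (vec_nth x))"
    by (rule continuous_on_compose2[OF c v]) auto
  then show ?thesis by simp
qed

context stein_vector
begin

text \<open>The switching variance r is replaced by t = r^\<beta>. Then ln r = ln t / \<beta>, and
  both contributions share the factor 1/\<beta>. Leaving t free serves the optimised bound and the
  limit of vanishing discrepancy alike.\<close>

lemma relative_entropy_estimate:
  assumes S: "stein_discrepancy_sq \<tau> (law M F) < \<infinity>"
    and \<kappa>: "\<kappa> = (2 + \<alpha>) / (2 * (4 + 3 * \<alpha>))" and \<beta>: "\<beta> = 1 - 4 * \<kappa>"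
    and K: "K = enn2real (A_functional M L F) + real CARD('n) * (enn2real (B_functional M L F \<alpha>) + 1)"
    and t: "0 < t" "t < 1"
  shows "integrable std_gaussian (\<lambda>y. h y * ln (h y))" "0 \<le> relative_entropy h"
    and "relative_entropy h \<le> (K * t - (stein_discrepancy \<tau> (law M F))\<^sup>2 / 2 * ln t) / \<beta>"
proof -
  have \<beta>0: "0 < \<beta>" using alpha_pos by (simp add: \<beta> \<kappa> field_simps)
  have K0: "0 \<le> K" by (simp add: K)
  define r where "r = t powr (1 / \<beta>)"
  have r: "0 < r" "r < 1"
  proof -
    show "0 < r" using t by (simp add: r_def)
    have "t powr (1 / \<beta>) < 1 powr (1 / \<beta>)" using t \<beta>0 by (intro powr_less_mono2) auto
    then show "r < 1" by (simp add: r_def)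
  qed
  have r\<beta>: "r powr \<beta> = t" using t \<beta>0 by (simp add: r_def powr_powr)
  have lnr: "ln r = ln t / \<beta>" using t by (simp add: r_def ln_powr)
  define s2 where "s2 = (stein_discrepancy \<tau> (law M F))\<^sup>2"
  have bound: "entropy_at c \<le> K * r powr \<beta> / \<beta> - s2 / 2 * ln r" if c: "sqrt (1 - r) < c" "c < 1" for c
  proof (rule entropy_bound[OF \<beta>0 K0 _ _ _ r])
    \<comment> \<open>The estimate holds with K. Its double is passed on so that
      \<open>entropy_bound\<close> returns K t / \<beta>, and optimisation then evaluates
      \<open>Psi\<close> at 2 K / S, with S the squared discrepancy.\<close>
    show "fisher c \<le> 2 * K * (1 - c\<^sup>2) powr (\<beta> - 1)" if "0 < c" "c < 1" for c
    proof -
      have "fisher c \<le> K * (1 - c\<^sup>2) powr (\<beta> - 1)"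
        unfolding K \<beta> by (rule fisher_le_nondegenerate[OF that \<kappa>])
      moreover have "0 \<le> K * (1 - c\<^sup>2) powr (\<beta> - 1)" using K0 by simp
      ultimately show ?thesis by linarith
    qed
    show "fisher c \<le> c\<^sup>2 * s2 / (1 - c\<^sup>2)" if "0 < c" "c < 1" for c
      unfolding s2_def by (rule fisher_le_stein[OF S that])
    show c0: "0 < c" using c(1) r by (meson le_less_trans real_sqrt_ge_zero diff_ge_0_iff_ge less_imp_le)
    have "(sqrt (1 - r))\<^sup>2 \<le> c\<^sup>2" using c(1) r by (intro power_mono) auto
    then show "1 - c\<^sup>2 \<le> r" using r by simp
  qed (use c in \<open>auto simp: s2_def\<close>)
  have c0: "0 \<le> sqrt (1 - r)" "sqrt (1 - r) < 1" using r by auto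
  note re = relative_entropy_le[OF law_density smooth_imp_continuous[OF h_smooth] h_nonneg bound c0]
  show "integrable std_gaussian (\<lambda>y. h y * ln (h y))" "0 \<le> relative_entropy h"
    using re by blast+
  have "K * r powr \<beta> / \<beta> - s2 / 2 * ln r = (K * t - s2 / 2 * ln t) / \<beta>"
    unfolding r\<beta> lnr by (simp add: diff_divide_distrib)
  then show "relative_entropy h \<le> (K * t - (stein_discrepancy \<tau> (law M F))\<^sup>2 / 2 * ln t) / \<beta>"
    using re(2) by (simp add: s2_def)
qed

end

text \<open>\<open>S\<close> stands for the squared discrepancy. The right-hand side is smallest at
  t = S/(2K); if this is below 1 it produces the logarithmic branch of \<open>Psi\<close>, and
  otherwise t tends to 1 and gives the linear branch.\<close>

lemma optimised_bound:
  fixes x K S \<beta> :: real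
  assumes le: "\<And>t. 0 < t \<Longrightarrow> t < 1 \<Longrightarrow> x \<le> (K * t - S / 2 * ln t) / \<beta>"
    and K: "0 < K" and S: "0 \<le> S" and \<beta>: "0 < \<beta>"
  shows "x \<le> S / (2 * \<beta>) * Psi (2 * K / S)"
proof -
  consider "S = 0" | "0 < S" "1 < 2 * K / S" | "0 < S" "2 * K / S \<le> 1" using S by linarith
  then show ?thesis
  proof cases
    case 1
    have "x \<le> 0"
    proof (rule ccontr)
      assume "\<not> x \<le> 0"
      then have x: "0 < x" by simp
      \<comment> \<open>For S = 0 the bound is K t / \<beta>, and this t makes it at most
        x/2.\<close>
      define t where "t = min (1 / 2) (x * \<beta> / (2 * K))"
      have t: "0 < t" "t < 1" using x \<beta> K by (auto simp: t_def)
      have "x \<le> K * t / \<beta>" using le[OF t] 1 by simp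
      also have "\<dots> \<le> K * (x * \<beta> / (2 * K)) / \<beta>"
        using K \<beta> by (intro divide_right_mono mult_left_mono) (auto simp: t_def)
      also have "\<dots> = x / 2" using K \<beta> by simp
      finally show False using x by simp
    qed
    then show ?thesis using 1 by simp
  next
    case 2
    define R where "R = 2 * K / S"
    have R: "1 < R" using 2 by (simp add: R_def)
    have "x \<le> (K * (1 / R) - S / 2 * ln (1 / R)) / \<beta>" using R by (intro le) auto
    also have "\<dots> = (S / 2 + S / 2 * ln R) / \<beta>"
    proof -
      have "K * (1 / R) = S / 2" using K 2 by (simp add: R_def)
      moreover have "ln (1 / R) = - ln R" using R by (simp add: ln_div)
      ultimately show ?thesis by simp
    qed
    also have "\<dots> = S / (2 * \<beta>) * Psi R" using R \<beta> by (simp add: Psi_def field_simps)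
    finally show ?thesis by (simp add: R_def)
  next
    case 3
    \<comment> \<open>The value t = 1 is not allowed in the hypothesis and is reached as a limit
      from the left.\<close>
    have "x \<le> (K * 1 - S / 2 * ln 1) / \<beta>"
    proof (rule tendsto_lowerbound)
      show "((\<lambda>t. (K * t - S / 2 * ln t) / \<beta>) \<longlongrightarrow> (K * 1 - S / 2 * ln 1) / \<beta>) (at_left 1)"
        using \<beta> by (intro tendsto_intros) auto
      show "\<forall>\<^sub>F t in at_left 1. x \<le> (K * t - S / 2 * ln t) / \<beta>"
        using eventually_at_left_real[OF zero_less_one] by eventually_elim (rule le; simp)
    qed simp
    also have "\<dots> = S / (2 * \<beta>) * (2 * K / S)" using 3 by simp
    also have "2 * K / S = Psi (2 * K / S)" using 3 by (simp add: Psi_def)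
    finally show ?thesis .
  qed
qed

theorem theorem5p7:
  fixes M :: "'a measure"
    and P :: "real \<Rightarrow> ('a \<Rightarrow> real) \<Rightarrow> 'a \<Rightarrow> real"
    and A :: "('a \<Rightarrow> real) set"
    and L :: "('a \<Rightarrow> real) \<Rightarrow> 'a \<Rightarrow> real"
    and F :: "'n::finite \<Rightarrow> 'a \<Rightarrow> real"
    and h :: "real ^ 'n \<Rightarrow> real"
    and \<tau> :: "real ^ 'n \<Rightarrow> real ^ 'n ^ 'n"
    and \<alpha> \<kappa> :: real
  assumes "stein_vector M P A L F h \<tau> \<alpha>"
    and "\<kappa> = (2 + \<alpha>) / (2 * (4 + 3 * \<alpha>))"
  shows "\<kappa> < 1 / 4 \<and>
    A_functional M L F < \<infinity> \<and>
    (stein_discrepancy_sq \<tau> (law M F) < \<infinity> \<longrightarrow>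
      integrable std_gaussian (\<lambda>y. h y * ln (h y)) \<and>
      relative_entropy h \<le>
        (stein_discrepancy \<tau> (law M F))\<^sup>2 / (2 * (1 - 4 * \<kappa>)) *
        Psi (2 * (enn2real (A_functional M L F) +
                  real CARD('n) * (enn2real (B_functional M L F \<alpha>) + 1)) /
             (stein_discrepancy \<tau> (law M F))\<^sup>2)) \<and>
    (\<forall>C. \<forall>\<epsilon>>0. \<exists>\<delta>>0.
      \<forall>(M' :: 'a measure) P' A' L' (F' :: 'n \<Rightarrow> 'a \<Rightarrow> real) h' \<tau>'.
        stein_vector M' P' A' L' F' h' \<tau>' \<alpha> \<and>
        A_functional M' L' F' \<le> ennreal C \<and> B_functional M' L' F' \<alpha> \<le> ennreal C \<and>
        stein_discrepancy_sq \<tau>' (law M' F') < \<infinity> \<and> stein_discrepancy \<tau>' (law M' F') < \<delta> \<longrightarrow>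
        integrable std_gaussian (\<lambda>y. h' y * ln (h' y)) \<and> \<bar>relative_entropy h'\<bar> < \<epsilon>)"
proof -
  interpret stein_vector M P A L F h \<tau> \<alpha> by (rule assms(1))
  have \<kappa>: "\<kappa> < 1 / 4" using alpha_pos by (simp add: assms(2) field_simps)
  define \<beta> where "\<beta> = 1 - 4 * \<kappa>"
  have \<beta>: "0 < \<beta>" using \<kappa> by (simp add: \<beta>_def)
  have card: "1 \<le> real CARD('n)" by (simp add: Suc_le_eq)
  have main: "integrable std_gaussian (\<lambda>y. h y * ln (h y)) \<and>
      relative_entropy h \<le>
        (stein_discrepancy \<tau> (law M F))\<^sup>2 / (2 * (1 - 4 * \<kappa>)) *
        Psi (2 * (enn2real (A_functional M L F) +
                  real CARD('n) * (enn2real (B_functional M L F \<alpha>) + 1)) /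
             (stein_discrepancy \<tau> (law M F))\<^sup>2)"
    if S: "stein_discrepancy_sq \<tau> (law M F) < \<infinity>"
  proof
    show "integrable std_gaussian (\<lambda>y. h y * ln (h y))"
      by (rule relative_entropy_estimate(1)[OF S assms(2) refl refl, of "1 / 2"]) auto
    have "0 < real CARD('n) * (enn2real (B_functional M L F \<alpha>) + 1)"
      using card enn2real_nonneg[of "B_functional M L F \<alpha>"] by (intro mult_pos_pos) linarith+
    then have K: "0 < enn2real (A_functional M L F) + real CARD('n) * (enn2real (B_functional M L F \<alpha>) + 1)"
      using enn2real_nonneg[of "A_functional M L F"] by linarith
    show "relative_entropy h \<le>
        (stein_discrepancy \<tau> (law M F))\<^sup>2 / (2 * (1 - 4 * \<kappa>)) *
        Psi (2 * (enn2real (A_functional M L F) +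
                  real CARD('n) * (enn2real (B_functional M L F \<alpha>) + 1)) /
             (stein_discrepancy \<tau> (law M F))\<^sup>2)"
      using \<kappa> by (intro optimised_bound[OF _ K] relative_entropy_estimate(3)[OF S assms(2) refl refl]) auto
  qed
  have continuity: "\<exists>\<delta>>0. \<forall>(M' :: 'a measure) P' A' L' (F' :: 'n \<Rightarrow> 'a \<Rightarrow> real) h' \<tau>'.
        stein_vector M' P' A' L' F' h' \<tau>' \<alpha> \<and>
        A_functional M' L' F' \<le> ennreal C \<and> B_functional M' L' F' \<alpha> \<le> ennreal C \<and>
        stein_discrepancy_sq \<tau>' (law M' F') < \<infinity> \<and> stein_discrepancy \<tau>' (law M' F') < \<delta> \<longrightarrow>
        integrable std_gaussian (\<lambda>y. h' y * ln (h' y)) \<and> \<bar>relative_entropy h'\<bar> < \<epsilon>"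
    if \<epsilon>: "0 < \<epsilon>" for C \<epsilon> :: real
  proof -
    \<comment> \<open>A negative bound C becomes 0 under \<open>ennreal\<close>, so C' is the real
      value of \<open>ennreal C\<close>.\<close>
    define C' where "C' = max 0 C"
    define K where "K = C' + real CARD('n) * (C' + 1)"
    have "0 < real CARD('n) * (C' + 1)" using card by (intro mult_pos_pos) (auto simp: C'_def)
    moreover have "0 \<le> C'" by (simp add: C'_def)
    ultimately have K: "0 < K" unfolding K_def by linarith
    \<comment> \<open>A single t serves all vectors with the given bounds on A and B. It makes K t
      at most half of \<epsilon> \<beta>, and \<delta> below is chosen so that the logarithmic term
      stays under the other half.\<close>
    define t where "t = min (1 / 2) (\<epsilon> * \<beta> / (2 * K))"
    have t: "0 < t" "t < 1" using \<epsilon> \<beta> K by (auto simp: t_def)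
    have Kt: "K * t \<le> \<epsilon> * \<beta> / 2"
    proof -
      have "K * t \<le> K * (\<epsilon> * \<beta> / (2 * K))" using K by (intro mult_left_mono) (auto simp: t_def)
      then show ?thesis using K by simp
    qed
    define l where "l = - ln t"
    have l: "0 < l" using t by (simp add: l_def)
    define \<delta> where "\<delta> = sqrt (\<epsilon> * \<beta> / l)"
    have \<delta>: "0 < \<delta>" "\<delta>\<^sup>2 = \<epsilon> * \<beta> / l" using \<epsilon> \<beta> l by (auto simp: \<delta>_def)
    show ?thesis
    proof (intro exI[of _ \<delta>] conjI allI impI \<delta>(1), goal_cases)
      case (1 M' P' A' L' F' h' \<tau>')
      then interpret V: stein_vector M' P' A' L' F' h' \<tau>' \<alpha> by blast
      show ?case using 1 by (intro V.relative_entropy_estimate(1)[OF _ assms(2) refl refl t]) blast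
    next
      case (2 M' P' A' L' F' h' \<tau>')
      then interpret V: stein_vector M' P' A' L' F' h' \<tau>' \<alpha> by blast
      define s where "s = stein_discrepancy \<tau>' (law M' F')"
      have S: "stein_discrepancy_sq \<tau>' (law M' F') < \<infinity>" and s: "s < \<delta>"
        and AB: "A_functional M' L' F' \<le> ennreal C" "B_functional M' L' F' \<alpha> \<le> ennreal C"
        using 2 by (auto simp: s_def)
      have C': "enn2real (ennreal C) = C'" by (cases "0 \<le> C") (auto simp: C'_def ennreal_neg)
      have AB': "enn2real (A_functional M' L' F') \<le> C'" "enn2real (B_functional M' L' F' \<alpha>) \<le> C'"
        using enn2real_mono[OF AB(1)] enn2real_mono[OF AB(2)] unfolding C' by simp_all
      note re = V.relative_entropy_estimate[OF S assms(2) \<beta>_def refl t]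
      have "s\<^sup>2 < \<delta>\<^sup>2" using s by (intro power_strict_mono) (auto simp: s_def stein_discrepancy_def)
      then have "s\<^sup>2 * l < \<epsilon> * \<beta>" using l by (simp add: \<delta>(2) pos_less_divide_eq)
      moreover have "(enn2real (A_functional M' L' F') + real CARD('n) * (enn2real (B_functional M' L' F' \<alpha>) + 1)) * t \<le> K * t"
        unfolding K_def using AB' t by (intro mult_right_mono add_mono mult_left_mono) auto
      ultimately have "(enn2real (A_functional M' L' F') + real CARD('n) * (enn2real (B_functional M' L' F' \<alpha>) + 1)) * t
          - s\<^sup>2 / 2 * ln t < \<epsilon> * \<beta>"
        using Kt by (simp add: l_def)
      then have "((enn2real (A_functional M' L' F') + real CARD('n) * (enn2real (B_functional M' L' F' \<alpha>) + 1)) * t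
          - s\<^sup>2 / 2 * ln t) / \<beta> < \<epsilon>"
        using \<beta> by (simp add: pos_divide_less_eq)
      then show ?case using re(2,3) unfolding s_def by linarith
    qed
  qed
  show ?thesis using \<kappa> A_functional_finite main continuity by blast
qed

end
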